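(* The theory ${\rm LZFC}+TMA+$"there exists a strongly critical model" proves $V\neq L$.
   Context: All theories are in the language $\{\in\}$. BST is the theory with axioms: Empty set, Extensionality, Pair, Union, Cartesian Product, "$\omega$ exists", $\Delta_0$-Separation. $Loc({\rm ZFC})$ is the statement $\forall x\exists y(x\in y\wedge Tr(y)\wedge (y,\in)\models{\rm ZFC})$, where $Tr(y)$ means $y$ is transitive; ${\rm LZFC}={\rm BST}+Loc({\rm ZFC})$. "Model" means a (set) transitive model of ZFC. $TMA$ (Tall Model Axiom) is the statement $$(\forall \kappa)(\exists \alpha>\kappa)(\forall \delta\geq \alpha)(\exists M)(\delta\in M \wedge M\models |\kappa|<|\alpha|),$$ where $\kappa,\alpha,\delta$ range over ordinals and $M$ over models. For an elementary embedding $j:N\rightarrow K$ between models, ${\rm Crit}(j)$ is the set of all $x\in N$ with $j\restriction x=id$ and $j(x)\neq x$. A model $M$ is $x$-strongly critical if there are models $N,K$ and an elementary embedding $j:N\rightarrow K$ such that $\{M,x\}\subset N$ and $M\in {\rm Crit}(j)$; $M$ is strongly critical if it is $x$-strongly critical for every set $x$. $V=L$ says that every set belongs to some $L_\alpha$, $\alpha$ an ordinal (in LZFC each $L_\alpha$ exists, since it can be computed absolutely in any model containing $\alpha$). *)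

theory Defs
  imports Main
begin

section \<open>First-order logic with equality in the language of set theory\<close>

text \<open>Variables are de Bruijn indices; as the language has no function symbols, they are the
  only terms.\<close>

datatype fm =
    Member nat nat
  | Equal nat nat
  | Falsum
  | Implies fm fm
  | Forall fm

primrec rename :: "(nat \<Rightarrow> nat) \<Rightarrow> fm \<Rightarrow> fm" where
  "rename r (Member i j) = Member (r i) (r j)"
| "rename r (Equal i j) = Equal (r i) (r j)"
| "rename r Falsum = Falsum"
| "rename r (Implies p q) = Implies (rename r p) (rename r q)"
| "rename r (Forall p) = Forall (rename (case_nat 0 (\<lambda>i. Suc (r i))) p)"

definition inst :: "nat \<Rightarrow> fm \<Rightarrow> fm" where
  "inst t = rename (case_nat t (\<lambda>i. i))"

text \<open>All free indices are smaller than \<open>k\<close>.\<close>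

primrec free_below :: "nat \<Rightarrow> fm \<Rightarrow> bool" where
  "free_below k (Member i j) \<longleftrightarrow> i < k \<and> j < k"
| "free_below k (Equal i j) \<longleftrightarrow> i < k \<and> j < k"
| "free_below k Falsum \<longleftrightarrow> True"
| "free_below k (Implies p q) \<longleftrightarrow> free_below k p \<and> free_below k q"
| "free_below k (Forall p) \<longleftrightarrow> free_below (Suc k) p"

text \<open>Classical natural deduction. In the rule for introducing a universal quantifier the
  context is shifted, so that index \<open>0\<close> is a fresh variable.\<close>

inductive proves :: "fm set \<Rightarrow> fm \<Rightarrow> bool" (infix "\<turnstile>" 20) where
  Assm: "p \<in> T \<Longrightarrow> T \<turnstile> p"
| ImpI: "insert p T \<turnstile> q \<Longrightarrow> T \<turnstile> Implies p q"
| ImpE: "T \<turnstile> Implies p q \<Longrightarrow> T \<turnstile> p \<Longrightarrow> T \<turnstile> q"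
| Contr: "insert (Implies p Falsum) T \<turnstile> Falsum \<Longrightarrow> T \<turnstile> p"
| AllI: "rename Suc ` T \<turnstile> p \<Longrightarrow> T \<turnstile> Forall p"
| AllE: "T \<turnstile> Forall p \<Longrightarrow> T \<turnstile> inst t p"
| Refl: "T \<turnstile> Equal t t"
| Subst: "T \<turnstile> Equal s t \<Longrightarrow> T \<turnstile> inst s p \<Longrightarrow> T \<turnstile> inst t p"


section \<open>Writing formulas with bound names\<close>

text \<open>A formula in context maps the number \<open>n\<close> of variables in scope to an \<^typ>\<open>fm\<close>. The
  variables in scope are \<open>0, \<dots>, n - 1\<close>, numbered from the outermost binder inwards (de Bruijn
  levels), so that level \<open>x\<close> has index \<open>n - Suc x\<close> and a quantifier binds the new level \<open>n\<close>.
  A sentence is obtained by applying a formula in context to \<open>0\<close>.\<close>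

type_synonym var = nat
type_synonym form = "nat \<Rightarrow> fm"

definition mem :: "var \<Rightarrow> var \<Rightarrow> form" (infix "\<^bold>\<in>" 55) where
  "x \<^bold>\<in> y = (\<lambda>n. Member (n - Suc x) (n - Suc y))"

definition eq :: "var \<Rightarrow> var \<Rightarrow> form" (infix "\<^bold>=" 55) where
  "x \<^bold>= y = (\<lambda>n. Equal (n - Suc x) (n - Suc y))"

definition fls :: form ("\<^bold>\<bottom>") where
  "\<^bold>\<bottom> = (\<lambda>n. Falsum)"

definition imp :: "form \<Rightarrow> form \<Rightarrow> form" (infixr "\<^bold>\<longrightarrow>" 25) where
  "(p \<^bold>\<longrightarrow> q) = (\<lambda>n. Implies (p n) (q n))"

definition all :: "(var \<Rightarrow> form) \<Rightarrow> form" (binder "\<^bold>\<forall>" 10) where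
  "all F = (\<lambda>n. Forall (F n (Suc n)))"

definition neg :: "form \<Rightarrow> form" ("\<^bold>\<not> _" [40] 40) where
  "(\<^bold>\<not> p) = (p \<^bold>\<longrightarrow> \<^bold>\<bottom>)"

definition conj :: "form \<Rightarrow> form \<Rightarrow> form" (infixr "\<^bold>\<and>" 35) where
  "(p \<^bold>\<and> q) = (\<^bold>\<not> (p \<^bold>\<longrightarrow> \<^bold>\<not> q))"

definition disj :: "form \<Rightarrow> form \<Rightarrow> form" (infixr "\<^bold>\<or>" 30) where
  "(p \<^bold>\<or> q) = (\<^bold>\<not> p \<^bold>\<longrightarrow> q)"

definition iff :: "form \<Rightarrow> form \<Rightarrow> form" (infixr "\<^bold>\<longleftrightarrow>" 25) where
  "(p \<^bold>\<longleftrightarrow> q) = ((p \<^bold>\<longrightarrow> q) \<^bold>\<and> (q \<^bold>\<longrightarrow> p))"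

definition ex :: "(var \<Rightarrow> form) \<Rightarrow> form" (binder "\<^bold>\<exists>" 10) where
  "ex F = (\<^bold>\<not> (\<^bold>\<forall>x. \<^bold>\<not> F x))"


section \<open>Basic set-theoretic notions\<close>

definition is_empty :: "var \<Rightarrow> form" where
  "is_empty x = (\<^bold>\<forall>z. \<^bold>\<not> z \<^bold>\<in> x)"

definition sub :: "var \<Rightarrow> var \<Rightarrow> form" (infix "\<^bold>\<subseteq>" 55) where
  "x \<^bold>\<subseteq> y = (\<^bold>\<forall>z. z \<^bold>\<in> x \<^bold>\<longrightarrow> z \<^bold>\<in> y)"

definition is_upair :: "var \<Rightarrow> var \<Rightarrow> var \<Rightarrow> form" where
  "is_upair x y p = (\<^bold>\<forall>z. z \<^bold>\<in> p \<^bold>\<longleftrightarrow> z \<^bold>= x \<^bold>\<or> z \<^bold>= y)"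

definition is_pair :: "var \<Rightarrow> var \<Rightarrow> var \<Rightarrow> form" where
  "is_pair x y p = (\<^bold>\<exists>u v. is_upair x x u \<^bold>\<and> is_upair x y v \<^bold>\<and> is_upair u v p)"

text \<open>\<open>y = x \<union> {x}\<close>\<close>

definition is_succ :: "var \<Rightarrow> var \<Rightarrow> form" where
  "is_succ x y = (\<^bold>\<forall>z. z \<^bold>\<in> y \<^bold>\<longleftrightarrow> z \<^bold>\<in> x \<^bold>\<or> z \<^bold>= x)"

definition is_trans :: "var \<Rightarrow> form" where
  "is_trans x = (\<^bold>\<forall>y. y \<^bold>\<in> x \<^bold>\<longrightarrow> y \<^bold>\<subseteq> x)"

text \<open>Transitive sets well-ordered by membership; BST has no axiom of foundation. Irreflexivity
  and transitivity of membership on \<open>x\<close> follow from the last two clauses.\<close>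

definition is_ord :: "var \<Rightarrow> form" where
  "is_ord x = (is_trans x
     \<^bold>\<and> (\<^bold>\<forall>y z. y \<^bold>\<in> x \<^bold>\<and> z \<^bold>\<in> x \<^bold>\<longrightarrow> y \<^bold>\<in> z \<^bold>\<or> y \<^bold>= z \<^bold>\<or> z \<^bold>\<in> y)
     \<^bold>\<and> (\<^bold>\<forall>s. s \<^bold>\<subseteq> x \<^bold>\<and> \<^bold>\<not> is_empty s \<^bold>\<longrightarrow> (\<^bold>\<exists>y. y \<^bold>\<in> s \<^bold>\<and> (\<^bold>\<forall>z. z \<^bold>\<in> s \<^bold>\<longrightarrow> \<^bold>\<not> z \<^bold>\<in> y))))"

definition is_limit :: "var \<Rightarrow> form" where
  "is_limit x = (is_ord x \<^bold>\<and> \<^bold>\<not> is_empty x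
     \<^bold>\<and> (\<^bold>\<forall>y. y \<^bold>\<in> x \<^bold>\<longrightarrow> (\<^bold>\<exists>z. z \<^bold>\<in> x \<^bold>\<and> is_succ y z)))"

definition is_omega :: "var \<Rightarrow> form" where
  "is_omega w = (is_limit w \<^bold>\<and> (\<^bold>\<forall>x. x \<^bold>\<in> w \<^bold>\<longrightarrow> \<^bold>\<not> is_limit x))"

definition is_nat :: "var \<Rightarrow> form" where
  "is_nat x = (\<^bold>\<exists>w. is_omega w \<^bold>\<and> x \<^bold>\<in> w)"

text \<open>\<open>(x, y) \<in> f\<close>\<close>

definition is_app :: "var \<Rightarrow> var \<Rightarrow> var \<Rightarrow> form" where
  "is_app f x y = (\<^bold>\<exists>p. p \<^bold>\<in> f \<^bold>\<and> is_pair x y p)"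

definition is_fun :: "var \<Rightarrow> var \<Rightarrow> form" where
  "is_fun f a = ((\<^bold>\<forall>p. p \<^bold>\<in> f \<^bold>\<longrightarrow> (\<^bold>\<exists>x y. x \<^bold>\<in> a \<^bold>\<and> is_pair x y p))
     \<^bold>\<and> (\<^bold>\<forall>x. x \<^bold>\<in> a \<^bold>\<longrightarrow> (\<^bold>\<exists>y. is_app f x y \<^bold>\<and> (\<^bold>\<forall>z. is_app f x z \<^bold>\<longrightarrow> z \<^bold>= y))))"

definition is_map :: "var \<Rightarrow> var \<Rightarrow> var \<Rightarrow> form" where
  "is_map f a b = (is_fun f a \<^bold>\<and> (\<^bold>\<forall>x y. is_app f x y \<^bold>\<longrightarrow> y \<^bold>\<in> b))"

definition is_inj :: "var \<Rightarrow> var \<Rightarrow> var \<Rightarrow> form" where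
  "is_inj f a b = (is_map f a b
     \<^bold>\<and> (\<^bold>\<forall>x y z. is_app f x z \<^bold>\<and> is_app f y z \<^bold>\<longrightarrow> x \<^bold>= y))"

definition is_bij :: "var \<Rightarrow> var \<Rightarrow> var \<Rightarrow> form" where
  "is_bij f a b = (is_inj f a b \<^bold>\<and> (\<^bold>\<forall>y. y \<^bold>\<in> b \<^bold>\<longrightarrow> (\<^bold>\<exists>x. is_app f x y)))"

text \<open>\<open>|a| < |b|\<close>\<close>

definition card_less :: "var \<Rightarrow> var \<Rightarrow> form" where
  "card_less a b = ((\<^bold>\<exists>f. is_inj f a b) \<^bold>\<and> \<^bold>\<not> (\<^bold>\<exists>f. is_bij f a b))"


section \<open>The theory BST\<close>

definition ax_empty :: form where
  "ax_empty = (\<^bold>\<exists>x. is_empty x)"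

definition ax_ext :: form where
  "ax_ext = (\<^bold>\<forall>x y. (\<^bold>\<forall>z. z \<^bold>\<in> x \<^bold>\<longleftrightarrow> z \<^bold>\<in> y) \<^bold>\<longrightarrow> x \<^bold>= y)"

definition ax_pair :: form where
  "ax_pair = (\<^bold>\<forall>x y. \<^bold>\<exists>p. is_upair x y p)"

definition ax_union :: form where
  "ax_union = (\<^bold>\<forall>x. \<^bold>\<exists>u. \<^bold>\<forall>z. z \<^bold>\<in> u \<^bold>\<longleftrightarrow> (\<^bold>\<exists>y. y \<^bold>\<in> x \<^bold>\<and> z \<^bold>\<in> y))"

definition ax_product :: form where
  "ax_product = (\<^bold>\<forall>x y. \<^bold>\<exists>c. \<^bold>\<forall>p. p \<^bold>\<in> c \<^bold>\<longleftrightarrow> (\<^bold>\<exists>u v. u \<^bold>\<in> x \<^bold>\<and> v \<^bold>\<in> y \<^bold>\<and> is_pair u v p))"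

definition ax_omega :: form where
  "ax_omega = (\<^bold>\<exists>w. is_omega w)"

text \<open>In the quantifier rule, \<open>Member 0 (Suc i)\<close> says that the bound variable belongs to a
  variable other than itself. Bounded existential quantifiers are negated bounded universal
  ones.\<close>

inductive delta0 :: "fm \<Rightarrow> bool" where
  "delta0 (Member i j)"
| "delta0 (Equal i j)"
| "delta0 Falsum"
| "delta0 p \<Longrightarrow> delta0 q \<Longrightarrow> delta0 (Implies p q)"
| "delta0 p \<Longrightarrow> delta0 (Forall (Implies (Member 0 (Suc i)) p))"

text \<open>The universal closure of \<open>\<forall>z. \<exists>y. \<forall>x. x \<in> y \<longleftrightarrow> x \<in> z \<and> p\<close>, where in \<open>p\<close> index \<open>0\<close> is \<open>x\<close>,
  index \<open>1\<close> is \<open>z\<close>, the \<open>k\<close> further ones are parameters, and the renaming makes room for \<open>y\<close>.\<close>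

definition separation :: "nat \<Rightarrow> fm \<Rightarrow> fm" where
  "separation k p = (Forall ^^ k)
     ((\<^bold>\<forall>z. \<^bold>\<exists>y. \<^bold>\<forall>x. x \<^bold>\<in> y \<^bold>\<longleftrightarrow> x \<^bold>\<in> z \<^bold>\<and> (\<lambda>n. rename (case_nat 0 (\<lambda>i. Suc (Suc i))) p)) k)"

definition BST :: "fm set" where
  "BST = {ax_empty 0, ax_ext 0, ax_pair 0, ax_union 0, ax_product 0, ax_omega 0}
     \<union> {separation k p | k p. delta0 p \<and> free_below (k + 2) p}"


section \<open>Formulas coded as sets\<close>

text \<open>A term \<open>t\<close> is given by the operation taking a predicate \<open>P\<close> to ``the value of \<open>t\<close> exists and
  satisfies \<open>P\<close>''.\<close>

type_synonym trm = "(var \<Rightarrow> form) \<Rightarrow> form"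

definition is_val :: "var \<Rightarrow> trm \<Rightarrow> form" (infix "\<^bold>\<simeq>" 55) where
  "x \<^bold>\<simeq> t = t (\<lambda>y. x \<^bold>= y)"

definition V :: "var \<Rightarrow> trm" where
  "V x = (\<lambda>P. P x)"

primrec num :: "nat \<Rightarrow> trm" where
  "num 0 = (\<lambda>P. \<^bold>\<exists>x. is_empty x \<^bold>\<and> P x)"
| "num (Suc n) = (\<lambda>P. num n (\<lambda>x. \<^bold>\<exists>y. is_succ x y \<^bold>\<and> P y))"

definition pair :: "trm \<Rightarrow> trm \<Rightarrow> trm" where
  "pair s t = (\<lambda>P. s (\<lambda>x. t (\<lambda>y. \<^bold>\<exists>p. is_pair x y p \<^bold>\<and> P p)))"

text \<open>The coded language has the variables \<open>v\<^sub>i\<close> for \<open>i \<in> \<omega>\<close>, and quantifiers name the variable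
  they bind.\<close>

definition cMem :: "trm \<Rightarrow> trm \<Rightarrow> trm" where "cMem i j = pair (num 0) (pair i j)"
definition cEq :: "trm \<Rightarrow> trm \<Rightarrow> trm" where "cEq i j = pair (num 1) (pair i j)"
definition cFls :: trm where "cFls = pair (num 2) (num 0)"
definition cImp :: "trm \<Rightarrow> trm \<Rightarrow> trm" where "cImp s t = pair (num 3) (pair s t)"
definition cAll :: "trm \<Rightarrow> trm \<Rightarrow> trm" where "cAll i t = pair (num 4) (pair i t)"

definition cNeg :: "trm \<Rightarrow> trm" where "cNeg s = cImp s cFls"
definition cAnd :: "trm \<Rightarrow> trm \<Rightarrow> trm" where "cAnd s t = cNeg (cImp s (cNeg t))"
definition cIff :: "trm \<Rightarrow> trm \<Rightarrow> trm" where "cIff s t = cAnd (cImp s t) (cImp t s)"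
definition cEx :: "trm \<Rightarrow> trm \<Rightarrow> trm" where "cEx i t = cNeg (cAll i (cNeg t))"

text \<open>The code of a formula with \<open>d\<close> variables in scope, the variable of level \<open>i\<close> being \<open>v\<^sub>i\<close>.\<close>

primrec quote :: "nat \<Rightarrow> fm \<Rightarrow> trm" where
  "quote d (Member i j) = cMem (num (d - Suc i)) (num (d - Suc j))"
| "quote d (Equal i j) = cEq (num (d - Suc i)) (num (d - Suc j))"
| "quote d Falsum = cFls"
| "quote d (Implies p q) = cImp (quote d p) (quote d q)"
| "quote d (Forall p) = cAll (num d) (quote (Suc d) p)"

text \<open>\<open>c\<close> is the code of a formula all of whose variables, free or bound, are among
  \<open>v\<^sub>0, \<dots>, v\<^sub>m\<^sub>-\<^sub>1\<close>; it is witnessed by a construction sequence \<open>f\<close> of length \<open>n \<in> \<omega>\<close>.\<close>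

definition is_formula :: "var \<Rightarrow> var \<Rightarrow> form" where
  "is_formula m c = (is_nat m \<^bold>\<and> (\<^bold>\<exists>n f. is_nat n \<^bold>\<and> is_fun f n
     \<^bold>\<and> (\<^bold>\<exists>k. k \<^bold>\<in> n \<^bold>\<and> is_app f k c)
     \<^bold>\<and> (\<^bold>\<forall>k d. k \<^bold>\<in> n \<^bold>\<and> is_app f k d \<^bold>\<longrightarrow>
            (\<^bold>\<exists>i j. i \<^bold>\<in> m \<^bold>\<and> j \<^bold>\<in> m \<^bold>\<and> d \<^bold>\<simeq> cMem (V i) (V j))
          \<^bold>\<or> (\<^bold>\<exists>i j. i \<^bold>\<in> m \<^bold>\<and> j \<^bold>\<in> m \<^bold>\<and> d \<^bold>\<simeq> cEq (V i) (V j))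
          \<^bold>\<or> d \<^bold>\<simeq> cFls
          \<^bold>\<or> (\<^bold>\<exists>k1 d1 k2 d2. k1 \<^bold>\<in> k \<^bold>\<and> is_app f k1 d1 \<^bold>\<and> k2 \<^bold>\<in> k \<^bold>\<and> is_app f k2 d2
               \<^bold>\<and> d \<^bold>\<simeq> cImp (V d1) (V d2))
          \<^bold>\<or> (\<^bold>\<exists>i k1 d1. i \<^bold>\<in> m \<^bold>\<and> k1 \<^bold>\<in> k \<^bold>\<and> is_app f k1 d1 \<^bold>\<and> d \<^bold>\<simeq> cAll (V i) (V d1)))))"

text \<open>\<open>S\<close> is the set of those \<open>a : m \<rightarrow> M\<close> that satisfy \<open>P\<close>.\<close>

definition is_truth_set :: "var \<Rightarrow> var \<Rightarrow> var \<Rightarrow> (var \<Rightarrow> form) \<Rightarrow> form" where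
  "is_truth_set M m S P = (\<^bold>\<forall>a. a \<^bold>\<in> S \<^bold>\<longleftrightarrow> is_map a m M \<^bold>\<and> P a)"

text \<open>The functions \<open>a\<close> and \<open>b\<close> on \<open>m\<close> agree except possibly at \<open>i\<close>.\<close>

definition agree_off :: "var \<Rightarrow> var \<Rightarrow> var \<Rightarrow> var \<Rightarrow> form" where
  "agree_off m i a b = (\<^bold>\<forall>j x. j \<^bold>\<in> m \<^bold>\<and> \<^bold>\<not> j \<^bold>= i \<^bold>\<longrightarrow> (is_app a j x \<^bold>\<longleftrightarrow> is_app b j x))"

text \<open>\<open>(M, \<in>)\<close> satisfies the formula coded by \<open>c\<close> under the assignment \<open>a : m \<rightarrow> M\<close>. The sequence
  \<open>s\<close> lists the truth sets of the formulas in the construction sequence \<open>f\<close>. Assignments are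
  finite since without the power set axiom the functions from \<open>\<omega>\<close> to \<open>M\<close> need not form a set.\<close>

definition sat :: "var \<Rightarrow> var \<Rightarrow> var \<Rightarrow> var \<Rightarrow> form" where
  "sat M m c a = (is_nat m \<^bold>\<and> (\<^bold>\<exists>n f s. is_nat n \<^bold>\<and> is_fun f n \<^bold>\<and> is_fun s n
     \<^bold>\<and> (\<^bold>\<exists>k S. k \<^bold>\<in> n \<^bold>\<and> is_app f k c \<^bold>\<and> is_app s k S \<^bold>\<and> a \<^bold>\<in> S)
     \<^bold>\<and> (\<^bold>\<forall>k d S. k \<^bold>\<in> n \<^bold>\<and> is_app f k d \<^bold>\<and> is_app s k S \<^bold>\<longrightarrow>
            (\<^bold>\<exists>i j. i \<^bold>\<in> m \<^bold>\<and> j \<^bold>\<in> m \<^bold>\<and> d \<^bold>\<simeq> cMem (V i) (V j)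
               \<^bold>\<and> is_truth_set M m S (\<lambda>a. \<^bold>\<exists>x y. is_app a i x \<^bold>\<and> is_app a j y \<^bold>\<and> x \<^bold>\<in> y))
          \<^bold>\<or> (\<^bold>\<exists>i j. i \<^bold>\<in> m \<^bold>\<and> j \<^bold>\<in> m \<^bold>\<and> d \<^bold>\<simeq> cEq (V i) (V j)
               \<^bold>\<and> is_truth_set M m S (\<lambda>a. \<^bold>\<exists>x. is_app a i x \<^bold>\<and> is_app a j x))
          \<^bold>\<or> (d \<^bold>\<simeq> cFls \<^bold>\<and> is_truth_set M m S (\<lambda>a. \<^bold>\<bottom>))
          \<^bold>\<or> (\<^bold>\<exists>k1 d1 S1 k2 d2 S2. k1 \<^bold>\<in> k \<^bold>\<and> is_app f k1 d1 \<^bold>\<and> is_app s k1 S1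
               \<^bold>\<and> k2 \<^bold>\<in> k \<^bold>\<and> is_app f k2 d2 \<^bold>\<and> is_app s k2 S2
               \<^bold>\<and> d \<^bold>\<simeq> cImp (V d1) (V d2)
               \<^bold>\<and> is_truth_set M m S (\<lambda>a. a \<^bold>\<in> S1 \<^bold>\<longrightarrow> a \<^bold>\<in> S2))
          \<^bold>\<or> (\<^bold>\<exists>i k1 d1 S1. i \<^bold>\<in> m \<^bold>\<and> k1 \<^bold>\<in> k \<^bold>\<and> is_app f k1 d1 \<^bold>\<and> is_app s k1 S1
               \<^bold>\<and> d \<^bold>\<simeq> cAll (V i) (V d1)
               \<^bold>\<and> is_truth_set M m S
                    (\<lambda>a. \<^bold>\<forall>b. is_map b m M \<^bold>\<and> agree_off m i a b \<^bold>\<longrightarrow> b \<^bold>\<in> S1)))))"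


section \<open>ZFC and its transitive models\<close>

definition ax_foundation :: form where
  "ax_foundation = (\<^bold>\<forall>x. \<^bold>\<not> is_empty x \<^bold>\<longrightarrow> (\<^bold>\<exists>y. y \<^bold>\<in> x \<^bold>\<and> (\<^bold>\<forall>z. z \<^bold>\<in> x \<^bold>\<longrightarrow> \<^bold>\<not> z \<^bold>\<in> y)))"

definition ax_power :: form where
  "ax_power = (\<^bold>\<forall>x. \<^bold>\<exists>y. \<^bold>\<forall>z. z \<^bold>\<in> y \<^bold>\<longleftrightarrow> z \<^bold>\<subseteq> x)"

definition ax_infinity :: form where
  "ax_infinity = (\<^bold>\<exists>w. (\<^bold>\<exists>x. x \<^bold>\<in> w \<^bold>\<and> is_empty x)
     \<^bold>\<and> (\<^bold>\<forall>x. x \<^bold>\<in> w \<^bold>\<longrightarrow> (\<^bold>\<exists>y. y \<^bold>\<in> w \<^bold>\<and> is_succ x y)))"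

definition ax_choice :: form where
  "ax_choice = (\<^bold>\<forall>x.
     (\<^bold>\<forall>y. y \<^bold>\<in> x \<^bold>\<longrightarrow> \<^bold>\<not> is_empty y)
     \<^bold>\<and> (\<^bold>\<forall>y z u. y \<^bold>\<in> x \<^bold>\<and> z \<^bold>\<in> x \<^bold>\<and> u \<^bold>\<in> y \<^bold>\<and> u \<^bold>\<in> z \<^bold>\<longrightarrow> y \<^bold>= z)
     \<^bold>\<longrightarrow> (\<^bold>\<exists>c. \<^bold>\<forall>y. y \<^bold>\<in> x \<^bold>\<longrightarrow>
            (\<^bold>\<exists>u. u \<^bold>\<in> y \<^bold>\<and> u \<^bold>\<in> c \<^bold>\<and> (\<^bold>\<forall>v. v \<^bold>\<in> y \<^bold>\<and> v \<^bold>\<in> c \<^bold>\<longrightarrow> v \<^bold>= u))))"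

text \<open>\<open>\<forall>v\<^sub>1. \<exists>v\<^sub>k. \<forall>v\<^sub>0. v\<^sub>0 \<in> v\<^sub>k \<longleftrightarrow> v\<^sub>0 \<in> v\<^sub>1 \<and> p\<close>, to be used with \<open>v\<^sub>k\<close> not in \<open>p\<close>\<close>

definition cSeparation :: "trm \<Rightarrow> trm \<Rightarrow> trm" where
  "cSeparation k p = cAll (num 1) (cEx k (cAll (num 0)
     (cIff (cMem (num 0) k) (cAnd (cMem (num 0) (num 1)) p))))"

text \<open>\<open>\<forall>v\<^sub>2. (\<forall>v\<^sub>0 \<in> v\<^sub>2. \<exists>!v\<^sub>1. p) \<longrightarrow> (\<exists>v\<^sub>k. \<forall>v\<^sub>0 \<in> v\<^sub>2. \<exists>v\<^sub>1 \<in> v\<^sub>k. p)\<close>, where \<open>\<exists>!v\<^sub>1. p\<close> is written as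
  \<open>\<exists>v\<^sub>k. \<forall>v\<^sub>1. p \<longleftrightarrow> v\<^sub>1 = v\<^sub>k\<close>, again to be used with \<open>v\<^sub>k\<close> not in \<open>p\<close>\<close>

definition cReplacement :: "trm \<Rightarrow> trm \<Rightarrow> trm" where
  "cReplacement k p = cAll (num 2) (cImp
     (cAll (num 0) (cImp (cMem (num 0) (num 2))
        (cEx k (cAll (num 1) (cIff p (cEq (num 1) k))))))
     (cEx k (cAll (num 0) (cImp (cMem (num 0) (num 2))
        (cEx (num 1) (cAnd (cMem (num 1) k) p))))))"

text \<open>The instances of the schemes may have free variables, which range over the parameters;
  validity in a model is truth under all assignments.\<close>

definition is_ZFC_axiom :: "var \<Rightarrow> form" where
  "is_ZFC_axiom c = (
       c \<^bold>\<simeq> quote 0 (ax_ext 0) \<^bold>\<or> c \<^bold>\<simeq> quote 0 (ax_foundation 0) \<^bold>\<or> c \<^bold>\<simeq> quote 0 (ax_pair 0)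
     \<^bold>\<or> c \<^bold>\<simeq> quote 0 (ax_union 0) \<^bold>\<or> c \<^bold>\<simeq> quote 0 (ax_power 0) \<^bold>\<or> c \<^bold>\<simeq> quote 0 (ax_infinity 0)
     \<^bold>\<or> c \<^bold>\<simeq> quote 0 (ax_choice 0)
     \<^bold>\<or> (\<^bold>\<exists>k p i. i \<^bold>\<simeq> num 1 \<^bold>\<and> i \<^bold>\<in> k \<^bold>\<and> is_formula k p \<^bold>\<and> c \<^bold>\<simeq> cSeparation (V k) (V p))
     \<^bold>\<or> (\<^bold>\<exists>k p i. i \<^bold>\<simeq> num 2 \<^bold>\<and> i \<^bold>\<in> k \<^bold>\<and> is_formula k p \<^bold>\<and> c \<^bold>\<simeq> cReplacement (V k) (V p)))"

definition is_valid :: "var \<Rightarrow> var \<Rightarrow> form" where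
  "is_valid M c = (\<^bold>\<forall>m a. is_formula m c \<^bold>\<and> is_map a m M \<^bold>\<longrightarrow> sat M m c a)"

text \<open>First-order structures are nonempty; the empty set would validate all axioms vacuously.\<close>

definition sat_ZFC :: "var \<Rightarrow> form" where
  "sat_ZFC M = (\<^bold>\<not> is_empty M \<^bold>\<and> (\<^bold>\<forall>c. is_ZFC_axiom c \<^bold>\<longrightarrow> is_valid M c))"

definition is_model :: "var \<Rightarrow> form" where
  "is_model M = (is_trans M \<^bold>\<and> sat_ZFC M)"

definition Loc_ZFC :: form where
  "Loc_ZFC = (\<^bold>\<forall>x. \<^bold>\<exists>y. x \<^bold>\<in> y \<^bold>\<and> is_trans y \<^bold>\<and> sat_ZFC y)"

definition LZFC :: "fm set" where
  "LZFC = insert (Loc_ZFC 0) BST"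


section \<open>The Tall Model Axiom\<close>

text \<open>\<open>x, y \<in> M\<close> and \<open>M \<Turnstile> |x| < |y|\<close>: the code of \<open>|v\<^sub>0| < |v\<^sub>1|\<close> holds in \<open>M\<close> under some (equivalently,
  every) long enough assignment starting with \<open>x, y\<close>.\<close>

definition sat_card_less :: "var \<Rightarrow> var \<Rightarrow> var \<Rightarrow> form" where
  "sat_card_less M x y = (\<^bold>\<exists>m a c i j. is_map a m M
     \<^bold>\<and> i \<^bold>\<simeq> num 0 \<^bold>\<and> is_app a i x \<^bold>\<and> j \<^bold>\<simeq> num 1 \<^bold>\<and> is_app a j y
     \<^bold>\<and> c \<^bold>\<simeq> quote 2 (card_less 0 1 2) \<^bold>\<and> sat M m c a)"

definition TMA :: form where
  "TMA = (\<^bold>\<forall>\<kappa>. is_ord \<kappa> \<^bold>\<longrightarrow> (\<^bold>\<exists>\<alpha>. is_ord \<alpha> \<^bold>\<and> \<kappa> \<^bold>\<in> \<alpha> \<^bold>\<and>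
     (\<^bold>\<forall>\<delta>. is_ord \<delta> \<^bold>\<and> (\<alpha> \<^bold>\<in> \<delta> \<^bold>\<or> \<alpha> \<^bold>= \<delta>) \<^bold>\<longrightarrow>
        (\<^bold>\<exists>M. is_model M \<^bold>\<and> \<delta> \<^bold>\<in> M \<^bold>\<and> sat_card_less M \<kappa> \<alpha>))))"


section \<open>Strongly critical models\<close>

text \<open>The map \<open>j : N \<rightarrow> K\<close> preserves the truth of each formula, \<open>b\<close> being \<open>j \<circ> a\<close>.\<close>

definition is_elem_emb :: "var \<Rightarrow> var \<Rightarrow> var \<Rightarrow> form" where
  "is_elem_emb j N K = (is_map j N K \<^bold>\<and>
     (\<^bold>\<forall>m c a b. is_formula m c \<^bold>\<and> is_map a m N \<^bold>\<and> is_map b m K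
        \<^bold>\<and> (\<^bold>\<forall>i x y. is_app a i x \<^bold>\<and> is_app j x y \<^bold>\<longrightarrow> is_app b i y)
        \<^bold>\<longrightarrow> (sat N m c a \<^bold>\<longleftrightarrow> sat K m c b)))"

definition in_Crit :: "var \<Rightarrow> var \<Rightarrow> var \<Rightarrow> form" where
  "in_Crit x j N = (x \<^bold>\<in> N \<^bold>\<and> (\<^bold>\<forall>y. y \<^bold>\<in> x \<^bold>\<longrightarrow> is_app j y y) \<^bold>\<and> \<^bold>\<not> is_app j x x)"

definition strongly_critical_at :: "var \<Rightarrow> var \<Rightarrow> form" where
  "strongly_critical_at x M = (\<^bold>\<exists>N K j. is_model N \<^bold>\<and> is_model K \<^bold>\<and> is_elem_emb j N K
     \<^bold>\<and> M \<^bold>\<in> N \<^bold>\<and> x \<^bold>\<in> N \<^bold>\<and> in_Crit M j N)"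

definition strongly_critical :: "var \<Rightarrow> form" where
  "strongly_critical M = (is_model M \<^bold>\<and> (\<^bold>\<forall>x. strongly_critical_at x M))"

definition exists_strongly_critical :: form where
  "exists_strongly_critical = (\<^bold>\<exists>M. strongly_critical M)"


section \<open>Constructibility\<close>

text \<open>\<open>D\<close> is the set of all \<open>X \<subseteq> A\<close> definable over \<open>(A, \<in>)\<close> with parameters, in the sense that
  \<open>X = {x \<in> A. A \<Turnstile> c[x, p]}\<close>. Here \<open>x\<close> is assigned to \<open>v\<^sub>0\<close>, while \<open>p : m - {0} \<rightarrow> A\<close> assigns the
  other variables; this way the empty set is definable over the empty set.\<close>

definition is_Def :: "var \<Rightarrow> var \<Rightarrow> form" where
  "is_Def A D = (\<^bold>\<forall>X. X \<^bold>\<in> D \<^bold>\<longleftrightarrow> X \<^bold>\<subseteq> A \<^bold>\<and>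
     (\<^bold>\<exists>m c z d p. is_formula m c \<^bold>\<and> is_empty z \<^bold>\<and> z \<^bold>\<in> m
        \<^bold>\<and> (\<^bold>\<forall>i. i \<^bold>\<in> d \<^bold>\<longleftrightarrow> i \<^bold>\<in> m \<^bold>\<and> \<^bold>\<not> i \<^bold>= z) \<^bold>\<and> is_map p d A
        \<^bold>\<and> (\<^bold>\<forall>x. x \<^bold>\<in> A \<^bold>\<longrightarrow>
             (x \<^bold>\<in> X \<^bold>\<longleftrightarrow> (\<^bold>\<exists>a. is_map a m A \<^bold>\<and> p \<^bold>\<subseteq> a \<^bold>\<and> is_app a z x \<^bold>\<and> sat A m c a)))))"

text \<open>\<open>g\<close> is the sequence of the \<open>L\<^sub>\<gamma>\<close> for \<open>\<gamma> < \<beta>\<close>.\<close>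

definition is_L_hierarchy :: "var \<Rightarrow> var \<Rightarrow> form" where
  "is_L_hierarchy \<beta> g = (is_ord \<beta> \<^bold>\<and> is_fun g \<beta> \<^bold>\<and>
     (\<^bold>\<forall>\<gamma> A. \<gamma> \<^bold>\<in> \<beta> \<^bold>\<and> is_app g \<gamma> A \<^bold>\<longrightarrow>
          (is_empty \<gamma> \<^bold>\<and> is_empty A)
        \<^bold>\<or> (\<^bold>\<exists>\<delta> B. is_succ \<delta> \<gamma> \<^bold>\<and> is_app g \<delta> B \<^bold>\<and> is_Def B A)
        \<^bold>\<or> (is_limit \<gamma> \<^bold>\<and> (\<^bold>\<forall>x. x \<^bold>\<in> A \<^bold>\<longleftrightarrow> (\<^bold>\<exists>\<delta> B. \<delta> \<^bold>\<in> \<gamma> \<^bold>\<and> is_app g \<delta> B \<^bold>\<and> x \<^bold>\<in> B)))))"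

definition is_L_level :: "var \<Rightarrow> var \<Rightarrow> form" where
  "is_L_level \<alpha> A = (\<^bold>\<exists>\<beta> g. \<alpha> \<^bold>\<in> \<beta> \<^bold>\<and> is_L_hierarchy \<beta> g \<^bold>\<and> is_app g \<alpha> A)"

definition V_eq_L :: form where
  "V_eq_L = (\<^bold>\<forall>x. \<^bold>\<exists>\<alpha> A. is_ord \<alpha> \<^bold>\<and> is_L_level \<alpha> A \<^bold>\<and> x \<^bold>\<in> A)"

end

theory Submission
  imports Defs "HOL-Library.Countable" "HOL-Library.Infinite_Set"
begin

text \<open>By the completeness theorem it suffices to refute the theory together with \<open>V = L\<close> in an
  arbitrary structure. Arguments inside the structure are carried out in its transitive models, as
  power sets and replacement are only available there.

  Let \<open>N0\<close> be a model and \<open>\<kappa>\<close> an ordinal mapped onto it. By \<open>TMA\<close> there is \<open>\<theta> > \<kappa>\<close> that is not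
  equinumerous with \<open>\<kappa>\<close> in arbitrarily tall models, hence, by \<open>V = L\<close>, not at all. For \<open>X \<subseteq> N0\<close> the
  collapse of a hull of \<open>N0 \<union> {X}\<close> is a model of size at most \<open>\<kappa>\<close> containing \<open>X\<close>, and there
  \<open>X \<in> L\<^sub>\<delta>\<close> with \<open>\<delta> < \<theta>\<close>. So every model that contains \<open>\<theta>\<close> contains all subsets of \<open>N0\<close>.

  Let \<open>M\<close> be strongly critical. Take models \<open>M \<in> N0 \<in> N2 \<in> N3\<close> such that \<open>N2\<close> contains the ordinal
  \<open>\<theta>\<close> for \<open>N0\<close>, and \<open>N3\<close> the one for \<open>N2\<close>, and \<open>j : N \<rightarrow> K\<close> with \<open>N3 \<in> N\<close> and \<open>M \<in> Crit(j)\<close>. Since \<open>j\<close>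
  cannot fix a map from an ordinal onto \<open>M\<close>, it moves a least ordinal \<open>\<kappa>\<close>. Collapsing
  \<open>{j(f)(\<kappa>) | f : \<kappa> \<rightarrow> N3}\<close> gives an elementary \<open>e : N3 \<rightarrow> T\<close> with critical point \<open>\<kappa>\<close> for which every
  element of \<open>e(\<kappa>)\<close> is \<open>e(f)(\<kappa>)\<close> for some \<open>f : \<kappa> \<rightarrow> \<kappa>\<close>. The relation \<open>e(f)(\<kappa>) < e(g)(\<kappa>)\<close> is a
  subset of \<open>N2\<close> and thus belongs to \<open>T\<close>, where its collapse maps the functions \<open>\<kappa> \<rightarrow> \<kappa>\<close> onto \<open>e(\<kappa>)\<close>.
  By elementarity \<open>N3\<close> contains \<open>\<mu> < \<kappa>\<close> and a map \<open>s\<close> from functions \<open>\<mu> \<rightarrow> \<mu>\<close> onto \<open>\<kappa>\<close>. Now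
  \<open>\<kappa> = e(s)(z)\<close> for some \<open>z : \<mu> \<rightarrow> \<mu>\<close> in \<open>T\<close>. But \<open>z \<subseteq> N0\<close> belongs to \<open>N3\<close> and \<open>e(z) = z\<close>, so
  \<open>\<kappa> = e(s(z)) = s(z) < \<kappa>\<close>.\<close>

section \<open>Semantics and completeness\<close>

text \<open>The final contradiction is one of cardinality. A critical point is a strong limit, so
  \<open>e(\<kappa>)\<close> would be one in \<open>T\<close>; yet each of its elements is
  represented by a function from \<kappa> to \<kappa>. For \<open>j\<close> itself nothing bounds
  \<open>j(\<kappa>)\<close>, which is why \<open>j\<close> is replaced by a collapse of values at
  \<kappa>. \<open>N2\<close> holds all functions on ordinals of \<open>N0\<close>, so that
  \<open>z\<close> cannot be new; the ordinal attached to \<open>N2\<close> is not lowered by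
  \<open>e\<close>, so \<open>T\<close> also has all subsets of \<open>N2\<close>. Two obstacles
  shape the rest. The universe lacks power set and replacement and separates only by bounded
  formulas, so each internal induction or recursion is localised in a model containing the
  parameters, and absoluteness makes the outcome independent of that model. Moreover the natural
  numbers of the structure may be nonstandard, so internal satisfaction is compared with external
  truth only at codes of actual formulas. Hulls and collapses are therefore only shown to satisfy
  the standard axioms (\<open>ZF\<close> in place of \<open>Mdl\<close>), and a hull is built by an
  internal recursion so that it is a set with an internal map from \<open>N0\<close> onto
  it.\<close>

text \<open>The carrier is separate from the relation because one membership relation is evaluated
  over many carriers: the whole structure and the extensions of its sets. Free variables are not
  forced into the carrier.\<close>

primrec ev :: "('a \<Rightarrow> 'a \<Rightarrow> bool) \<Rightarrow> 'a set \<Rightarrow> fm \<Rightarrow> (nat \<Rightarrow> 'a) \<Rightarrow> bool" where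
  "ev E A (Member i j) v = E (v i) (v j)"
| "ev E A (Equal i j) v = (v i = v j)"
| "ev E A Falsum v = False"
| "ev E A (Implies p q) v = (ev E A p v \<longrightarrow> ev E A q v)"
| "ev E A (Forall p) v = (\<forall>d\<in>A. ev E A p (case_nat d v))"

lemma ev_cong: "free_below k p \<Longrightarrow> (\<And>i. i < k \<Longrightarrow> v i = w i) \<Longrightarrow> ev E A p v = ev E A p w"
proof (induction p arbitrary: k v w)
  case (Forall p)
  have "ev E A p (case_nat d v) = ev E A p (case_nat d w)" for d
    using Forall.prems by (intro Forall.IH[of "Suc k"]) (auto split: nat.split)
  then show ?case by simp
next
  case (Implies p q)
  then have "ev E A p v = ev E A p w" "ev E A q v = ev E A q w"
    by (metis free_below.simps(4))+
  then show ?case by simp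
qed auto

lemma free_below_mono: "free_below k p \<Longrightarrow> k \<le> l \<Longrightarrow> free_below l p"
  by (induction p arbitrary: k l) fastforce+

lemma free_below_exists: "\<exists>k. free_below k p"
proof (induction p)
  case (Member i j)
  show ?case by (rule exI[of _ "Suc (i + j)"]) simp
next
  case (Equal i j)
  show ?case by (rule exI[of _ "Suc (i + j)"]) simp
next
  case (Implies p q)
  then obtain k l where "free_below k p" "free_below l q" by blast
  then have "free_below (k + l) (Implies p q)" by (simp add: free_below_mono)
  then show ?case ..
next
  case (Forall p)
  then show ?case by (metis free_below.simps(5) free_below_mono le_Suc_eq order_refl)
qed auto

text \<open>Used both to move a countable structure onto the full type of naturals and to carry
  truth along the Mostowski collapse.\<close>

lemma ev_iso:
  assumes "bij_betw h A B" and "\<And>x y. x \<in> A \<Longrightarrow> y \<in> A \<Longrightarrow> E' (h x) (h y) = E x y"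
    and "\<And>i. v i \<in> A"
  shows "ev E' B p (\<lambda>i. h (v i)) = ev E A p v"
  using assms(3)
proof (induction p arbitrary: v)
  case (Equal i j)
  then show ?case using assms(1) by (auto simp: bij_betw_def inj_on_def)
next
  case (Forall p)
  have *: "case_nat (h d) (\<lambda>i. h (v i)) = (\<lambda>i. h (case_nat d v i))" for d
    by (auto split: nat.split)
  have B: "B = h ` A" using assms(1) by (simp add: bij_betw_def)
  have "ev E' B p (\<lambda>i. h (case_nat d v i)) = ev E A p (case_nat d v)" if "d \<in> A" for d
    using Forall.prems that by (intro Forall.IH) (auto split: nat.split)
  then show ?case unfolding B by (simp add: *)
qed (use assms(2) in auto)

section \<open>Renaming of variables and structural properties of derivability\<close>

lemma rename_cong: "free_below k p \<Longrightarrow> (\<And>i. i < k \<Longrightarrow> r i = s i) \<Longrightarrow> rename r p = rename s p"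
proof (induction p arbitrary: k r s)
  case (Forall p)
  have "rename (case_nat 0 (\<lambda>i. Suc (r i))) p = rename (case_nat 0 (\<lambda>i. Suc (s i))) p"
    using Forall.prems by (intro Forall.IH[of "Suc k"]) (auto split: nat.split)
  then show ?case by simp
next
  case (Implies p q)
  then show ?case by (metis free_below.simps(4) rename.simps(4))
qed auto

lemma rename_rename: "rename r (rename s p) = rename (\<lambda>i. r (s i)) p"
proof (induction p arbitrary: r s)
  case (Forall p)
  have "(\<lambda>i. case_nat 0 (\<lambda>i. Suc (r i)) (case_nat 0 (\<lambda>i. Suc (s i)) i))
      = case_nat 0 (\<lambda>i. Suc (r (s i)))"
    by (auto split: nat.split)
  then show ?case by (simp add: Forall.IH)
qed auto

lemma rename_id [simp]: "rename (\<lambda>i. i) p = p"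
proof (induction p)
  case (Forall p)
  have "case_nat 0 (\<lambda>i. Suc i) = (\<lambda>i. i)" by (auto split: nat.split)
  then show ?case by (simp add: Forall)
qed auto

lemma ev_rename: "ev E A (rename r p) v = ev E A p (\<lambda>i. v (r i))"
proof (induction p arbitrary: r v)
  case (Forall p)
  have "(\<lambda>i. case_nat d v (case_nat 0 (\<lambda>i. Suc (r i)) i)) = case_nat d (\<lambda>i. v (r i))" for d
    by (auto split: nat.split)
  then show ?case by (simp add: Forall.IH)
qed auto

lemma free_below_rename:
  "free_below k p \<Longrightarrow> (\<And>i. i < k \<Longrightarrow> r i < l) \<Longrightarrow> free_below l (rename r p)"
proof (induction p arbitrary: k l r)
  case (Forall p)
  have "free_below (Suc l) (rename (case_nat 0 (\<lambda>i. Suc (r i))) p)"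
    using Forall.prems by (intro Forall.IH[of "Suc k"]) (auto split: nat.split)
  then show ?case by simp
qed auto

lemma rename_inst:
  "rename r (inst t p) = inst (r t) (rename (case_nat 0 (\<lambda>i. Suc (r i))) p)"
proof -
  have "(\<lambda>i. r (case_nat t (\<lambda>i. i) i))
      = (\<lambda>i. case_nat (r t) (\<lambda>i. i) (case_nat 0 (\<lambda>i. Suc (r i)) i))"
    by (auto split: nat.split)
  then show ?thesis by (simp add: inst_def rename_rename)
qed

lemma proves_weaken: "S \<turnstile> p \<Longrightarrow> S \<subseteq> S' \<Longrightarrow> S' \<turnstile> p"
proof (induction arbitrary: S' rule: proves.induct)
  case (ImpI p T q)
  then show ?case by (metis insert_mono proves.ImpI)
next
  case (Contr p T)
  then show ?case by (metis insert_mono proves.Contr)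
next
  case (AllI T p)
  then show ?case by (metis image_mono proves.AllI)
qed (blast intro: proves.intros)+

text \<open>In the case of quantifier introduction the renaming is lifted under the binder, and the
  lifted renaming commutes with the shift of the context.\<close>

lemma proves_rename: "S \<turnstile> p \<Longrightarrow> rename r ` S \<turnstile> rename r p"
proof (induction arbitrary: r rule: proves.induct)
  case (AllI T p)
  have "rename (case_nat 0 (\<lambda>i. Suc (r i))) ` rename Suc ` T = rename Suc ` rename r ` T"
    by (simp add: image_image rename_rename)
  with AllI.IH[of "case_nat 0 (\<lambda>i. Suc (r i))"] show ?case
    by (simp add: proves.AllI)
next
  case (AllE T p t)
  then show ?case by (metis proves.AllE rename.simps(5) rename_inst)
next
  case (Subst T s t p)
  then show ?case by (metis proves.Subst rename.simps(2) rename_inst)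
next
  case (ImpI p T q)
  then show ?case by (metis image_insert proves.ImpI rename.simps(4))
next
  case (ImpE T p q)
  then show ?case by (metis proves.ImpE rename.simps(4))
next
  case (Contr p T)
  then show ?case
    by (metis image_insert proves.Contr rename.simps(3) rename.simps(4))
qed (auto intro: proves.intros)

text \<open>A derivation touches finitely many assumptions; this is what keeps the union of an
  increasing chain of consistent sets consistent.\<close>

lemma proves_compact: "S \<turnstile> p \<Longrightarrow> \<exists>F\<subseteq>S. finite F \<and> (F \<turnstile> p)"
proof (induction rule: proves.induct)
  case (Assm p T)
  then show ?case by (intro exI[of _ "{p}"]) (auto intro: proves.Assm)
next
  case (ImpI p T q)
  then obtain F where F: "F \<subseteq> insert p T" "finite F" "F \<turnstile> q" by blast
  then have "insert p (F - {p}) \<turnstile> q" by (auto intro: proves_weaken)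
  then have "F - {p} \<turnstile> Implies p q" by (rule proves.ImpI)
  then show ?case using F by (intro exI[of _ "F - {p}"]) auto
next
  case (Contr p T)
  let ?n = "Implies p Falsum"
  obtain F where F: "F \<subseteq> insert ?n T" "finite F" "F \<turnstile> Falsum" using Contr by blast
  then have "insert ?n (F - {?n}) \<turnstile> Falsum" by (auto intro: proves_weaken)
  then have "F - {?n} \<turnstile> p" by (rule proves.Contr)
  then show ?case using F by (intro exI[of _ "F - {?n}"]) auto
next
  case (ImpE T p q)
  then obtain F G where "F \<subseteq> T" "finite F" "F \<turnstile> Implies p q" "G \<subseteq> T" "finite G" "G \<turnstile> p"
    by blast
  then show ?case
    by (intro exI[of _ "F \<union> G"]) (auto intro: proves.ImpE proves_weaken)
next
  case (AllI T p)
  then obtain F where F: "F \<subseteq> rename Suc ` T" "finite F" "F \<turnstile> p" by blast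
  then obtain G where "G \<subseteq> T" "finite G" "F = rename Suc ` G"
    by (meson finite_subset_image)
  then show ?case using F proves.AllI by blast
next
  case (Subst T s t p)
  then obtain F G where "F \<subseteq> T" "finite F" "F \<turnstile> Equal s t" "G \<subseteq> T" "finite G" "G \<turnstile> inst s p"
    by blast
  then show ?case
    by (intro exI[of _ "F \<union> G"]) (auto intro: proves.Subst proves_weaken)
qed (blast intro: proves.intros)+

text \<open>The calculus generalizes only over index 0 of a shifted context. A variable
  \<open>k\<close> that is fresh for \<open>S\<close> is brought there by a renaming.\<close>

lemma proves_generalize:
  assumes "S \<turnstile> inst k p" and "\<forall>q\<in>S. free_below k q" and "free_below k (Forall p)"
  shows "S \<turnstile> Forall p"
proof -
  \<comment> \<open>On formulas whose indices are below \<open>k\<close> this is just the shift, so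
    the context becomes the one that \<open>AllI\<close> expects, while \<open>k\<close> itself
    becomes index 0.\<close>
  let ?r = "\<lambda>i. if i = k then 0 else Suc i"
  have "rename ?r ` S = rename Suc ` S"
    using assms(2) by (intro image_cong refl) (auto intro!: rename_cong)
  moreover have "rename ?r (inst k p) = p"
  proof -
    have "rename ?r (inst k p) = rename (\<lambda>i. ?r (case_nat k (\<lambda>i. i) i)) p"
      by (simp add: inst_def rename_rename)
    also have "\<dots> = rename (\<lambda>i. i) p"
      using assms(3) by (intro rename_cong[of "Suc k"]) (auto split: nat.split)
    finally show ?thesis by simp
  qed
  ultimately have "rename Suc ` S \<turnstile> p" using proves_rename[OF assms(1), of ?r] by simp
  then show ?thesis by (rule proves.AllI)
qed

section \<open>Henkin's construction and completeness\<close>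

abbreviation Neg :: "fm \<Rightarrow> fm" where "Neg p \<equiv> Implies p Falsum"

definition con :: "fm set \<Rightarrow> bool" where "con S \<longleftrightarrow> \<not> (S \<turnstile> Falsum)"

text \<open>Free variables serve as Henkin constants, so the language is never extended: a bound on
  the free indices of \<open>S\<close> always leaves fresh ones.\<close>

lemma henkin_step:
  assumes "con S" and "\<forall>q\<in>S. free_below k q"
  obtains S' k' where "S \<subseteq> S'" "con S'" "\<forall>q\<in>S'. free_below k' q"
    "\<phi> \<in> S' \<or> \<not> con (insert \<phi> S)" "\<And>q. \<phi> = Neg (Forall q) \<Longrightarrow> \<phi> \<in> S' \<Longrightarrow> \<exists>t. Neg (inst t q) \<in> S'"
proof (cases "con (insert \<phi> S)")
  case True
  obtain l where "free_below l \<phi>" using free_below_exists by blast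
  \<comment> \<open>No free index of \<open>S\<close> or of \<open>\<phi>\<close> reaches
    \<open>m\<close>, so \<open>m\<close> can name the counterexample to a negated universal
    formula.\<close>
  define m where "m = k + l"
  have m: "\<forall>q\<in>insert \<phi> S. free_below m q"
    using assms(2) \<open>free_below l \<phi>\<close> by (auto simp: m_def intro: free_below_mono)
  show ?thesis
  proof (cases "\<exists>q. \<phi> = Neg (Forall q)")
    case True
    then obtain q where q: "\<phi> = Neg (Forall q)" by blast
    let ?S = "insert (Neg (inst m q)) (insert \<phi> S)"
    have "con ?S"
      unfolding con_def
    proof
      assume "?S \<turnstile> Falsum"
      then have "insert \<phi> S \<turnstile> inst m q" by (rule proves.Contr)
      then have "insert \<phi> S \<turnstile> Forall q"
        using m q by (intro proves_generalize[of _ m]) auto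
      moreover have "insert \<phi> S \<turnstile> Neg (Forall q)" using q by (auto intro: proves.Assm)
      ultimately have "insert \<phi> S \<turnstile> Falsum" by (blast intro: proves.ImpE)
      with \<open>con (insert \<phi> S)\<close> show False by (simp add: con_def)
    qed
    moreover have "\<forall>q\<in>?S. free_below (Suc m) q"
    proof -
      have "free_below (Suc m) (inst m q)"
        using m q unfolding inst_def by (intro free_below_rename[of "Suc m"]) (auto split: nat.split)
      then show ?thesis using m by (auto intro: free_below_mono)
    qed
    ultimately show ?thesis
      by (intro that[of ?S "Suc m"]) (use q in auto)
  next
    case False
    show ?thesis by (rule that[of "insert \<phi> S" m]) (use False True m in auto)
  qed
next
  case False
  have "\<phi> \<notin> S" using False assms(1) by (auto simp: insert_absorb)
  then show ?thesis using that[of S k] False assms by blast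
qed

instance fm :: countable by countable_datatype

text \<open>All formulas are enumerated and decided one at a time. Every stage has its own bound on
  free indices but the union has none, hence the existential bound in the invariant of the
  chain.\<close>

lemma henkin_exists:
  assumes "con S" and "\<forall>q\<in>S. free_below k q"
  obtains W where "S \<subseteq> W" "con W" "\<And>\<phi>. \<phi> \<in> W \<or> \<not> con (insert \<phi> W)"
    "\<And>q. Neg (Forall q) \<in> W \<Longrightarrow> \<exists>t. Neg (inst t q) \<in> W"
proof -
  let ?P = "\<lambda>n (X::fm set). S \<subseteq> X \<and> con X \<and> (\<exists>k. \<forall>q\<in>X. free_below k q)"
  let ?Q = "\<lambda>n X X'. X \<subseteq> X' \<and> (from_nat n \<in> X' \<or> \<not> con (insert (from_nat n) X))
    \<and> (\<forall>q. from_nat n = Neg (Forall q) \<and> from_nat n \<in> X' \<longrightarrow> (\<exists>t. Neg (inst t q) \<in> X'))"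
  have "\<exists>f. \<forall>n. ?P n (f n) \<and> ?Q n (f n) (f (Suc n))"
  proof (rule dependent_nat_choice)
    show "\<exists>X. ?P 0 X" using assms by blast
  next
    fix X :: "fm set" and n assume X: "?P n X"
    then obtain k where "con X" "\<forall>q\<in>X. free_below k q" by blast
    from henkin_step[OF this, of "from_nat n"] X
    show "\<exists>Y. ?P (Suc n) Y \<and> ?Q n X Y" by (smt (verit) order_trans)
  qed
  then obtain f where f: "\<And>n. ?P n (f n)" "\<And>n. ?Q n (f n) (f (Suc n))" by blast
  define W where "W = (\<Union>n. f n)"
  have mono: "mono f" using f(2) by (simp add: mono_iff_le_Suc)
  have fin: "\<exists>n. F \<subseteq> f n" if "finite F" "F \<subseteq> W" for F
    using that
  proof (induction F)
    case (insert x F)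
    then obtain n m where "F \<subseteq> f n" "x \<in> f m" by (auto simp: W_def)
    then have "insert x F \<subseteq> f (max n m)"
      using monoD[OF mono, of n "max n m"] monoD[OF mono, of m "max n m"] by auto
    then show ?case ..
  qed simp
  have conW: "con W"
    unfolding con_def
  proof
    assume "W \<turnstile> Falsum"
    then obtain F where "F \<subseteq> W" "finite F" "F \<turnstile> Falsum" using proves_compact by blast
    then obtain n where "F \<subseteq> f n" using fin by blast
    then have "f n \<turnstile> Falsum" using \<open>F \<turnstile> Falsum\<close> by (rule proves_weaken[rotated])
    then show False using f(1)[of n] by (simp add: con_def)
  qed
  have sub: "f n \<subseteq> W" for n by (auto simp: W_def)
  show ?thesis
  proof (rule that[of W])
    show "S \<subseteq> W" using f(1)[of 0] sub by blast
    show "con W" by (rule conW)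
    show "\<phi> \<in> W \<or> \<not> con (insert \<phi> W)" for \<phi>
    proof -
      obtain n where n: "\<phi> = from_nat n" by (metis from_nat_to_nat)
      have "\<phi> \<in> f (Suc n) \<or> \<not> con (insert \<phi> (f n))" using f(2)[of n] n by blast
      then show ?thesis
        using sub[of n] sub[of "Suc n"] proves_weaken unfolding con_def by (meson insert_mono subsetD)
    qed
    fix q assume q: "Neg (Forall q) \<in> W"
    obtain n where n: "Neg (Forall q) = from_nat n" by (metis from_nat_to_nat)
    \<comment> \<open>A formula of \<open>W\<close> is consistent with every stage, so at its own
      turn it was accepted, and its witness with it.\<close>
    have "con (insert (Neg (Forall q)) (f n))"
      using conW q sub[of n] proves_weaken unfolding con_def
      by (metis insert_subset)
    then have "Neg (Forall q) \<in> f (Suc n)" using f(2)[of n] n by force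
    then have "\<exists>t. Neg (inst t q) \<in> f (Suc n)" using f(2)[of n] n by (metis (no_types))
    then show "\<exists>t. Neg (inst t q) \<in> W" using sub by blast
  qed
qed

text \<open>The term model consists of the variables modulo equality in \<open>W\<close>. Its
  elements are least representatives rather than classes, which makes the carrier a set of naturals;
  this is used later to pass to a structure on a full type.\<close>

theorem completeness:
  assumes "\<forall>p\<in>S. free_below 0 p" and "free_below 0 \<phi>" and "\<not> (S \<turnstile> \<phi>)"
  obtains E :: "nat \<Rightarrow> nat \<Rightarrow> bool" and A v where
    "\<And>i. v i \<in> A" "\<And>p. p \<in> S \<Longrightarrow> ev E A p v" "\<not> ev E A \<phi> v"
proof -
  let ?S = "insert (Neg \<phi>) S"
  have "con ?S" using assms(3) proves.Contr unfolding con_def by metis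
  moreover have "\<forall>q\<in>?S. free_below 0 q" using assms by auto
  ultimately obtain W where W: "?S \<subseteq> W" and conW: "con W"
    and max: "\<And>\<phi>. \<phi> \<in> W \<or> \<not> con (insert \<phi> W)"
    and wit: "\<And>q. Neg (Forall q) \<in> W \<Longrightarrow> \<exists>t. Neg (inst t q) \<in> W"
    using henkin_exists by metis
  have neg: "W \<turnstile> Neg p" if "p \<notin> W" for p
    using max[of p] that proves.ImpI unfolding con_def by metis
  have closed: "p \<in> W" if "W \<turnstile> p" for p
    using neg[of p] that conW proves.ImpE unfolding con_def by metis
  have F: "Falsum \<notin> W" using conW proves.Assm unfolding con_def by metis
  have I: "Implies p q \<in> W \<longleftrightarrow> (p \<in> W \<longrightarrow> q \<in> W)" for p q
  proof
    show "Implies p q \<in> W \<Longrightarrow> p \<in> W \<longrightarrow> q \<in> W"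
      using closed proves.ImpE proves.Assm by metis
    have "W \<turnstile> Implies p q" if "p \<notin> W"
    proof (rule proves.ImpI, rule proves.Contr)
      have "insert (Neg q) (insert p W) \<turnstile> Neg p" using neg[OF that] proves_weaken by (metis subset_insertI insertI2 subsetI)
      then show "insert (Neg q) (insert p W) \<turnstile> Falsum"
        by (rule proves.ImpE) (simp add: proves.Assm)
    qed
    moreover have "W \<turnstile> Implies p q" if "q \<in> W"
      using that by (intro proves.ImpI proves.Assm) simp
    ultimately show "p \<in> W \<longrightarrow> q \<in> W \<Longrightarrow> Implies p q \<in> W" using closed by blast
  qed
  have A: "Forall p \<in> W \<longleftrightarrow> (\<forall>t. inst t p \<in> W)" for p
  proof
    show "Forall p \<in> W \<Longrightarrow> \<forall>t. inst t p \<in> W"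
      using closed proves.AllE proves.Assm by metis
    show "\<forall>t. inst t p \<in> W \<Longrightarrow> Forall p \<in> W"
      using wit[of p] closed[OF neg, of "Forall p"] I F by blast
  qed
  have refl: "Equal x x \<in> W" for x using closed proves.Refl by metis
  have subst: "inst y p \<in> W" if "Equal x y \<in> W" "inst x p \<in> W" for x y p
    using that closed proves.Subst proves.Assm by metis
  have sym: "Equal y x \<in> W" if "Equal x y \<in> W" for x y
    using subst[OF that, of "Equal 0 (Suc x)"] refl[of x] by (simp add: inst_def)
  have trans: "Equal x z \<in> W" if "Equal x y \<in> W" "Equal y z \<in> W" for x y z
    using subst[OF that(2), of "Equal (Suc x) 0"] that by (simp add: inst_def)
  define h where "h x = (LEAST y. Equal x y \<in> W)" for x
  have h: "Equal x (h x) \<in> W" for x unfolding h_def using refl by (rule LeastI)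
  have heq: "h x = h y \<longleftrightarrow> Equal x y \<in> W" for x y
  proof
    show "h x = h y \<Longrightarrow> Equal x y \<in> W" using h sym trans by metis
    assume "Equal x y \<in> W"
    then have "Equal x z \<in> W \<longleftrightarrow> Equal y z \<in> W" for z using sym trans by blast
    then show "h x = h y" by (simp add: h_def)
  qed
  define E where "E x y \<longleftrightarrow> Member x y \<in> W" for x y
  have hmem: "E (h x) (h y) \<longleftrightarrow> Member x y \<in> W" for x y
  proof -
    have "Member x y \<in> W \<Longrightarrow> Equal x x' \<in> W \<Longrightarrow> Equal y y' \<in> W \<Longrightarrow> Member x' y' \<in> W" for x y x' y'
      using subst[of x x' "Member 0 (Suc y)"] subst[of y y' "Member (Suc x') 0"]
      by (simp add: inst_def)
    then show ?thesis unfolding E_def using h sym by blast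
  qed
  \<comment> \<open>Every assignment into the carrier has the form \<open>h\<close> after some
    \<open>r\<close>, so generalizing over renamings is what the quantifier case requires.\<close>
  have truth: "ev E (range h) p (\<lambda>i. h (r i)) \<longleftrightarrow> rename r p \<in> W" for p r
  proof (induction p arbitrary: r)
    case (Forall p)
    have "case_nat (h t) (\<lambda>i. h (r i)) = (\<lambda>i. h (case_nat t r i))" for t
      by (auto split: nat.split)
    moreover have "inst t (rename (case_nat 0 (\<lambda>i. Suc (r i))) p) = rename (case_nat t r) p" for t
      unfolding inst_def rename_rename by (rule arg_cong[of _ _ "\<lambda>r. rename r p"]) (auto split: nat.split)
    ultimately show ?case by (simp add: A Forall.IH)
  qed (auto simp: hmem heq I F)
  show ?thesis
  proof (rule that[of h "range h" E])
    show "ev E (range h) p h" if "p \<in> S" for p using truth[of p "\<lambda>i. i"] W that by auto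
    show "\<not> ev E (range h) \<phi> h" using truth[of \<phi> "\<lambda>i. i"] W I F by auto
  qed simp
qed

section \<open>Semantics of formulas in context\<close>

declare num.simps [simp del]

text \<open>The list \<open>xs\<close> gives the values of the variables in scope by level, outermost first, so the
  assignment to de Bruijn indices reads it backwards.\<close>

definition env :: "'a list \<Rightarrow> nat \<Rightarrow> 'a" where
  "env xs i = (if i < length xs then xs ! (length xs - Suc i) else undefined)"

definition holds :: "('a \<Rightarrow> 'a \<Rightarrow> bool) \<Rightarrow> 'a set \<Rightarrow> 'a list \<Rightarrow> form \<Rightarrow> bool" where
  "holds E A xs F = ev E A (F (length xs)) (env xs)"

lemma env_snoc: "env (xs @ [d]) = case_nat d (env xs)"
  by (rule ext) (auto simp: env_def nth_append split: nat.split)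

lemma holds_mem [simp]:
  "x < length xs \<Longrightarrow> y < length xs \<Longrightarrow> holds E A xs (x \<^bold>\<in> y) \<longleftrightarrow> E (xs ! x) (xs ! y)"
  by (cases "xs = []") (simp_all add: holds_def mem_def env_def)

lemma holds_eq [simp]:
  "x < length xs \<Longrightarrow> y < length xs \<Longrightarrow> holds E A xs (x \<^bold>= y) \<longleftrightarrow> xs ! x = xs ! y"
  by (cases "xs = []") (simp_all add: holds_def eq_def env_def)

lemma holds_fls [simp]: "\<not> holds E A xs \<^bold>\<bottom>"
  by (simp add: holds_def fls_def)

lemma holds_imp [simp]: "holds E A xs (p \<^bold>\<longrightarrow> q) \<longleftrightarrow> (holds E A xs p \<longrightarrow> holds E A xs q)"
  by (simp add: holds_def imp_def)

lemma holds_neg [simp]: "holds E A xs (\<^bold>\<not> p) \<longleftrightarrow> \<not> holds E A xs p"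
  by (simp add: neg_def)

lemma holds_conj [simp]: "holds E A xs (p \<^bold>\<and> q) \<longleftrightarrow> holds E A xs p \<and> holds E A xs q"
  by (simp add: conj_def)

lemma holds_disj [simp]: "holds E A xs (p \<^bold>\<or> q) \<longleftrightarrow> holds E A xs p \<or> holds E A xs q"
  by (auto simp: disj_def)

lemma holds_iff [simp]: "holds E A xs (p \<^bold>\<longleftrightarrow> q) \<longleftrightarrow> (holds E A xs p \<longleftrightarrow> holds E A xs q)"
  by (auto simp: iff_def)

text \<open>A quantifier binds the level \<open>length xs\<close>, so the new value goes to the end
  of the list and the existing levels keep their meaning.\<close>

lemma holds_all [simp]:
  "holds E A xs (all F) \<longleftrightarrow> (\<forall>d\<in>A. holds E A (xs @ [d]) (F (length xs)))"
  by (simp add: holds_def all_def env_snoc)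

lemma holds_ex [simp]:
  "holds E A xs (ex F) \<longleftrightarrow> (\<exists>d\<in>A. holds E A (xs @ [d]) (F (length xs)))"
  by (simp add: ex_def)

section \<open>Bounds on the free variables of formulas in context\<close>

definition fb :: "nat \<Rightarrow> form \<Rightarrow> bool" where
  "fb n F = free_below n (F n)"

text \<open>Truncated subtraction keeps \<open>n - Suc x\<close> below \<open>n\<close> for every
  \<open>x\<close>, so no side conditions on levels arise.\<close>

lemma fb_mem [simp]: "0 < n \<Longrightarrow> fb n (x \<^bold>\<in> y)"
  by (simp add: fb_def mem_def)

lemma fb_eq [simp]: "0 < n \<Longrightarrow> fb n (x \<^bold>= y)"
  by (simp add: fb_def eq_def)

lemma fb_fls [simp]: "fb n \<^bold>\<bottom>"
  by (simp add: fb_def fls_def)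

lemma fb_imp [simp]: "fb n (p \<^bold>\<longrightarrow> q) \<longleftrightarrow> fb n p \<and> fb n q"
  by (simp add: fb_def imp_def)

lemma fb_all [simp]: "fb n (all F) \<longleftrightarrow> fb (Suc n) (F n)"
  by (simp add: fb_def all_def)

lemma fb_connectives [simp]:
  "fb n (\<^bold>\<not> p) \<longleftrightarrow> fb n p" "fb n (p \<^bold>\<and> q) \<longleftrightarrow> fb n p \<and> fb n q"
  "fb n (p \<^bold>\<or> q) \<longleftrightarrow> fb n p \<and> fb n q" "fb n (p \<^bold>\<longleftrightarrow> q) \<longleftrightarrow> fb n p \<and> fb n q"
  "fb n (ex F) \<longleftrightarrow> fb (Suc n) (F n)"
  by (auto simp: neg_def conj_def disj_def iff_def ex_def)

lemma fb_basic [simp]: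
  assumes "0 < n"
  shows "fb n (is_empty x)" "fb n (x \<^bold>\<subseteq> y)" "fb n (is_upair x y z)" "fb n (is_succ x y)"
    "fb n (is_trans x)" "fb n (is_pair x y z)" "fb n (is_ord x)" "fb n (is_limit x)"
    "fb n (is_omega x)" "fb n (is_nat x)" "fb n (is_app x y z)" "fb n (is_fun x y)"
    "fb n (is_map x y z)" "fb n (is_inj x y z)" "fb n (is_bij x y z)" "fb n (card_less x y)"
  using assms
  by (simp_all add: is_empty_def sub_def is_upair_def is_succ_def is_trans_def is_pair_def
      is_ord_def is_limit_def is_omega_def is_nat_def is_app_def is_fun_def is_map_def is_inj_def
      is_bij_def card_less_def)

text \<open>A term may bind auxiliary variables before it calls \<open>P\<close>, and may itself be
  called in a longer context; boundedness of \<open>P\<close> is therefore asked in all longer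
  contexts.\<close>

definition tfb :: "nat \<Rightarrow> trm \<Rightarrow> bool" where
  "tfb n t \<longleftrightarrow> (\<forall>m\<ge>n. \<forall>P. (\<forall>k\<ge>m. \<forall>y. 0 < k \<longrightarrow> fb k (P y)) \<longrightarrow> fb m (t P))"

lemma tfbD: "tfb n t \<Longrightarrow> n \<le> m \<Longrightarrow> (\<And>k y. m \<le> k \<Longrightarrow> 0 < k \<Longrightarrow> fb k (P y)) \<Longrightarrow> fb m (t P)"
  unfolding tfb_def by blast

lemma tfb_V [simp]: "0 < n \<Longrightarrow> tfb n (V x)"
  by (simp add: tfb_def V_def)

lemma tfb_num [simp]: "tfb n (num i)"
proof (induction i)
  case (Suc i)
  show ?case unfolding tfb_def by (auto simp: num.simps intro!: tfbD[OF Suc])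
qed (simp add: tfb_def num.simps)

lemma tfb_pair [simp]: "tfb n s \<Longrightarrow> tfb n t \<Longrightarrow> tfb n (pair s t)"
  unfolding tfb_def[of n "pair s t"]
  by (auto simp: pair_def intro!: tfbD[of n s] tfbD[of n t])

lemma tfb_codes [simp]:
  "tfb n s \<Longrightarrow> tfb n t \<Longrightarrow> tfb n (cMem s t)" "tfb n s \<Longrightarrow> tfb n t \<Longrightarrow> tfb n (cEq s t)"
  "tfb n cFls" "tfb n s \<Longrightarrow> tfb n t \<Longrightarrow> tfb n (cImp s t)"
  "tfb n s \<Longrightarrow> tfb n t \<Longrightarrow> tfb n (cAll s t)"
  by (simp_all add: cMem_def cEq_def cFls_def cImp_def cAll_def)

lemma tfb_derived_codes [simp]:
  "tfb n s \<Longrightarrow> tfb n (cNeg s)" "tfb n s \<Longrightarrow> tfb n t \<Longrightarrow> tfb n (cAnd s t)"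
  "tfb n s \<Longrightarrow> tfb n t \<Longrightarrow> tfb n (cIff s t)" "tfb n s \<Longrightarrow> tfb n t \<Longrightarrow> tfb n (cEx s t)"
  by (simp_all add: cNeg_def cAnd_def cIff_def cEx_def)

lemma tfb_schemes [simp]:
  "tfb n s \<Longrightarrow> tfb n t \<Longrightarrow> tfb n (cSeparation s t)"
  "tfb n s \<Longrightarrow> tfb n t \<Longrightarrow> tfb n (cReplacement s t)"
  unfolding cSeparation_def cReplacement_def
  by (intro tfb_codes tfb_derived_codes tfb_num; assumption)+

lemma tfb_quote [simp]: "tfb n (quote d p)"
  by (induction p arbitrary: d) simp_all

lemma fb_is_val [simp]: "0 < n \<Longrightarrow> tfb n t \<Longrightarrow> fb n (x \<^bold>\<simeq> t)"
  unfolding is_val_def by (auto intro: tfbD)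

lemma fb_sat [simp]:
  assumes "0 < n"
  shows "fb n (is_formula m c)" "(\<And>k y. 0 < k \<Longrightarrow> fb k (P y)) \<Longrightarrow> fb n (is_truth_set M m S P)"
    "fb n (agree_off m i x y)" "fb n (sat M m c a)"
  using assms by (simp_all add: is_formula_def is_truth_set_def agree_off_def sat_def)

lemma fb_models [simp]:
  assumes "0 < n"
  shows "fb n (is_ZFC_axiom c)" "fb n (is_valid M c)" "fb n (sat_ZFC M)" "fb n (is_model M)"
    "fb n (sat_card_less M x y)" "fb n (is_elem_emb j M N)" "fb n (in_Crit x j M)"
    "fb n (strongly_critical_at x M)" "fb n (strongly_critical M)"
  using assms
  by (simp_all add: is_ZFC_axiom_def is_valid_def sat_ZFC_def is_model_def sat_card_less_def
      is_elem_emb_def in_Crit_def strongly_critical_at_def strongly_critical_def)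

lemma fb_L [simp]:
  assumes "0 < n"
  shows "fb n (is_Def x y)" "fb n (is_L_hierarchy x y)" "fb n (is_L_level x y)"
  using assms by (simp_all add: is_Def_def is_L_hierarchy_def is_L_level_def)

lemma fb_sentences:
  "fb 0 ax_empty" "fb 0 ax_ext" "fb 0 ax_pair" "fb 0 ax_union" "fb 0 ax_product" "fb 0 ax_omega"
  "fb 0 ax_foundation" "fb 0 ax_power" "fb 0 ax_infinity" "fb 0 ax_choice"
  "fb 0 Loc_ZFC" "fb 0 TMA" "fb 0 exists_strongly_critical" "fb 0 V_eq_L"
  by (simp_all add: ax_empty_def ax_ext_def ax_pair_def ax_union_def ax_product_def ax_omega_def
      ax_foundation_def ax_power_def ax_infinity_def ax_choice_def
      Loc_ZFC_def TMA_def exists_strongly_critical_def V_eq_L_def)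

lemma free_below_funpow_Forall: "free_below n ((Forall ^^ k) p) \<longleftrightarrow> free_below (n + k) p"
  by (induction k arbitrary: n) auto

lemma free_below_separation:
  assumes "free_below (k + 2) p"
  shows "free_below 0 (separation k p)"
proof -
  have "free_below (Suc (Suc (Suc k))) (rename (case_nat 0 (\<lambda>i. Suc (Suc i))) p)"
    using assms by (rule free_below_rename) (auto split: nat.split)
  then have "fb k (\<^bold>\<forall>z. \<^bold>\<exists>y. \<^bold>\<forall>x. x \<^bold>\<in> y \<^bold>\<longleftrightarrow> x \<^bold>\<in> z \<^bold>\<and> (\<lambda>n. rename (case_nat 0 (\<lambda>i. Suc (Suc i))) p))"
    by simp (simp add: fb_def)
  then show ?thesis by (simp add: separation_def free_below_funpow_Forall fb_def)
qed

lemma free_below_LZFC: "p \<in> LZFC \<Longrightarrow> free_below 0 p"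
  using fb_sentences unfolding LZFC_def BST_def fb_def by (auto simp: free_below_separation)

lemma ev_sentence: "fb 0 F \<Longrightarrow> ev E A (F 0) v \<longleftrightarrow> holds E A [] F"
  unfolding holds_def fb_def by (metis ev_cong less_nat_zero_code list.size(3))

lemma ev_holds:
  assumes "fb (length xs) F" "\<And>i. i < length xs \<Longrightarrow> v i = xs ! (length xs - Suc i)"
  shows "ev E A (F (length xs)) v \<longleftrightarrow> holds E A xs F"
  using assms unfolding holds_def fb_def by (intro ev_cong[of "length xs"]) (auto simp: env_def)

section \<open>Set theory inside a structure\<close>

text \<open>Parts of \<open>is_formula\<close>, \<open>sat\<close> and \<open>is_Def\<close>, named so that their absoluteness can be shown step
  by step.\<close>

definition fC :: "var \<Rightarrow> var \<Rightarrow> var \<Rightarrow> var \<Rightarrow> form" where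
  "fC m f k d =
            ((\<^bold>\<exists>i j. i \<^bold>\<in> m \<^bold>\<and> j \<^bold>\<in> m \<^bold>\<and> d \<^bold>\<simeq> cMem (V i) (V j))
          \<^bold>\<or> (\<^bold>\<exists>i j. i \<^bold>\<in> m \<^bold>\<and> j \<^bold>\<in> m \<^bold>\<and> d \<^bold>\<simeq> cEq (V i) (V j))
          \<^bold>\<or> d \<^bold>\<simeq> cFls
          \<^bold>\<or> (\<^bold>\<exists>k1 d1 k2 d2. k1 \<^bold>\<in> k \<^bold>\<and> is_app f k1 d1 \<^bold>\<and> k2 \<^bold>\<in> k \<^bold>\<and> is_app f k2 d2
               \<^bold>\<and> d \<^bold>\<simeq> cImp (V d1) (V d2))
          \<^bold>\<or> (\<^bold>\<exists>i k1 d1. i \<^bold>\<in> m \<^bold>\<and> k1 \<^bold>\<in> k \<^bold>\<and> is_app f k1 d1 \<^bold>\<and> d \<^bold>\<simeq> cAll (V i) (V d1)))"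

definition fT :: "var \<Rightarrow> var \<Rightarrow> var \<Rightarrow> var \<Rightarrow> var \<Rightarrow> var \<Rightarrow> var \<Rightarrow> form" where
  "fT M m f s k d S =
            ((\<^bold>\<exists>i j. i \<^bold>\<in> m \<^bold>\<and> j \<^bold>\<in> m \<^bold>\<and> d \<^bold>\<simeq> cMem (V i) (V j)
               \<^bold>\<and> is_truth_set M m S (\<lambda>a. \<^bold>\<exists>x y. is_app a i x \<^bold>\<and> is_app a j y \<^bold>\<and> x \<^bold>\<in> y))
          \<^bold>\<or> (\<^bold>\<exists>i j. i \<^bold>\<in> m \<^bold>\<and> j \<^bold>\<in> m \<^bold>\<and> d \<^bold>\<simeq> cEq (V i) (V j)
               \<^bold>\<and> is_truth_set M m S (\<lambda>a. \<^bold>\<exists>x. is_app a i x \<^bold>\<and> is_app a j x))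
          \<^bold>\<or> (d \<^bold>\<simeq> cFls \<^bold>\<and> is_truth_set M m S (\<lambda>a. \<^bold>\<bottom>))
          \<^bold>\<or> (\<^bold>\<exists>k1 d1 S1 k2 d2 S2. k1 \<^bold>\<in> k \<^bold>\<and> is_app f k1 d1 \<^bold>\<and> is_app s k1 S1
               \<^bold>\<and> k2 \<^bold>\<in> k \<^bold>\<and> is_app f k2 d2 \<^bold>\<and> is_app s k2 S2
               \<^bold>\<and> d \<^bold>\<simeq> cImp (V d1) (V d2)
               \<^bold>\<and> is_truth_set M m S (\<lambda>a. a \<^bold>\<in> S1 \<^bold>\<longrightarrow> a \<^bold>\<in> S2))
          \<^bold>\<or> (\<^bold>\<exists>i k1 d1 S1. i \<^bold>\<in> m \<^bold>\<and> k1 \<^bold>\<in> k \<^bold>\<and> is_app f k1 d1 \<^bold>\<and> is_app s k1 S1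
               \<^bold>\<and> d \<^bold>\<simeq> cAll (V i) (V d1)
               \<^bold>\<and> is_truth_set M m S
                    (\<lambda>a. \<^bold>\<forall>b. is_map b m M \<^bold>\<and> agree_off m i a b \<^bold>\<longrightarrow> b \<^bold>\<in> S1)))"

definition in_Def :: "var \<Rightarrow> var \<Rightarrow> form" where
  "in_Def A X = (X \<^bold>\<subseteq> A \<^bold>\<and>
     (\<^bold>\<exists>m c z d p. is_formula m c \<^bold>\<and> is_empty z \<^bold>\<and> z \<^bold>\<in> m
        \<^bold>\<and> (\<^bold>\<forall>i. i \<^bold>\<in> d \<^bold>\<longleftrightarrow> i \<^bold>\<in> m \<^bold>\<and> \<^bold>\<not> i \<^bold>= z) \<^bold>\<and> is_map p d A
        \<^bold>\<and> (\<^bold>\<forall>x. x \<^bold>\<in> A \<^bold>\<longrightarrow>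
             (x \<^bold>\<in> X \<^bold>\<longleftrightarrow> (\<^bold>\<exists>a. is_map a m A \<^bold>\<and> p \<^bold>\<subseteq> a \<^bold>\<and> is_app a z x \<^bold>\<and> sat A m c a)))))"

lemma is_Def_eq: "is_Def A D = (\<^bold>\<forall>X. X \<^bold>\<in> D \<^bold>\<longleftrightarrow> in_Def A X)"
  unfolding is_Def_def in_Def_def ..

lemma fb_in_Def [simp]: "0 < n \<Longrightarrow> fb n (in_Def A X)"
  by (simp add: in_Def_def)

lemma fb_fC [simp]: "0 < n \<Longrightarrow> fb n (fC m f k d)" "0 < n \<Longrightarrow> fb n (fT M m f s k d S)"
  by (simp_all add: fC_def fT_def)

section \<open>The external reading of the formulas over an arbitrary membership relation\<close>

locale membership =
  fixes E :: "'a \<Rightarrow> 'a \<Rightarrow> bool"  (infix "\<epsilon>" 50)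
begin

definition els :: "'a \<Rightarrow> 'a set" where "els x = {y. y \<epsilon> x}"

lemma els_iff [simp]: "y \<in> els x \<longleftrightarrow> y \<epsilon> x"
  by (simp add: els_def)

definition small :: "'a set \<Rightarrow> bool" where "small X \<longleftrightarrow> (\<exists>x. els x = X)"

text \<open>Choice makes the set-forming operations below total functions. Each of them has the
  intended elements only after an axiom has shown smallness.\<close>

definition mk :: "'a set \<Rightarrow> 'a" where "mk X = (SOME x. els x = X)"

lemma mem_mk: "small X \<Longrightarrow> y \<epsilon> mk X \<longleftrightarrow> y \<in> X"
  unfolding small_def mk_def by (metis (mono_tags, lifting) els_iff someI)

definition emp :: 'a where "emp = mk {}"
definition upr :: "'a \<Rightarrow> 'a \<Rightarrow> 'a" where "upr x y = mk {x, y}"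
definition opr :: "'a \<Rightarrow> 'a \<Rightarrow> 'a" where "opr x y = upr (upr x x) (upr x y)"
definition big :: "'a \<Rightarrow> 'a" where "big x = mk {z. \<exists>y. y \<epsilon> x \<and> z \<epsilon> y}"
definition cup :: "'a \<Rightarrow> 'a \<Rightarrow> 'a" where "cup x y = big (upr x y)"
definition adj :: "'a \<Rightarrow> 'a \<Rightarrow> 'a" where "adj x y = cup x (upr y y)"
definition suc :: "'a \<Rightarrow> 'a" where "suc x = adj x x"

primrec nu :: "nat \<Rightarrow> 'a" where
  "nu 0 = emp"
| "nu (Suc n) = suc (nu n)"

declare nu.simps [simp del]

definition Sub :: "'a \<Rightarrow> 'a \<Rightarrow> bool" where "Sub x y \<longleftrightarrow> (\<forall>z. z \<epsilon> x \<longrightarrow> z \<epsilon> y)"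
definition Trn :: "'a \<Rightarrow> bool" where "Trn x \<longleftrightarrow> (\<forall>y z. y \<epsilon> x \<longrightarrow> z \<epsilon> y \<longrightarrow> z \<epsilon> x)"
definition Fnd :: "'a \<Rightarrow> bool" where "Fnd s \<longleftrightarrow> (\<exists>y. y \<epsilon> s \<and> (\<forall>z. z \<epsilon> s \<longrightarrow> \<not> z \<epsilon> y))"
definition Ord :: "'a \<Rightarrow> bool" where
  "Ord x \<longleftrightarrow> Trn x \<and> (\<forall>y z. y \<epsilon> x \<and> z \<epsilon> x \<longrightarrow> y \<epsilon> z \<or> y = z \<or> z \<epsilon> y)
    \<and> (\<forall>s. Sub s x \<and> s \<noteq> emp \<longrightarrow> Fnd s)"
definition Lim :: "'a \<Rightarrow> bool" where
  "Lim x \<longleftrightarrow> Ord x \<and> x \<noteq> emp \<and> (\<forall>y. y \<epsilon> x \<longrightarrow> suc y \<epsilon> x)"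
definition Omega :: "'a \<Rightarrow> bool" where "Omega w \<longleftrightarrow> Lim w \<and> (\<forall>x. x \<epsilon> w \<longrightarrow> \<not> Lim x)"
definition Nt :: "'a \<Rightarrow> bool" where "Nt x \<longleftrightarrow> (\<exists>w. Omega w \<and> x \<epsilon> w)"

definition Fun :: "'a \<Rightarrow> 'a \<Rightarrow> bool" where
  "Fun f a \<longleftrightarrow> (\<forall>p. p \<epsilon> f \<longrightarrow> (\<exists>x y. x \<epsilon> a \<and> p = opr x y)) \<and> (\<forall>x. x \<epsilon> a \<longrightarrow> (\<exists>!y. opr x y \<epsilon> f))"
definition Map :: "'a \<Rightarrow> 'a \<Rightarrow> 'a \<Rightarrow> bool" where
  "Map f a b \<longleftrightarrow> Fun f a \<and> (\<forall>x y. opr x y \<epsilon> f \<longrightarrow> y \<epsilon> b)"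
definition Inj :: "'a \<Rightarrow> 'a \<Rightarrow> 'a \<Rightarrow> bool" where
  "Inj f a b \<longleftrightarrow> Map f a b \<and> (\<forall>x y z. opr x z \<epsilon> f \<and> opr y z \<epsilon> f \<longrightarrow> x = y)"
definition Bij :: "'a \<Rightarrow> 'a \<Rightarrow> 'a \<Rightarrow> bool" where
  "Bij f a b \<longleftrightarrow> Inj f a b \<and> (\<forall>y. y \<epsilon> b \<longrightarrow> (\<exists>x. opr x y \<epsilon> f))"

definition kMem :: "'a \<Rightarrow> 'a \<Rightarrow> 'a" where "kMem i j = opr (nu 0) (opr i j)"
definition kEq :: "'a \<Rightarrow> 'a \<Rightarrow> 'a" where "kEq i j = opr (nu 1) (opr i j)"
definition kFls :: "'a" where "kFls = opr (nu 2) (nu 0)"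
definition kImp :: "'a \<Rightarrow> 'a \<Rightarrow> 'a" where "kImp i j = opr (nu 3) (opr i j)"
definition kAll :: "'a \<Rightarrow> 'a \<Rightarrow> 'a" where "kAll i j = opr (nu 4) (opr i j)"

definition FC :: "'a \<Rightarrow> 'a \<Rightarrow> 'a \<Rightarrow> 'a \<Rightarrow> bool" where
  "FC m f k d \<longleftrightarrow>
     (\<exists>i j. i \<epsilon> m \<and> j \<epsilon> m \<and> d = kMem i j) \<or> (\<exists>i j. i \<epsilon> m \<and> j \<epsilon> m \<and> d = kEq i j) \<or> d = kFls
   \<or> (\<exists>k1 d1 k2 d2. k1 \<epsilon> k \<and> opr k1 d1 \<epsilon> f \<and> k2 \<epsilon> k \<and> opr k2 d2 \<epsilon> f \<and> d = kImp d1 d2)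
   \<or> (\<exists>i k1 d1. i \<epsilon> m \<and> k1 \<epsilon> k \<and> opr k1 d1 \<epsilon> f \<and> d = kAll i d1)"

definition Cons :: "'a \<Rightarrow> 'a \<Rightarrow> 'a \<Rightarrow> bool" where
  "Cons m n f \<longleftrightarrow> Nt n \<and> Fun f n \<and> (\<forall>k d. k \<epsilon> n \<and> opr k d \<epsilon> f \<longrightarrow> FC m f k d)"

definition Fml :: "'a \<Rightarrow> 'a \<Rightarrow> bool" where
  "Fml m c \<longleftrightarrow> Nt m \<and> (\<exists>n f. Cons m n f \<and> (\<exists>k. k \<epsilon> n \<and> opr k c \<epsilon> f))"

definition TS :: "'a \<Rightarrow> 'a \<Rightarrow> 'a \<Rightarrow> ('a \<Rightarrow> bool) \<Rightarrow> bool" where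
  "TS M m S P \<longleftrightarrow> (\<forall>a. a \<epsilon> S \<longleftrightarrow> Map a m M \<and> P a)"

definition Agr :: "'a \<Rightarrow> 'a \<Rightarrow> 'a \<Rightarrow> 'a \<Rightarrow> bool" where
  "Agr m i a b \<longleftrightarrow> (\<forall>j x. j \<epsilon> m \<and> j \<noteq> i \<longrightarrow> (opr j x \<epsilon> a \<longleftrightarrow> opr j x \<epsilon> b))"

definition TC :: "'a \<Rightarrow> 'a \<Rightarrow> 'a \<Rightarrow> 'a \<Rightarrow> 'a \<Rightarrow> 'a \<Rightarrow> 'a \<Rightarrow> bool" where
  "TC M m f s k d S \<longleftrightarrow>
     (\<exists>i j. i \<epsilon> m \<and> j \<epsilon> m \<and> d = kMem i j
        \<and> TS M m S (\<lambda>a. \<exists>x y. opr i x \<epsilon> a \<and> opr j y \<epsilon> a \<and> x \<epsilon> y))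
   \<or> (\<exists>i j. i \<epsilon> m \<and> j \<epsilon> m \<and> d = kEq i j \<and> TS M m S (\<lambda>a. \<exists>x. opr i x \<epsilon> a \<and> opr j x \<epsilon> a))
   \<or> d = kFls \<and> TS M m S (\<lambda>a. False)
   \<or> (\<exists>k1 d1 S1 k2 d2 S2. k1 \<epsilon> k \<and> opr k1 d1 \<epsilon> f \<and> opr k1 S1 \<epsilon> s
        \<and> k2 \<epsilon> k \<and> opr k2 d2 \<epsilon> f \<and> opr k2 S2 \<epsilon> s \<and> d = kImp d1 d2
        \<and> TS M m S (\<lambda>a. a \<epsilon> S1 \<longrightarrow> a \<epsilon> S2))
   \<or> (\<exists>i k1 d1 S1. i \<epsilon> m \<and> k1 \<epsilon> k \<and> opr k1 d1 \<epsilon> f \<and> opr k1 S1 \<epsilon> s \<and> d = kAll i d1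
        \<and> TS M m S (\<lambda>a. \<forall>b. Map b m M \<and> Agr m i a b \<longrightarrow> b \<epsilon> S1))"

definition TSq :: "'a \<Rightarrow> 'a \<Rightarrow> 'a \<Rightarrow> 'a \<Rightarrow> 'a \<Rightarrow> bool" where
  "TSq M m n f s \<longleftrightarrow> Nt n \<and> Fun f n \<and> Fun s n
     \<and> (\<forall>k d S. k \<epsilon> n \<and> opr k d \<epsilon> f \<and> opr k S \<epsilon> s \<longrightarrow> TC M m f s k d S)"

definition Sat :: "'a \<Rightarrow> 'a \<Rightarrow> 'a \<Rightarrow> 'a \<Rightarrow> bool" where
  "Sat M m c a \<longleftrightarrow> Nt m
     \<and> (\<exists>n f s. TSq M m n f s \<and> (\<exists>k S. k \<epsilon> n \<and> opr k c \<epsilon> f \<and> opr k S \<epsilon> s \<and> a \<epsilon> S))"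

definition isDef :: "'a \<Rightarrow> 'a \<Rightarrow> bool" where
  "isDef A X \<longleftrightarrow> Sub X A \<and> (\<exists>m c d p. Fml m c \<and> emp \<epsilon> m
        \<and> (\<forall>i. i \<epsilon> d \<longleftrightarrow> i \<epsilon> m \<and> i \<noteq> emp) \<and> Map p d A
        \<and> (\<forall>x. x \<epsilon> A \<longrightarrow>
             (x \<epsilon> X \<longleftrightarrow> (\<exists>a. Map a m A \<and> Sub p a \<and> opr emp x \<epsilon> a \<and> Sat A m c a))))"

definition LH :: "'a \<Rightarrow> 'a \<Rightarrow> bool" where
  "LH \<beta> g \<longleftrightarrow> Ord \<beta> \<and> Fun g \<beta> \<and> (\<forall>\<gamma> A. \<gamma> \<epsilon> \<beta> \<and> opr \<gamma> A \<epsilon> g \<longrightarrow>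
        \<gamma> = emp \<and> A = emp
      \<or> (\<exists>\<delta> B. \<gamma> = suc \<delta> \<and> opr \<delta> B \<epsilon> g \<and> (\<forall>X. X \<epsilon> A \<longleftrightarrow> isDef B X))
      \<or> Lim \<gamma> \<and> (\<forall>x. x \<epsilon> A \<longleftrightarrow> (\<exists>\<delta> B. \<delta> \<epsilon> \<gamma> \<and> opr \<delta> B \<epsilon> g \<and> x \<epsilon> B)))"

definition Lev :: "'a \<Rightarrow> 'a \<Rightarrow> bool" where
  "Lev \<alpha> A \<longleftrightarrow> (\<exists>\<beta> g. \<alpha> \<epsilon> \<beta> \<and> LH \<beta> g \<and> opr \<alpha> A \<epsilon> g)"

text \<open>The classes over which formulas are evaluated: the universe and transitive sets. Well-foundedness
  of ordinals is absolute for them, by the axiom of foundation, once that is known. The further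
  conditions make \<open>Sat\<close> and then the levels of the constructible hierarchy absolute.\<close>

definition okA :: "'a set \<Rightarrow> bool" where
  "okA A \<longleftrightarrow> emp \<in> A \<and> (\<forall>x\<in>A. \<forall>y. y \<epsilon> x \<longrightarrow> y \<in> A) \<and> (\<forall>x\<in>A. \<forall>y\<in>A. upr x y \<in> A)
     \<and> (\<forall>x\<in>A. (\<forall>s\<in>A. Sub s x \<and> s \<noteq> emp \<longrightarrow> Fnd s) \<longrightarrow> (\<forall>s. Sub s x \<and> s \<noteq> emp \<longrightarrow> Fnd s))"

definition good0 :: "'a set \<Rightarrow> bool" where
  "good0 A \<longleftrightarrow> okA A \<and> (\<forall>w. Omega w \<longrightarrow> w \<in> A) \<and> (\<forall>M\<in>A. \<forall>m a. Nt m \<and> Map a m M \<longrightarrow> a \<in> A)"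

definition good :: "'a set \<Rightarrow> bool" where
  "good A \<longleftrightarrow> good0 A
     \<and> (\<forall>m\<in>A. \<forall>c\<in>A. Fml m c \<longrightarrow> (\<exists>n\<in>A. \<exists>f\<in>A. Cons m n f \<and> (\<exists>k. k \<epsilon> n \<and> opr k c \<epsilon> f)))
     \<and> (\<forall>M\<in>A. \<forall>m\<in>A. \<forall>c\<in>A. \<forall>a. Sat M m c a \<longrightarrow> (\<exists>n\<in>A. \<exists>f\<in>A. \<exists>s\<in>A. TSq M m n f s
          \<and> (\<exists>k S. k \<epsilon> n \<and> opr k c \<epsilon> f \<and> opr k S \<epsilon> s \<and> a \<epsilon> S)))"

definition vgood :: "'a set \<Rightarrow> bool" where
  "vgood A \<longleftrightarrow> good A \<and> (\<forall>B\<in>A. \<forall>X. isDef B X \<longrightarrow> X \<in> A)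
     \<and> (\<forall>m c. Fml m c \<longrightarrow> c \<in> A)
     \<and> (\<forall>B\<in>A. \<forall>m d p. Nt m \<and> Sub d m \<and> Map p d B \<longrightarrow> p \<in> A \<and> d \<in> A)"

end

text \<open>The carrier is the whole type, so \<open>mk\<close> and the operations built from it
  never leave the structure.\<close>

locale bst = membership +
  assumes LZFC: "p \<in> LZFC \<Longrightarrow> ev E UNIV p v"
begin

lemma axiom: "F 0 \<in> LZFC \<Longrightarrow> fb 0 F \<Longrightarrow> holds E UNIV [] F"
  using LZFC ev_sentence by blast

lemma extensionality: "(\<And>z. z \<epsilon> x \<longleftrightarrow> z \<epsilon> y) \<Longrightarrow> x = y"
  using axiom[of ax_ext] fb_sentences by (simp add: LZFC_def BST_def ax_ext_def)

lemma small_empty: "small {}"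
  using axiom[of ax_empty] fb_sentences
  by (auto simp: LZFC_def BST_def ax_empty_def is_empty_def small_def els_def)

lemma small_pair: "small {x, y}"
proof -
  have "\<exists>p. \<forall>z. z \<epsilon> p \<longleftrightarrow> z = x \<or> z = y"
    using axiom[of ax_pair] fb_sentences
    by (simp add: LZFC_def BST_def ax_pair_def is_upair_def)
  then show ?thesis by (auto simp: small_def els_def)
qed

lemma small_union: "small {z. \<exists>y. y \<epsilon> x \<and> z \<epsilon> y}"
proof -
  have "\<exists>u. \<forall>z. z \<epsilon> u \<longleftrightarrow> (\<exists>y. y \<epsilon> x \<and> z \<epsilon> y)"
    using axiom[of ax_union] fb_sentences
    by (simp add: LZFC_def BST_def ax_union_def)
  then show ?thesis by (auto simp: small_def els_def)
qed

lemma Omega_ex: "\<exists>w. holds E UNIV [w] (is_omega 0)"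
  using axiom[of ax_omega] fb_sentences by (simp add: LZFC_def BST_def ax_omega_def)

lemma not_emp [simp]: "\<not> x \<epsilon> emp"
  using small_empty by (simp add: emp_def mem_mk)

lemma emp_iff: "x = emp \<longleftrightarrow> (\<forall>z. \<not> z \<epsilon> x)"
  using extensionality not_emp by metis

lemma upr_iff [simp]: "z \<epsilon> upr x y \<longleftrightarrow> z = x \<or> z = y"
  using small_pair by (simp add: upr_def mem_mk)

lemma big_iff [simp]: "z \<epsilon> big x \<longleftrightarrow> (\<exists>y. y \<epsilon> x \<and> z \<epsilon> y)"
  using small_union by (simp add: big_def mem_mk)

lemma cup_iff [simp]: "z \<epsilon> cup x y \<longleftrightarrow> z \<epsilon> x \<or> z \<epsilon> y"
  by (auto simp: cup_def)

lemma adj_iff [simp]: "z \<epsilon> adj x y \<longleftrightarrow> z \<epsilon> x \<or> z = y"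
  by (auto simp: adj_def)

lemma suc_iff [simp]: "z \<epsilon> suc x \<longleftrightarrow> z \<epsilon> x \<or> z = x"
  by (auto simp: suc_def)

lemma upr_eq: "p = upr x y \<longleftrightarrow> (\<forall>z. z \<epsilon> p \<longleftrightarrow> z = x \<or> z = y)"
  using extensionality[of p "upr x y"] by auto

lemma suc_eq: "p = suc x \<longleftrightarrow> (\<forall>z. z \<epsilon> p \<longleftrightarrow> z \<epsilon> x \<or> z = x)"
  using extensionality[of p "suc x"] by auto

lemma upr_inject: "upr x y = upr u v \<longleftrightarrow> x = u \<and> y = v \<or> x = v \<and> y = u"
proof
  assume "upr x y = upr u v"
  then have "z = x \<or> z = y \<longleftrightarrow> z = u \<or> z = v" for z by (metis upr_iff)
  then show "x = u \<and> y = v \<or> x = v \<and> y = u" by metis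
qed (auto simp: upr_eq)

lemma opr_inject [simp]: "opr x y = opr u v \<longleftrightarrow> x = u \<and> y = v"
  unfolding opr_def by (metis upr_inject)

section \<open>Absoluteness of the basic set-theoretic notions\<close>

lemma okA_trans: "okA A \<Longrightarrow> x \<in> A \<Longrightarrow> y \<epsilon> x \<Longrightarrow> y \<in> A"
  by (auto simp: okA_def)

lemma okA_upr [simp]: "okA A \<Longrightarrow> x \<in> A \<Longrightarrow> y \<in> A \<Longrightarrow> upr x y \<in> A"
  by (auto simp: okA_def)

lemma okA_opr [simp]: "okA A \<Longrightarrow> x \<in> A \<Longrightarrow> y \<in> A \<Longrightarrow> opr x y \<in> A"
  by (auto simp: opr_def)

lemma okA_oprD: "okA A \<Longrightarrow> opr x y \<in> A \<Longrightarrow> x \<in> A \<and> y \<in> A"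
  unfolding opr_def by (metis okA_trans upr_iff)

lemma okA_app: "okA A \<Longrightarrow> f \<in> A \<Longrightarrow> opr x y \<epsilon> f \<Longrightarrow> x \<in> A \<and> y \<in> A"
  using okA_oprD okA_trans by blast

lemma okA_UNIV [simp]: "okA UNIV"
  by (simp add: okA_def)

lemma nth_in [simp]: "set xs \<subseteq> A \<Longrightarrow> i < length xs \<Longrightarrow> xs ! i \<in> A"
  using nth_mem by blast

declare nth_append [simp] less_SucI [simp]

lemma h_empty [simp]: "okA A \<Longrightarrow> set xs \<subseteq> A \<Longrightarrow> x < length xs \<Longrightarrow>
    holds E A xs (is_empty x) \<longleftrightarrow> xs ! x = emp"
  by (auto simp: is_empty_def emp_iff less_SucI intro: okA_trans[OF _ nth_in])

lemma h_sub [simp]: "okA A \<Longrightarrow> set xs \<subseteq> A \<Longrightarrow> x < length xs \<Longrightarrow> y < length xs \<Longrightarrow>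
    holds E A xs (x \<^bold>\<subseteq> y) \<longleftrightarrow> Sub (xs ! x) (xs ! y)"
  by (auto simp: sub_def Sub_def less_SucI intro: okA_trans[OF _ nth_in])

lemma h_upair [simp]: "okA A \<Longrightarrow> set xs \<subseteq> A \<Longrightarrow> x < length xs \<Longrightarrow> y < length xs \<Longrightarrow>
    p < length xs \<Longrightarrow> holds E A xs (is_upair x y p) \<longleftrightarrow> xs ! p = upr (xs ! x) (xs ! y)"
  unfolding upr_eq using okA_trans[of A "xs ! p"] by (simp add: is_upair_def) (metis nth_in)

lemma h_succ [simp]:
  assumes "okA A" "set xs \<subseteq> A" "x < length xs" "y < length xs"
  shows "holds E A xs (is_succ x y) \<longleftrightarrow> xs ! y = suc (xs ! x)"
proof -
  have "xs ! x \<in> A" "xs ! y \<in> A" using assms by auto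
  then have "(\<forall>d\<in>A. d \<epsilon> xs ! y \<longleftrightarrow> d \<epsilon> xs ! x \<or> d = xs ! x) \<longleftrightarrow> (\<forall>d. d \<epsilon> xs ! y \<longleftrightarrow> d \<epsilon> xs ! x \<or> d = xs ! x)"
    using okA_trans[OF assms(1)] by blast
  then show ?thesis unfolding suc_eq using assms by (simp add: is_succ_def)
qed

lemma h_trans [simp]: "okA A \<Longrightarrow> set xs \<subseteq> A \<Longrightarrow> x < length xs \<Longrightarrow>
    holds E A xs (is_trans x) \<longleftrightarrow> Trn (xs ! x)"
  by (auto simp: is_trans_def Trn_def Sub_def less_SucI intro: okA_trans[OF _ nth_in])

lemma h_pair [simp]: "okA A \<Longrightarrow> set xs \<subseteq> A \<Longrightarrow> x < length xs \<Longrightarrow> y < length xs \<Longrightarrow>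
    p < length xs \<Longrightarrow> holds E A xs (is_pair x y p) \<longleftrightarrow> xs ! p = opr (xs ! x) (xs ! y)"
  by (simp add: is_pair_def opr_def)

text \<open>Transitivity of \<open>A\<close> bounds every quantifier except the one over subsets;
  the last condition in \<open>okA\<close> is made for that clause.\<close>

lemma h_ord [simp]:
  assumes "okA A" "set xs \<subseteq> A" "x < length xs"
  shows "holds E A xs (is_ord x) \<longleftrightarrow> Ord (xs ! x)"
proof -
  let ?x = "xs ! x"
  have "?x \<in> A" using assms by simp
  have "holds E A xs (is_ord x) \<longleftrightarrow> Trn ?x
    \<and> (\<forall>y\<in>A. \<forall>z\<in>A. y \<epsilon> ?x \<and> z \<epsilon> ?x \<longrightarrow> y \<epsilon> z \<or> y = z \<or> z \<epsilon> y)
    \<and> (\<forall>s\<in>A. Sub s ?x \<and> s \<noteq> emp \<longrightarrow> (\<exists>y\<in>A. y \<epsilon> s \<and> (\<forall>z\<in>A. z \<epsilon> s \<longrightarrow> \<not> z \<epsilon> y)))"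
    using assms by (simp add: is_ord_def)
  also have "\<dots> \<longleftrightarrow> Trn ?x
    \<and> (\<forall>y z. y \<epsilon> ?x \<and> z \<epsilon> ?x \<longrightarrow> y \<epsilon> z \<or> y = z \<or> z \<epsilon> y)
    \<and> (\<forall>s\<in>A. Sub s ?x \<and> s \<noteq> emp \<longrightarrow> Fnd s)"
  proof -
    have "(\<exists>y\<in>A. y \<epsilon> s \<and> (\<forall>z\<in>A. z \<epsilon> s \<longrightarrow> \<not> z \<epsilon> y)) \<longleftrightarrow> Fnd s" if "s \<in> A" for s
      unfolding Fnd_def using okA_trans[OF assms(1) that] by blast
    moreover have "(\<forall>y\<in>A. \<forall>z\<in>A. y \<epsilon> ?x \<and> z \<epsilon> ?x \<longrightarrow> y \<epsilon> z \<or> y = z \<or> z \<epsilon> y)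
      \<longleftrightarrow> (\<forall>y z. y \<epsilon> ?x \<and> z \<epsilon> ?x \<longrightarrow> y \<epsilon> z \<or> y = z \<or> z \<epsilon> y)"
      using okA_trans[OF assms(1) \<open>?x \<in> A\<close>] by blast
    ultimately show ?thesis by simp
  qed
  also have "\<dots> \<longleftrightarrow> Ord ?x"
    using assms(1) \<open>?x \<in> A\<close> unfolding okA_def Ord_def by blast
  finally show ?thesis .
qed

lemma h_limit [simp]: "okA A \<Longrightarrow> set xs \<subseteq> A \<Longrightarrow> x < length xs \<Longrightarrow>
    holds E A xs (is_limit x) \<longleftrightarrow> Lim (xs ! x)"
  using okA_trans[of A "xs ! x"]
  by (auto simp: is_limit_def Lim_def)

lemma h_omega [simp]: "okA A \<Longrightarrow> set xs \<subseteq> A \<Longrightarrow> x < length xs \<Longrightarrow>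
    holds E A xs (is_omega x) \<longleftrightarrow> Omega (xs ! x)"
  using okA_trans[of A "xs ! x"]
  by (auto simp: is_omega_def Omega_def)

lemma h_app [simp]: "okA A \<Longrightarrow> set xs \<subseteq> A \<Longrightarrow> f < length xs \<Longrightarrow> x < length xs \<Longrightarrow> y < length xs \<Longrightarrow>
    holds E A xs (is_app f x y) \<longleftrightarrow> opr (xs ! x) (xs ! y) \<epsilon> xs ! f"
  by (simp add: is_app_def)

lemma h_fun [simp]:
  assumes "okA A" "set xs \<subseteq> A" "f < length xs" "a < length xs"
  shows "holds E A xs (is_fun f a) \<longleftrightarrow> Fun (xs ! f) (xs ! a)"
proof -
  have A: "xs ! f \<in> A" "xs ! a \<in> A" using assms by auto
  have "holds E A xs (is_fun f a) \<longleftrightarrow>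
      (\<forall>p\<in>A. p \<epsilon> xs ! f \<longrightarrow> (\<exists>x\<in>A. \<exists>y\<in>A. x \<epsilon> xs ! a \<and> p = opr x y))
    \<and> (\<forall>x\<in>A. x \<epsilon> xs ! a \<longrightarrow> (\<exists>y\<in>A. opr x y \<epsilon> xs ! f \<and> (\<forall>z\<in>A. opr x z \<epsilon> xs ! f \<longrightarrow> z = y)))"
    using assms by (simp add: is_fun_def)
  also have "\<dots> \<longleftrightarrow> Fun (xs ! f) (xs ! a)"
  proof -
    have "(\<exists>x\<in>A. \<exists>y\<in>A. x \<epsilon> xs ! a \<and> p = opr x y) \<longleftrightarrow> (\<exists>x y. x \<epsilon> xs ! a \<and> p = opr x y)" if "p \<epsilon> xs ! f" for p
      using okA_app[OF assms(1) A(1)] that by blast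
    moreover have "(\<exists>y\<in>A. opr x y \<epsilon> xs ! f \<and> (\<forall>z\<in>A. opr x z \<epsilon> xs ! f \<longrightarrow> z = y)) \<longleftrightarrow> (\<exists>!y. opr x y \<epsilon> xs ! f)" for x
      using okA_app[OF assms(1) A(1)] by blast
    moreover have "(\<forall>p\<in>A. p \<epsilon> xs ! f \<longrightarrow> P p) \<longleftrightarrow> (\<forall>p. p \<epsilon> xs ! f \<longrightarrow> P p)" for P
      using okA_trans[OF assms(1) A(1)] by blast
    moreover have "(\<forall>p\<in>A. p \<epsilon> xs ! a \<longrightarrow> P p) \<longleftrightarrow> (\<forall>p. p \<epsilon> xs ! a \<longrightarrow> P p)" for P
      using okA_trans[OF assms(1) A(2)] by blast
    ultimately show ?thesis unfolding Fun_def by simp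
  qed
  finally show ?thesis .
qed

lemma h_map [simp]:
  assumes "okA A" "set xs \<subseteq> A" "f < length xs" "a < length xs" "b < length xs"
  shows "holds E A xs (is_map f a b) \<longleftrightarrow> Map (xs ! f) (xs ! a) (xs ! b)"
proof -
  have "(\<forall>x\<in>A. \<forall>y\<in>A. opr x y \<epsilon> xs ! f \<longrightarrow> y \<epsilon> xs ! b) \<longleftrightarrow> (\<forall>x y. opr x y \<epsilon> xs ! f \<longrightarrow> y \<epsilon> xs ! b)"
    using okA_app[OF assms(1) nth_in[OF assms(2,3)]] by blast
  then show ?thesis using assms by (simp add: is_map_def Map_def)
qed

lemma h_inj [simp]:
  assumes "okA A" "set xs \<subseteq> A" "f < length xs" "a < length xs" "b < length xs"
  shows "holds E A xs (is_inj f a b) \<longleftrightarrow> Inj (xs ! f) (xs ! a) (xs ! b)"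
proof -
  have "(\<forall>x\<in>A. \<forall>y\<in>A. \<forall>z\<in>A. opr x z \<epsilon> xs ! f \<and> opr y z \<epsilon> xs ! f \<longrightarrow> x = y)
      \<longleftrightarrow> (\<forall>x y z. opr x z \<epsilon> xs ! f \<and> opr y z \<epsilon> xs ! f \<longrightarrow> x = y)"
    using okA_app[OF assms(1) nth_in[OF assms(2,3)]] by blast
  then show ?thesis using assms by (simp add: is_inj_def Inj_def del: ex_simps)
qed

lemma h_bij [simp]:
  assumes "okA A" "set xs \<subseteq> A" "f < length xs" "a < length xs" "b < length xs"
  shows "holds E A xs (is_bij f a b) \<longleftrightarrow> Bij (xs ! f) (xs ! a) (xs ! b)"
proof -
  have "(\<forall>y\<in>A. y \<epsilon> xs ! b \<longrightarrow> (\<exists>x\<in>A. opr x y \<epsilon> xs ! f)) \<longleftrightarrow> (\<forall>y. y \<epsilon> xs ! b \<longrightarrow> (\<exists>x. opr x y \<epsilon> xs ! f))"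
    using okA_app[OF assms(1) nth_in[OF assms(2,3)]] okA_trans[OF assms(1) nth_in[OF assms(2,5)]] by blast
  then show ?thesis using assms by (simp add: is_bij_def Bij_def)
qed

lemma h_card_less [simp]:
  assumes "okA A" "set xs \<subseteq> A" "a < length xs" "b < length xs"
  shows "holds E A xs (card_less a b) \<longleftrightarrow>
    (\<exists>f\<in>A. Inj f (xs ! a) (xs ! b)) \<and> \<not> (\<exists>f\<in>A. Bij f (xs ! a) (xs ! b))"
  using assms by (simp add: card_less_def)

lemma okA_emp [simp]: "okA A \<Longrightarrow> emp \<in> A"
  by (simp add: okA_def)

lemma Omega_exists: "\<exists>w. Omega w"
  using Omega_ex by simp

text \<open>Foundation is only available inside ordinals at this stage: a minimal element of
  \<open>w\<close> is empty, since its own elements would belong to \<open>w\<close> as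
  well.\<close>

lemma Lim_nu:
  assumes "Lim w"
  shows "nu n \<epsilon> w"
proof (induction n)
  case 0
  have "Ord w" "w \<noteq> emp" using assms by (auto simp: Lim_def)
  then have "Fnd w" "Trn w" unfolding Ord_def Sub_def by blast+
  then obtain y where "y \<epsilon> w" "y = emp" unfolding Fnd_def Trn_def by (metis emp_iff)
  then show ?case by (simp add: nu.simps)
next
  case (Suc n)
  then show ?case using assms by (simp add: Lim_def nu.simps)
qed

lemma Omega_nu: "Omega w \<Longrightarrow> nu n \<epsilon> w"
  using Lim_nu by (simp add: Omega_def)

lemma Nt_nu [simp]: "Nt (nu n)"
  using Omega_exists Omega_nu by (auto simp: Nt_def)

lemma good0_okA [simp]: "good0 A \<Longrightarrow> okA A"
  by (simp add: good0_def)

lemma good_Omega: "good0 A \<Longrightarrow> Omega w \<Longrightarrow> w \<in> A"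
  by (simp add: good0_def)

lemma good_nat: "good0 A \<Longrightarrow> Nt m \<Longrightarrow> m \<in> A"
  unfolding good0_def Nt_def okA_def by blast

lemma good_nu [simp]: "good0 A \<Longrightarrow> nu n \<in> A"
  by (simp add: good_nat)

lemma good0_UNIV [simp]: "good0 UNIV"
  by (simp add: good0_def)

lemma good_good0 [simp]: "good A \<Longrightarrow> good0 A"
  by (simp add: good_def)

lemma good_UNIV [simp]: "good UNIV"
  by (auto simp: good_def Fml_def Sat_def)

lemma h_nat [simp]: "good0 A \<Longrightarrow> set xs \<subseteq> A \<Longrightarrow> x < length xs \<Longrightarrow>
    holds E A xs (is_nat x) \<longleftrightarrow> Nt (xs ! x)"
  by (simp add: is_nat_def Nt_def) (meson good_Omega)

text \<open>Denotation of terms in continuation form: \<open>t\<close> has the value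
  \<open>u\<close> if \<open>t P\<close> gets the truth value \<open>Q\<close> whenever
  \<open>P\<close> gets \<open>Q\<close> at every variable denoting \<open>u\<close> in every
  extended context. Quantifying over \<open>ws\<close> makes this stable under lengthening of the
  context, which happens when terms are nested.\<close>

definition tv :: "'a set \<Rightarrow> 'a list \<Rightarrow> trm \<Rightarrow> 'a \<Rightarrow> bool" where
  "tv A xs t u \<longleftrightarrow> u \<in> A \<and> (\<forall>ws P Q. set ws \<subseteq> A
    \<longrightarrow> (\<forall>zs y. set zs \<subseteq> A \<and> y < length (xs @ ws @ zs) \<and> (xs @ ws @ zs) ! y = u
          \<longrightarrow> holds E A (xs @ ws @ zs) (P y) = Q)
    \<longrightarrow> holds E A (xs @ ws) (t P) = Q)"

lemma tv_ext:
  assumes "tv A xs t u" "set ws \<subseteq> A"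
  shows "tv A (xs @ ws) t u"
  unfolding tv_def
proof (intro conjI allI impI)
  show "u \<in> A" using assms by (simp add: tv_def)
  fix vs P Q
  assume "set vs \<subseteq> A" "\<forall>zs y. set zs \<subseteq> A \<and> y < length ((xs @ ws) @ vs @ zs) \<and> ((xs @ ws) @ vs @ zs) ! y = u
          \<longrightarrow> holds E A ((xs @ ws) @ vs @ zs) (P y) = Q"
  then show "holds E A ((xs @ ws) @ vs) (t P) = Q"
    using assms unfolding tv_def append_assoc by (metis append_assoc le_sup_iff set_append)
qed

lemma tvD:
  assumes "tv A xs t u" "set xs \<subseteq> A" and
    "\<And>zs y. set zs \<subseteq> A \<Longrightarrow> y < length (xs @ zs) \<Longrightarrow> (xs @ zs) ! y = u \<Longrightarrow> holds E A (xs @ zs) (P y) = Q"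
  shows "holds E A xs (t P) = Q"
proof -
  have "\<forall>zs y. set zs \<subseteq> A \<and> y < length (xs @ [] @ zs) \<and> (xs @ [] @ zs) ! y = u
          \<longrightarrow> holds E A (xs @ [] @ zs) (P y) = Q"
    using assms(3) by simp
  then show ?thesis using assms(1) unfolding tv_def by (metis append_Nil2 empty_set empty_subsetI)
qed

lemma tvI:
  assumes "u \<in> A" and
    "\<And>ws P Q. set ws \<subseteq> A \<Longrightarrow>
      (\<And>zs y. set zs \<subseteq> A \<Longrightarrow> y < length (xs @ ws @ zs) \<Longrightarrow> (xs @ ws @ zs) ! y = u
        \<Longrightarrow> holds E A (xs @ ws @ zs) (P y) = Q) \<Longrightarrow> holds E A (xs @ ws) (t P) = Q"
  shows "tv A xs t u"
  unfolding tv_def using assms by blast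

lemma tv_V: "set xs \<subseteq> A \<Longrightarrow> x < length xs \<Longrightarrow> tv A xs (V x) (xs ! x)"
proof (rule tvI)
  fix ws P Q
  assume *: "x < length xs" "\<And>zs y. set zs \<subseteq> A \<Longrightarrow> y < length (xs @ ws @ zs) \<Longrightarrow> (xs @ ws @ zs) ! y = xs ! x
        \<Longrightarrow> holds E A (xs @ ws @ zs) (P y) = Q"
  show "holds E A (xs @ ws) (V x P) = Q"
    using *(2)[of "[]" x] *(1) by (simp add: V_def)
qed simp

lemma tv_num:
  assumes "good0 A" "set xs \<subseteq> A"
  shows "tv A xs (num n) (nu n)"
proof (induction n)
  case 0
  show ?case
  proof (rule tvI)
    fix ws P Q
    assume *: "set ws \<subseteq> A" "\<And>zs y. set zs \<subseteq> A \<Longrightarrow> y < length (xs @ ws @ zs) \<Longrightarrow> (xs @ ws @ zs) ! y = nu 0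
        \<Longrightarrow> holds E A (xs @ ws @ zs) (P y) = Q"
    show "holds E A (xs @ ws) (num 0 P) = Q"
      using *(2)[of "[emp]" "length xs + length ws"] *(1) assms by (simp add: num.simps nu.simps)
  qed (use assms in simp)
next
  case (Suc n)
  show ?case
  proof (rule tvI)
    fix ws P Q
    assume *: "set ws \<subseteq> A" "\<And>zs y. set zs \<subseteq> A \<Longrightarrow> y < length (xs @ ws @ zs) \<Longrightarrow> (xs @ ws @ zs) ! y = nu (Suc n)
        \<Longrightarrow> holds E A (xs @ ws @ zs) (P y) = Q"
    show "holds E A (xs @ ws) (num (Suc n) P) = Q"
      unfolding num.simps
    proof (rule tvD[OF tv_ext[OF Suc]])
      fix zs x
      define L where "L = (xs @ ws) @ zs"
      assume "set zs \<subseteq> A" "x < length ((xs @ ws) @ zs)" "((xs @ ws) @ zs) ! x = nu n"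
      then have L: "set L \<subseteq> A" "x < length L" "L ! x = nu n" using * assms by (auto simp: L_def)
      have "holds E A (L @ [nu (Suc n)]) (P (length L)) = Q"
        using *(2)[of "zs @ [nu (Suc n)]" "length L"] *(1) assms \<open>set zs \<subseteq> A\<close>
        by (simp add: L_def)
      then have "holds E A L (\<^bold>\<exists>y. is_succ x y \<^bold>\<and> P y) = Q"
        using L assms(1) good_nu[OF assms(1), of "Suc n"] by (simp add: nu.simps)
      then show "holds E A ((xs @ ws) @ zs) (\<^bold>\<exists>y. is_succ x y \<^bold>\<and> P y) = Q"
        by (simp only: L_def)
    qed (use * assms in auto)
  qed (use assms good_nu in blast)
qed

lemma tv_pair:
  assumes "okA A" "set xs \<subseteq> A" "tv A xs s u" "tv A xs t w"
  shows "tv A xs (pair s t) (opr u w)"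
proof (rule tvI)
  have uw: "u \<in> A" "w \<in> A" using assms by (auto simp: tv_def)
  then show "opr u w \<in> A" using assms by simp
  fix ws P Q
  assume *: "set ws \<subseteq> A" "\<And>zs y. set zs \<subseteq> A \<Longrightarrow> y < length (xs @ ws @ zs) \<Longrightarrow> (xs @ ws @ zs) ! y = opr u w
        \<Longrightarrow> holds E A (xs @ ws @ zs) (P y) = Q"
  show "holds E A (xs @ ws) (pair s t P) = Q"
    unfolding pair_def
  proof (rule tvD[OF tv_ext[OF assms(3)]])
    fix zs x
    assume zs: "set zs \<subseteq> A" "x < length ((xs @ ws) @ zs)" "((xs @ ws) @ zs) ! x = u"
    show "holds E A ((xs @ ws) @ zs) (t (\<lambda>y. \<^bold>\<exists>p. is_pair x y p \<^bold>\<and> P p)) = Q"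
    proof (rule tvD[OF tv_ext[OF tv_ext[OF assms(4) *(1)] zs(1)]])
      fix vs y
      define L where "L = ((xs @ ws) @ zs) @ vs"
      assume vs: "set vs \<subseteq> A" "y < length (((xs @ ws) @ zs) @ vs)" "(((xs @ ws) @ zs) @ vs) ! y = w"
      moreover have "(((xs @ ws) @ zs) @ vs) ! x = u" using zs by (simp add: nth_append del: append_assoc)
      ultimately have L: "set L \<subseteq> A" "x < length L" "L ! x = u" "y < length L" "L ! y = w"
        using zs * assms by (auto simp: L_def simp del: append_assoc nth_append)
      have "holds E A (L @ [opr u w]) (P (length L)) = Q"
        using *(2)[of "zs @ vs @ [opr u w]" "length L"] *(1) assms zs uw vs(1)
        by (simp add: L_def)
      then have "holds E A L (\<^bold>\<exists>p. is_pair x y p \<^bold>\<and> P p) = Q"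
        using L assms(1) uw by simp
      then show "holds E A (((xs @ ws) @ zs) @ vs) (\<^bold>\<exists>p. is_pair x y p \<^bold>\<and> P p) = Q"
        by (simp only: L_def)
    qed (use * assms zs in auto)
  qed (use * assms in auto)
qed

lemma h_val:
  assumes "set xs \<subseteq> A" "y < length xs" "tv A xs t u"
  shows "holds E A xs (y \<^bold>\<simeq> t) \<longleftrightarrow> xs ! y = u"
  unfolding is_val_def using assms(2) by (intro tvD[OF assms(3,1)]) auto

lemma h_codes [simp]:
  assumes "good0 A" "set xs \<subseteq> A" "d < length xs"
  shows "i < length xs \<Longrightarrow> j < length xs \<Longrightarrow> holds E A xs (d \<^bold>\<simeq> cMem (V i) (V j)) \<longleftrightarrow> xs ! d = kMem (xs ! i) (xs ! j)"
    "i < length xs \<Longrightarrow> j < length xs \<Longrightarrow> holds E A xs (d \<^bold>\<simeq> cEq (V i) (V j)) \<longleftrightarrow> xs ! d = kEq (xs ! i) (xs ! j)"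
    "i < length xs \<Longrightarrow> j < length xs \<Longrightarrow> holds E A xs (d \<^bold>\<simeq> cImp (V i) (V j)) \<longleftrightarrow> xs ! d = kImp (xs ! i) (xs ! j)"
    "i < length xs \<Longrightarrow> j < length xs \<Longrightarrow> holds E A xs (d \<^bold>\<simeq> cAll (V i) (V j)) \<longleftrightarrow> xs ! d = kAll (xs ! i) (xs ! j)"
    "holds E A xs (d \<^bold>\<simeq> cFls) \<longleftrightarrow> xs ! d = kFls"
    "holds E A xs (d \<^bold>\<simeq> num n) \<longleftrightarrow> xs ! d = nu n"
  unfolding cMem_def cEq_def cImp_def cAll_def cFls_def kMem_def kEq_def kImp_def kAll_def kFls_def
  using assms by (rule_tac [!] h_val; (intro tv_pair tv_num tv_V)?; simp)+

lemma good_map: "good0 A \<Longrightarrow> M \<in> A \<Longrightarrow> Nt m \<Longrightarrow> Map a m M \<Longrightarrow> a \<in> A"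
  by (auto simp: good0_def)

lemma h_FC [simp]:
  assumes "good0 A" "set xs \<subseteq> A" "m < length xs" "f < length xs" "k < length xs" "d < length xs"
  shows "holds E A xs (fC m f k d) \<longleftrightarrow> FC (xs ! m) (xs ! f) (xs ! k) (xs ! d)"
proof -
  have ok: "okA A" and A: "xs ! m \<in> A" "xs ! f \<in> A" "xs ! k \<in> A" using assms by auto
  have 1: "(\<exists>i\<in>A. \<exists>j\<in>A. i \<epsilon> xs ! m \<and> j \<epsilon> xs ! m \<and> P i j) \<longleftrightarrow> (\<exists>i j. i \<epsilon> xs ! m \<and> j \<epsilon> xs ! m \<and> P i j)" for P
    using okA_trans[OF ok A(1)] by blast
  have 2: "(\<exists>k1\<in>A. \<exists>d1\<in>A. \<exists>k2\<in>A. \<exists>d2\<in>A. k1 \<epsilon> xs ! k \<and> opr k1 d1 \<epsilon> xs ! f \<and> k2 \<epsilon> xs ! k \<and> opr k2 d2 \<epsilon> xs ! f \<and> P k1 d1 k2 d2)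
     \<longleftrightarrow> (\<exists>k1 d1 k2 d2. k1 \<epsilon> xs ! k \<and> opr k1 d1 \<epsilon> xs ! f \<and> k2 \<epsilon> xs ! k \<and> opr k2 d2 \<epsilon> xs ! f \<and> P k1 d1 k2 d2)" for P
    using okA_app[OF ok A(2)] by blast
  have 3: "(\<exists>i\<in>A. \<exists>k1\<in>A. \<exists>d1\<in>A. i \<epsilon> xs ! m \<and> k1 \<epsilon> xs ! k \<and> opr k1 d1 \<epsilon> xs ! f \<and> P i k1 d1)
     \<longleftrightarrow> (\<exists>i k1 d1. i \<epsilon> xs ! m \<and> k1 \<epsilon> xs ! k \<and> opr k1 d1 \<epsilon> xs ! f \<and> P i k1 d1)" for P
    using okA_app[OF ok A(2)] okA_trans[OF ok A(1)] by blast
  show ?thesis unfolding FC_def fC_def 1[symmetric] 2[symmetric] 3[symmetric]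
    using assms by (simp del: bex_simps ex_simps)
qed

lemma h_Agr [simp]:
  assumes "okA A" "set xs \<subseteq> A" "m < length xs" "i < length xs" "a < length xs" "b < length xs"
  shows "holds E A xs (agree_off m i a b) \<longleftrightarrow> Agr (xs ! m) (xs ! i) (xs ! a) (xs ! b)"
proof -
  have A: "xs ! m \<in> A" "xs ! a \<in> A" "xs ! b \<in> A" using assms by auto
  have "(\<forall>j\<in>A. \<forall>x\<in>A. j \<epsilon> xs ! m \<and> j \<noteq> xs ! i \<longrightarrow> (opr j x \<epsilon> xs ! a \<longleftrightarrow> opr j x \<epsilon> xs ! b))
     \<longleftrightarrow> Agr (xs ! m) (xs ! i) (xs ! a) (xs ! b)"
    unfolding Agr_def using okA_app[OF assms(1) A(2)] okA_app[OF assms(1) A(3)] by blast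
  then show ?thesis unfolding agree_off_def using assms by simp
qed

text \<open>The quantifier over assignments is unbounded, but a map from a natural number into an
  element of \<open>A\<close> already lies in \<open>A\<close> by \<open>good0\<close>.\<close>

lemma h_TS:
  assumes "good0 A" "set xs \<subseteq> A" "M < length xs" "m < length xs" "S < length xs" "Nt (xs ! m)"
    and "\<And>a. a \<in> A \<Longrightarrow> Map a (xs ! m) (xs ! M) \<Longrightarrow> holds E A (xs @ [a]) (P (length xs)) = P' a"
  shows "holds E A xs (is_truth_set M m S P) \<longleftrightarrow> TS (xs ! M) (xs ! m) (xs ! S) P'"
proof -
  have "holds E A xs (is_truth_set M m S P) \<longleftrightarrow>
     (\<forall>a\<in>A. a \<epsilon> xs ! S \<longleftrightarrow> Map a (xs ! m) (xs ! M) \<and> P' a)"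
    unfolding is_truth_set_def using assms by (simp cong: conj_cong)
  also have "\<dots> \<longleftrightarrow> TS (xs ! M) (xs ! m) (xs ! S) P'"
    unfolding TS_def
    using okA_trans[OF good0_okA[OF assms(1)] nth_in[OF assms(2,5)]] good_map[OF assms(1) nth_in[OF assms(2,3)] assms(6)]
    by blast
  finally show ?thesis .
qed

lemma h_TC:
  assumes "good0 A" "set xs \<subseteq> A" "M < length xs" "m < length xs" "f < length xs" "s < length xs"
    "k < length xs" "d < length xs" "S < length xs" "Nt (xs ! m)"
  shows "holds E A xs (fT M m f s k d S)
     \<longleftrightarrow> TC (xs ! M) (xs ! m) (xs ! f) (xs ! s) (xs ! k) (xs ! d) (xs ! S)"
proof -
  have ok: "okA A" and A: "xs ! M \<in> A" "xs ! m \<in> A" "xs ! f \<in> A" "xs ! s \<in> A" "xs ! k \<in> A" using assms by auto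
  have 1: "(\<exists>i\<in>A. \<exists>j\<in>A. i \<epsilon> xs ! m \<and> j \<epsilon> xs ! m \<and> P i j) \<longleftrightarrow> (\<exists>i j. i \<epsilon> xs ! m \<and> j \<epsilon> xs ! m \<and> P i j)" for P
    using okA_trans[OF ok A(2)] by blast
  have 2: "(\<exists>k1\<in>A. \<exists>d1\<in>A. \<exists>S1\<in>A. \<exists>k2\<in>A. \<exists>d2\<in>A. \<exists>S2\<in>A. k1 \<epsilon> xs ! k \<and> opr k1 d1 \<epsilon> xs ! f \<and> opr k1 S1 \<epsilon> xs ! s
       \<and> k2 \<epsilon> xs ! k \<and> opr k2 d2 \<epsilon> xs ! f \<and> opr k2 S2 \<epsilon> xs ! s \<and> P k1 d1 S1 k2 d2 S2)
     \<longleftrightarrow> (\<exists>k1 d1 S1 k2 d2 S2. k1 \<epsilon> xs ! k \<and> opr k1 d1 \<epsilon> xs ! f \<and> opr k1 S1 \<epsilon> xs ! s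
       \<and> k2 \<epsilon> xs ! k \<and> opr k2 d2 \<epsilon> xs ! f \<and> opr k2 S2 \<epsilon> xs ! s \<and> P k1 d1 S1 k2 d2 S2)" for P
    using okA_app[OF ok A(3)] okA_app[OF ok A(4)] by blast
  have 3: "(\<exists>i\<in>A. \<exists>k1\<in>A. \<exists>d1\<in>A. \<exists>S1\<in>A. i \<epsilon> xs ! m \<and> k1 \<epsilon> xs ! k \<and> opr k1 d1 \<epsilon> xs ! f \<and> opr k1 S1 \<epsilon> xs ! s \<and> P i k1 d1 S1)
     \<longleftrightarrow> (\<exists>i k1 d1 S1. i \<epsilon> xs ! m \<and> k1 \<epsilon> xs ! k \<and> opr k1 d1 \<epsilon> xs ! f \<and> opr k1 S1 \<epsilon> xs ! s \<and> P i k1 d1 S1)" for P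
    using okA_app[OF ok A(3)] okA_app[OF ok A(4)] okA_trans[OF ok A(2)] by blast
  have T1: "holds E A (xs @ [i, j]) (is_truth_set M m S (\<lambda>a. \<^bold>\<exists>x y. is_app a (length xs) x \<^bold>\<and> is_app a (Suc (length xs)) y \<^bold>\<and> x \<^bold>\<in> y))
     \<longleftrightarrow> TS (xs ! M) (xs ! m) (xs ! S) (\<lambda>a. \<exists>x y. opr i x \<epsilon> a \<and> opr j y \<epsilon> a \<and> x \<epsilon> y)" if "i \<in> A" "j \<in> A" for i j
    by (subst h_TS[where P' = "\<lambda>a. \<exists>x y. opr i x \<epsilon> a \<and> opr j y \<epsilon> a \<and> x \<epsilon> y" and A = A])
      (use assms that in \<open>auto dest: okA_app[OF ok]\<close>)
  have T2: "holds E A (xs @ [i, j]) (is_truth_set M m S (\<lambda>a. \<^bold>\<exists>x. is_app a (length xs) x \<^bold>\<and> is_app a (Suc (length xs)) x))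
     \<longleftrightarrow> TS (xs ! M) (xs ! m) (xs ! S) (\<lambda>a. \<exists>x. opr i x \<epsilon> a \<and> opr j x \<epsilon> a)" if "i \<in> A" "j \<in> A" for i j
    by (subst h_TS[where P' = "\<lambda>a. \<exists>x. opr i x \<epsilon> a \<and> opr j x \<epsilon> a" and A = A])
      (use assms that in \<open>auto dest: okA_app[OF ok]\<close>)
  have T3: "holds E A xs (is_truth_set M m S (\<lambda>a. \<^bold>\<bottom>)) \<longleftrightarrow> TS (xs ! M) (xs ! m) (xs ! S) (\<lambda>a. False)"
    by (subst h_TS[where P' = "\<lambda>a. False" and A = A]) (use assms in auto)
  have T4: "holds E A (xs @ [k1, d1, S1, k2, d2, S2])
        (is_truth_set M m S (\<lambda>a. a \<^bold>\<in> Suc (Suc (length xs)) \<^bold>\<longrightarrow> a \<^bold>\<in> Suc (Suc (Suc (Suc (Suc (length xs)))))))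
     \<longleftrightarrow> TS (xs ! M) (xs ! m) (xs ! S) (\<lambda>a. a \<epsilon> S1 \<longrightarrow> a \<epsilon> S2)"
    if "k1 \<in> A" "d1 \<in> A" "S1 \<in> A" "k2 \<in> A" "d2 \<in> A" "S2 \<in> A" for k1 d1 S1 k2 d2 S2
    by (subst h_TS[where P' = "\<lambda>a. a \<epsilon> S1 \<longrightarrow> a \<epsilon> S2" and A = A]) (use assms that in auto)
  have T5: "holds E A (xs @ [i, k1, d1, S1])
        (is_truth_set M m S (\<lambda>a. \<^bold>\<forall>b. is_map b m M \<^bold>\<and> agree_off m (length xs) a b \<^bold>\<longrightarrow> b \<^bold>\<in> Suc (Suc (Suc (length xs)))))
     \<longleftrightarrow> TS (xs ! M) (xs ! m) (xs ! S) (\<lambda>a. \<forall>b. Map b (xs ! m) (xs ! M) \<and> Agr (xs ! m) i a b \<longrightarrow> b \<epsilon> S1)"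
    if "i \<in> A" "k1 \<in> A" "d1 \<in> A" "S1 \<in> A" for i k1 d1 S1
    by (subst h_TS[where P' = "\<lambda>a. \<forall>b. Map b (xs ! m) (xs ! M) \<and> Agr (xs ! m) i a b \<longrightarrow> b \<epsilon> S1" and A = A])
      (use assms that in \<open>auto dest: good_map[OF assms(1) nth_in[OF assms(2,3)] assms(10)]\<close>)
  show ?thesis unfolding TC_def fT_def 1[symmetric] 2[symmetric] 3[symmetric]
    using assms by (simp add: T1 T2 T3 T4 T5 del: bex_simps ex_simps)
qed

lemma is_formula_eq: "is_formula m c = (is_nat m \<^bold>\<and> (\<^bold>\<exists>n f. is_nat n \<^bold>\<and> is_fun f n
     \<^bold>\<and> (\<^bold>\<exists>k. k \<^bold>\<in> n \<^bold>\<and> is_app f k c) \<^bold>\<and> (\<^bold>\<forall>k d. k \<^bold>\<in> n \<^bold>\<and> is_app f k d \<^bold>\<longrightarrow> fC m f k d)))"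
  unfolding is_formula_def fC_def ..

lemma sat_eq: "sat M m c a = (is_nat m \<^bold>\<and> (\<^bold>\<exists>n f s. is_nat n \<^bold>\<and> is_fun f n \<^bold>\<and> is_fun s n
     \<^bold>\<and> (\<^bold>\<exists>k S. k \<^bold>\<in> n \<^bold>\<and> is_app f k c \<^bold>\<and> is_app s k S \<^bold>\<and> a \<^bold>\<in> S)
     \<^bold>\<and> (\<^bold>\<forall>k d S. k \<^bold>\<in> n \<^bold>\<and> is_app f k d \<^bold>\<and> is_app s k S \<^bold>\<longrightarrow> fT M m f s k d S)))"
  unfolding sat_def fT_def ..

text \<open>The existence of a construction sequence is not a bounded statement; \<open>good\<close>
  supplies one inside \<open>A\<close>. The same holds for truth sequences in
  \<open>h_sat\<close>.\<close>

lemma h_formula [simp]: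
  assumes "good A" "set xs \<subseteq> A" "m < length xs" "c < length xs"
  shows "holds E A xs (is_formula m c) \<longleftrightarrow> Fml (xs ! m) (xs ! c)"
proof -
  have 1: "(\<forall>k\<in>A. \<forall>d\<in>A. k \<epsilon> n \<and> opr k d \<epsilon> f \<longrightarrow> P k d) \<longleftrightarrow> (\<forall>k d. k \<epsilon> n \<and> opr k d \<epsilon> f \<longrightarrow> P k d)" if "f \<in> A" for P n f
    using okA_app[OF good0_okA[OF good_good0[OF assms(1)]] that] by blast
  have 2: "(\<exists>k\<in>A. k \<epsilon> n \<and> P k) \<longleftrightarrow> (\<exists>k. k \<epsilon> n \<and> P k)" if "n \<in> A" for P n
    using okA_trans[OF good0_okA[OF good_good0[OF assms(1)]] that] by blast
  have "holds E A xs (is_formula m c) \<longleftrightarrow>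
     Nt (xs ! m) \<and> (\<exists>n\<in>A. \<exists>f\<in>A. Cons (xs ! m) n f \<and> (\<exists>k. k \<epsilon> n \<and> opr k (xs ! c) \<epsilon> f))"
    unfolding is_formula_eq Cons_def using assms by (simp add: 1 2 cong: bex_cong_simp) blast
  also have "\<dots> \<longleftrightarrow> Fml (xs ! m) (xs ! c)"
    using assms(1) nth_in[OF assms(2,3)] nth_in[OF assms(2,4)] unfolding Fml_def good_def by blast
  finally show ?thesis .
qed

lemma h_sat [simp]:
  assumes "good A" "set xs \<subseteq> A" "M < length xs" "m < length xs" "c < length xs" "a < length xs"
  shows "holds E A xs (sat M m c a) \<longleftrightarrow> Sat (xs ! M) (xs ! m) (xs ! c) (xs ! a)"
proof (cases "Nt (xs ! m)")
  case True
  have 1: "(\<forall>k\<in>A. \<forall>d\<in>A. \<forall>S\<in>A. k \<epsilon> n \<and> opr k d \<epsilon> f \<and> opr k S \<epsilon> s \<longrightarrow> P k d S)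
      \<longleftrightarrow> (\<forall>k d S. k \<epsilon> n \<and> opr k d \<epsilon> f \<and> opr k S \<epsilon> s \<longrightarrow> P k d S)" if "f \<in> A" "s \<in> A" for P n f s
    using okA_app[OF good0_okA[OF good_good0[OF assms(1)]] that(1)] okA_app[OF good0_okA[OF good_good0[OF assms(1)]] that(2)] by blast
  have 2: "(\<exists>k\<in>A. \<exists>S\<in>A. k \<epsilon> n \<and> opr k d \<epsilon> f \<and> opr k S \<epsilon> s \<and> b \<epsilon> S) \<longleftrightarrow>
     (\<exists>k S. k \<epsilon> n \<and> opr k d \<epsilon> f \<and> opr k S \<epsilon> s \<and> b \<epsilon> S)" if "s \<in> A" for s n f d b
    using okA_app[OF good0_okA[OF good_good0[OF assms(1)]] that] by blast
  have "holds E A xs (sat M m c a) \<longleftrightarrow>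
     (\<exists>n\<in>A. \<exists>f\<in>A. \<exists>s\<in>A. TSq (xs ! M) (xs ! m) n f s
        \<and> (\<exists>k S. k \<epsilon> n \<and> opr k (xs ! c) \<epsilon> f \<and> opr k S \<epsilon> s \<and> xs ! a \<epsilon> S))"
    unfolding sat_eq TSq_def using assms True by (simp add: 1 2 h_TC del: ex_simps bex_simps) blast
  also have "\<dots> \<longleftrightarrow> Sat (xs ! M) (xs ! m) (xs ! c) (xs ! a)"
    using assms(1) True nth_in[OF assms(2,3)] nth_in[OF assms(2,4)] nth_in[OF assms(2,5)]
    unfolding Sat_def good_def by blast
  finally show ?thesis .
next
  case False
  then show ?thesis unfolding sat_eq Sat_def using assms by simp
qed

lemma vgood_good [simp]: "vgood A \<Longrightarrow> good A"
  by (simp add: vgood_def)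

lemma vgood_UNIV [simp]: "vgood UNIV"
  by (simp add: vgood_def)

lemma Fml_Nt: "Fml m c \<Longrightarrow> Nt m"
  by (simp add: Fml_def)

text \<open>The unbounded witnesses are a number, a formula, a finite domain and a finite
  assignment, and \<open>vgood\<close> places all of them in \<open>A\<close>.\<close>

lemma h_in_Def [simp]:
  assumes "vgood A" "set xs \<subseteq> A" "B < length xs" "X < length xs"
  shows "holds E A xs (in_Def B X) \<longleftrightarrow> isDef (xs ! B) (xs ! X)"
proof -
  have A: "good A" "okA A" "xs ! B \<in> A" using assms by auto
  have *: "(\<exists>m\<in>A. \<exists>c\<in>A. \<exists>z\<in>A. \<exists>d\<in>A. \<exists>p\<in>A. Fml m c \<and> z = emp \<and> z \<epsilon> m
        \<and> (\<forall>i\<in>A. i \<epsilon> d \<longleftrightarrow> i \<epsilon> m \<and> i \<noteq> z) \<and> Map p d (xs ! B)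
        \<and> (\<forall>x\<in>A. x \<epsilon> xs ! B \<longrightarrow>
             (x \<epsilon> X \<longleftrightarrow> (\<exists>a\<in>A. Map a m (xs ! B) \<and> Sub p a \<and> opr z x \<epsilon> a \<and> Sat (xs ! B) m c a))))
    \<longleftrightarrow> (\<exists>m c d p. Fml m c \<and> emp \<epsilon> m
        \<and> (\<forall>i. i \<epsilon> d \<longleftrightarrow> i \<epsilon> m \<and> i \<noteq> emp) \<and> Map p d (xs ! B)
        \<and> (\<forall>x. x \<epsilon> xs ! B \<longrightarrow>
             (x \<epsilon> X \<longleftrightarrow> (\<exists>a. Map a m (xs ! B) \<and> Sub p a \<and> opr emp x \<epsilon> a \<and> Sat (xs ! B) m c a))))"
    (is "?l \<longleftrightarrow> ?r") for X
  proof -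
    have 1: "(\<exists>a\<in>A. Map a m (xs ! B) \<and> Sub p a \<and> opr emp x \<epsilon> a \<and> Sat (xs ! B) m c a)
      \<longleftrightarrow> (\<exists>a. Map a m (xs ! B) \<and> Sub p a \<and> opr emp x \<epsilon> a \<and> Sat (xs ! B) m c a)" if "Fml m c" for m c x p
      using good_map[OF good_good0[OF A(1)] A(3)] Fml_Nt[OF that] by blast
    have 2: "(\<forall>i\<in>A. i \<epsilon> d \<longleftrightarrow> i \<epsilon> m \<and> i \<noteq> emp) \<longleftrightarrow> (\<forall>i. i \<epsilon> d \<longleftrightarrow> i \<epsilon> m \<and> i \<noteq> emp)" if "m \<in> A" "d \<in> A" for m d
      using okA_trans[OF A(2) that(1)] okA_trans[OF A(2) that(2)] by blast
    have 3: "(\<forall>x\<in>A. x \<epsilon> xs ! B \<longrightarrow> P x) \<longleftrightarrow> (\<forall>x. x \<epsilon> xs ! B \<longrightarrow> P x)" for P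
      using okA_trans[OF A(2,3)] by blast
    have "?l \<longleftrightarrow> (\<exists>m\<in>A. \<exists>c\<in>A. \<exists>d\<in>A. \<exists>p\<in>A. Fml m c \<and> emp \<epsilon> m
        \<and> (\<forall>i\<in>A. i \<epsilon> d \<longleftrightarrow> i \<epsilon> m \<and> i \<noteq> emp) \<and> Map p d (xs ! B)
        \<and> (\<forall>x. x \<epsilon> xs ! B \<longrightarrow>
             (x \<epsilon> X \<longleftrightarrow> (\<exists>a\<in>A. Map a m (xs ! B) \<and> Sub p a \<and> opr emp x \<epsilon> a \<and> Sat (xs ! B) m c a))))"
      unfolding 3 using okA_emp[OF A(2)] by blast
    also have "\<dots> \<longleftrightarrow> (\<exists>m\<in>A. \<exists>c\<in>A. \<exists>d\<in>A. \<exists>p\<in>A. Fml m c \<and> emp \<epsilon> m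
        \<and> (\<forall>i. i \<epsilon> d \<longleftrightarrow> i \<epsilon> m \<and> i \<noteq> emp) \<and> Map p d (xs ! B)
        \<and> (\<forall>x. x \<epsilon> xs ! B \<longrightarrow>
             (x \<epsilon> X \<longleftrightarrow> (\<exists>a. Map a m (xs ! B) \<and> Sub p a \<and> opr emp x \<epsilon> a \<and> Sat (xs ! B) m c a))))"
      by (intro bex_cong refl conj_cong 2) (simp_all add: 1)
    also have "\<dots> \<longleftrightarrow> ?r"
    proof
      assume ?r
      then obtain m c d p where r: "Fml m c" "emp \<epsilon> m"
        "\<forall>i. i \<epsilon> d \<longleftrightarrow> i \<epsilon> m \<and> i \<noteq> emp" "Map p d (xs ! B)"
        "\<forall>x. x \<epsilon> xs ! B \<longrightarrow>
             (x \<epsilon> X \<longleftrightarrow> (\<exists>a. Map a m (xs ! B) \<and> Sub p a \<and> opr emp x \<epsilon> a \<and> Sat (xs ! B) m c a))"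
        by blast
      have "Nt m" "Sub d m" using r(1,3) by (auto simp: Fml_def Sub_def)
      then have "m \<in> A" "c \<in> A" "d \<in> A" "p \<in> A"
        using assms(1) A(1,3) r(1,4) good_nat[OF good_good0[OF A(1)]] unfolding vgood_def by blast+
      with r show "\<exists>m\<in>A. \<exists>c\<in>A. \<exists>d\<in>A. \<exists>p\<in>A. Fml m c \<and> emp \<epsilon> m
        \<and> (\<forall>i. i \<epsilon> d \<longleftrightarrow> i \<epsilon> m \<and> i \<noteq> emp) \<and> Map p d (xs ! B)
        \<and> (\<forall>x. x \<epsilon> xs ! B \<longrightarrow>
             (x \<epsilon> X \<longleftrightarrow> (\<exists>a. Map a m (xs ! B) \<and> Sub p a \<and> opr emp x \<epsilon> a \<and> Sat (xs ! B) m c a)))"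
        by blast
    qed blast
    finally show ?thesis .
  qed
  have "holds E A xs (in_Def B X) \<longleftrightarrow> Sub (xs ! X) (xs ! B) \<and>
    (\<exists>m\<in>A. \<exists>c\<in>A. \<exists>z\<in>A. \<exists>d\<in>A. \<exists>p\<in>A. Fml m c \<and> z = emp \<and> z \<epsilon> m
        \<and> (\<forall>i\<in>A. i \<epsilon> d \<longleftrightarrow> i \<epsilon> m \<and> i \<noteq> z) \<and> Map p d (xs ! B)
        \<and> (\<forall>x\<in>A. x \<epsilon> xs ! B \<longrightarrow>
             (x \<epsilon> xs ! X \<longleftrightarrow> (\<exists>a\<in>A. Map a m (xs ! B) \<and> Sub p a \<and> opr z x \<epsilon> a \<and> Sat (xs ! B) m c a))))"
    unfolding in_Def_def using assms A by (simp del: bex_simps ex_simps)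
  then show ?thesis unfolding * isDef_def .
qed

lemma h_Def [simp]:
  assumes "vgood A" "set xs \<subseteq> A" "B < length xs" "D < length xs"
  shows "holds E A xs (is_Def B D) \<longleftrightarrow> (\<forall>X. X \<epsilon> xs ! D \<longleftrightarrow> isDef (xs ! B) X)"
proof -
  have A: "okA A" "xs ! B \<in> A" "xs ! D \<in> A" using assms by auto
  have "holds E A xs (is_Def B D) \<longleftrightarrow> (\<forall>X\<in>A. X \<epsilon> xs ! D \<longleftrightarrow> isDef (xs ! B) X)"
    unfolding is_Def_eq using assms by simp
  also have "\<dots> \<longleftrightarrow> (\<forall>X. X \<epsilon> xs ! D \<longleftrightarrow> isDef (xs ! B) X)"
    using okA_trans[OF A(1,3)] assms(1) A(2) unfolding vgood_def by blast
  finally show ?thesis .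
qed

lemma h_LH [simp]:
  assumes "vgood A" "set xs \<subseteq> A" "b < length xs" "g < length xs"
  shows "holds E A xs (is_L_hierarchy b g) \<longleftrightarrow> LH (xs ! b) (xs ! g)"
proof -
  have A: "good A" "okA A" "xs ! b \<in> A" "xs ! g \<in> A" using assms by auto
  note gA = okA_app[OF A(2,4)]
  have 1: "(\<forall>\<gamma>\<in>A. \<forall>x\<in>A. \<gamma> \<epsilon> xs ! b \<and> opr \<gamma> x \<epsilon> xs ! g \<longrightarrow> P \<gamma> x) \<longleftrightarrow>
     (\<forall>\<gamma> x. \<gamma> \<epsilon> xs ! b \<and> opr \<gamma> x \<epsilon> xs ! g \<longrightarrow> \<gamma> \<in> A \<and> x \<in> A \<longrightarrow> P \<gamma> x)" for P
    using gA by blast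
  have 2: "(\<exists>\<delta>\<in>A. \<exists>B\<in>A. \<gamma> = suc \<delta> \<and> opr \<delta> B \<epsilon> xs ! g \<and> P B) \<longleftrightarrow>
      (\<exists>\<delta> B. \<gamma> = suc \<delta> \<and> opr \<delta> B \<epsilon> xs ! g \<and> P B)" for \<gamma> P
    using gA by blast
  have 3: "(\<forall>x\<in>A. x \<epsilon> C \<longleftrightarrow> (\<exists>\<delta>\<in>A. \<exists>B\<in>A. \<delta> \<epsilon> \<gamma> \<and> opr \<delta> B \<epsilon> xs ! g \<and> x \<epsilon> B)) \<longleftrightarrow>
      (\<forall>x. x \<epsilon> C \<longleftrightarrow> (\<exists>\<delta> B. \<delta> \<epsilon> \<gamma> \<and> opr \<delta> B \<epsilon> xs ! g \<and> x \<epsilon> B))" if "C \<in> A" for C \<gamma>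
    using gA okA_trans[OF A(2)] that by blast
  have "holds E A xs (is_L_hierarchy b g) \<longleftrightarrow> Ord (xs ! b) \<and> Fun (xs ! g) (xs ! b) \<and>
     (\<forall>\<gamma>\<in>A. \<forall>C\<in>A. \<gamma> \<epsilon> xs ! b \<and> opr \<gamma> C \<epsilon> xs ! g \<longrightarrow>
        \<gamma> = emp \<and> C = emp
      \<or> (\<exists>\<delta>\<in>A. \<exists>B\<in>A. \<gamma> = suc \<delta> \<and> opr \<delta> B \<epsilon> xs ! g \<and> (\<forall>X. X \<epsilon> C \<longleftrightarrow> isDef B X))
      \<or> Lim \<gamma> \<and> (\<forall>x\<in>A. x \<epsilon> C \<longleftrightarrow> (\<exists>\<delta>\<in>A. \<exists>B\<in>A. \<delta> \<epsilon> \<gamma> \<and> opr \<delta> B \<epsilon> xs ! g \<and> x \<epsilon> B)))"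
    unfolding is_L_hierarchy_def using assms A by (simp del: bex_simps ex_simps)
  also have "\<dots> \<longleftrightarrow> LH (xs ! b) (xs ! g)"
    unfolding LH_def 1 2 using gA by (simp add: 3 del: bex_simps ex_simps cong: conj_cong imp_cong) blast
  finally show ?thesis .
qed

text \<open>The witnesses stay bounded by \<open>A\<close>: a level of the universe is recognized in
  \<open>A\<close> only if some hierarchy reaching it belongs to \<open>A\<close>. Applications
  going upwards must therefore put such a hierarchy into the model first.\<close>

lemma h_Lev [simp]:
  assumes "vgood A" "set xs \<subseteq> A" "a < length xs" "b < length xs"
  shows "holds E A xs (is_L_level a b) \<longleftrightarrow> (\<exists>\<beta>\<in>A. \<exists>g\<in>A. xs ! a \<epsilon> \<beta> \<and> LH \<beta> g \<and> opr (xs ! a) (xs ! b) \<epsilon> g)"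
  unfolding is_L_level_def using assms by simp

end

section \<open>Coded formulas\<close>

text \<open>The standard formulas of the coded language. A code inside the structure may have
  nonstandard length; only the codes of these formulas are compared with external truth.\<close>

datatype nfm =
    NMem nat nat
  | NEq nat nat
  | NFls
  | NImp nfm nfm
  | NAll nat nfm

abbreviation NNeg :: "nfm \<Rightarrow> nfm" where "NNeg p \<equiv> NImp p NFls"
abbreviation NAnd :: "nfm \<Rightarrow> nfm \<Rightarrow> nfm" where "NAnd p q \<equiv> NNeg (NImp p (NNeg q))"
abbreviation NIff :: "nfm \<Rightarrow> nfm \<Rightarrow> nfm" where "NIff p q \<equiv> NAnd (NImp p q) (NImp q p)"
abbreviation NEx :: "nat \<Rightarrow> nfm \<Rightarrow> nfm" where "NEx i p \<equiv> NNeg (NAll i (NNeg p))"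

primrec nsat :: "('a \<Rightarrow> 'a \<Rightarrow> bool) \<Rightarrow> 'a set \<Rightarrow> nfm \<Rightarrow> (nat \<Rightarrow> 'a) \<Rightarrow> bool" where
  "nsat E A (NMem i j) v = E (v i) (v j)"
| "nsat E A (NEq i j) v = (v i = v j)"
| "nsat E A NFls v = False"
| "nsat E A (NImp p q) v = (nsat E A p v \<longrightarrow> nsat E A q v)"
| "nsat E A (NAll i p) v = (\<forall>d\<in>A. nsat E A p (v(i := d)))"

lemma nsat_derived:
  "nsat E A (NAnd p q) v \<longleftrightarrow> nsat E A p v \<and> nsat E A q v"
  "nsat E A (NIff p q) v \<longleftrightarrow> (nsat E A p v \<longleftrightarrow> nsat E A q v)"
  "nsat E A (NEx i p) v \<longleftrightarrow> (\<exists>d\<in>A. nsat E A p (v(i := d)))"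
  by auto

text \<open>The condition keeps rewriting from unfolding the negations inside \<open>NAnd\<close>,
  \<open>NIff\<close> and \<open>NEx\<close>, so that \<open>nsat_derived\<close> can still
  recognize them.\<close>

lemma nsat_imp: "q \<noteq> NFls \<Longrightarrow> nsat E A (NImp p q) v \<longleftrightarrow> (nsat E A p v \<longrightarrow> nsat E A q v)"
  by simp

text \<open>Bound variables are counted as well, in agreement with
  \<open>is_formula\<close>.\<close>

primrec nb :: "nat \<Rightarrow> nfm \<Rightarrow> bool" where
  "nb m (NMem i j) \<longleftrightarrow> i < m \<and> j < m"
| "nb m (NEq i j) \<longleftrightarrow> i < m \<and> j < m"
| "nb m NFls \<longleftrightarrow> True"
| "nb m (NImp p q) \<longleftrightarrow> nb m p \<and> nb m q"
| "nb m (NAll i p) \<longleftrightarrow> i < m \<and> nb m p"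

text \<open>Passage from de Bruijn indices to names: \<open>r\<close> names the indices in scope and
  \<open>d\<close> is the next name to be bound. With \<open>r\<close> sending \<open>i\<close> to
  \<open>d - Suc i\<close> the result mirrors \<open>quote\<close>.\<close>

primrec named :: "(nat \<Rightarrow> nat) \<Rightarrow> nat \<Rightarrow> fm \<Rightarrow> nfm" where
  "named r d (Member i j) = NMem (r i) (r j)"
| "named r d (Equal i j) = NEq (r i) (r j)"
| "named r d Falsum = NFls"
| "named r d (Implies p q) = NImp (named r d p) (named r d q)"
| "named r d (Forall p) = NAll d (named (case_nat d r) (Suc d) p)"

lemma nb_mono: "nb m p \<Longrightarrow> m \<le> n \<Longrightarrow> nb n p"
  by (induction p) auto

lemma nb_exists: "\<exists>m\<ge>l. nb m p"
proof -
  have "\<exists>m. nb m p"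
  proof (induction p)
    case (NMem i j)
    show ?case by (rule exI[of _ "Suc (i + j)"]) simp
  next
    case (NEq i j)
    show ?case by (rule exI[of _ "Suc (i + j)"]) simp
  next
    case (NImp p q)
    then obtain m n where "nb m p" "nb n q" by blast
    then have "nb (m + n) (NImp p q)" by (auto intro: nb_mono)
    then show ?case ..
  next
    case (NAll i p)
    then obtain m where "nb m p" by blast
    then have "nb (Suc (m + i)) (NAll i p)" by (auto intro: nb_mono)
    then show ?case ..
  qed auto
  then obtain m where "nb m p" ..
  then have "nb (m + l) p" by (auto intro: nb_mono)
  then show ?thesis by (auto intro: exI[of _ "m + l"])
qed

lemma nsat_cong: "nb m p \<Longrightarrow> (\<And>i. i < m \<Longrightarrow> v i = w i) \<Longrightarrow> nsat E A p v = nsat E A p w"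
proof (induction p arbitrary: v w)
  case (NAll i p)
  have "nsat E A p (v(i := d)) = nsat E A p (w(i := d))" for d
    using NAll.prems by (intro NAll.IH) auto
  then show ?case by simp
next
  case (NImp p q)
  have "nsat E A p v = nsat E A p w" using NImp.prems by (intro NImp.IH(1)) simp_all
  moreover have "nsat E A q v = nsat E A q w" using NImp.prems by (intro NImp.IH(2)) simp_all
  ultimately show ?case by simp
qed auto

text \<open>All names in use are below \<open>d\<close>, so binding \<open>d\<close> captures none
  of them.\<close>

lemma nsat_named:
  "free_below k p \<Longrightarrow> (\<And>i. i < k \<Longrightarrow> r i < d) \<Longrightarrow> nsat E A (named r d p) v = ev E A p (\<lambda>i. v (r i))"
proof (induction p arbitrary: k r d v)
  case (Forall p)
  have "nsat E A (named (case_nat d r) (Suc d) p) (v(d := x)) = ev E A p (case_nat x (\<lambda>i. v (r i)))" for x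
  proof -
    have "nsat E A (named (case_nat d r) (Suc d) p) (v(d := x))
        = ev E A p (\<lambda>i. (v(d := x)) (case_nat d r i))"
      using Forall.prems by (intro Forall.IH[of "Suc k"]) (auto split: nat.split intro: less_SucI)
    also have "\<dots> = ev E A p (case_nat x (\<lambda>i. v (r i)))"
      using Forall.prems by (intro ev_cong[of "Suc k"]) (auto split: nat.split)
    finally show ?thesis .
  qed
  then show ?case by simp
next
  case (Implies p q)
  then show ?case by (metis ev.simps(4) free_below.simps(4) named.simps(4) nsat.simps(4))
qed auto

primrec subfms :: "nfm \<Rightarrow> nfm list" where
  "subfms (NMem i j) = [NMem i j]"
| "subfms (NEq i j) = [NEq i j]"
| "subfms NFls = [NFls]"
| "subfms (NImp p q) = subfms p @ subfms q @ [NImp p q]"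
| "subfms (NAll i p) = subfms p @ [NAll i p]"

text \<open>External counterpart of a construction sequence. The list \<open>subfms\<close> meets it
  because it enumerates the subformulas in postorder.\<close>

definition constr :: "nfm list \<Rightarrow> bool" where
  "constr ps \<longleftrightarrow> (\<forall>k<length ps. (\<forall>p q. ps ! k = NImp p q \<longrightarrow> p \<in> set (take k ps) \<and> q \<in> set (take k ps))
     \<and> (\<forall>i p. ps ! k = NAll i p \<longrightarrow> p \<in> set (take k ps)))"

lemma constr_append: "constr ps \<Longrightarrow> constr qs \<Longrightarrow> constr (ps @ qs)"
  unfolding constr_def
  by (auto simp: nth_append dest: spec[of _ "_ - length ps"])

lemma constr_snoc:
  "constr ps \<Longrightarrow> (\<And>p q. r = NImp p q \<Longrightarrow> p \<in> set ps \<and> q \<in> set ps) \<Longrightarrow>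
    (\<And>i p. r = NAll i p \<Longrightarrow> p \<in> set ps) \<Longrightarrow> constr (ps @ [r])"
  unfolding constr_def by (auto simp: nth_append less_Suc_eq)

lemma in_subfms: "p \<in> set (subfms p)"
  by (cases p) auto

lemma constr_subfms: "constr (subfms p)"
proof (induction p)
  case (NImp p q)
  then have "constr ((subfms p @ subfms q) @ [NImp p q])"
    by (intro constr_snoc constr_append) (auto simp: in_subfms)
  then show ?case by simp
next
  case (NAll i p)
  then have "constr (subfms p @ [NAll i p])" by (intro constr_snoc) (auto simp: in_subfms)
  then show ?case by simp
qed (auto simp: constr_def)

lemma nb_subfms: "nb m p \<Longrightarrow> q \<in> set (subfms p) \<Longrightarrow> nb m q"
  by (induction p) auto

text \<open>Index 0 of \<open>q\<close> is the element being tested. The other indices jump over the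
  three binders and refer to the ambient assignment, so the set that is separated from is visible in
  \<open>q\<close> only if passed as a parameter.\<close>

definition sepa :: "fm \<Rightarrow> fm" where
  "sepa q = (\<^bold>\<forall>z. \<^bold>\<exists>y. \<^bold>\<forall>x. x \<^bold>\<in> y \<^bold>\<longleftrightarrow> x \<^bold>\<in> z \<^bold>\<and> (\<lambda>n. rename (case_nat 0 (\<lambda>i. i + 3)) q)) 0"

text \<open>In \<open>q\<close>, index 0 is the argument, index 1 the value, and the rest are
  parameters. The two renamings differ because the argument and the bound set are quantified in
  opposite orders in the two halves.\<close>

definition repa :: "fm \<Rightarrow> fm" where
  "repa q = (\<^bold>\<forall>z. (\<^bold>\<forall>x. x \<^bold>\<in> z \<^bold>\<longrightarrow> (\<^bold>\<exists>w. \<^bold>\<forall>y. (\<lambda>n. rename (case_nat 2 (case_nat 0 (\<lambda>i. i + 4))) q) \<^bold>\<longleftrightarrow> y \<^bold>= w))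
    \<^bold>\<longrightarrow> (\<^bold>\<exists>w. \<^bold>\<forall>x. x \<^bold>\<in> z \<^bold>\<longrightarrow> (\<^bold>\<exists>y. y \<^bold>\<in> w \<^bold>\<and> (\<lambda>n. rename (case_nat 1 (case_nat 0 (\<lambda>i. i + 4))) q)))) 0"

definition zfc :: "fm set" where
  "zfc = {ax_ext 0, ax_foundation 0, ax_pair 0, ax_union 0, ax_power 0, ax_infinity 0, ax_choice 0}
     \<union> range sepa \<union> range repa"

lemma ev_forms:
  "ev E A ((x \<^bold>\<in> y) n) v \<longleftrightarrow> E (v (n - Suc x)) (v (n - Suc y))"
  "ev E A ((x \<^bold>= y) n) v \<longleftrightarrow> v (n - Suc x) = v (n - Suc y)"
  "ev E A ((p \<^bold>\<longrightarrow> q) n) v \<longleftrightarrow> (ev E A (p n) v \<longrightarrow> ev E A (q n) v)"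
  "ev E A ((p \<^bold>\<and> q) n) v \<longleftrightarrow> ev E A (p n) v \<and> ev E A (q n) v"
  "ev E A ((p \<^bold>\<longleftrightarrow> q) n) v \<longleftrightarrow> (ev E A (p n) v \<longleftrightarrow> ev E A (q n) v)"
  "ev E A (all F n) v \<longleftrightarrow> (\<forall>d\<in>A. ev E A (F n (Suc n)) (case_nat d v))"
  "ev E A (ex F n) v \<longleftrightarrow> (\<exists>d\<in>A. ev E A (F n (Suc n)) (case_nat d v))"
  by (auto simp: mem_def eq_def fls_def imp_def all_def neg_def conj_def iff_def ex_def)

lemma ev_sepa: "ev E A (sepa q) v \<longleftrightarrow>
  (\<forall>z\<in>A. \<exists>y\<in>A. \<forall>x\<in>A. E x y \<longleftrightarrow> E x z \<and> ev E A q (case_nat x v))"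
proof -
  have "(\<lambda>i. case_nat x (case_nat y (case_nat z v)) (case_nat 0 (\<lambda>i. i + 3) i)) = case_nat x v" for x y z
    by (auto split: nat.split simp: numeral_3_eq_3)
  then show ?thesis by (simp add: sepa_def ev_forms ev_rename)
qed

lemma ev_repa: "ev E A (repa q) v \<longleftrightarrow>
  (\<forall>z\<in>A. (\<forall>x\<in>A. E x z \<longrightarrow> (\<exists>w\<in>A. \<forall>y\<in>A. ev E A q (case_nat x (case_nat y v)) \<longleftrightarrow> y = w))
    \<longrightarrow> (\<exists>w\<in>A. \<forall>x\<in>A. E x z \<longrightarrow> (\<exists>y\<in>A. E y w \<and> ev E A q (case_nat x (case_nat y v)))))"
proof -
  have 1: "(\<lambda>i. case_nat y (case_nat w (case_nat x (case_nat z v))) (case_nat 2 (case_nat 0 (\<lambda>i. i + 4)) i))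
      = case_nat x (case_nat y v)" for x y z w
    by (auto split: nat.split simp: eval_nat_numeral)
  have 2: "(\<lambda>i. case_nat y (case_nat x (case_nat w (case_nat z v))) (case_nat (Suc 0) (case_nat 0 (\<lambda>i. i + 4)) i))
      = case_nat x (case_nat y v)" for x y z w
    by (auto split: nat.split simp: eval_nat_numeral)
  show ?thesis by (simp add: repa_def ev_forms ev_rename 1 2)
qed

context bst
begin

primrec code :: "nfm \<Rightarrow> 'a" where
  "code (NMem i j) = kMem (nu i) (nu j)"
| "code (NEq i j) = kEq (nu i) (nu j)"
| "code NFls = kFls"
| "code (NImp p q) = kImp (code p) (code q)"
| "code (NAll i p) = kAll (nu i) (code p)"

lemma tv_codes:
  assumes "good0 A" "set xs \<subseteq> A"
  shows "tv A xs s a \<Longrightarrow> tv A xs t b \<Longrightarrow> tv A xs (cMem s t) (kMem a b)"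
    "tv A xs s a \<Longrightarrow> tv A xs t b \<Longrightarrow> tv A xs (cEq s t) (kEq a b)"
    "tv A xs cFls kFls"
    "tv A xs s a \<Longrightarrow> tv A xs t b \<Longrightarrow> tv A xs (cImp s t) (kImp a b)"
    "tv A xs s a \<Longrightarrow> tv A xs t b \<Longrightarrow> tv A xs (cAll s t) (kAll a b)"
  unfolding cMem_def cEq_def cImp_def cAll_def cFls_def kMem_def kEq_def kImp_def kAll_def kFls_def
  using assms by (simp_all add: tv_pair tv_num)

lemma tv_quote:
  assumes "good0 A" "set xs \<subseteq> A"
  shows "tv A xs (quote d p) (code (named (\<lambda>i. d - Suc i) d p))"
proof (induction p arbitrary: d)
  case (Forall p)
  have "case_nat d (\<lambda>i. d - Suc i) = (\<lambda>i. Suc d - Suc i)" by (auto split: nat.split)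
  then show ?case using Forall[of "Suc d"] by (simp add: tv_codes tv_num assms)
qed (simp_all add: tv_codes tv_num assms)

text \<open>The axiom of foundation has not been reached yet, so the well-foundedness clause for the
  ordinal \<open>w\<close> is applied to a singleton.\<close>

lemma Omega_irrefl: "Omega w \<Longrightarrow> x \<epsilon> w \<Longrightarrow> \<not> x \<epsilon> x"
proof
  assume "Omega w" "x \<epsilon> w" "x \<epsilon> x"
  then have "Ord w" by (simp add: Omega_def Lim_def)
  moreover have "Sub (upr x x) w" "upr x x \<noteq> emp"
    using \<open>x \<epsilon> w\<close> by (auto simp: Sub_def emp_iff)
  ultimately have "Fnd (upr x x)" by (auto simp: Ord_def)
  then show False using \<open>x \<epsilon> x\<close> by (auto simp: Fnd_def)
qed

lemma mem_nu: "x \<epsilon> nu n \<longleftrightarrow> (\<exists>i<n. x = nu i)"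
  by (induction n) (auto simp: nu.simps less_Suc_eq)

lemma nu_irrefl: "\<not> nu n \<epsilon> nu n"
  using Omega_exists Omega_nu Omega_irrefl by blast

lemma nu_inject [simp]: "nu i = nu j \<longleftrightarrow> i = j"
  using nu_irrefl mem_nu by (metis linorder_neqE_nat)

lemma nu_mem [simp]: "nu i \<epsilon> nu j \<longleftrightarrow> i < j"
  by (auto simp: mem_nu)

lemma code_distinct:
  "kMem a b \<noteq> kEq c d" "kMem a b \<noteq> kFls" "kMem a b \<noteq> kImp c d" "kMem a b \<noteq> kAll c d"
  "kEq a b \<noteq> kFls" "kEq a b \<noteq> kImp c d" "kEq a b \<noteq> kAll c d"
  "kFls \<noteq> kImp c d" "kFls \<noteq> kAll c d" "kImp a b \<noteq> kAll c d"
  by (simp_all add: kMem_def kEq_def kFls_def kImp_def kAll_def)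

lemmas code_ne [simp] = code_distinct code_distinct[symmetric]

lemma code_inject [simp]:
  "kMem a b = kMem c d \<longleftrightarrow> a = c \<and> b = d" "kEq a b = kEq c d \<longleftrightarrow> a = c \<and> b = d"
  "kImp a b = kImp c d \<longleftrightarrow> a = c \<and> b = d" "kAll a b = kAll c d \<longleftrightarrow> a = c \<and> b = d"
  by (simp_all add: kMem_def kEq_def kFls_def kImp_def kAll_def)

text \<open>The recursion runs on the reversed list, so that \<open>lseq\<close> grows at the end
  and earlier entries keep their positions.\<close>

primrec lsq :: "'a list \<Rightarrow> 'a" where
  "lsq [] = emp"
| "lsq (x # xs) = adj (lsq xs) (opr (nu (length xs)) x)"

definition lseq :: "'a list \<Rightarrow> 'a" where "lseq xs = lsq (rev xs)"

lemma lseq_Nil [simp]: "lseq [] = emp"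
  by (simp add: lseq_def)

lemma lseq_snoc [simp]: "lseq (xs @ [x]) = adj (lseq xs) (opr (nu (length xs)) x)"
  by (simp add: lseq_def)

lemma mem_lseq: "p \<epsilon> lseq xs \<longleftrightarrow> (\<exists>i<length xs. p = opr (nu i) (xs ! i))"
  by (induction xs rule: rev_induct) (auto simp: less_Suc_eq)

lemma opr_mem_lseq [simp]: "opr i x \<epsilon> lseq xs \<longleftrightarrow> (\<exists>k<length xs. i = nu k \<and> x = xs ! k)"
  by (auto simp: mem_lseq)

lemma Fun_lseq: "Fun (lseq xs) (nu (length xs))"
  by (auto simp: Fun_def mem_lseq mem_nu)

lemma Map_lseq: "Map (lseq xs) (nu (length xs)) M \<longleftrightarrow> set xs \<subseteq> els M"
  by (auto simp: Map_def Fun_lseq in_set_conv_nth subset_iff)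

lemma lseq_eq_iff: "length xs = length ys \<Longrightarrow> lseq xs = lseq ys \<longleftrightarrow> xs = ys"
  by (metis nth_equalityI nu_inject opr_mem_lseq)

text \<open>A standard number has only standard elements, so a map defined on it has finitely many
  values, which can be listed externally.\<close>

lemma Map_nu:
  assumes "Map a (nu m) M"
  obtains xs where "length xs = m" "set xs \<subseteq> els M" "a = lseq xs"
proof -
  have F: "Fun a (nu m)" and M: "\<And>x y. opr x y \<epsilon> a \<Longrightarrow> y \<epsilon> M" using assms by (auto simp: Map_def)
  define xs where "xs = map (\<lambda>i. THE y. opr (nu i) y \<epsilon> a) [0..<m]"
  have 1: "opr (nu i) (xs ! i) \<epsilon> a" if "i < m" for i
  proof -
    have "\<exists>!y. opr (nu i) y \<epsilon> a" using F that by (simp add: Fun_def)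
    then show ?thesis using that theI'[of "\<lambda>y. opr (nu i) y \<epsilon> a"] by (simp add: xs_def)
  qed
  have "a = lseq xs"
  proof (rule extensionality)
    fix p
    show "p \<epsilon> a \<longleftrightarrow> p \<epsilon> lseq xs"
    proof
      assume "p \<epsilon> a"
      then obtain i y where "i < m" "p = opr (nu i) y" using F unfolding Fun_def mem_nu by blast
      moreover have "y = xs ! i" using F 1[OF \<open>i < m\<close>] \<open>p \<epsilon> a\<close> calculation unfolding Fun_def by (metis nu_mem)
      ultimately show "p \<epsilon> lseq xs" by (simp add: xs_def)
    next
      assume "p \<epsilon> lseq xs"
      then obtain i where "i < m" "p = opr (nu i) (xs ! i)" by (auto simp: mem_lseq xs_def)
      then show "p \<epsilon> a" using 1 by simp
    qed
  qed
  moreover have "length xs = m" by (simp add: xs_def)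
  ultimately show ?thesis using that[of xs] assms Map_lseq[of xs M] by simp
qed

lemma Map_nu_iff: "Map a (nu m) M \<longleftrightarrow> (\<exists>xs. length xs = m \<and> set xs \<subseteq> els M \<and> a = lseq xs)"
  using Map_nu Map_lseq by metis

lemma Agr_lseq: "length xs = m \<Longrightarrow> length ys = m \<Longrightarrow> i < m \<Longrightarrow>
    Agr (nu m) (nu i) (lseq xs) (lseq ys) \<longleftrightarrow> ys = xs[i := ys ! i]"
proof
  assume *: "length xs = m" "length ys = m" "i < m" "Agr (nu m) (nu i) (lseq xs) (lseq ys)"
  have "ys ! j = xs ! j" if "j < m" "j \<noteq> i" for j
    using *(4) that *(1-3) unfolding Agr_def by (metis nu_inject nu_mem opr_mem_lseq)
  then show "ys = xs[i := ys ! i]" using *(1-3) by (intro nth_equalityI) (auto simp: nth_list_update)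
next
  assume *: "length xs = m" "length ys = m" "i < m" "ys = xs[i := ys ! i]"
  then show "Agr (nu m) (nu i) (lseq xs) (lseq ys)"
    unfolding Agr_def mem_nu by (metis nth_list_update_neq nu_inject opr_mem_lseq)
qed

text \<open>Induction on the external formula. Injectivity of codes forces the entry for
  \<open>p\<close> to be justified by earlier entries for its immediate subformulas. The sequence
  \<open>f\<close> may have nonstandard length and may contain nonstandard entries
  elsewhere.\<close>

lemma TSq_truth:
  assumes "TSq M (nu m) n f s"
  shows "k \<epsilon> n \<Longrightarrow> opr k (code p) \<epsilon> f \<Longrightarrow> opr k S \<epsilon> s \<Longrightarrow>
    a \<epsilon> S \<longleftrightarrow> (\<exists>xs. length xs = m \<and> set xs \<subseteq> els M \<and> a = lseq xs \<and> nsat E (els M) p (\<lambda>i. xs ! i))"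
proof (induction p arbitrary: k S a)
  case (NMem i j)
  then have "TC M (nu m) f s k (code (NMem i j)) S" using assms by (auto simp: TSq_def)
  then have "i < m" "j < m" and S: "TS M (nu m) S (\<lambda>a. \<exists>x y. opr (nu i) x \<epsilon> a \<and> opr (nu j) y \<epsilon> a \<and> x \<epsilon> y)"
    by (auto simp: TC_def mem_nu)
  then show ?case by (auto simp: TS_def Map_nu_iff)
next
  case (NEq i j)
  then have "TC M (nu m) f s k (code (NEq i j)) S" using assms by (auto simp: TSq_def)
  then have "i < m" "j < m" and S: "TS M (nu m) S (\<lambda>a. \<exists>x. opr (nu i) x \<epsilon> a \<and> opr (nu j) x \<epsilon> a)"
    by (auto simp: TC_def mem_nu)
  then show ?case by (auto simp: TS_def Map_nu_iff)
next
  case NFls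
  then have "TC M (nu m) f s k (code NFls) S" using assms by (auto simp: TSq_def)
  then have "TS M (nu m) S (\<lambda>a. False)" by (auto simp: TC_def)
  then show ?case by (auto simp: TS_def)
next
  case (NImp p q)
  have "TC M (nu m) f s k (code (NImp p q)) S" using NImp.prems assms unfolding TSq_def by blast
  then obtain k1 S1 k2 S2 where k: "k1 \<epsilon> k" "opr k1 (code p) \<epsilon> f" "opr k1 S1 \<epsilon> s"
    "k2 \<epsilon> k" "opr k2 (code q) \<epsilon> f" "opr k2 S2 \<epsilon> s" and S: "TS M (nu m) S (\<lambda>a. a \<epsilon> S1 \<longrightarrow> a \<epsilon> S2)"
    by (auto simp: TC_def)
  have "k1 \<epsilon> n" "k2 \<epsilon> n"
    using assms k unfolding TSq_def Fun_def by (metis opr_inject)+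
  note 1 = NImp.IH(1)[OF this(1) k(2,3)] and 2 = NImp.IH(2)[OF this(2) k(5,6)]
  have "(lseq xs \<epsilon> S1 \<longrightarrow> lseq xs \<epsilon> S2) \<longleftrightarrow> nsat E (els M) (NImp p q) (\<lambda>i. xs ! i)"
    if "length xs = m" "set xs \<subseteq> els M" for xs
  proof -
    have "lseq xs \<epsilon> S1 \<longleftrightarrow> nsat E (els M) p (\<lambda>i. xs ! i)" unfolding 1 using that by (metis lseq_eq_iff)
    moreover have "lseq xs \<epsilon> S2 \<longleftrightarrow> nsat E (els M) q (\<lambda>i. xs ! i)" unfolding 2 using that by (metis lseq_eq_iff)
    ultimately show ?thesis by simp
  qed
  then show ?case using S unfolding TS_def Map_nu_iff by (auto simp del: nsat.simps)
next
  case (NAll i p)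
  have "TC M (nu m) f s k (code (NAll i p)) S" using NAll.prems assms unfolding TSq_def by blast
  then obtain k1 S1 where i: "i < m" and k: "k1 \<epsilon> k" "opr k1 (code p) \<epsilon> f" "opr k1 S1 \<epsilon> s" and
    S: "TS M (nu m) S (\<lambda>a. \<forall>b. Map b (nu m) M \<and> Agr (nu m) (nu i) a b \<longrightarrow> b \<epsilon> S1)"
    by (auto simp: TC_def mem_nu)
  have "k1 \<epsilon> n" using assms k unfolding TSq_def Fun_def by (metis opr_inject)
  note IH = NAll.IH[OF this k(2,3)]
  have IH': "lseq ys \<epsilon> S1 \<longleftrightarrow> nsat E (els M) p (\<lambda>i. ys ! i)" if "length ys = m" "set ys \<subseteq> els M" for ys
    unfolding IH using that by (metis lseq_eq_iff)
  have *: "(\<forall>b. Map b (nu m) M \<and> Agr (nu m) (nu i) (lseq xs) b \<longrightarrow> b \<epsilon> S1)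
      \<longleftrightarrow> nsat E (els M) (NAll i p) (\<lambda>i. xs ! i)" if xs: "length xs = m" "set xs \<subseteq> els M" for xs
  proof -
    \<comment> \<open>Agreement off \<open>i\<close> becomes a list update at \<open>i\<close>,
      which is the function update in the semantics of \<open>NAll\<close>.\<close>
    have "(\<forall>b. Map b (nu m) M \<and> Agr (nu m) (nu i) (lseq xs) b \<longrightarrow> b \<epsilon> S1) \<longleftrightarrow>
        (\<forall>ys. length ys = m \<and> set ys \<subseteq> els M \<and> ys = xs[i := ys ! i] \<longrightarrow> nsat E (els M) p (\<lambda>i. ys ! i))"
      unfolding Map_nu_iff using IH' Agr_lseq[OF xs(1) _ i] by blast
    also have "\<dots> \<longleftrightarrow> (\<forall>d\<in>els M. nsat E (els M) p (\<lambda>k. xs[i := d] ! k))"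
    proof (intro iffI ballI allI impI; (elim conjE)?)
      fix d assume *: "\<forall>ys. length ys = m \<and> set ys \<subseteq> els M \<and> ys = xs[i := ys ! i] \<longrightarrow> nsat E (els M) p (\<lambda>i. ys ! i)"
        "d \<in> els M"
      then show "nsat E (els M) p (\<lambda>k. xs[i := d] ! k)"
        using xs i set_update_subset_insert[of xs i d] by (auto dest!: spec[of _ "xs[i := d]"])
    next
      fix ys assume *: "\<forall>d\<in>els M. nsat E (els M) p (\<lambda>k. xs[i := d] ! k)" "length ys = m" "set ys \<subseteq> els M"
        "ys = xs[i := ys ! i]"
      then show "nsat E (els M) p (\<lambda>i. ys ! i)" using i by (metis nth_mem subsetD)
    qed
    also have "\<dots> \<longleftrightarrow> (\<forall>d\<in>els M. nsat E (els M) p ((\<lambda>i. xs ! i)(i := d)))"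
    proof -
      have "(\<lambda>k. xs[i := d] ! k) = (\<lambda>i. xs ! i)(i := d)" for d
        using i xs by (auto simp: nth_list_update)
      then show ?thesis by (simp only:)
    qed
    finally show ?thesis by simp
  qed
  have "a \<epsilon> S \<longleftrightarrow> Map a (nu m) M \<and> (\<forall>b. Map b (nu m) M \<and> Agr (nu m) (nu i) a b \<longrightarrow> b \<epsilon> S1)"
    using S by (simp add: TS_def)
  also have "\<dots> \<longleftrightarrow> (\<exists>xs. length xs = m \<and> set xs \<subseteq> els M \<and> a = lseq xs \<and> nsat E (els M) (NAll i p) (\<lambda>i. xs ! i))"
    using * unfolding Map_nu_iff[of a] by blast
  finally show ?case .
qed

lemma Sat_truth:
  assumes "Sat M (nu m) (code p) (lseq xs)" "length xs = m"
  shows "nsat E (els M) p (\<lambda>i. xs ! i)"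
  using assms TSq_truth unfolding Sat_def by (metis lseq_eq_iff)

text \<open>The postorder list of subformulas, coded entry by entry, is a construction sequence of
  standard length.\<close>

lemma Fml_code:
  assumes "nb m p"
  shows "Fml (nu m) (code p)"
proof -
  let ?L = "subfms p"
  have "Cons (nu m) (nu (length ?L)) (lseq (map code ?L))"
    unfolding Cons_def
  proof (intro conjI allI impI)
    show "Fun (lseq (map code ?L)) (nu (length ?L))" using Fun_lseq[of "map code ?L"] by simp
    fix k d assume "k \<epsilon> nu (length ?L) \<and> opr k d \<epsilon> lseq (map code ?L)"
    then obtain i where i: "i < length ?L" "k = nu i" "d = code (?L ! i)" by auto
    have nb: "nb m (?L ! i)" using assms i(1) nb_subfms nth_mem by blast
    have earlier: "\<exists>j<i. opr (nu j) (code q) \<epsilon> lseq (map code ?L)" if "q \<in> set (take i ?L)" for q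
      using that i(1) by (auto simp: in_set_conv_nth)
    show "FC (nu m) (lseq (map code ?L)) k d"
    proof (cases "?L ! i")
      case (NImp q r)
      then have "q \<in> set (take i ?L)" "r \<in> set (take i ?L)"
        using constr_subfms[of p] i(1) by (auto simp: constr_def)
      then show ?thesis using earlier i NImp unfolding FC_def by (auto simp del: opr_mem_lseq) (metis nu_mem)
    next
      case (NAll j q)
      then have "q \<in> set (take i ?L)" using constr_subfms[of p] i(1) by (auto simp: constr_def)
      then show ?thesis using earlier i NAll nb unfolding FC_def by (auto simp del: opr_mem_lseq) (metis nu_mem)
    qed (use i nb in \<open>auto simp: FC_def\<close>)
  qed simp
  moreover obtain i where "i < length ?L" "?L ! i = p" using in_subfms by (metis in_set_conv_nth)
  ultimately show ?thesis unfolding Fml_def by (metis (no_types, lifting) Nt_nu length_map nth_map nu_mem opr_mem_lseq)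
qed

text \<open>Only the standard axiom instances are asked for, unlike in \<open>Mdl\<close>, so this
  is an external notion. In return it passes to elementarily equivalent transitive sets, and thus to
  collapses of hulls.\<close>

definition ZF :: "'a \<Rightarrow> bool" where
  "ZF T \<longleftrightarrow> Trn T \<and> T \<noteq> emp \<and> (\<forall>p\<in>zfc. \<forall>v. (\<forall>i. v i \<epsilon> T) \<longrightarrow> ev E (els T) p v)"

definition Mdl :: "'a \<Rightarrow> bool" where "Mdl N \<longleftrightarrow> holds E UNIV [N] (is_model 0)"

lemma valid_nsat:
  assumes "\<forall>m a. Fml m (code p) \<and> Map a m N \<longrightarrow> Sat N m (code p) a" "\<And>i. v i \<epsilon> N"
  shows "nsat E (els N) p v"
proof -
  obtain m where m: "nb m p" using nb_exists by blast
  let ?xs = "map v [0..<m]"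
  have "Sat N (nu m) (code p) (lseq ?xs)"
    using assms Fml_code[OF m] Map_lseq[of ?xs N] by auto
  then have "nsat E (els N) p (\<lambda>i. ?xs ! i)" by (rule Sat_truth) simp
  then show ?thesis using nsat_cong[OF m, of "\<lambda>i. ?xs ! i" v] by simp
qed

abbreviation kNeg :: "'a \<Rightarrow> 'a" where "kNeg p \<equiv> kImp p kFls"
abbreviation kAnd :: "'a \<Rightarrow> 'a \<Rightarrow> 'a" where "kAnd p q \<equiv> kNeg (kImp p (kNeg q))"
abbreviation kIff :: "'a \<Rightarrow> 'a \<Rightarrow> 'a" where "kIff p q \<equiv> kAnd (kImp p q) (kImp q p)"
abbreviation kEx :: "'a \<Rightarrow> 'a \<Rightarrow> 'a" where "kEx i p \<equiv> kNeg (kAll i (kNeg p))"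

lemma tv_derived:
  assumes "good0 A" "set xs \<subseteq> A"
  shows "tv A xs s a \<Longrightarrow> tv A xs (cNeg s) (kNeg a)"
    "tv A xs s a \<Longrightarrow> tv A xs t b \<Longrightarrow> tv A xs (cAnd s t) (kAnd a b)"
    "tv A xs s a \<Longrightarrow> tv A xs t b \<Longrightarrow> tv A xs (cIff s t) (kIff a b)"
    "tv A xs s a \<Longrightarrow> tv A xs t b \<Longrightarrow> tv A xs (cEx s t) (kEx a b)"
  unfolding cNeg_def cAnd_def cIff_def cEx_def
  by (intro tv_codes[OF assms]; assumption)+

definition kSep :: "'a \<Rightarrow> 'a \<Rightarrow> 'a" where
  "kSep k p = kAll (nu 1) (kEx k (kAll (nu 0)
     (kIff (kMem (nu 0) k) (kAnd (kMem (nu 0) (nu 1)) p))))"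

definition kRep :: "'a \<Rightarrow> 'a \<Rightarrow> 'a" where
  "kRep k p = kAll (nu 2) (kImp
     (kAll (nu 0) (kImp (kMem (nu 0) (nu 2))
        (kEx k (kAll (nu 1) (kIff p (kEq (nu 1) k))))))
     (kEx k (kAll (nu 0) (kImp (kMem (nu 0) (nu 2))
        (kEx (nu 1) (kAnd (kMem (nu 1) k) p))))))"

lemma tv_schemes:
  assumes "good0 A" "set xs \<subseteq> A" "tv A xs s a" "tv A xs t b"
  shows "tv A xs (cSeparation s t) (kSep a b)" "tv A xs (cReplacement s t) (kRep a b)"
  unfolding cSeparation_def cReplacement_def kSep_def kRep_def
  by (intro tv_codes[OF assms(1,2)] tv_derived[OF assms(1,2)] tv_num[OF assms(1,2)] assms)+

definition Ax :: "'a \<Rightarrow> bool" where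
  "Ax c \<longleftrightarrow> (\<exists>p\<in>{ax_ext 0, ax_foundation 0, ax_pair 0, ax_union 0, ax_power 0, ax_infinity 0, ax_choice 0}.
      c = code (named (\<lambda>i. 0 - Suc i) 0 p))
   \<or> (\<exists>k p. nu 1 \<epsilon> k \<and> Fml k p \<and> c = kSep k p) \<or> (\<exists>k p. nu 2 \<epsilon> k \<and> Fml k p \<and> c = kRep k p)"

lemma h_Ax:
  assumes "c < length xs"
  shows "holds E UNIV xs (is_ZFC_axiom c) \<longleftrightarrow> Ax (xs ! c)"
proof -
  have q: "holds E UNIV xs (c \<^bold>\<simeq> quote 0 p) \<longleftrightarrow> xs ! c = code (named (\<lambda>i. 0 - Suc i) 0 p)" for p
    using assms by (intro h_val tv_quote) auto
  have s1: "holds E UNIV ys (c \<^bold>\<simeq> cSeparation (V k) (V p)) \<longleftrightarrow> ys ! c = kSep (ys ! k) (ys ! p)"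
    if "c < length ys" "k < length ys" "p < length ys" for ys k p
    by (rule h_val, simp, rule that, intro tv_schemes tv_V) (use that in simp_all)
  have s2: "holds E UNIV ys (c \<^bold>\<simeq> cReplacement (V k) (V p)) \<longleftrightarrow> ys ! c = kRep (ys ! k) (ys ! p)"
    if "c < length ys" "k < length ys" "p < length ys" for ys k p
    by (rule h_val, simp, rule that, intro tv_schemes tv_V) (use that in simp_all)
  show ?thesis unfolding is_ZFC_axiom_def Ax_def using assms
    by (simp add: q s1 s2)
qed

lemma Mdl_iff: "Mdl N \<longleftrightarrow> Trn N \<and> N \<noteq> emp \<and> (\<forall>c. Ax c \<longrightarrow> (\<forall>m a. Fml m c \<and> Map a m N \<longrightarrow> Sat N m c a))"
  unfolding Mdl_def is_model_def sat_ZFC_def is_valid_def by (simp add: h_Ax)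

lemma Mdl_axiom:
  assumes "Mdl N" "Ax (code p)" "\<And>i. v i \<epsilon> N"
  shows "nsat E (els N) p v"
  using assms by (intro valid_nsat) (auto simp: Mdl_iff)

lemma Mdl_sentence:
  assumes "Mdl N" and "p \<in> {ax_ext 0, ax_foundation 0, ax_pair 0, ax_union 0, ax_power 0, ax_infinity 0, ax_choice 0}"
    and "\<And>i. v i \<epsilon> N"
  shows "ev E (els N) p v"
proof -
  have "free_below 0 p" using assms(2) fb_sentences by (auto simp: fb_def)
  moreover have "nsat E (els N) (named (\<lambda>i. 0 - Suc i) 0 p) v"
    using assms by (intro Mdl_axiom) (auto simp: Ax_def)
  ultimately have "ev E (els N) p (\<lambda>i. v (0 - Suc i))"
    using nsat_named[of 0 p "\<lambda>i. 0 - Suc i" 0 E "els N" v] by simp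
  then show ?thesis using ev_cong[OF \<open>free_below 0 p\<close>, of v "\<lambda>i. v (0 - Suc i)"] by simp
qed

text \<open>The coded scheme is instantiated at the code of a standard formula, where internal
  validity gives external truth.\<close>

lemma Mdl_sepa:
  assumes "Mdl N" and v: "\<And>i. v i \<epsilon> N"
  shows "ev E (els N) (sepa q) v"
proof -
  obtain k where k: "free_below k q" using free_below_exists by blast
  \<comment> \<open>The scheme binds \<open>v0\<close> and \<open>v1\<close>, so the element keeps
    the name 0 and parameter \<open>i\<close> of \<open>q\<close> becomes variable
    \<open>i + 2\<close>. The number \<open>K\<close> below is large enough not to occur in the
    formula.\<close>
  let ?r = "case_nat 0 (\<lambda>i. i + 2)"
  let ?P = "named ?r (k + 2) q"
  obtain K where K: "K \<ge> k + 2" "nb K ?P" using nb_exists by blast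
  let ?v = "\<lambda>i. v (i - 2)"
  have P: "nsat E (els N) ?P (?v(1 := z, K := y, 0 := x)) = ev E (els N) q (case_nat x v)" for z y x
  proof -
    have "nsat E (els N) ?P (?v(1 := z, K := y, 0 := x)) = ev E (els N) q (\<lambda>i. (?v(1 := z, K := y, 0 := x)) (?r i))"
      using k by (intro nsat_named[of k]) (auto split: nat.split)
    also have "\<dots> = ev E (els N) q (case_nat x v)"
      using K by (intro ev_cong[OF k]) (auto split: nat.split)
    finally show ?thesis .
  qed
  have "nsat E (els N) (NAll 1 (NEx K (NAll 0 (NIff (NMem 0 K) (NAnd (NMem 0 1) ?P))))) ?v"
  proof (rule Mdl_axiom[OF assms(1)])
    have "Fml (nu K) (code ?P)" "nu 1 \<epsilon> nu K" using K by (auto simp: Fml_code)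
    then show "Ax (code (NAll 1 (NEx K (NAll 0 (NIff (NMem 0 K) (NAnd (NMem 0 1) ?P))))))"
      unfolding Ax_def kSep_def by (intro disjI2 disjI1 exI[of _ "nu K"] exI[of _ "code ?P"]) simp
  qed (use v in simp)
  then have "\<forall>z\<in>els N. \<exists>y\<in>els N. \<forall>x\<in>els N. x \<epsilon> y \<longleftrightarrow> x \<epsilon> z \<and> nsat E (els N) ?P (?v(1 := z, K := y, 0 := x))"
    using K(1) by (simp only: nsat_derived nsat_imp nsat.simps(1,2,5) nfm.distinct not_False_eq_True) (simp add: iff_conv_conj_imp)
  then show ?thesis unfolding ev_sepa P .
qed

lemma Mdl_repa:
  assumes "Mdl N" and v: "\<And>i. v i \<epsilon> N"
  shows "ev E (els N) (repa q) v"
proof -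
  obtain k where k: "free_below k q" using free_below_exists by blast
  let ?r = "case_nat 0 (case_nat 1 (\<lambda>i. i + 3))"
  let ?P = "named ?r (k + 3) q"
  obtain K where K: "K \<ge> k + 3" "nb K ?P" using nb_exists by blast
  let ?v = "\<lambda>i. v (i - 3)"
  \<comment> \<open>The values at 2 and at \<open>K\<close> are left free: 2 names the domain and
    \<open>K\<close> the bounding set, neither of which occurs in the formula. Parameters start at
    3.\<close>
  have P: "nsat E (els N) ?P u = ev E (els N) q (case_nat x (case_nat y v))"
    if "u 0 = x" "u 1 = y" "\<And>i. i \<noteq> 0 \<Longrightarrow> i \<noteq> 1 \<Longrightarrow> i \<noteq> 2 \<Longrightarrow> i < K \<Longrightarrow> u i = ?v i" for u x y
  proof -
    have "nsat E (els N) ?P u = ev E (els N) q (\<lambda>i. u (?r i))"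
      using k by (intro nsat_named[of k]) (auto split: nat.split)
    also have "\<dots> = ev E (els N) q (case_nat x (case_nat y v))"
      using K that by (intro ev_cong[OF k]) (auto split: nat.split)
    finally show ?thesis .
  qed
  let ?R = "NAll 2 (NImp
     (NAll 0 (NImp (NMem 0 2)
        (NEx K (NAll 1 (NIff ?P (NEq 1 K))))))
     (NEx K (NAll 0 (NImp (NMem 0 2)
        (NEx 1 (NAnd (NMem 1 K) ?P))))))"
  have "nsat E (els N) ?R ?v"
  proof (rule Mdl_axiom[OF assms(1)])
    have "Fml (nu K) (code ?P)" "nu 2 \<epsilon> nu K" using K by (auto simp: Fml_code)
    then show "Ax (code ?R)"
      unfolding Ax_def kRep_def by (intro disjI2 exI[of _ "nu K"] exI[of _ "code ?P"]) simp
  qed (use v in simp)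
  then have "\<forall>z\<in>els N. (\<forall>x\<in>els N. x \<epsilon> z \<longrightarrow> (\<exists>w\<in>els N. \<forall>y\<in>els N. nsat E (els N) ?P (?v(2 := z, 0 := x, K := w, 1 := y)) \<longleftrightarrow> y = w))
    \<longrightarrow> (\<exists>w\<in>els N. \<forall>x\<in>els N. x \<epsilon> z \<longrightarrow> (\<exists>y\<in>els N. y \<epsilon> w \<and> nsat E (els N) ?P (?v(2 := z, K := w, 0 := x, 1 := y))))"
    using K(1) by (simp only: nsat_derived nsat_imp nsat.simps(1,2,5) nfm.distinct not_False_eq_True) (simp add: iff_conv_conj_imp)
  moreover have "nsat E (els N) ?P (?v(2 := z, 0 := x, K := w, 1 := y)) = ev E (els N) q (case_nat x (case_nat y v))"
    "nsat E (els N) ?P (?v(2 := z, K := w, 0 := x, 1 := y)) = ev E (els N) q (case_nat x (case_nat y v))" for z x w y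
    using K(1) by (intro P; simp)+
  ultimately show ?thesis unfolding ev_repa by (simp only:)
qed

theorem Mdl_ZF:
  assumes "Mdl N"
  shows "ZF N"
  unfolding ZF_def zfc_def
  using assms Mdl_sentence[OF assms] Mdl_sepa[OF assms] Mdl_repa[OF assms] by (auto simp: Mdl_iff)

lemma Loc: "\<exists>N. x \<epsilon> N \<and> Mdl N"
proof -
  have "holds E UNIV [] Loc_ZFC"
    by (rule axiom) (simp_all add: LZFC_def fb_sentences)
  then have "\<exists>y. x \<epsilon> y \<and> Trn y \<and> holds E UNIV [x, y] (sat_ZFC 1)" by (simp add: Loc_ZFC_def)
  then obtain y where y: "x \<epsilon> y" "Trn y" "holds E UNIV [x, y] (sat_ZFC 1)" by blast
  have "Mdl y"
    unfolding Mdl_def is_model_def using y(2,3)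
    by (simp add: sat_ZFC_def is_valid_def h_Ax)
  with y(1) show ?thesis by blast
qed

end

section \<open>Transitive models of ZFC\<close>

context bst
begin

declare els_iff [iff]

lemma Trn_opr: "Trn N \<Longrightarrow> opr x y \<epsilon> N \<Longrightarrow> x \<epsilon> N \<and> y \<epsilon> N"
  unfolding opr_def Trn_def by (metis upr_iff)

text \<open>\<open>Loc\<close> captures one set at a time, so the list is packed into a single set
  \<open>lseq xs\<close>; transitivity of the model recovers its entries.\<close>

lemma Loc_list: "\<exists>N. Mdl N \<and> set xs \<subseteq> els N"
proof -
  obtain N where N: "lseq xs \<epsilon> N" "Mdl N" using Loc by blast
  then have "Trn N" by (simp add: Mdl_iff)
  have "xs ! i \<epsilon> N" if "i < length xs" for i
  proof -
    have "opr (nu i) (xs ! i) \<epsilon> N"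
      using \<open>Trn N\<close> N(1) that unfolding Trn_def by (metis opr_mem_lseq)
    then show ?thesis using Trn_opr[OF \<open>Trn N\<close>] by blast
  qed
  then have "set xs \<subseteq> els N" by (metis els_iff in_set_conv_nth subsetI)
  then show ?thesis using N(2) by blast
qed

lemma ZF_Trn: "ZF T \<Longrightarrow> x \<epsilon> T \<Longrightarrow> y \<epsilon> x \<Longrightarrow> y \<epsilon> T"
  by (auto simp: ZF_def Trn_def)

lemma ZF_sentence: "ZF T \<Longrightarrow> F 0 \<in> zfc \<Longrightarrow> fb 0 F \<Longrightarrow> holds E (els T) [] F"
proof -
  assume *: "ZF T" "F 0 \<in> zfc" "fb 0 F"
  then obtain x where "x \<epsilon> T" by (auto simp: ZF_def emp_iff)
  then have "ev E (els T) (F 0) (\<lambda>_. x)" using * by (auto simp: ZF_def)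
  then show ?thesis using ev_sentence[OF *(3)] by blast
qed

text \<open>BST does not postulate this. A model containing \<open>x\<close> satisfies foundation,
  and by transitivity a minimal element found there is minimal in the universe.\<close>

lemma foundation: "x \<noteq> emp \<Longrightarrow> Fnd x"
proof -
  assume x: "x \<noteq> emp"
  obtain N where N: "x \<epsilon> N" "ZF N" using Loc Mdl_ZF by blast
  have "holds E (els N) [] ax_foundation"
    using N(2) by (rule ZF_sentence) (simp_all add: zfc_def fb_sentences)
  then have "\<not> (\<forall>z\<in>els N. \<not> z \<epsilon> x) \<longrightarrow> (\<exists>y\<in>els N. y \<epsilon> x \<and> (\<forall>z\<in>els N. z \<epsilon> x \<longrightarrow> \<not> z \<epsilon> y))"
    using N(1) by (simp add: ax_foundation_def is_empty_def)
  then show ?thesis using x N ZF_Trn unfolding Fnd_def emp_iff by (metis els_iff)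
qed

lemma ZF_emp: "ZF T \<Longrightarrow> emp \<epsilon> T"
proof -
  assume T: "ZF T"
  then have "T \<noteq> emp" by (simp add: ZF_def)
  then obtain y where y: "y \<epsilon> T" "\<forall>z. z \<epsilon> T \<longrightarrow> \<not> z \<epsilon> y" using foundation unfolding Fnd_def by blast
  then have "y = emp" using ZF_Trn[OF T y(1)] unfolding emp_iff by blast
  with y(1) show ?thesis by simp
qed

lemma ZF_okA [simp]: "ZF T \<Longrightarrow> okA (els T)"
proof -
  assume T: "ZF T"
  have "holds E (els T) [] ax_pair"
    using T by (rule ZF_sentence) (simp_all add: zfc_def fb_sentences)
  then have p: "\<forall>x\<in>els T. \<forall>y\<in>els T. \<exists>p\<in>els T. \<forall>z\<in>els T. z \<epsilon> p \<longleftrightarrow> z = x \<or> z = y"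
    by (simp add: ax_pair_def is_upair_def)
  have "upr x y \<epsilon> T" if xy: "x \<epsilon> T" "y \<epsilon> T" for x y
  proof -
    obtain p where "p \<epsilon> T" and p: "\<forall>z\<in>els T. z \<epsilon> p \<longleftrightarrow> z = x \<or> z = y" using p xy by fastforce
    have "p = upr x y" unfolding upr_eq using p ZF_Trn[OF T \<open>p \<epsilon> T\<close>] xy by auto
    with \<open>p \<epsilon> T\<close> show ?thesis by simp
  qed
  moreover have "\<forall>x\<in>els T. \<forall>y. y \<epsilon> x \<longrightarrow> y \<in> els T" using ZF_Trn[OF T] by blast
  ultimately show ?thesis
    unfolding okA_def using foundation ZF_emp[OF T] by simp
qed

section \<open>Closure of transitive models under set operations, separation and replacement\<close>

lemma bnd:
  assumes "ZF N" "a \<epsilon> N"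
  shows "(\<exists>u\<in>els N. u \<epsilon> a \<and> Q u) \<longleftrightarrow> (\<exists>u. u \<epsilon> a \<and> Q u)" "(\<exists>u\<in>els N. u \<epsilon> a) \<longleftrightarrow> (\<exists>u. u \<epsilon> a)"
    "(\<forall>u\<in>els N. u \<epsilon> a \<longrightarrow> Q u) \<longleftrightarrow> (\<forall>u. u \<epsilon> a \<longrightarrow> Q u)"
    "(\<exists>y\<in>els N. a = opr i y) \<longleftrightarrow> (\<exists>y. a = opr i y)"
    "(\<exists>y\<in>els N. opr i y \<epsilon> a \<and> Q y) \<longleftrightarrow> (\<exists>y. opr i y \<epsilon> a \<and> Q y)"
    "(\<exists>y\<in>els N. opr i y \<epsilon> a) \<longleftrightarrow> (\<exists>y. opr i y \<epsilon> a)"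
    "(\<exists>y\<in>els N. opr y i \<epsilon> a \<and> Q y) \<longleftrightarrow> (\<exists>y. opr y i \<epsilon> a \<and> Q y)"
    "(\<exists>y\<in>els N. opr y i \<epsilon> a) \<longleftrightarrow> (\<exists>y. opr y i \<epsilon> a)"
    "(\<forall>y\<in>els N. opr i y \<epsilon> a \<longrightarrow> Q y) \<longleftrightarrow> (\<forall>y. opr i y \<epsilon> a \<longrightarrow> Q y)"
    "(\<forall>y\<in>els N. opr y i \<epsilon> a \<longrightarrow> Q y) \<longleftrightarrow> (\<forall>y. opr y i \<epsilon> a \<longrightarrow> Q y)"
  using ZF_Trn[OF assms] ZF_Trn[OF assms(1)] Trn_opr[of N] assms unfolding ZF_def by (blast | metis els_iff)+

lemma ZF_upr: "ZF T \<Longrightarrow> x \<epsilon> T \<Longrightarrow> y \<epsilon> T \<Longrightarrow> upr x y \<epsilon> T"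
  by (metis ZF_okA els_iff okA_upr)

lemma ZF_opr: "ZF T \<Longrightarrow> opr x y \<epsilon> T \<longleftrightarrow> x \<epsilon> T \<and> y \<epsilon> T"
  by (metis ZF_okA els_iff okA_opr okA_oprD)

lemma ZF_app: "ZF T \<Longrightarrow> f \<epsilon> T \<Longrightarrow> opr x y \<epsilon> f \<Longrightarrow> x \<epsilon> T \<and> y \<epsilon> T"
  using ZF_opr ZF_Trn by metis

lemma ZF_big: "ZF T \<Longrightarrow> x \<epsilon> T \<Longrightarrow> big x \<epsilon> T"
proof -
  assume T: "ZF T" "x \<epsilon> T"
  have "holds E (els T) [] ax_union"
    using T(1) by (rule ZF_sentence) (simp_all add: zfc_def fb_sentences)
  then have *: "\<forall>x\<in>els T. \<exists>u\<in>els T. \<forall>z\<in>els T. z \<epsilon> u \<longleftrightarrow> (\<exists>y\<in>els T. y \<epsilon> x \<and> z \<epsilon> y)"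
    by (simp add: ax_union_def)
  have "x \<in> els T" using T(2) by simp
  from bspec[OF * this] obtain u where u: "u \<in> els T" "\<forall>z\<in>els T. z \<epsilon> u \<longleftrightarrow> (\<exists>y\<in>els T. y \<epsilon> x \<and> z \<epsilon> y)"
    by (rule bexE)
  then have "u \<epsilon> T" by simp
  have "u = big x"
  proof (rule extensionality)
    fix z
    have "z \<epsilon> u \<Longrightarrow> z \<in> els T" "y \<epsilon> x \<Longrightarrow> z \<epsilon> y \<Longrightarrow> z \<in> els T \<and> y \<in> els T" for y
      using ZF_Trn[OF T(1)] T(2) \<open>u \<epsilon> T\<close> by blast+
    then show "z \<epsilon> u \<longleftrightarrow> z \<epsilon> big x" unfolding big_iff using u(2) by metis
  qed
  with \<open>u \<epsilon> T\<close> show ?thesis by simp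
qed

lemma ZF_cup: "ZF T \<Longrightarrow> x \<epsilon> T \<Longrightarrow> y \<epsilon> T \<Longrightarrow> cup x y \<epsilon> T"
  by (simp add: cup_def ZF_big ZF_upr)

lemma ZF_adj: "ZF T \<Longrightarrow> x \<epsilon> T \<Longrightarrow> y \<epsilon> T \<Longrightarrow> adj x y \<epsilon> T"
  by (simp add: adj_def ZF_cup ZF_upr)

lemma ZF_suc: "ZF T \<Longrightarrow> x \<epsilon> T \<Longrightarrow> suc x \<epsilon> T"
  by (simp add: suc_def ZF_adj)

lemma ZF_pow:
  assumes "ZF T" "x \<epsilon> T"
  obtains p where "p \<epsilon> T" "\<And>z. z \<epsilon> p \<longleftrightarrow> z \<epsilon> T \<and> Sub z x"
proof -
  have "holds E (els T) [] ax_power"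
    using assms(1) by (rule ZF_sentence) (simp_all add: zfc_def fb_sentences)
  then have "\<exists>p\<in>els T. \<forall>z\<in>els T. z \<epsilon> p \<longleftrightarrow> Sub z x"
    using assms by (simp add: ax_power_def)
  then obtain p where p: "p \<epsilon> T" "\<forall>z\<in>els T. z \<epsilon> p \<longleftrightarrow> Sub z x" by auto
  then have "z \<epsilon> p \<longleftrightarrow> z \<epsilon> T \<and> Sub z x" for z using ZF_Trn[OF assms(1) p(1)] by auto
  with p(1) show ?thesis using that by blast
qed

lemma ZF_sep_holds:
  assumes T: "ZF T" and xs: "set xs \<subseteq> els T" and a: "a \<epsilon> T" and F: "fb (Suc (length xs)) F"
  shows "\<exists>b. b \<epsilon> T \<and> (\<forall>x. x \<epsilon> b \<longleftrightarrow> x \<epsilon> a \<and> holds E (els T) (xs @ [x]) F)"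
proof -
  \<comment> \<open>Beyond the listed parameters the assignment takes the harmless default
    \<open>a\<close>, so that all of its values lie in \<open>T\<close>.\<close>
  let ?v = "\<lambda>i. if i < length xs then xs ! (length xs - Suc i) else a"
  let ?q = "F (Suc (length xs))"
  have "?v i \<epsilon> T" for i
    using xs a nth_in[of xs "els T" "length xs - Suc i"] by simp
  then have "ev E (els T) (sepa ?q) ?v" using T by (auto simp: ZF_def zfc_def)
  then obtain b where b: "b \<epsilon> T" "\<forall>x\<in>els T. x \<epsilon> b \<longleftrightarrow> x \<epsilon> a \<and> ev E (els T) ?q (case_nat x ?v)"
    using a unfolding ev_sepa by auto
  have "ev E (els T) ?q (case_nat x ?v) \<longleftrightarrow> holds E (els T) (xs @ [x]) F" for x
  proof -
    have "case_nat x ?v i = (xs @ [x]) ! (length (xs @ [x]) - Suc i)" if "i < Suc (length xs)" for i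
      using that by (cases i) auto
    then show ?thesis using ev_holds[of "xs @ [x]" F "case_nat x ?v" E "els T"] F by simp
  qed
  then have "x \<epsilon> b \<longleftrightarrow> x \<epsilon> a \<and> holds E (els T) (xs @ [x]) F" if "x \<epsilon> T" for x
    using b(2) that by simp
  then have "x \<epsilon> b \<longleftrightarrow> x \<epsilon> a \<and> holds E (els T) (xs @ [x]) F" for x
    using ZF_Trn[OF T a] ZF_Trn[OF T b(1)] by blast
  with b(1) show ?thesis by blast
qed

lemma ZF_sep:
  assumes "ZF T" "set xs \<subseteq> els T" "a \<epsilon> T" "fb (Suc (length xs)) F"
    and "\<And>x. x \<epsilon> T \<Longrightarrow> x \<epsilon> a \<Longrightarrow> holds E (els T) (xs @ [x]) F \<longleftrightarrow> P x"
  obtains b where "b \<epsilon> T" "\<And>x. x \<epsilon> b \<longleftrightarrow> x \<epsilon> a \<and> P x"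
proof -
  obtain b where "b \<epsilon> T" "\<forall>x. x \<epsilon> b \<longleftrightarrow> x \<epsilon> a \<and> holds E (els T) (xs @ [x]) F"
    using ZF_sep_holds[OF assms(1-4)] by blast
  then show ?thesis using that[of b] assms(5) ZF_Trn[OF assms(1)] assms(3) by blast
qed

text \<open>The scheme yields only a set that includes the image; separation then cuts it down. The
  value precedes the argument in the context because \<open>repa\<close> expects the argument at
  index 0.\<close>

lemma ZF_repl:
  assumes T: "ZF T" and xs: "set xs \<subseteq> els T" and a: "a \<epsilon> T" and F: "fb (Suc (Suc (length xs))) F"
    and G: "\<And>x. x \<epsilon> a \<Longrightarrow> G x \<epsilon> T"
    and FG: "\<And>x y. x \<epsilon> a \<Longrightarrow> x \<epsilon> T \<Longrightarrow> y \<epsilon> T \<Longrightarrow> holds E (els T) (xs @ [y, x]) F \<longleftrightarrow> y = G x"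
  obtains b where "b \<epsilon> T" "\<And>y. y \<epsilon> b \<longleftrightarrow> (\<exists>x. x \<epsilon> a \<and> y = G x)"
proof -
  let ?v = "\<lambda>i. if i < length xs then xs ! (length xs - Suc i) else a"
  let ?q = "F (Suc (Suc (length xs)))"
  have "?v i \<epsilon> T" for i
    using xs a nth_in[of xs "els T" "length xs - Suc i"] by simp
  then have "ev E (els T) (repa ?q) ?v" using T by (auto simp: ZF_def zfc_def)
  moreover have ev: "ev E (els T) ?q (case_nat x (case_nat y ?v)) \<longleftrightarrow> y = G x" if "x \<epsilon> a" "y \<epsilon> T" for x y
  proof -
    have "case_nat x (case_nat y ?v) i = (xs @ [y, x]) ! (length (xs @ [y, x]) - Suc i)" if "i < Suc (Suc (length xs))" for i
      using that by (auto split: nat.split simp: nth_Cons')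
    then have "ev E (els T) ?q (case_nat x (case_nat y ?v)) \<longleftrightarrow> holds E (els T) (xs @ [y, x]) F"
      using ev_holds[of "xs @ [y, x]" F "case_nat x (case_nat y ?v)" E "els T"] F by simp
    then show ?thesis using FG that ZF_Trn[OF T a] by blast
  qed
  ultimately obtain w where w: "w \<epsilon> T" "\<forall>x. x \<epsilon> a \<longrightarrow> G x \<epsilon> w"
  proof -
    assume *: "ev E (els T) (repa ?q) ?v" and that: "\<And>w. w \<epsilon> T \<Longrightarrow> \<forall>x. x \<epsilon> a \<longrightarrow> G x \<epsilon> w \<Longrightarrow> thesis"
    define R where "R x y \<longleftrightarrow> ev E (els T) ?q (case_nat x (case_nat y ?v))" for x y
    have R: "R x y \<longleftrightarrow> y = G x" if "x \<epsilon> a" "y \<epsilon> T" for x y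
      using ev that by (simp add: R_def)
    have aT: "a \<in> els T" using a by simp
    have "\<forall>x\<in>els T. x \<epsilon> a \<longrightarrow> (\<exists>w\<in>els T. \<forall>y\<in>els T. R x y \<longleftrightarrow> y = w)"
    proof (intro ballI impI)
      fix x assume "x \<epsilon> a"
      then show "\<exists>w\<in>els T. \<forall>y\<in>els T. R x y \<longleftrightarrow> y = w"
        using R G by (intro bexI[of _ "G x"]) simp_all
    qed
    with bspec[OF *[unfolded ev_repa, folded R_def] aT]
    have "\<exists>w\<in>els T. \<forall>x\<in>els T. x \<epsilon> a \<longrightarrow> (\<exists>y\<in>els T. y \<epsilon> w \<and> R x y)" by (rule mp)
    then obtain w where w: "w \<in> els T" "\<forall>x\<in>els T. x \<epsilon> a \<longrightarrow> (\<exists>y\<in>els T. y \<epsilon> w \<and> R x y)" by (rule bexE)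
    show thesis
    proof (rule that)
      show "w \<epsilon> T" using w(1) by simp
      show "\<forall>x. x \<epsilon> a \<longrightarrow> G x \<epsilon> w"
      proof (intro allI impI)
        fix x assume x: "x \<epsilon> a"
        then have "x \<in> els T" using ZF_Trn[OF T a] by simp
        then obtain y where "y \<epsilon> T" "y \<epsilon> w" "R x y" using w(2) x by auto
        then show "G x \<epsilon> w" using R x by simp
      qed
    qed
  qed
  \<comment> \<open>The set \<open>a\<close> is added to the context between the parameters and the
    value. Indices 0 and 1 remain the argument and the value, and all later ones are shifted past
    \<open>a\<close>.\<close>
  let ?H = "\<^bold>\<exists>x. x \<^bold>\<in> length xs \<^bold>\<and> (\<lambda>n. rename (\<lambda>i. if i = 0 then 0 else if i = 1 then 1 else Suc i) ?q)"
  have "\<exists>b. b \<epsilon> T \<and> (\<forall>y. y \<epsilon> b \<longleftrightarrow> y \<epsilon> w \<and> holds E (els T) ((xs @ [a]) @ [y]) ?H)"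
  proof (rule ZF_sep_holds[OF T])
    have "free_below (Suc (Suc (Suc (length xs)))) (rename (\<lambda>i. if i = 0 then 0 else if i = 1 then 1 else Suc i) ?q)"
      using F unfolding fb_def by (rule free_below_rename) auto
    then show "fb (Suc (length (xs @ [a]))) ?H" by simp (simp add: fb_def)
  qed (use xs a w in auto)
  then obtain b where b: "b \<epsilon> T" "\<And>y. y \<epsilon> b \<longleftrightarrow> y \<epsilon> w \<and> holds E (els T) ((xs @ [a]) @ [y]) ?H" by blast
  have "holds E (els T) ((xs @ [a]) @ [y]) ?H \<longleftrightarrow> (\<exists>x. x \<epsilon> a \<and> y = G x)" if "y \<epsilon> T" for y
  proof -
    have "holds E (els T) (xs @ [a, y, x]) (\<lambda>n. rename (\<lambda>i. if i = 0 then 0 else if i = 1 then 1 else Suc i) ?q)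
      \<longleftrightarrow> y = G x" if "x \<epsilon> a" for x
    proof -
      have "holds E (els T) (xs @ [a, y, x]) (\<lambda>n. rename (\<lambda>i. if i = 0 then 0 else if i = 1 then 1 else Suc i) ?q)
        \<longleftrightarrow> ev E (els T) ?q (case_nat x (case_nat y ?v))"
        unfolding holds_def ev_rename using F unfolding fb_def
        by (rule ev_cong) (auto simp: env_def split: nat.split)
      then show ?thesis using ev that \<open>y \<epsilon> T\<close> by simp
    qed
    then show ?thesis using ZF_Trn[OF T a] by auto
  qed
  then have "y \<epsilon> b \<longleftrightarrow> (\<exists>x. x \<epsilon> a \<and> y = G x)" for y
    using b(2) w ZF_Trn[OF T w(1)] by blast
  with b(1) show ?thesis using that by blast
qed

text \<open>The universe itself separates only by bounded formulas. A formula with the same meaning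
  in all transitive models can nevertheless be used: the set is formed inside a model that contains
  \<open>a\<close> and the parameters.\<close>

lemma vsep:
  assumes "fb (Suc (length xs)) F"
    and "\<And>N x. ZF N \<Longrightarrow> set xs \<subseteq> els N \<Longrightarrow> a \<epsilon> N \<Longrightarrow> x \<epsilon> N \<Longrightarrow> x \<epsilon> a \<Longrightarrow> holds E (els N) (xs @ [x]) F \<longleftrightarrow> P x"
  obtains b where "\<And>x. x \<epsilon> b \<longleftrightarrow> x \<epsilon> a \<and> P x"
proof -
  obtain N where "Mdl N" "set (a # xs) \<subseteq> els N" using Loc_list by blast
  then show ?thesis
    using that ZF_sep[of N xs a F P] assms Mdl_ZF by (metis els_iff list.set_intros(1) set_subset_Cons subset_iff)
qed

text \<open>Membership induction for absolute properties: \<open>vsep\<close> makes the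
  counterexamples in \<open>a\<close> a set, and foundation yields a minimal one.\<close>

lemma vind:
  assumes "fb (Suc (length xs)) F"
    and "\<And>N x. ZF N \<Longrightarrow> set xs \<subseteq> els N \<Longrightarrow> a \<epsilon> N \<Longrightarrow> x \<epsilon> N \<Longrightarrow> x \<epsilon> a \<Longrightarrow> holds E (els N) (xs @ [x]) F \<longleftrightarrow> P x"
    and step: "\<And>x. x \<epsilon> a \<Longrightarrow> (\<And>y. y \<epsilon> a \<Longrightarrow> y \<epsilon> x \<Longrightarrow> P y) \<Longrightarrow> P x"
    and "x \<epsilon> a"
  shows "P x"
proof (rule ccontr)
  assume "\<not> P x"
  obtain b where b: "\<And>x. x \<epsilon> b \<longleftrightarrow> x \<epsilon> a \<and> \<not> P x"
    by (rule vsep[of xs "\<^bold>\<not> F" a "\<lambda>x. \<not> P x"]) (use assms in auto)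
  then have "b \<noteq> emp" using \<open>\<not> P x\<close> \<open>x \<epsilon> a\<close> by (auto simp: emp_iff)
  then obtain y where "y \<epsilon> b" "\<forall>z. z \<epsilon> b \<longrightarrow> \<not> z \<epsilon> y" using foundation unfolding Fnd_def by blast
  then show False using b step by blast
qed

section \<open>Ordinals and natural numbers\<close>

lemma no_loop: "\<not> x \<epsilon> x"
  using foundation[of "upr x x"] by (auto simp: Fnd_def emp_iff)

lemma no_loop2: "x \<epsilon> y \<Longrightarrow> \<not> y \<epsilon> x"
  using foundation[of "upr x y"] unfolding Fnd_def emp_iff by (metis upr_iff)

lemma Ord_iff: "Ord x \<longleftrightarrow> Trn x \<and> (\<forall>y z. y \<epsilon> x \<and> z \<epsilon> x \<longrightarrow> y \<epsilon> z \<or> y = z \<or> z \<epsilon> y)"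
  unfolding Ord_def using foundation by blast

lemma no_loop3: "x \<epsilon> y \<Longrightarrow> y \<epsilon> z \<Longrightarrow> \<not> z \<epsilon> x"
proof
  assume "x \<epsilon> y" "y \<epsilon> z" "z \<epsilon> x"
  moreover have "Fnd (adj (upr x y) z)" by (rule foundation) (auto simp: emp_iff)
  ultimately show False unfolding Fnd_def by (metis adj_iff upr_iff)
qed

lemma Ord_mem: "Ord x \<Longrightarrow> y \<epsilon> x \<Longrightarrow> Ord y"
  unfolding Ord_iff Trn_def using no_loop3 no_loop2 by metis

lemma Ord_Trn: "Ord x \<Longrightarrow> y \<epsilon> x \<Longrightarrow> z \<epsilon> y \<Longrightarrow> z \<epsilon> x"
  by (auto simp: Ord_def Trn_def)

lemma Sub_antisym: "Sub x y \<Longrightarrow> Sub y x \<Longrightarrow> x = y"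
  using extensionality unfolding Sub_def by blast

text \<open>A minimal element of the difference of \<open>y\<close> and \<open>x\<close> has exactly
  the elements of \<open>x\<close>.\<close>

lemma Ord_Sub:
  assumes "Ord x" "Ord y" "Sub x y" "x \<noteq> y"
  shows "x \<epsilon> y"
proof -
  obtain d where d: "\<And>z. z \<epsilon> d \<longleftrightarrow> z \<epsilon> y \<and> \<not> z \<epsilon> x"
    by (rule vsep[of "[x]" "\<^bold>\<not> 1 \<^bold>\<in> 0" y "\<lambda>z. \<not> z \<epsilon> x"]) auto
  have "d \<noteq> emp" using assms(3,4) Sub_antisym d unfolding emp_iff Sub_def by blast
  then obtain z where z: "z \<epsilon> y" "\<not> z \<epsilon> x" "\<And>u. u \<epsilon> z \<Longrightarrow> \<not> u \<epsilon> d"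
    using foundation[of d] d unfolding Fnd_def by blast
  have "z = x"
  proof (rule extensionality)
    show "u \<epsilon> z \<longleftrightarrow> u \<epsilon> x" for u
    proof
      show "u \<epsilon> z \<Longrightarrow> u \<epsilon> x" using z d Ord_Trn[OF assms(2)] by blast
      assume "u \<epsilon> x"
      then have "u \<epsilon> y" using assms(3) by (auto simp: Sub_def)
      then have "u \<epsilon> z \<or> u = z \<or> z \<epsilon> u" using assms(2) z(1) by (auto simp: Ord_def)
      then show "u \<epsilon> z" using z(2) \<open>u \<epsilon> x\<close> Ord_Trn[OF assms(1)] by blast
    qed
  qed
  with z(1) show ?thesis by simp
qed

text \<open>The intersection is an ordinal included in both; if it differed from each of them it
  would be an element of both, hence of itself.\<close>

lemma Ord_trich:
  assumes "Ord x" "Ord y"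
  shows "x \<epsilon> y \<or> x = y \<or> y \<epsilon> x"
proof -
  obtain d where d: "\<And>z. z \<epsilon> d \<longleftrightarrow> z \<epsilon> y \<and> z \<epsilon> x"
    by (rule vsep[of "[x]" "1 \<^bold>\<in> 0" y "\<lambda>z. z \<epsilon> x"]) auto
  have "Trn d" unfolding Trn_def d using Ord_Trn assms by blast
  then have "Ord d" using assms(2) d unfolding Ord_iff by blast
  moreover have "Sub d x" "Sub d y" using d by (auto simp: Sub_def)
  ultimately have "d \<epsilon> x \<or> d = x" "d \<epsilon> y \<or> d = y" using Ord_Sub assms by blast+
  then show ?thesis using d no_loop by blast
qed

lemma Ord_Sub_iff: "Ord x \<Longrightarrow> Ord y \<Longrightarrow> Sub x y \<longleftrightarrow> x \<epsilon> y \<or> x = y"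
  using Ord_Sub Ord_Trn unfolding Sub_def by blast

lemma Ord_suc: "Ord x \<Longrightarrow> Ord (suc x)"
  unfolding Ord_iff Trn_def by auto

lemma Ord_emp: "Ord emp"
  by (simp add: Ord_iff Trn_def)

lemma Ord_of_Trn: "Trn x \<Longrightarrow> (\<And>y. y \<epsilon> x \<Longrightarrow> Ord y) \<Longrightarrow> Ord x"
  unfolding Ord_iff[of x] using Ord_trich by blast

lemma Ord_cases:
  assumes "Ord x"
  shows "x = emp \<or> (\<exists>y. Ord y \<and> x = suc y) \<or> Lim x"
proof -
  have "suc y \<epsilon> x" if "y \<epsilon> x" "\<forall>y. Ord y \<longrightarrow> x \<noteq> suc y" for y
  proof -
    have "Ord y" using assms that(1) by (rule Ord_mem)
    then have "suc y \<epsilon> x \<or> suc y = x \<or> x \<epsilon> suc y" using Ord_trich Ord_suc assms by blast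
    then show ?thesis using that \<open>Ord y\<close> no_loop no_loop2 by auto
  qed
  then show ?thesis using assms unfolding Lim_def by blast
qed

lemma Omega_unique: "Omega w \<Longrightarrow> Omega w' \<Longrightarrow> w = w'"
  using Ord_trich unfolding Omega_def Lim_def by blast

lemma Nt_Ord: "Nt x \<Longrightarrow> Ord x"
  unfolding Nt_def Omega_def Lim_def using Ord_mem by blast

lemma Nt_iff: "Omega w \<Longrightarrow> Nt x \<longleftrightarrow> x \<epsilon> w"
  unfolding Nt_def using Omega_unique by blast

lemma Nt_mem: "Nt x \<Longrightarrow> y \<epsilon> x \<Longrightarrow> Nt y"
  unfolding Nt_def Omega_def Lim_def using Ord_Trn by blast

lemma Nt_cases: "Nt x \<Longrightarrow> x = emp \<or> (\<exists>y. Nt y \<and> x = suc y)"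
proof -
  assume "Nt x"
  then have "\<not> Lim x" by (auto simp: Nt_def Omega_def)
  then show ?thesis using Ord_cases[OF Nt_Ord[OF \<open>Nt x\<close>]] Nt_mem[OF \<open>Nt x\<close>] by (metis suc_iff)
qed

text \<open>This covers the nonstandard natural numbers of the structure too, so \<open>P\<close>
  has to be expressed by an absolute formula.\<close>

lemma Nt_induct:
  assumes "fb (Suc (length xs)) F"
    and "\<And>N x. ZF N \<Longrightarrow> set xs \<subseteq> els N \<Longrightarrow> x \<epsilon> N \<Longrightarrow> Nt x \<Longrightarrow> holds E (els N) (xs @ [x]) F \<longleftrightarrow> P x"
    and "P emp" and "\<And>x. Nt x \<Longrightarrow> P x \<Longrightarrow> P (suc x)" and "Nt x"
  shows "P x"
proof -
  obtain w where w: "Omega w" using Omega_exists by blast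
  show ?thesis
  proof (rule vind[of xs F w P])
    show "x \<epsilon> w" using assms(5) w Nt_iff by blast
    fix y assume "y \<epsilon> w" "\<And>z. z \<epsilon> w \<Longrightarrow> z \<epsilon> y \<Longrightarrow> P z"
    then show "P y" using Nt_cases[of y] assms(3,4) Nt_iff[OF w] Nt_mem by (metis suc_iff)
  qed (use assms Nt_iff[OF w] in auto)
qed

text \<open>The set given by the axiom of infinity contains every natural number of the universe by
  internal induction. Inside it, omega is cut out as the ordinals that neither are limits nor have
  limit elements, a condition that does not mention omega.\<close>

lemma ZF_Omega: "ZF T \<Longrightarrow> Omega w \<Longrightarrow> w \<epsilon> T"
proof -
  assume T: "ZF T" and w: "Omega w"
  have "holds E (els T) [] ax_infinity"
    using T by (rule ZF_sentence) (simp_all add: zfc_def fb_sentences)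
  then obtain W where W: "W \<epsilon> T" "emp \<epsilon> W" "\<And>x. x \<epsilon> W \<Longrightarrow> x \<epsilon> T \<Longrightarrow> suc x \<epsilon> W"
    using T by (auto simp: ax_infinity_def)
  have "x \<epsilon> W" if "Nt x" for x
    using that
    by (rule Nt_induct[of "[W]" "1 \<^bold>\<in> 0", rotated -1]) (use W ZF_Trn[OF T W(1)] in auto)
  then have wW: "Sub w W" using Nt_iff[OF w] by (simp add: Sub_def)
  have 1: "holds E (els T) [x] (is_ord 0 \<^bold>\<and> (\<^bold>\<forall>y. y \<^bold>\<in> 0 \<^bold>\<or> y \<^bold>= 0 \<^bold>\<longrightarrow> \<^bold>\<not> is_limit y)) \<longleftrightarrow>
      Ord x \<and> (\<forall>y. y \<epsilon> x \<or> y = x \<longrightarrow> \<not> Lim y)" if "x \<epsilon> T" for x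
    using T that ZF_Trn[OF T that] by auto
  obtain b where b: "b \<epsilon> T" "\<And>x. x \<epsilon> b \<longleftrightarrow> x \<epsilon> W \<and> (Ord x \<and> (\<forall>y. y \<epsilon> x \<or> y = x \<longrightarrow> \<not> Lim y))"
    by (rule ZF_sep[of T "[]" W "is_ord 0 \<^bold>\<and> (\<^bold>\<forall>y. y \<^bold>\<in> 0 \<^bold>\<or> y \<^bold>= 0 \<^bold>\<longrightarrow> \<^bold>\<not> is_limit y)"
          "\<lambda>x. Ord x \<and> (\<forall>y. y \<epsilon> x \<or> y = x \<longrightarrow> \<not> Lim y)"]) (use T W(1) 1 in auto)
  have "x \<epsilon> b \<longleftrightarrow> x \<epsilon> w" for x
  proof
    assume "x \<epsilon> b"
    then have x: "Ord x" "\<And>y. y \<epsilon> x \<or> y = x \<Longrightarrow> \<not> Lim y" using b by auto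
    have "Ord w" "Lim w" using w by (auto simp: Omega_def Lim_def)
    then show "x \<epsilon> w" using Ord_trich[OF x(1), of w] x(2) by blast
  next
    assume "x \<epsilon> w"
    then show "x \<epsilon> b" unfolding b(2) using wW w Nt_iff[OF w] Nt_Ord Nt_mem
      unfolding Sub_def Omega_def by metis
  qed
  then have "b = w" by (rule extensionality)
  with b(1) show ?thesis by simp
qed

lemma ZF_Nt: "ZF T \<Longrightarrow> Nt m \<Longrightarrow> m \<epsilon> T"
  unfolding Nt_def using ZF_Omega ZF_Trn by blast

lemma ZF_nu: "ZF T \<Longrightarrow> nu n \<epsilon> T"
  by (simp add: ZF_Nt)

text \<open>The restrictions of \<open>f\<close> to the numbers up to \<open>m\<close> are built in
  \<open>T\<close> by adjoining one pair at a time. The induction is internal since \<open>m\<close>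
  may be nonstandard, and it refers to \<open>f\<close> as a parameter of an ambient model. Places
  where \<open>f\<close> is undefined are allowed.\<close>

lemma ZF_finite_fun:
  assumes T: "ZF T" and m: "Nt m" and dom: "\<And>q. q \<epsilon> f \<Longrightarrow> \<exists>i y. i \<epsilon> m \<and> y \<epsilon> T \<and> q = opr i y"
    and sv: "\<And>i y z. opr i y \<epsilon> f \<Longrightarrow> opr i z \<epsilon> f \<Longrightarrow> y = z"
  shows "f \<epsilon> T"
proof -
  let ?P = "\<lambda>k. \<exists>u. u \<epsilon> T \<and> (\<forall>q. q \<epsilon> u \<longleftrightarrow> q \<epsilon> f \<and> (\<exists>i y. i \<epsilon> k \<and> q = opr i y))"
  have "?P m"
  proof (rule Nt_induct[of "[T, f]" "\<^bold>\<exists>u. u \<^bold>\<in> 0 \<^bold>\<and> (\<^bold>\<forall>q. q \<^bold>\<in> u \<^bold>\<longleftrightarrow> q \<^bold>\<in> 1 \<^bold>\<and> (\<^bold>\<exists>i y. i \<^bold>\<in> 2 \<^bold>\<and> is_pair i y q))"])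
    fix N k assume N: "ZF N" "set [T, f] \<subseteq> els N" "k \<epsilon> N"
    have 1: "(\<exists>i\<in>els N. \<exists>y\<in>els N. i \<epsilon> k \<and> q = opr i y) \<longleftrightarrow> (\<exists>i y. i \<epsilon> k \<and> q = opr i y)" if "q \<epsilon> N" for q
      using that ZF_opr[OF N(1)] by blast
    have fN: "f \<epsilon> N" "T \<epsilon> N" using N(2) by simp_all
    have 2: "(\<forall>q\<in>els N. q \<epsilon> u \<longleftrightarrow> q \<epsilon> f \<and> (\<exists>i y. i \<epsilon> k \<and> q = opr i y)) \<longleftrightarrow>
        (\<forall>q. q \<epsilon> u \<longleftrightarrow> q \<epsilon> f \<and> (\<exists>i y. i \<epsilon> k \<and> q = opr i y))" if "u \<epsilon> N" for u
      using ZF_Trn[OF N(1)] that fN by blast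
    show "holds E (els N) ([T, f] @ [k]) (\<^bold>\<exists>u. u \<^bold>\<in> 0 \<^bold>\<and> (\<^bold>\<forall>q. q \<^bold>\<in> u \<^bold>\<longleftrightarrow> q \<^bold>\<in> 1 \<^bold>\<and> (\<^bold>\<exists>i y. i \<^bold>\<in> 2 \<^bold>\<and> is_pair i y q)))
      \<longleftrightarrow> ?P k"
      using N fN by (simp add: 1 2 bnd del: bex_simps ex_simps)
  next
    show "?P emp" using ZF_emp[OF T] by (auto intro: exI[of _ emp])
  next
    fix k assume "Nt k" "?P k"
    then obtain u where u: "u \<epsilon> T" "\<And>q. q \<epsilon> u \<longleftrightarrow> q \<epsilon> f \<and> (\<exists>i y. i \<epsilon> k \<and> q = opr i y)" by blast
    show "?P (suc k)"
    proof (cases "\<exists>y. opr k y \<epsilon> f")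
      case True
      then obtain y where y: "opr k y \<epsilon> f" by blast
      then have "y \<epsilon> T" using dom by fastforce
      then have "opr k y \<epsilon> T" by (simp add: ZF_opr[OF T] ZF_Nt[OF T \<open>Nt k\<close>])
      then have "adj u (opr k y) \<epsilon> T" using ZF_adj[OF T] u(1) by blast
      moreover have "q \<epsilon> adj u (opr k y) \<longleftrightarrow> q \<epsilon> f \<and> (\<exists>i y. i \<epsilon> suc k \<and> q = opr i y)" for q
        unfolding adj_iff u(2) suc_iff using y sv by (metis opr_inject)
      ultimately show ?thesis by blast
    next
      case False
      then have "q \<epsilon> u \<longleftrightarrow> q \<epsilon> f \<and> (\<exists>i y. i \<epsilon> suc k \<and> q = opr i y)" for q
        using u(2) by auto
      then show ?thesis using u(1) by blast
    qed
  qed (use m in auto)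
  then obtain u where u: "u \<epsilon> T" "\<And>q. q \<epsilon> u \<longleftrightarrow> q \<epsilon> f \<and> (\<exists>i y. i \<epsilon> m \<and> q = opr i y)" by blast
  have "u = f" by (rule extensionality) (use u(2) dom in blast)
  with u(1) show ?thesis by simp
qed

lemma ZF_map:
  assumes "ZF T" "Nt m" "Map a m M" "\<And>y. y \<epsilon> M \<Longrightarrow> y \<epsilon> T"
  shows "a \<epsilon> T"
  using assms(1,2)
proof (rule ZF_finite_fun)
  show "\<And>q. q \<epsilon> a \<Longrightarrow> \<exists>i y. i \<epsilon> m \<and> y \<epsilon> T \<and> q = opr i y"
    using assms(3,4) unfolding Map_def Fun_def by blast
  show "opr i y \<epsilon> a \<Longrightarrow> opr i z \<epsilon> a \<Longrightarrow> y = z" for i y z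
    using assms(3) unfolding Map_def Fun_def by (metis opr_inject)
qed

lemma FunD: "Fun f a \<Longrightarrow> opr x y \<epsilon> f \<Longrightarrow> opr x z \<epsilon> f \<Longrightarrow> y = z"
  unfolding Fun_def by (metis opr_inject)

lemma Fun_dom: "Fun f a \<Longrightarrow> opr x y \<epsilon> f \<Longrightarrow> x \<epsilon> a"
  unfolding Fun_def by (metis opr_inject)

lemma Fun_ex: "Fun f a \<Longrightarrow> x \<epsilon> a \<Longrightarrow> \<exists>y. opr x y \<epsilon> f"
  unfolding Fun_def by blast

lemma Fun_pair: "Fun f a \<Longrightarrow> p \<epsilon> f \<Longrightarrow> \<exists>x y. x \<epsilon> a \<and> p = opr x y"
  unfolding Fun_def by blast

lemma FunI:
  assumes "\<And>p. p \<epsilon> f \<Longrightarrow> \<exists>x y. x \<epsilon> a \<and> p = opr x y" and "\<And>x. x \<epsilon> a \<Longrightarrow> \<exists>y. opr x y \<epsilon> f"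
    and "\<And>x y z. opr x y \<epsilon> f \<Longrightarrow> opr x z \<epsilon> f \<Longrightarrow> y = z"
  shows "Fun f a"
  unfolding Fun_def using assms by metis

lemma Fun_adj:
  assumes "Fun s l" "\<not> x \<epsilon> l"
  shows "Fun (adj s (opr x y)) (adj l x)"
proof (rule FunI)
  show "p \<epsilon> adj s (opr x y) \<Longrightarrow> \<exists>u z. u \<epsilon> adj l x \<and> p = opr u z" for p
    using Fun_pair[OF assms(1)] unfolding adj_iff by blast
  show "u \<epsilon> adj l x \<Longrightarrow> \<exists>z. opr u z \<epsilon> adj s (opr x y)" for u
    using Fun_ex[OF assms(1)] unfolding adj_iff by blast
  show "opr u z \<epsilon> adj s (opr x y) \<Longrightarrow> opr u z' \<epsilon> adj s (opr x y) \<Longrightarrow> z = z'" for u z z'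
    using FunD[OF assms(1)] Fun_dom[OF assms(1)] assms(2) unfolding adj_iff by (metis opr_inject)
qed

lemma ZF_prod:
  assumes T: "ZF T" "a \<epsilon> T" "b \<epsilon> T"
  obtains c where "c \<epsilon> T" "\<And>p. p \<epsilon> c \<longleftrightarrow> (\<exists>x y. x \<epsilon> a \<and> y \<epsilon> b \<and> p = opr x y)"
proof -
  obtain p where p: "p \<epsilon> T" "\<And>z. z \<epsilon> p \<longleftrightarrow> z \<epsilon> T \<and> Sub z (cup a b)"
    using ZF_pow[OF T(1) ZF_cup[OF T]] by metis
  obtain q where q: "q \<epsilon> T" "\<And>z. z \<epsilon> q \<longleftrightarrow> z \<epsilon> T \<and> Sub z p"
    using ZF_pow[OF T(1) p(1)] by metis
  have in_q: "opr x y \<epsilon> q" if "x \<epsilon> a" "y \<epsilon> b" for x y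
  proof -
    have "x \<epsilon> T" "y \<epsilon> T" using that T ZF_Trn by blast+
    then have "upr x x \<epsilon> p" "upr x y \<epsilon> p" using that ZF_upr[OF T(1)] by (auto simp: p(2) Sub_def)
    then show ?thesis using ZF_upr[OF T(1)] p(2) by (auto simp: q(2) Sub_def opr_def)
  qed
  obtain c where c: "c \<epsilon> T" "\<And>p. p \<epsilon> c \<longleftrightarrow> p \<epsilon> q \<and> (\<exists>x y. x \<epsilon> a \<and> y \<epsilon> b \<and> p = opr x y)"
  proof (rule ZF_sep[of T "[a, b]" q "\<^bold>\<exists>x y. x \<^bold>\<in> 0 \<^bold>\<and> y \<^bold>\<in> 1 \<^bold>\<and> is_pair x y 2" "\<lambda>p. \<exists>x y. x \<epsilon> a \<and> y \<epsilon> b \<and> p = opr x y"])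
    fix p assume "p \<epsilon> T"
    have "(\<exists>x\<in>els T. \<exists>y\<in>els T. x \<epsilon> a \<and> y \<epsilon> b \<and> p = opr x y) \<longleftrightarrow> (\<exists>x y. x \<epsilon> a \<and> y \<epsilon> b \<and> p = opr x y)"
      using ZF_Trn[OF T(1) T(2)] ZF_Trn[OF T(1) T(3)] by blast
    then show "holds E (els T) ([a, b] @ [p]) (\<^bold>\<exists>x y. x \<^bold>\<in> 0 \<^bold>\<and> y \<^bold>\<in> 1 \<^bold>\<and> is_pair x y 2) \<longleftrightarrow> (\<exists>x y. x \<epsilon> a \<and> y \<epsilon> b \<and> p = opr x y)"
      using T \<open>p \<epsilon> T\<close> by (simp del: bex_simps ex_simps)
  qed (use T q in auto)
  have "p \<epsilon> c \<longleftrightarrow> (\<exists>x y. x \<epsilon> a \<and> y \<epsilon> b \<and> p = opr x y)" for p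
    unfolding c(2) using in_q by blast
  with c(1) show ?thesis using that by blast
qed

lemma ZF_good0 [simp]: "ZF T \<Longrightarrow> good0 (els T)"
proof -
  assume T: "ZF T"
  have "a \<epsilon> T" if "M \<epsilon> T" "Nt m" "Map a m M" for M m a
    using ZF_map[OF T that(2,3)] ZF_Trn[OF T that(1)] by blast
  then show ?thesis unfolding good0_def using ZF_okA[OF T] ZF_Omega[OF T] by blast
qed

lemma ZF_maps:
  assumes T: "ZF T" "M \<epsilon> T" "Nt m"
  obtains Z where "Z \<epsilon> T" "\<And>a. a \<epsilon> Z \<longleftrightarrow> Map a m M"
proof -
  have mT: "m \<epsilon> T" using ZF_Nt T by blast
  obtain c where c: "c \<epsilon> T" "\<And>p. p \<epsilon> c \<longleftrightarrow> (\<exists>x y. x \<epsilon> m \<and> y \<epsilon> M \<and> p = opr x y)"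
    using ZF_prod[OF T(1) mT T(2)] by metis
  obtain p where p: "p \<epsilon> T" "\<And>z. z \<epsilon> p \<longleftrightarrow> z \<epsilon> T \<and> Sub z c"
    using ZF_pow[OF T(1) c(1)] by metis
  obtain Z where Z: "Z \<epsilon> T" "\<And>a. a \<epsilon> Z \<longleftrightarrow> a \<epsilon> p \<and> Map a m M"
    by (rule ZF_sep[of T "[m, M]" p "is_map 2 0 1" "\<lambda>a. Map a m M"]) (use T mT p in auto)
  have "a \<epsilon> p" if "Map a m M" for a
  proof -
    have "a \<epsilon> T" using good_map[OF ZF_good0[OF T(1)]] T(2,3) that by simp
    moreover have "Sub a c" unfolding Sub_def c(2) using that unfolding Map_def Fun_def by blast
    ultimately show ?thesis by (simp add: p(2))
  qed
  then show ?thesis using that[OF Z(1)] Z(2) by blast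
qed

section \<open>Existence and uniqueness of truth sequences\<close>

lemma ZF_codes:
  assumes "ZF T"
  shows "kMem i j \<epsilon> T \<longleftrightarrow> i \<epsilon> T \<and> j \<epsilon> T" "kEq i j \<epsilon> T \<longleftrightarrow> i \<epsilon> T \<and> j \<epsilon> T"
    "kImp i j \<epsilon> T \<longleftrightarrow> i \<epsilon> T \<and> j \<epsilon> T" "kAll i j \<epsilon> T \<longleftrightarrow> i \<epsilon> T \<and> j \<epsilon> T" "kFls \<epsilon> T"
  using assms by (simp_all add: kMem_def kEq_def kImp_def kAll_def kFls_def ZF_opr ZF_nu)

lemma TC_FC: "TC M m f s k d S \<Longrightarrow> FC m f k d"
  unfolding TC_def FC_def by (elim disjE exE conjE) blast+

lemma TSq_Cons: "TSq M m n f s \<Longrightarrow> Cons m n f"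
  unfolding TSq_def Cons_def
proof (elim conjE, intro conjI allI impI)
  fix k d
  assume "Fun s n" and TC: "\<forall>k d S. k \<epsilon> n \<and> opr k d \<epsilon> f \<and> opr k S \<epsilon> s \<longrightarrow> TC M m f s k d S"
    and k: "k \<epsilon> n \<and> opr k d \<epsilon> f"
  then obtain S where "opr k S \<epsilon> s" using Fun_ex by blast
  then have "TC M m f s k d S" using TC k by blast
  then show "FC m f k d" by (rule TC_FC)
qed

text \<open>Codes arise by pairing from natural numbers and earlier entries, so induction along the
  sequence keeps every entry in \<open>T\<close>; the sequence is then a finite function into
  \<open>T\<close>. Hence all transitive models have the same coded formulas, nonstandard ones
  included.\<close>

lemma Cons_in:
  assumes T: "ZF T" and m: "Nt m" and f: "Cons m n f"
  shows "opr k d \<epsilon> f \<Longrightarrow> d \<epsilon> T" and "f \<epsilon> T"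
proof -
  have F: "Fun f n" and FC: "\<And>k d. k \<epsilon> n \<Longrightarrow> opr k d \<epsilon> f \<Longrightarrow> FC m f k d" and n: "Nt n"
    using f by (auto simp: Cons_def)
  have "\<forall>d. opr k d \<epsilon> f \<longrightarrow> d \<epsilon> T" if "k \<epsilon> n" for k
  proof (rule vind[of "[f, T]" "\<^bold>\<forall>d. is_app 0 2 d \<^bold>\<longrightarrow> d \<^bold>\<in> 1" n "\<lambda>k. \<forall>d. opr k d \<epsilon> f \<longrightarrow> d \<epsilon> T" k, OF _ _ _ that])
    fix k assume k: "k \<epsilon> n" and IH: "\<And>y. y \<epsilon> n \<Longrightarrow> y \<epsilon> k \<Longrightarrow> \<forall>d. opr y d \<epsilon> f \<longrightarrow> d \<epsilon> T"
    have IH': "d \<epsilon> T" if "y \<epsilon> k" "opr y d \<epsilon> f" for y d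
      using IH Fun_dom[OF F] that by blast
    have mT: "i \<epsilon> T" if "i \<epsilon> m" for i using ZF_Nt[OF T] Nt_mem[OF m] that by blast
    show "\<forall>d. opr k d \<epsilon> f \<longrightarrow> d \<epsilon> T"
    proof (intro allI impI)
      fix d assume "opr k d \<epsilon> f"
      from FC[OF k this] show "d \<epsilon> T"
        unfolding FC_def by (elim disjE exE conjE) (simp_all add: ZF_codes[OF T] mT IH')
    qed
  qed (simp_all add: bnd)
  then show *: "opr k d \<epsilon> f \<Longrightarrow> d \<epsilon> T" for k d using Fun_dom[OF F] by blast
  show "f \<epsilon> T"
  proof (rule ZF_finite_fun[OF T n])
    show "\<And>q. q \<epsilon> f \<Longrightarrow> \<exists>i y. i \<epsilon> n \<and> y \<epsilon> T \<and> q = opr i y" using Fun_pair[OF F] * by blast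
    show "opr i y \<epsilon> f \<Longrightarrow> opr i z \<epsilon> f \<Longrightarrow> y = z" for i y z using F by (rule FunD)
  qed
qed

lemma Fml_in: "ZF T \<Longrightarrow> Fml m c \<Longrightarrow> c \<epsilon> T"
  unfolding Fml_def using Cons_in(1) by blast

lemma TS_unique: "TS M m S P \<Longrightarrow> TS M m S' P' \<Longrightarrow> (\<And>a. P a \<longleftrightarrow> P' a) \<Longrightarrow> S = S'"
  by (rule extensionality) (simp add: TS_def)

lemma TC_mono:
  assumes "TC M m f s k d S" "\<And>k1 S1. opr k1 S1 \<epsilon> s \<Longrightarrow> opr k1 S1 \<epsilon> s'"
  shows "TC M m f s' k d S"
proof -
  have "\<exists>k1 d1 S1 k2 d2 S2. k1 \<epsilon> k \<and> opr k1 d1 \<epsilon> f \<and> opr k1 S1 \<epsilon> s'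
        \<and> k2 \<epsilon> k \<and> opr k2 d2 \<epsilon> f \<and> opr k2 S2 \<epsilon> s' \<and> d = kImp d1 d2
        \<and> TS M m S (\<lambda>a. a \<epsilon> S1 \<longrightarrow> a \<epsilon> S2)"
    if "\<exists>k1 d1 S1 k2 d2 S2. k1 \<epsilon> k \<and> opr k1 d1 \<epsilon> f \<and> opr k1 S1 \<epsilon> s
        \<and> k2 \<epsilon> k \<and> opr k2 d2 \<epsilon> f \<and> opr k2 S2 \<epsilon> s \<and> d = kImp d1 d2
        \<and> TS M m S (\<lambda>a. a \<epsilon> S1 \<longrightarrow> a \<epsilon> S2)"
    using that assms(2) by blast
  moreover have "\<exists>i k1 d1 S1. i \<epsilon> m \<and> k1 \<epsilon> k \<and> opr k1 d1 \<epsilon> f \<and> opr k1 S1 \<epsilon> s' \<and> d = kAll i d1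
        \<and> TS M m S (\<lambda>a. \<forall>b. Map b m M \<and> Agr m i a b \<longrightarrow> b \<epsilon> S1)"
    if "\<exists>i k1 d1 S1. i \<epsilon> m \<and> k1 \<epsilon> k \<and> opr k1 d1 \<epsilon> f \<and> opr k1 S1 \<epsilon> s \<and> d = kAll i d1
        \<and> TS M m S (\<lambda>a. \<forall>b. Map b m M \<and> Agr m i a b \<longrightarrow> b \<epsilon> S1)"
    using that assms(2) by blast
  ultimately show ?thesis using assms(1) unfolding TC_def by argo
qed

lemma TS_exists:
  assumes T: "ZF T" "M \<epsilon> T" "Nt m" and "set xs \<subseteq> els T" "fb (Suc (length xs)) F"
    and "\<And>a. a \<epsilon> T \<Longrightarrow> Map a m M \<Longrightarrow> holds E (els T) (xs @ [a]) F \<longleftrightarrow> P a"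
  shows "\<exists>S. S \<epsilon> T \<and> TS M m S P"
proof -
  obtain Z where Z: "Z \<epsilon> T" "\<And>a. a \<epsilon> Z \<longleftrightarrow> Map a m M" using ZF_maps[OF T] by metis
  obtain S where "S \<epsilon> T" "\<And>a. a \<epsilon> S \<longleftrightarrow> a \<epsilon> Z \<and> P a"
    by (rule ZF_sep[OF T(1) assms(4) Z(1) assms(5), of P]) (use assms(6) Z(2) in auto)
  then show ?thesis unfolding TS_def using Z(2) by blast
qed

lemma TC_exists:
  assumes T: "ZF T" "M \<epsilon> T" "Nt m" and F: "FC m f k d"
    and s: "\<And>k1 d1. k1 \<epsilon> k \<Longrightarrow> opr k1 d1 \<epsilon> f \<Longrightarrow> \<exists>S1. S1 \<epsilon> T \<and> opr k1 S1 \<epsilon> s"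
  shows "\<exists>S. S \<epsilon> T \<and> TC M m f s k d S"
proof -
  have mT: "m \<epsilon> T" using ZF_Nt T by blast
  then have iT: "i \<epsilon> T" if "i \<epsilon> m" for i using ZF_Trn[OF T(1)] that by blast
  consider (1) i j where "i \<epsilon> m" "j \<epsilon> m" "d = kMem i j" | (2) i j where "i \<epsilon> m" "j \<epsilon> m" "d = kEq i j"
    | (3) "d = kFls"
    | (4) k1 d1 k2 d2 where "k1 \<epsilon> k" "opr k1 d1 \<epsilon> f" "k2 \<epsilon> k" "opr k2 d2 \<epsilon> f" "d = kImp d1 d2"
    | (5) i k1 d1 where "i \<epsilon> m" "k1 \<epsilon> k" "opr k1 d1 \<epsilon> f" "d = kAll i d1"
    using F unfolding FC_def by blast
  then show ?thesis
  proof cases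
    case 1
    have "\<exists>S. S \<epsilon> T \<and> TS M m S (\<lambda>a. \<exists>x y. opr i x \<epsilon> a \<and> opr j y \<epsilon> a \<and> x \<epsilon> y)"
    proof (rule TS_exists[OF T, of "[i, j]" "\<^bold>\<exists>x y. is_app 2 0 x \<^bold>\<and> is_app 2 1 y \<^bold>\<and> x \<^bold>\<in> y"])
      fix a assume "a \<epsilon> T"
      then show "holds E (els T) ([i, j] @ [a]) (\<^bold>\<exists>x y. is_app 2 0 x \<^bold>\<and> is_app 2 1 y \<^bold>\<and> x \<^bold>\<in> y) \<longleftrightarrow>
        (\<exists>x y. opr i x \<epsilon> a \<and> opr j y \<epsilon> a \<and> x \<epsilon> y)"
        using T iT 1 by (simp add: bnd)
    qed (use iT 1 in simp_all)
    then show ?thesis using 1 unfolding TC_def by blast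
  next
    case 2
    have "\<exists>S. S \<epsilon> T \<and> TS M m S (\<lambda>a. \<exists>x. opr i x \<epsilon> a \<and> opr j x \<epsilon> a)"
      by (rule TS_exists[OF T, of "[i, j]" "\<^bold>\<exists>x. is_app 2 0 x \<^bold>\<and> is_app 2 1 x"]) (use T iT 2 in \<open>simp_all add: bnd\<close>)
    then show ?thesis using 2 unfolding TC_def by blast
  next
    case 3
    have "\<exists>S. S \<epsilon> T \<and> TS M m S (\<lambda>a. False)"
      by (rule TS_exists[OF T, of "[]" "\<^bold>\<bottom>"]) simp_all
    then show ?thesis using 3 unfolding TC_def by blast
  next
    case 4
    then obtain S1 S2 where S: "S1 \<epsilon> T" "opr k1 S1 \<epsilon> s" "S2 \<epsilon> T" "opr k2 S2 \<epsilon> s" using s by metis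
    have "\<exists>S. S \<epsilon> T \<and> TS M m S (\<lambda>a. a \<epsilon> S1 \<longrightarrow> a \<epsilon> S2)"
      by (rule TS_exists[OF T, of "[S1, S2]" "2 \<^bold>\<in> 0 \<^bold>\<longrightarrow> 2 \<^bold>\<in> 1"]) (use S in simp_all)
    then show ?thesis using 4 S unfolding TC_def by blast
  next
    case 5
    then obtain S1 where S: "S1 \<epsilon> T" "opr k1 S1 \<epsilon> s" using s by metis
    have "\<exists>S. S \<epsilon> T \<and> TS M m S (\<lambda>a. \<forall>b. Map b m M \<and> Agr m i a b \<longrightarrow> b \<epsilon> S1)"
    proof (rule TS_exists[OF T, of "[m, M, i, S1]" "\<^bold>\<forall>b. is_map b 0 1 \<^bold>\<and> agree_off 0 2 4 b \<^bold>\<longrightarrow> b \<^bold>\<in> 3"])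
      fix a assume "a \<epsilon> T"
      have "(\<forall>b\<in>els T. Map b m M \<and> Agr m i a b \<longrightarrow> b \<epsilon> S1) \<longleftrightarrow> (\<forall>b. Map b m M \<and> Agr m i a b \<longrightarrow> b \<epsilon> S1)"
        using good_map[OF ZF_good0[OF T(1)] _ T(3)] T(2) by (metis els_iff)
      then show "holds E (els T) ([m, M, i, S1] @ [a]) (\<^bold>\<forall>b. is_map b 0 1 \<^bold>\<and> agree_off 0 2 4 b \<^bold>\<longrightarrow> b \<^bold>\<in> 3) \<longleftrightarrow>
        (\<forall>b. Map b m M \<and> Agr m i a b \<longrightarrow> b \<epsilon> S1)"
        using T iT 5 S mT \<open>a \<epsilon> T\<close> by simp
    qed (use T iT 5 S mT in simp_all)
    then show ?thesis using 5 S unfolding TC_def by blast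
  qed
qed

text \<open>Internal induction on initial segments of the construction sequence. The next truth set
  is separated in \<open>T\<close> from the set of all assignments, with the earlier truth sets as
  parameters.\<close>

lemma TSq_exists:
  assumes T: "ZF T" "M \<epsilon> T" "Nt m" and f: "Cons m n f"
  shows "\<exists>s. s \<epsilon> T \<and> TSq M m n f s"
proof -
  have F: "Fun f n" and FC: "\<And>k d. k \<epsilon> n \<Longrightarrow> opr k d \<epsilon> f \<Longrightarrow> FC m f k d" and n: "Nt n"
    using f by (auto simp: Cons_def)
  let ?P = "\<lambda>l. Sub l n \<longrightarrow> (\<exists>s. s \<epsilon> T \<and> Fun s l \<and> (\<forall>k d S. k \<epsilon> l \<and> opr k d \<epsilon> f \<and> opr k S \<epsilon> s \<longrightarrow> TC M m f s k d S))"
  let ?F = "5 \<^bold>\<subseteq> 4 \<^bold>\<longrightarrow> (\<^bold>\<exists>s. s \<^bold>\<in> 0 \<^bold>\<and> is_fun s 5 \<^bold>\<and> (\<^bold>\<forall>k d S. k \<^bold>\<in> 5 \<^bold>\<and> is_app 3 k d \<^bold>\<and> is_app s k S \<^bold>\<longrightarrow> fT 1 2 3 s k d S))"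
  have "?P n"
  proof (rule Nt_induct[of "[T, M, m, f, n]" ?F ?P n])
    fix N l assume N: "ZF N" "set [T, M, m, f, n] \<subseteq> els N" "l \<epsilon> N"
    have fN: "f \<epsilon> N" using N(2) by simp
    have 1: "(\<forall>k\<in>els N. \<forall>d\<in>els N. \<forall>S\<in>els N. k \<epsilon> l \<and> opr k d \<epsilon> f \<and> opr k S \<epsilon> s \<longrightarrow> TC M m f s k d S)
        \<longleftrightarrow> (\<forall>k d S. k \<epsilon> l \<and> opr k d \<epsilon> f \<and> opr k S \<epsilon> s \<longrightarrow> TC M m f s k d S)" if "s \<epsilon> N" for s
      using ZF_app[OF N(1) that] ZF_app[OF N(1) fN] by blast
    show "holds E (els N) ([T, M, m, f, n] @ [l]) ?F \<longleftrightarrow> ?P l"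
      using N T(3) by (simp add: h_TC 1 bnd del: all_simps ball_simps ex_simps bex_simps)
  next
    show "?P emp" using ZF_emp[OF T(1)] by (auto simp: Fun_def intro!: exI[of _ emp])
  next
    fix l assume l: "Nt l" "?P l"
    show "?P (suc l)"
    proof
      assume sub: "Sub (suc l) n"
      then have "Sub l n" "l \<epsilon> n" by (auto simp: Sub_def)
      with l obtain s where s: "s \<epsilon> T" "Fun s l"
        "\<And>k d S. k \<epsilon> l \<Longrightarrow> opr k d \<epsilon> f \<Longrightarrow> opr k S \<epsilon> s \<Longrightarrow> TC M m f s k d S" by blast
      obtain d where d: "opr l d \<epsilon> f" using Fun_ex[OF F \<open>l \<epsilon> n\<close>] by blast
      obtain S where S: "S \<epsilon> T" "TC M m f s l d S"
        using TC_exists[OF T FC[OF \<open>l \<epsilon> n\<close> d], of s] Fun_ex[OF s(2)] ZF_app[OF T(1) s(1)] by blast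
      let ?s = "adj s (opr l S)"
      have "?s \<epsilon> T" using ZF_adj[OF T(1) s(1)] S(1) by (simp add: ZF_opr[OF T(1)] ZF_Nt[OF T(1) l(1)])
      moreover have "Fun ?s (suc l)"
        unfolding suc_def using s(2) no_loop by (rule Fun_adj)
      moreover have "TC M m f ?s k d' S'" if "k \<epsilon> suc l" "opr k d' \<epsilon> f" "opr k S' \<epsilon> ?s" for k d' S'
      proof (cases "k = l")
        case True
        then have "d' = d" using that d FunD[OF F] by blast
        moreover have "S' = S" using that(3) Fun_dom[OF s(2)] no_loop True unfolding adj_iff by (metis opr_inject)
        ultimately show ?thesis using S(2) True by (auto intro: TC_mono)
      next
        case False
        then have "TC M m f s k d' S'" using that s(3) by auto
        then show ?thesis by (rule TC_mono) simp
      qed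
      ultimately show "\<exists>s. s \<epsilon> T \<and> Fun s (suc l) \<and>
          (\<forall>k d S. k \<epsilon> suc l \<and> opr k d \<epsilon> f \<and> opr k S \<epsilon> s \<longrightarrow> TC M m f s k d S)" by blast
    qed
  qed (use n in simp_all)
  then show ?thesis using F n by (auto simp: TSq_def Sub_def)
qed

text \<open>A truth set depends on the formula alone, whichever construction sequence reaches it:
  the outermost connective is determined by the code, and the induction handles the components. This
  makes satisfaction absolute.\<close>

lemma TSq_unique:
  assumes s: "TSq M m n f s" and s': "TSq M m n' f' s'" and k: "k \<epsilon> n" "opr k d \<epsilon> f" "opr k S \<epsilon> s"
    and k': "k' \<epsilon> n'" "opr k' d \<epsilon> f'" "opr k' S' \<epsilon> s'"
  shows "S = S'"
proof -
  let ?P = "\<lambda>k. \<forall>k' d S S'. k' \<epsilon> n' \<longrightarrow> opr k d \<epsilon> f \<longrightarrow> opr k' d \<epsilon> f' \<longrightarrow> opr k S \<epsilon> s \<longrightarrow> opr k' S' \<epsilon> s' \<longrightarrow> S = S'"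
  let ?F = "\<^bold>\<forall>k' d S S'. k' \<^bold>\<in> 2 \<^bold>\<longrightarrow> is_app 0 5 d \<^bold>\<longrightarrow> is_app 3 k' d \<^bold>\<longrightarrow> is_app 1 5 S \<^bold>\<longrightarrow> is_app 4 k' S' \<^bold>\<longrightarrow> S \<^bold>= S'"
  have "?P k"
  proof (rule vind[of "[f, s, n', f', s']" ?F n ?P k, OF _ _ _ k(1)])
    fix N k assume N: "ZF N" "set [f, s, n', f', s'] \<subseteq> els N" "k \<epsilon> N"
    have fN: "f \<epsilon> N" "s \<epsilon> N" "s' \<epsilon> N" "n' \<epsilon> N" using N(2) by simp_all
    have "(\<forall>k'\<in>els N. \<forall>d\<in>els N. \<forall>S\<in>els N. \<forall>S'\<in>els N. k' \<epsilon> n' \<longrightarrow> opr k d \<epsilon> f \<longrightarrow> opr k' d \<epsilon> f' \<longrightarrow> opr k S \<epsilon> s \<longrightarrow> opr k' S' \<epsilon> s' \<longrightarrow> S = S')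
      \<longleftrightarrow> ?P k"
      (is "?L \<longleftrightarrow> _")
    proof
      assume L: ?L
      show "?P k"
      proof (intro allI impI)
        fix k' d S S' assume *: "k' \<epsilon> n'" "opr k d \<epsilon> f" "opr k' d \<epsilon> f'" "opr k S \<epsilon> s" "opr k' S' \<epsilon> s'"
        then have "k' \<in> els N" "d \<in> els N" "S \<in> els N" "S' \<in> els N"
          using ZF_app[OF N(1) fN(1)] ZF_app[OF N(1) fN(2)] ZF_app[OF N(1) fN(3)] ZF_Trn[OF N(1) fN(4)] by blast+
        with L * show "S = S'" by blast
      qed
    qed blast
    then show "holds E (els N) ([f, s, n', f', s'] @ [k]) ?F \<longleftrightarrow> ?P k"
      using N by (simp del: all_simps ball_simps)
  next
    fix k assume k: "k \<epsilon> n" and IH: "\<And>y. y \<epsilon> n \<Longrightarrow> y \<epsilon> k \<Longrightarrow> ?P y"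
    show "?P k"
    proof (intro allI impI)
      fix k' d S S' assume *: "k' \<epsilon> n'" "opr k d \<epsilon> f" "opr k' d \<epsilon> f'" "opr k S \<epsilon> s" "opr k' S' \<epsilon> s'"
      have TC: "TC M m f s k d S" "TC M m f' s' k' d S'" using s s' k * by (auto simp: TSq_def)
      have sub: "y \<epsilon> n" if "y \<epsilon> k" for y using s k that Ord_Trn[OF Nt_Ord] unfolding TSq_def by blast
      have sub': "y \<epsilon> n'" if "y \<epsilon> k'" for y using s' * that Ord_Trn[OF Nt_Ord] unfolding TSq_def by blast
      have IH': "S1 = S1'" if "y \<epsilon> k" "y' \<epsilon> k'" "opr y d \<epsilon> f" "opr y' d \<epsilon> f'" "opr y S1 \<epsilon> s" "opr y' S1' \<epsilon> s'" for y y' d S1 S1'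
        using IH[OF sub that(1)] sub' that by blast
      show "S = S'"
        using TC(1) unfolding TC_def[of _ _ _ _ k]
      proof (elim disjE exE conjE)
        fix i j assume "d = kMem i j" and S: "TS M m S (\<lambda>a. \<exists>x y. opr i x \<epsilon> a \<and> opr j y \<epsilon> a \<and> x \<epsilon> y)"
        then have "TS M m S' (\<lambda>a. \<exists>x y. opr i x \<epsilon> a \<and> opr j y \<epsilon> a \<and> x \<epsilon> y)" using TC(2) unfolding TC_def by simp
        with S show ?thesis by (rule TS_unique) simp
      next
        fix i j assume "d = kEq i j" and S: "TS M m S (\<lambda>a. \<exists>x. opr i x \<epsilon> a \<and> opr j x \<epsilon> a)"
        then have "TS M m S' (\<lambda>a. \<exists>x. opr i x \<epsilon> a \<and> opr j x \<epsilon> a)" using TC(2) unfolding TC_def by simp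
        with S show ?thesis by (rule TS_unique) simp
      next
        assume "d = kFls" and S: "TS M m S (\<lambda>a. False)"
        then have "TS M m S' (\<lambda>a. False)" using TC(2) unfolding TC_def by simp
        with S show ?thesis by (rule TS_unique) simp
      next
        fix k1 d1 S1 k2 d2 S2 assume 1: "k1 \<epsilon> k" "opr k1 d1 \<epsilon> f" "opr k1 S1 \<epsilon> s" "k2 \<epsilon> k" "opr k2 d2 \<epsilon> f" "opr k2 S2 \<epsilon> s"
          "d = kImp d1 d2" and S: "TS M m S (\<lambda>a. a \<epsilon> S1 \<longrightarrow> a \<epsilon> S2)"
        then obtain k1' S1' k2' S2' where 2: "k1' \<epsilon> k'" "opr k1' d1 \<epsilon> f'" "opr k1' S1' \<epsilon> s'" "k2' \<epsilon> k'" "opr k2' d2 \<epsilon> f'" "opr k2' S2' \<epsilon> s'"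
          and S': "TS M m S' (\<lambda>a. a \<epsilon> S1' \<longrightarrow> a \<epsilon> S2')" using TC(2) unfolding TC_def by auto
        have "S1 = S1'" "S2 = S2'" using IH' 1 2 by blast+
        then show ?thesis using TS_unique[OF S S'] by blast
      next
        fix i k1 d1 S1 assume 1: "k1 \<epsilon> k" "opr k1 d1 \<epsilon> f" "opr k1 S1 \<epsilon> s" "d = kAll i d1"
          and S: "TS M m S (\<lambda>a. \<forall>b. Map b m M \<and> Agr m i a b \<longrightarrow> b \<epsilon> S1)"
        then obtain k1' S1' where 2: "k1' \<epsilon> k'" "opr k1' d1 \<epsilon> f'" "opr k1' S1' \<epsilon> s'"
          and S': "TS M m S' (\<lambda>a. \<forall>b. Map b m M \<and> Agr m i a b \<longrightarrow> b \<epsilon> S1')" using TC(2) unfolding TC_def by auto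
        have "S1 = S1'" using IH' 1 2 by blast
        then show ?thesis using TS_unique[OF S S'] by blast
      qed
    qed
  qed simp
  then show ?thesis using k k' by blast
qed

text \<open>The given truth sequence may lie outside \<open>T\<close>. A second one is formed in
  \<open>T\<close> for the same construction sequence, and uniqueness identifies the relevant truth
  sets.\<close>

lemma Sat_witness:
  assumes "ZF T" "M \<epsilon> T" "Sat M m c a"
  shows "\<exists>n f s. n \<epsilon> T \<and> f \<epsilon> T \<and> s \<epsilon> T \<and> TSq M m n f s \<and> (\<exists>k S. k \<epsilon> n \<and> opr k c \<epsilon> f \<and> opr k S \<epsilon> s \<and> a \<epsilon> S)"
proof -
  obtain n f s k S where m: "Nt m" and s: "TSq M m n f s" "k \<epsilon> n" "opr k c \<epsilon> f" "opr k S \<epsilon> s" "a \<epsilon> S"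
    using assms(3) unfolding Sat_def by blast
  have c: "Cons m n f" using s(1) by (rule TSq_Cons)
  then obtain s' where s': "s' \<epsilon> T" "TSq M m n f s'" using TSq_exists[OF assms(1,2) m] by blast
  then obtain S' where S': "opr k S' \<epsilon> s'" using s(2) Fun_ex unfolding TSq_def by blast
  have "S = S'" using TSq_unique[OF s(1) s'(2) s(2,3,4) s(2,3) S'] .
  moreover have "n \<epsilon> T" using c ZF_Nt[OF assms(1)] by (simp add: Cons_def)
  ultimately show ?thesis using s s' S' Cons_in(2)[OF assms(1) m c] by blast
qed

lemma ZF_good [simp]: "ZF T \<Longrightarrow> good (els T)"
  unfolding good_def
proof (intro conjI ballI impI allI)
  assume T: "ZF T"
  then show "good0 (els T)" by simp
  show "\<exists>n\<in>els T. \<exists>f\<in>els T. Cons m n f \<and> (\<exists>k. k \<epsilon> n \<and> opr k c \<epsilon> f)" if "Fml m c" for m c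
    using that Cons_in(2)[OF T] ZF_Nt[OF T] unfolding Fml_def Cons_def[of _ _ "_"] by (metis Cons_def els_iff)
  show "\<exists>n\<in>els T. \<exists>f\<in>els T. \<exists>s\<in>els T. TSq M m n f s \<and> (\<exists>k S. k \<epsilon> n \<and> opr k c \<epsilon> f \<and> opr k S \<epsilon> s \<and> a \<epsilon> S)"
    if "M \<in> els T" "Sat M m c a" for M m c a
    using Sat_witness[OF T] that by (metis els_iff)
qed

lemma isDef_in:
  assumes T: "ZF T" "B \<epsilon> T" and "isDef B X"
  shows "X \<epsilon> T"
proof -
  obtain m c d p where m: "Fml m c" "\<forall>i. i \<epsilon> d \<longleftrightarrow> i \<epsilon> m \<and> i \<noteq> emp" "Map p d B" "Sub X B"
    and X: "\<And>x. x \<epsilon> B \<Longrightarrow> (x \<epsilon> X \<longleftrightarrow> (\<exists>a. Map a m B \<and> Sub p a \<and> opr emp x \<epsilon> a \<and> Sat B m c a))"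
    using assms(3) unfolding isDef_def by blast
  have Nt: "Nt m" using m(1) by (rule Fml_Nt)
  have pT: "p \<epsilon> T"
  proof (rule ZF_finite_fun[OF T(1) Nt])
    show "q \<epsilon> p \<Longrightarrow> \<exists>i y. i \<epsilon> m \<and> y \<epsilon> T \<and> q = opr i y" for q
      using m(2,3) ZF_Trn[OF T] unfolding Map_def Fun_def by blast
    show "opr i y \<epsilon> p \<Longrightarrow> opr i z \<epsilon> p \<Longrightarrow> y = z" for i y z
      using m(3) FunD unfolding Map_def by blast
  qed
  have in_T: "m \<epsilon> T" "c \<epsilon> T" "emp \<epsilon> T" using ZF_Nt[OF T(1) Nt] Fml_in[OF T(1) m(1)] ZF_emp[OF T(1)] .
  obtain Y where "Y \<epsilon> T" "\<And>x. x \<epsilon> Y \<longleftrightarrow> x \<epsilon> B \<and> (\<exists>a. Map a m B \<and> Sub p a \<and> opr emp x \<epsilon> a \<and> Sat B m c a)"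
  proof (rule ZF_sep[of T "[B, m, c, p, emp]" B "\<^bold>\<exists>a. is_map a 1 0 \<^bold>\<and> 3 \<^bold>\<subseteq> a \<^bold>\<and> is_app a 4 5 \<^bold>\<and> sat 0 1 2 a"])
    fix x assume "x \<epsilon> T"
    have "(\<exists>a\<in>els T. Map a m B \<and> Sub p a \<and> opr emp x \<epsilon> a \<and> Sat B m c a) \<longleftrightarrow>
        (\<exists>a. Map a m B \<and> Sub p a \<and> opr emp x \<epsilon> a \<and> Sat B m c a)"
      using good_map[OF ZF_good0[OF T(1)] _ Nt, of B] T(2) by (metis els_iff)
    then show "holds E (els T) ([B, m, c, p, emp] @ [x]) (\<^bold>\<exists>a. is_map a 1 0 \<^bold>\<and> 3 \<^bold>\<subseteq> a \<^bold>\<and> is_app a 4 5 \<^bold>\<and> sat 0 1 2 a) \<longleftrightarrow>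
        (\<exists>a. Map a m B \<and> Sub p a \<and> opr emp x \<epsilon> a \<and> Sat B m c a)"
      using T in_T pT \<open>x \<epsilon> T\<close> by simp
  qed (use T in_T pT in auto)
  moreover have "x \<epsilon> X \<longleftrightarrow> x \<epsilon> B \<and> (\<exists>a. Map a m B \<and> Sub p a \<and> opr emp x \<epsilon> a \<and> Sat B m c a)" for x
    using X m(4) unfolding Sub_def by blast
  ultimately have "X = Y" by (intro extensionality) simp
  with \<open>Y \<epsilon> T\<close> show ?thesis by simp
qed

lemma ZF_vgood [simp]: "ZF T \<Longrightarrow> vgood (els T)"
  unfolding vgood_def
proof (intro conjI ballI impI allI)
  assume T: "ZF T"
  then show "good (els T)" by simp
  show "X \<in> els T" if "B \<in> els T" "isDef B X" for B X using isDef_in[OF T] that by simp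
  show "c \<in> els T" if "Fml m c" for m c using Fml_in[OF T that] by simp
  fix B m d p assume B: "B \<in> els T" and mdp: "Nt m \<and> Sub d m \<and> Map p d B"
  show p: "p \<in> els T"
  proof (simp, rule ZF_finite_fun[OF T])
    show "Nt m" using mdp by simp
    show "q \<epsilon> p \<Longrightarrow> \<exists>i y. i \<epsilon> m \<and> y \<epsilon> T \<and> q = opr i y" for q
      using mdp ZF_Trn[OF T] B unfolding Map_def Fun_def Sub_def by blast
    show "opr i y \<epsilon> p \<Longrightarrow> opr i z \<epsilon> p \<Longrightarrow> y = z" for i y z
      using mdp FunD unfolding Map_def by blast
  qed
  \<comment> \<open>An arbitrary subset of a natural number is not obviously in \<open>T\<close>;
    this one is, being the domain of a finite function in \<open>T\<close>.\<close>
  obtain d' where "d' \<epsilon> T" "\<And>i. i \<epsilon> d' \<longleftrightarrow> i \<epsilon> m \<and> (\<exists>y. opr i y \<epsilon> p)"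
    by (rule ZF_sep[of T "[p]" m "\<^bold>\<exists>y. is_app 0 1 y" "\<lambda>i. \<exists>y. opr i y \<epsilon> p"])
      (use T p ZF_Nt[OF T] mdp in \<open>auto simp: bnd\<close>)
  moreover have "i \<epsilon> d \<longleftrightarrow> i \<epsilon> m \<and> (\<exists>y. opr i y \<epsilon> p)" for i
    using mdp Fun_dom Fun_ex unfolding Map_def Sub_def by blast
  ultimately have "d = d'" by (intro extensionality) simp
  with \<open>d' \<epsilon> T\<close> show "d \<in> els T" by simp
qed

lemma Def_exists:
  assumes T: "ZF T" "B \<epsilon> T"
  obtains D where "D \<epsilon> T" "\<And>X. X \<epsilon> D \<longleftrightarrow> isDef B X"
proof -
  obtain p where p: "p \<epsilon> T" "\<And>z. z \<epsilon> p \<longleftrightarrow> z \<epsilon> T \<and> Sub z B" using ZF_pow[OF T] by metis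
  obtain D where D: "D \<epsilon> T" "\<And>X. X \<epsilon> D \<longleftrightarrow> X \<epsilon> p \<and> isDef B X"
    by (rule ZF_sep[of T "[B]" p "in_Def 0 1" "isDef B"]) (use T p in auto)
  have "X \<epsilon> D \<longleftrightarrow> isDef B X" for X
    unfolding D(2) p(2) using isDef_in[OF T] unfolding isDef_def by blast
  with D(1) show ?thesis using that by blast
qed

section \<open>The constructible hierarchy inside models\<close>

lemma Lim_not_suc: "Lim x \<Longrightarrow> x \<noteq> suc y"
  unfolding Lim_def using no_loop by (metis suc_iff)

lemma suc_not_emp: "suc x \<noteq> emp"
  by (auto simp: emp_iff)

lemma suc_inject: "suc x = suc y \<Longrightarrow> x = y"
  using no_loop2 by (metis suc_iff)

text \<open>The three clauses of a hierarchy exclude one another, so both hierarchies use the same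
  one at a given stage, and induction identifies the earlier levels it refers to.\<close>

lemma LH_unique:
  assumes g: "LH \<beta> g" and g': "LH \<beta>' g'" and x: "\<gamma> \<epsilon> \<beta>" "opr \<gamma> A \<epsilon> g" "opr \<gamma> A' \<epsilon> g'"
  shows "A = A'"
proof -
  let ?P = "\<lambda>\<gamma>. \<forall>A A'. opr \<gamma> A \<epsilon> g \<longrightarrow> opr \<gamma> A' \<epsilon> g' \<longrightarrow> A = A'"
  have F: "Fun g \<beta>" "Fun g' \<beta>'" and O: "Ord \<beta>" "Ord \<beta>'" using g g' by (auto simp: LH_def)
  have "?P \<gamma>"
  proof (rule vind[of "[g, g']" "\<^bold>\<forall>A A'. is_app 0 2 A \<^bold>\<longrightarrow> is_app 1 2 A' \<^bold>\<longrightarrow> A \<^bold>= A'" \<beta> ?P \<gamma>, OF _ _ _ x(1)])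
    fix N \<gamma> assume N: "ZF N" "set [g, g'] \<subseteq> els N" "\<gamma> \<epsilon> N"
    have gN: "g \<epsilon> N" "g' \<epsilon> N" using N(2) by simp_all
    have "(\<forall>A\<in>els N. \<forall>A'\<in>els N. opr \<gamma> A \<epsilon> g \<longrightarrow> opr \<gamma> A' \<epsilon> g' \<longrightarrow> A = A') \<longleftrightarrow> ?P \<gamma>"
      using ZF_app[OF N(1) gN(1)] ZF_app[OF N(1) gN(2)] by blast
    then show "holds E (els N) ([g, g'] @ [\<gamma>]) (\<^bold>\<forall>A A'. is_app 0 2 A \<^bold>\<longrightarrow> is_app 1 2 A' \<^bold>\<longrightarrow> A \<^bold>= A') \<longleftrightarrow> ?P \<gamma>"
      using N by (simp del: all_simps ball_simps)
  next
    fix \<gamma> assume \<gamma>: "\<gamma> \<epsilon> \<beta>" and IH: "\<And>\<delta>. \<delta> \<epsilon> \<beta> \<Longrightarrow> \<delta> \<epsilon> \<gamma> \<Longrightarrow> ?P \<delta>"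
    show "?P \<gamma>"
    proof (intro allI impI)
      fix A A' assume A: "opr \<gamma> A \<epsilon> g" "opr \<gamma> A' \<epsilon> g'"
      have \<gamma>': "\<gamma> \<epsilon> \<beta>'" using Fun_dom[OF F(2) A(2)] .
      have IH': "B = B'" if "\<delta> \<epsilon> \<gamma>" "opr \<delta> B \<epsilon> g" "opr \<delta> B' \<epsilon> g'" for \<delta> B B'
        using IH Ord_Trn[OF O(1) \<gamma>] that by blast
      have c: "\<gamma> = emp \<and> A = emp \<or> (\<exists>\<delta> B. \<gamma> = suc \<delta> \<and> opr \<delta> B \<epsilon> g \<and> (\<forall>X. X \<epsilon> A \<longleftrightarrow> isDef B X))
          \<or> Lim \<gamma> \<and> (\<forall>x. x \<epsilon> A \<longleftrightarrow> (\<exists>\<delta> B. \<delta> \<epsilon> \<gamma> \<and> opr \<delta> B \<epsilon> g \<and> x \<epsilon> B))"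
        using g \<gamma> A(1) by (auto simp: LH_def)
      have c': "\<gamma> = emp \<and> A' = emp \<or> (\<exists>\<delta> B. \<gamma> = suc \<delta> \<and> opr \<delta> B \<epsilon> g' \<and> (\<forall>X. X \<epsilon> A' \<longleftrightarrow> isDef B X))
          \<or> Lim \<gamma> \<and> (\<forall>x. x \<epsilon> A' \<longleftrightarrow> (\<exists>\<delta> B. \<delta> \<epsilon> \<gamma> \<and> opr \<delta> B \<epsilon> g' \<and> x \<epsilon> B))"
        using g' \<gamma>' A(2) by (auto simp: LH_def)
      show "A = A'"
        using c
      proof (elim disjE exE conjE)
        assume "\<gamma> = emp" "A = emp"
        then show ?thesis using c' suc_not_emp[symmetric] by (auto simp: Lim_def)
      next
        fix \<delta> B assume 1: "\<gamma> = suc \<delta>" "opr \<delta> B \<epsilon> g" "\<forall>X. X \<epsilon> A \<longleftrightarrow> isDef B X"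
        then obtain B' where 2: "opr \<delta> B' \<epsilon> g'" "\<forall>X. X \<epsilon> A' \<longleftrightarrow> isDef B' X"
          using c' suc_not_emp suc_inject Lim_not_suc by metis
        have "B = B'" using IH'[of \<delta> B B'] 1 2 by simp
        then show ?thesis using 1 2 by (intro extensionality) simp
      next
        assume 1: "Lim \<gamma>" "\<forall>x. x \<epsilon> A \<longleftrightarrow> (\<exists>\<delta> B. \<delta> \<epsilon> \<gamma> \<and> opr \<delta> B \<epsilon> g \<and> x \<epsilon> B)"
        then have 2: "\<forall>x. x \<epsilon> A' \<longleftrightarrow> (\<exists>\<delta> B. \<delta> \<epsilon> \<gamma> \<and> opr \<delta> B \<epsilon> g' \<and> x \<epsilon> B)"
          using c' Lim_not_suc unfolding Lim_def by metis
        have "(\<exists>\<delta> B. \<delta> \<epsilon> \<gamma> \<and> opr \<delta> B \<epsilon> g \<and> x \<epsilon> B) \<longleftrightarrow> (\<exists>\<delta> B. \<delta> \<epsilon> \<gamma> \<and> opr \<delta> B \<epsilon> g' \<and> x \<epsilon> B)" for x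
          using IH' Fun_ex[OF F(1)] Fun_ex[OF F(2)] Ord_Trn[OF O(1) \<gamma>] Ord_Trn[OF O(2) \<gamma>'] by metis
        then show ?thesis using 1(2) 2 by (intro extensionality) simp
      qed
    qed
  qed simp
  then show ?thesis using x by blast
qed

lemma LH_restrict:
  assumes g: "LH \<beta> g" and "\<gamma> \<epsilon> \<beta>" and h: "\<And>i y. opr i y \<epsilon> h \<longleftrightarrow> opr i y \<epsilon> g \<and> i \<epsilon> suc \<gamma>" and Fun: "Fun h (suc \<gamma>)"
  shows "LH (suc \<gamma>) h"
  unfolding LH_def
proof (intro conjI allI impI)
  have O: "Ord \<beta>" and F: "Fun g \<beta>" using g by (auto simp: LH_def)
  then have O\<gamma>: "Ord \<gamma>" using assms(2) Ord_mem by blast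
  then show O': "Ord (suc \<gamma>)" by (rule Ord_suc)
  show "Fun h (suc \<gamma>)" by fact
  fix \<delta> A assume \<delta>: "\<delta> \<epsilon> suc \<gamma> \<and> opr \<delta> A \<epsilon> h"
  then have "\<delta> \<epsilon> \<beta>" "opr \<delta> A \<epsilon> g" using Fun_dom[OF F] h by auto
  then have "\<delta> = emp \<and> A = emp \<or> (\<exists>\<xi> B. \<delta> = suc \<xi> \<and> opr \<xi> B \<epsilon> g \<and> (\<forall>X. X \<epsilon> A \<longleftrightarrow> isDef B X))
      \<or> Lim \<delta> \<and> (\<forall>x. x \<epsilon> A \<longleftrightarrow> (\<exists>\<xi> B. \<xi> \<epsilon> \<delta> \<and> opr \<xi> B \<epsilon> g \<and> x \<epsilon> B))"
    using g by (auto simp: LH_def)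
  moreover have "opr \<xi> B \<epsilon> h \<longleftrightarrow> opr \<xi> B \<epsilon> g" if "\<xi> \<epsilon> \<delta>" for \<xi> B
    using h Ord_Trn[OF O'] \<delta> that by blast
  ultimately show "\<delta> = emp \<and> A = emp \<or> (\<exists>\<xi> B. \<delta> = suc \<xi> \<and> opr \<xi> B \<epsilon> h \<and> (\<forall>X. X \<epsilon> A \<longleftrightarrow> isDef B X))
      \<or> Lim \<delta> \<and> (\<forall>x. x \<epsilon> A \<longleftrightarrow> (\<exists>\<xi> B. \<xi> \<epsilon> \<delta> \<and> opr \<xi> B \<epsilon> h \<and> x \<epsilon> B))"
    by (elim disjE exE conjE) (simp, metis suc_iff, metis)
qed

text \<open>Since the hierarchy exists in the universe, a model contains \<open>L\<^sub>\<gamma>\<close> for each of its ordinals \<open>\<gamma>\<close>: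
  at a stage \<open>\<gamma>\<close>, replacement in the model collects the earlier levels.\<close>

theorem Lev_in:
  assumes T: "ZF T" "\<gamma> \<epsilon> T" and "Lev \<gamma> A"
  shows "A \<epsilon> T"
proof -
  obtain \<beta> g where g: "\<gamma> \<epsilon> \<beta>" "LH \<beta> g" "opr \<gamma> A \<epsilon> g" using assms(3) unfolding Lev_def by blast
  have F: "Fun g \<beta>" and O: "Ord \<beta>" using g(2) by (auto simp: LH_def)
  \<comment> \<open>The induction carries the whole initial segment of \<open>g\<close> up to and
    including the stage: collecting levels in \<open>T\<close> requires hierarchies in
    \<open>T\<close> that witness them.\<close>
  let ?P = "\<lambda>\<gamma>. \<gamma> \<epsilon> T \<longrightarrow> (\<exists>h. h \<epsilon> T \<and> Fun h (suc \<gamma>) \<and> Sub h g)"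
  have "?P \<gamma>"
  proof (rule vind[of "[T, g]" "2 \<^bold>\<in> 0 \<^bold>\<longrightarrow> (\<^bold>\<exists>h s. h \<^bold>\<in> 0 \<^bold>\<and> is_succ 2 s \<^bold>\<and> is_fun h s \<^bold>\<and> h \<^bold>\<subseteq> 1)" \<beta> ?P \<gamma>, OF _ _ _ g(1)])
    fix N \<gamma> assume "ZF N" "set [T, g] \<subseteq> els N" "\<gamma> \<epsilon> N"
    then show "holds E (els N) ([T, g] @ [\<gamma>]) (2 \<^bold>\<in> 0 \<^bold>\<longrightarrow> (\<^bold>\<exists>h s. h \<^bold>\<in> 0 \<^bold>\<and> is_succ 2 s \<^bold>\<and> is_fun h s \<^bold>\<and> h \<^bold>\<subseteq> 1)) \<longleftrightarrow> ?P \<gamma>"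
      by (simp add: bnd ZF_suc)
  next
    fix \<gamma> assume \<gamma>: "\<gamma> \<epsilon> \<beta>" and IH: "\<And>\<delta>. \<delta> \<epsilon> \<beta> \<Longrightarrow> \<delta> \<epsilon> \<gamma> \<Longrightarrow> ?P \<delta>"
    show "?P \<gamma>"
    proof
      assume "\<gamma> \<epsilon> T"
      define G where "G x = (THE q. \<exists>y. q = opr x y \<and> q \<epsilon> g)" for x
      have G: "G x = opr x y" if "opr x y \<epsilon> g" for x y
        unfolding G_def using that FunD[OF F] by (intro the_equality) auto
      \<comment> \<open>Below the current stage \<open>g\<close> becomes definable in
        \<open>T\<close>, by truncated hierarchies from the induction hypothesis together with
        uniqueness. The parameter \<open>g\<close> itself need not be in \<open>T\<close>.\<close>
      have lev: "opr x y \<epsilon> g \<longleftrightarrow> (\<exists>b\<in>els T. \<exists>h\<in>els T. x \<epsilon> b \<and> LH b h \<and> opr x y \<epsilon> h)" and GT: "G x \<epsilon> T" if x\<gamma>: "x \<epsilon> \<gamma>" for x y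
      proof -
        have x: "x \<epsilon> \<beta>" "x \<epsilon> T" using x\<gamma> \<gamma> \<open>\<gamma> \<epsilon> T\<close> Ord_Trn[OF O] ZF_Trn[OF T(1)] by blast+
        obtain h where h: "h \<epsilon> T" "Fun h (suc x)" "Sub h g" using IH[OF x(1) x\<gamma>] x(2) by blast
        have hg: "opr i y \<epsilon> h \<longleftrightarrow> opr i y \<epsilon> g \<and> i \<epsilon> suc x" for i y
          using h(2,3) Fun_dom[OF h(2)] Fun_ex[OF h(2)] FunD[OF F] unfolding Sub_def by metis
        have LH: "LH (suc x) h" by (rule LH_restrict[OF g(2) x(1) hg h(2)])
        obtain y' where y': "opr x y' \<epsilon> h" using Fun_ex[OF h(2)] by auto
        show "opr x y \<epsilon> g \<longleftrightarrow> (\<exists>b\<in>els T. \<exists>h\<in>els T. x \<epsilon> b \<and> LH b h \<and> opr x y \<epsilon> h)"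
        proof
          assume "opr x y \<epsilon> g"
          then have "opr x y \<epsilon> h" using hg by simp
          then show "\<exists>b\<in>els T. \<exists>h\<in>els T. x \<epsilon> b \<and> LH b h \<and> opr x y \<epsilon> h"
            using LH h(1) ZF_suc[OF T(1) x(2)] by (intro bexI[of _ "suc x"] bexI[of _ h]) auto
        next
          assume "\<exists>b\<in>els T. \<exists>h\<in>els T. x \<epsilon> b \<and> LH b h \<and> opr x y \<epsilon> h"
          then obtain b h' where "x \<epsilon> b" "LH b h'" "opr x y \<epsilon> h'" by blast
          then have "y = y'" using LH_unique LH y' by blast
          then show "opr x y \<epsilon> g" using y' hg by simp
        qed
        have "opr x y' \<epsilon> g" using y' hg by simp
        then show "G x \<epsilon> T" using G ZF_Trn[OF T(1) h(1) y'] by simp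
      qed
      obtain h where h: "h \<epsilon> T" "\<And>q. q \<epsilon> h \<longleftrightarrow> (\<exists>x. x \<epsilon> \<gamma> \<and> q = G x)"
      proof (rule ZF_repl[of T "[]" \<gamma> "\<^bold>\<exists>y. is_L_level 1 y \<^bold>\<and> is_pair 1 y 0" G])
        fix x q assume x: "x \<epsilon> \<gamma>" "x \<epsilon> T" "q \<epsilon> T"
        then obtain y where y: "opr x y \<epsilon> g" using Fun_ex[OF F] Ord_Trn[OF O \<gamma>] by blast
        then have "opr x y \<epsilon> T" using GT[OF x(1)] G by simp
        then have "y \<in> els T" using ZF_opr[OF T(1)] by simp
        then have "(\<exists>y\<in>els T. opr x y \<epsilon> g \<and> q = opr x y) \<longleftrightarrow> q = opr x y" using y FunD[OF F] by blast
        then show "holds E (els T) ([] @ [q, x]) (\<^bold>\<exists>y. is_L_level 1 y \<^bold>\<and> is_pair 1 y 0) \<longleftrightarrow> q = G x"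
          using x T(1) by (simp add: lev[OF x(1)] G[OF y])
      qed (use T GT \<open>\<gamma> \<epsilon> T\<close> in auto)
      have hg: "opr i y \<epsilon> h \<longleftrightarrow> opr i y \<epsilon> g \<and> i \<epsilon> \<gamma>" for i y
        using h(2) G Fun_ex[OF F] FunD[OF F] Ord_Trn[OF O \<gamma>] by (metis opr_inject)
      have Fh: "Fun h \<gamma>"
      proof (rule FunI)
        show "q \<epsilon> h \<Longrightarrow> \<exists>x y. x \<epsilon> \<gamma> \<and> q = opr x y" for q
          using h(2) G Fun_ex[OF F] Ord_Trn[OF O \<gamma>] by metis
        show "x \<epsilon> \<gamma> \<Longrightarrow> \<exists>y. opr x y \<epsilon> h" for x using hg Fun_ex[OF F] Ord_Trn[OF O \<gamma>] by blast
        show "opr x y \<epsilon> h \<Longrightarrow> opr x z \<epsilon> h \<Longrightarrow> y = z" for x y z using hg FunD[OF F] by blast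
      qed
      obtain C where C: "opr \<gamma> C \<epsilon> g" using Fun_ex[OF F \<gamma>] by blast
      have "C \<epsilon> T"
      proof -
        have "\<gamma> = emp \<and> C = emp \<or> (\<exists>\<delta> B. \<gamma> = suc \<delta> \<and> opr \<delta> B \<epsilon> g \<and> (\<forall>X. X \<epsilon> C \<longleftrightarrow> isDef B X))
          \<or> Lim \<gamma> \<and> (\<forall>x. x \<epsilon> C \<longleftrightarrow> (\<exists>\<delta> B. \<delta> \<epsilon> \<gamma> \<and> opr \<delta> B \<epsilon> g \<and> x \<epsilon> B))"
          using g(2) \<gamma> C by (auto simp: LH_def)
        then show ?thesis
        proof (elim disjE exE conjE)
          show "C = emp \<Longrightarrow> C \<epsilon> T" using ZF_emp[OF T(1)] by simp
        next
          fix \<delta> B assume B: "\<gamma> = suc \<delta>" "opr \<delta> B \<epsilon> g" "\<forall>X. X \<epsilon> C \<longleftrightarrow> isDef B X"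
          then have "opr \<delta> B \<epsilon> h" using hg by simp
          then have "B \<epsilon> T" using ZF_app[OF T(1) h(1)] by blast
          then obtain D where "D \<epsilon> T" "\<And>X. X \<epsilon> D \<longleftrightarrow> isDef B X" using Def_exists[OF T(1)] by metis
          moreover have "C = D" by (rule extensionality) (use B calculation in simp)
          ultimately show ?thesis by simp
        next
          assume 1: "\<forall>x. x \<epsilon> C \<longleftrightarrow> (\<exists>\<delta> B. \<delta> \<epsilon> \<gamma> \<and> opr \<delta> B \<epsilon> g \<and> x \<epsilon> B)"
          \<comment> \<open>Three unions lead from a set of ordered pairs to the elements of their
            second components: first to the unordered pairs, then to the components, then to the
            elements.\<close>
          have "big (big (big h)) \<epsilon> T" using ZF_big[OF T(1)] h(1) by blast
          have 2: "(\<exists>\<delta>\<in>els T. \<exists>B\<in>els T. opr \<delta> B \<epsilon> h \<and> x \<epsilon> B) \<longleftrightarrow> (\<exists>\<delta> B. opr \<delta> B \<epsilon> h \<and> x \<epsilon> B)" for x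
            using ZF_app[OF T(1) h(1)] by blast
          obtain D where D: "D \<epsilon> T" "\<And>x. x \<epsilon> D \<longleftrightarrow> x \<epsilon> big (big (big h)) \<and> (\<exists>\<delta> B. opr \<delta> B \<epsilon> h \<and> x \<epsilon> B)"
            by (rule ZF_sep[of T "[h]" "big (big (big h))" "\<^bold>\<exists>\<delta> B. is_app 0 \<delta> B \<^bold>\<and> 1 \<^bold>\<in> B" "\<lambda>x. \<exists>\<delta> B. opr \<delta> B \<epsilon> h \<and> x \<epsilon> B"])
              (use T h(1) \<open>big (big (big h)) \<epsilon> T\<close> 2 in \<open>simp_all del: big_iff bex_simps ex_simps\<close>)
          have "x \<epsilon> big (big (big h))" if "opr \<delta> B \<epsilon> h" "x \<epsilon> B" for \<delta> B x
          proof -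
            have "upr \<delta> B \<epsilon> opr \<delta> B" by (simp add: opr_def)
            moreover have "B \<epsilon> upr \<delta> B" by simp
            ultimately show ?thesis unfolding big_iff using that by blast
          qed
          then have "C = D" by (intro extensionality) (use 1 D(2) hg in blast)
          with D(1) show ?thesis by simp
        qed
      qed
      have "adj h (opr \<gamma> C) \<epsilon> T" using ZF_adj[OF T(1) h(1)] \<open>C \<epsilon> T\<close> \<open>\<gamma> \<epsilon> T\<close> by (simp add: ZF_opr[OF T(1)])
      moreover have "Fun (adj h (opr \<gamma> C)) (suc \<gamma>)" unfolding suc_def using Fh no_loop by (rule Fun_adj)
      moreover have "Sub (adj h (opr \<gamma> C)) g" using Fun_pair[OF Fh] hg C unfolding Sub_def adj_iff by metis
      ultimately show "\<exists>h. h \<epsilon> T \<and> Fun h (suc \<gamma>) \<and> Sub h g" by blast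
    qed
  qed simp
  then obtain h where h: "h \<epsilon> T" "Fun h (suc \<gamma>)" "Sub h g" using T(2) by blast
  then obtain y where "opr \<gamma> y \<epsilon> h" using Fun_ex[of h "suc \<gamma>" \<gamma>] by auto
  moreover from this have "y = A" using h(3) FunD[OF F] g(3) unfolding Sub_def by blast
  ultimately show ?thesis using ZF_app[OF T(1) h(1)] by blast
qed

end

section \<open>Recursion, collapse and well-ordering\<close>

context bst
begin

text \<open>Separation is applied to the pair \<open>p\<close>, whose components are quantified
  afterwards; so \<open>F\<close> receives the two levels that follow that of
  \<open>p\<close>.\<close>

lemma ZF_rel:
  assumes T: "ZF T" and ab: "a \<epsilon> T" "b \<epsilon> T" and xs: "set xs \<subseteq> els T"
    and F: "fb (length xs + 3) (F (Suc (length xs)) (Suc (Suc (length xs))))"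
    and R: "\<And>p x y. p \<epsilon> T \<Longrightarrow> x \<epsilon> T \<Longrightarrow> y \<epsilon> T \<Longrightarrow> x \<epsilon> a \<Longrightarrow> y \<epsilon> b \<Longrightarrow>
      holds E (els T) (xs @ [p, x, y]) (F (Suc (length xs)) (Suc (Suc (length xs)))) \<longleftrightarrow> R x y"
  obtains r where "r \<epsilon> T" "\<And>p. p \<epsilon> r \<Longrightarrow> \<exists>x y. p = opr x y" "\<And>x y. opr x y \<epsilon> r \<longleftrightarrow> x \<epsilon> a \<and> y \<epsilon> b \<and> R x y"
proof -
  obtain c where c: "c \<epsilon> T" "\<And>p. p \<epsilon> c \<longleftrightarrow> (\<exists>x y. x \<epsilon> a \<and> y \<epsilon> b \<and> p = opr x y)"
    using ZF_prod[OF T ab] by metis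
  let ?F = "\<^bold>\<exists>x y. is_pair x y (length xs) \<^bold>\<and> F x y"
  obtain r where r: "r \<epsilon> T" "\<And>p. p \<epsilon> r \<longleftrightarrow> p \<epsilon> c \<and> (\<exists>x y. p = opr x y \<and> R x y)"
  proof (rule ZF_sep[of T xs c ?F])
    fix p assume p: "p \<epsilon> T" "p \<epsilon> c"
    then obtain x y where xy: "x \<epsilon> a" "y \<epsilon> b" "p = opr x y" using c(2) by blast
    then have T': "x \<epsilon> T" "y \<epsilon> T" using p(1) ZF_opr[OF T] by blast+
    have "holds E (els T) (xs @ [p]) ?F \<longleftrightarrow> (\<exists>u\<in>els T. \<exists>v\<in>els T. p = opr u v \<and>
        holds E (els T) (xs @ [p, u, v]) (F (Suc (length xs)) (Suc (Suc (length xs)))))"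
      using T xs p(1) by (simp del: ex_simps bex_simps)
    also have "\<dots> \<longleftrightarrow> (\<exists>u v. p = opr u v \<and> R u v)"
      using R[OF p(1) T' xy(1,2)] T' unfolding xy(3) opr_inject by blast
    finally show "holds E (els T) (xs @ [p]) ?F \<longleftrightarrow> (\<exists>x y. p = opr x y \<and> R x y)" .
  qed (use T xs c F in \<open>auto simp: numeral_3_eq_3\<close>)
  have "opr x y \<epsilon> r \<longleftrightarrow> x \<epsilon> a \<and> y \<epsilon> b \<and> R x y" for x y unfolding r(2) c(2) opr_inject by blast
  moreover have "\<exists>x y. p = opr x y" if "p \<epsilon> r" for p using r(2) that by blast
  ultimately show ?thesis using that r(1) by blast
qed

definition Sv :: "'a \<Rightarrow> bool" where "Sv f \<longleftrightarrow> (\<forall>x y z. opr x y \<epsilon> f \<and> opr x z \<epsilon> f \<longrightarrow> y = z)"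

lemma Fun_Sv: "Fun f a \<Longrightarrow> Sv f"
  unfolding Sv_def using FunD by blast

text \<open>\<open>p\<close> is the restriction of \<open>f\<close> to the
  \<open>W\<close>-predecessors of \<open>x\<close>, the data a recursion step depends on.\<close>

definition Res :: "'a \<Rightarrow> 'a \<Rightarrow> 'a \<Rightarrow> 'a \<Rightarrow> bool" where
  "Res W f x p \<longleftrightarrow> (\<forall>q. q \<epsilon> p \<longleftrightarrow> q \<epsilon> f \<and> (\<exists>u v. q = opr u v \<and> opr u x \<epsilon> W))"

definition wfr :: "'a \<Rightarrow> 'a \<Rightarrow> bool" where
  "wfr A W \<longleftrightarrow> (\<forall>S. S \<noteq> emp \<and> Sub S A \<longrightarrow> (\<exists>x. x \<epsilon> S \<and> (\<forall>y. y \<epsilon> S \<longrightarrow> \<not> opr y x \<epsilon> W)))"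

definition is_res :: "var \<Rightarrow> var \<Rightarrow> var \<Rightarrow> var \<Rightarrow> form" where
  "is_res W f x p = (\<^bold>\<forall>q. q \<^bold>\<in> p \<^bold>\<longleftrightarrow> q \<^bold>\<in> f \<^bold>\<and> (\<^bold>\<exists>u v. is_pair u v q \<^bold>\<and> is_app W u x))"

lemma fb_is_res [simp]: "0 < n \<Longrightarrow> fb n (is_res W f x p)"
  by (simp add: is_res_def)

lemma h_res [simp]:
  assumes T: "ZF T" and xs: "set xs \<subseteq> els T" "W < length xs" "f < length xs" "x < length xs" "p < length xs"
  shows "holds E (els T) xs (is_res W f x p) \<longleftrightarrow> Res (xs ! W) (xs ! f) (xs ! x) (xs ! p)"
proof -
  have A: "xs ! W \<epsilon> T" "xs ! f \<epsilon> T" "xs ! p \<epsilon> T" using nth_in[OF xs(1)] xs by auto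
  have 1: "(\<exists>u\<in>els T. \<exists>v\<in>els T. q = opr u v \<and> opr u (xs ! x) \<epsilon> xs ! W) \<longleftrightarrow> (\<exists>u v. q = opr u v \<and> opr u (xs ! x) \<epsilon> xs ! W)" if "q \<epsilon> T" for q
    using that ZF_opr[OF T] by blast
  have "holds E (els T) xs (is_res W f x p) \<longleftrightarrow>
      (\<forall>q\<in>els T. q \<epsilon> xs ! p \<longleftrightarrow> q \<epsilon> xs ! f \<and> (\<exists>u v. q = opr u v \<and> opr u (xs ! x) \<epsilon> xs ! W))"
    unfolding is_res_def using assms by (simp add: 1 del: bex_simps ex_simps)
  also have "\<dots> \<longleftrightarrow> Res (xs ! W) (xs ! f) (xs ! x) (xs ! p)"
    unfolding Res_def using ZF_Trn[OF T A(2)] ZF_Trn[OF T A(3)] by blast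
  finally show ?thesis .
qed

lemma Res_exists:
  assumes "ZF T" "W \<epsilon> T" "f \<epsilon> T" "x \<epsilon> T"
  obtains p where "p \<epsilon> T" "Res W f x p"
proof -
  obtain p where "p \<epsilon> T" "\<And>q. q \<epsilon> p \<longleftrightarrow> q \<epsilon> f \<and> (\<exists>u v. q = opr u v \<and> opr u x \<epsilon> W)"
  proof (rule ZF_sep[of T "[W, x]" f "\<^bold>\<exists>u v. is_pair u v 2 \<^bold>\<and> is_app 0 u 1"])
    fix q assume q: "q \<epsilon> T"
    have "(\<exists>u\<in>els T. \<exists>v\<in>els T. q = opr u v \<and> opr u x \<epsilon> W) \<longleftrightarrow> (\<exists>u v. q = opr u v \<and> opr u x \<epsilon> W)"
      using q ZF_opr[OF assms(1)] by blast
    then show "holds E (els T) ([W, x] @ [q]) (\<^bold>\<exists>u v. is_pair u v 2 \<^bold>\<and> is_app 0 u 1) \<longleftrightarrow> (\<exists>u v. q = opr u v \<and> opr u x \<epsilon> W)"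
      using assms q by (simp del: bex_simps ex_simps)
  qed (use assms in auto)
  then show ?thesis using that unfolding Res_def by blast
qed

lemma Res_unique: "Res W f x p \<Longrightarrow> Res W f x p' \<Longrightarrow> p = p'"
  by (rule extensionality) (simp add: Res_def)

lemma Res_Sv: "Sv f \<Longrightarrow> Res W f x p \<Longrightarrow> Sv p"
  unfolding Sv_def Res_def by blast

lemma Res_cong:
  assumes "Res W f x p" and "\<And>u v. opr u x \<epsilon> W \<Longrightarrow> opr u v \<epsilon> f \<longleftrightarrow> opr u v \<epsilon> f'"
  shows "Res W f' x p"
proof -
  have "(\<exists>u v. q = opr u v \<and> opr u x \<epsilon> W) \<Longrightarrow> q \<epsilon> f \<longleftrightarrow> q \<epsilon> f'" for q
    using assms(2) by metis
  then show ?thesis using assms(1) unfolding Res_def by metis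
qed

text \<open>Well-founded recursion with a definable step \<open>R\<close>, by gluing partial
  solutions whose domains are closed under \<open>W\<close>-predecessors. Instead of constructing
  closures first, all solutions in \<open>T\<close> are united and their domain is shown to be
  \<open>A\<close>.\<close>

lemma ZF_wfrec:
  assumes T: "ZF T" and A: "A \<epsilon> T" and W: "W \<epsilon> T" and wf: "wfr A W" and WA: "\<And>u x. opr u x \<epsilon> W \<Longrightarrow> u \<epsilon> A"
    and xs: "set xs \<subseteq> els T" and fbF: "\<And>n x p y. 0 < n \<Longrightarrow> fb n (F x p y)"
    and R: "\<And>x p. x \<epsilon> A \<Longrightarrow> p \<epsilon> T \<Longrightarrow> Sv p \<Longrightarrow> \<exists>!y. y \<epsilon> T \<and> R x p y"
    and FR: "\<And>zs x p y. set zs \<subseteq> els T \<Longrightarrow> x < length (xs @ zs) \<Longrightarrow> p < length (xs @ zs) \<Longrightarrow> y < length (xs @ zs) \<Longrightarrow>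
        holds E (els T) (xs @ zs) (F x p y) \<longleftrightarrow> R ((xs @ zs) ! x) ((xs @ zs) ! p) ((xs @ zs) ! y)"
  obtains f where "f \<epsilon> T" "Fun f A" "\<And>x y. opr x y \<epsilon> f \<Longrightarrow> \<exists>p. p \<epsilon> T \<and> Res W f x p \<and> R x p y"
proof -
  define App where "App a f \<longleftrightarrow> Sub a A \<and> (\<forall>x u. x \<epsilon> a \<and> opr u x \<epsilon> W \<longrightarrow> u \<epsilon> a) \<and> Fun f a \<and>
    (\<forall>x y. opr x y \<epsilon> f \<longrightarrow> (\<exists>p. p \<epsilon> T \<and> Res W f x p \<and> R x p y))" for a f
  let ?n = "length xs"
  define fApp where "fApp a f = (a \<^bold>\<subseteq> ?n \<^bold>\<and> (\<^bold>\<forall>x u. x \<^bold>\<in> a \<^bold>\<and> is_app (Suc ?n) u x \<^bold>\<longrightarrow> u \<^bold>\<in> a) \<^bold>\<and> is_fun f a \<^bold>\<and>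
    (\<^bold>\<forall>x y. is_app f x y \<^bold>\<longrightarrow> (\<^bold>\<exists>p. is_res (Suc ?n) f x p \<^bold>\<and> F x p y)))" for a f
  have fb_App: "fb n (fApp a f)" if "0 < n" for n a f using that fbF by (simp add: fApp_def)
  have h_App: "holds E (els T) (xs @ A # W # zs) (fApp a f)
      \<longleftrightarrow> App ((xs @ A # W # zs) ! a) ((xs @ A # W # zs) ! f)"
    if zs: "set zs \<subseteq> els T" and af: "a < length (xs @ A # W # zs)" "f < length (xs @ A # W # zs)" for zs a f
  proof -
    define L where "L = xs @ A # W # zs"
    have L: "set L \<subseteq> els T" "a < length L" "f < length L" "?n < length L" "Suc ?n < length L" "L ! ?n = A" "L ! Suc ?n = W"
      using zs af xs A W by (auto simp: L_def)
    have in_T: "L ! a \<epsilon> T" "L ! f \<epsilon> T" using nth_in[OF L(1)] L by auto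
    have FL: "holds E (els T) (L @ vs) (F x p y) \<longleftrightarrow> R ((L @ vs) ! x) ((L @ vs) ! p) ((L @ vs) ! y)"
      if "set vs \<subseteq> els T" "x < length (L @ vs)" "p < length (L @ vs)" "y < length (L @ vs)" for vs x p y
      using FR[of "A # W # zs @ vs" x p y] that zs A W by (simp add: L_def)
    have 1: "(\<forall>x\<in>els T. \<forall>u\<in>els T. x \<epsilon> L ! a \<and> opr u x \<epsilon> W \<longrightarrow> u \<epsilon> L ! a) \<longleftrightarrow> (\<forall>x u. x \<epsilon> L ! a \<and> opr u x \<epsilon> W \<longrightarrow> u \<epsilon> L ! a)"
      using ZF_app[OF T W] by blast
    have 2: "(\<forall>x\<in>els T. \<forall>y\<in>els T. opr x y \<epsilon> L ! f \<longrightarrow> P x y) \<longleftrightarrow> (\<forall>x y. opr x y \<epsilon> L ! f \<longrightarrow> P x y)" for P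
      using ZF_app[OF T in_T(2)] by blast
    have 3: "(\<exists>p\<in>els T. Res W (L ! f) x p \<and> R x p y) \<longleftrightarrow> (\<exists>p. p \<epsilon> T \<and> Res W (L ! f) x p \<and> R x p y)" for x y
      by blast
    have "holds E (els T) L (fApp a f) \<longleftrightarrow> App (L ! a) (L ! f)"
      unfolding fApp_def App_def 1[symmetric] 2[symmetric] 3[symmetric] using L T FL[of "[_, _, _]"]
      by (simp del: all_simps ball_simps ex_simps bex_simps)
    then show ?thesis by (simp only: L_def)
  qed
  \<comment> \<open>At a \<open>W\<close>-minimal point of disagreement the two restrictions
    coincide, so the step \<open>R\<close> has the same input and a unique value.\<close>
  have agree: "y = y'" if f: "App a f" "f \<epsilon> T" and f': "App a' f'" "f' \<epsilon> T" and y: "opr x y \<epsilon> f" "opr x y' \<epsilon> f'" for a f a' f' x y y'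
  proof (rule ccontr)
    assume "y \<noteq> y'"
    obtain S where S: "\<And>x. x \<epsilon> S \<longleftrightarrow> x \<epsilon> A \<and> (\<exists>y y'. opr x y \<epsilon> f \<and> opr x y' \<epsilon> f' \<and> y \<noteq> y')"
    proof (rule vsep[of "[f, f']" "\<^bold>\<exists>y y'. is_app 0 2 y \<^bold>\<and> is_app 1 2 y' \<^bold>\<and> \<^bold>\<not> y \<^bold>= y'" A])
      fix N x assume N: "ZF N" "set [f, f'] \<subseteq> els N" "x \<epsilon> N"
      have fN: "f \<epsilon> N" "f' \<epsilon> N" using N by simp_all
      have "(\<exists>y\<in>els N. \<exists>y'\<in>els N. opr x y \<epsilon> f \<and> opr x y' \<epsilon> f' \<and> y \<noteq> y') \<longleftrightarrow> (\<exists>y y'. opr x y \<epsilon> f \<and> opr x y' \<epsilon> f' \<and> y \<noteq> y')"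
        using ZF_app[OF N(1) fN(1)] ZF_app[OF N(1) fN(2)] by blast
      then show "holds E (els N) ([f, f'] @ [x]) (\<^bold>\<exists>y y'. is_app 0 2 y \<^bold>\<and> is_app 1 2 y' \<^bold>\<and> \<^bold>\<not> y \<^bold>= y')
         \<longleftrightarrow> (\<exists>y y'. opr x y \<epsilon> f \<and> opr x y' \<epsilon> f' \<and> y \<noteq> y')"
        using N by (simp del: ex_simps bex_simps)
    qed (simp, blast)
    have F: "Fun f a" "Fun f' a'" "Sub a A" using f f' by (auto simp: App_def)
    have "x \<epsilon> S" unfolding S using y \<open>y \<noteq> y'\<close> Fun_dom[OF F(1)] F(3) unfolding Sub_def by blast
    then have "S \<noteq> emp" by auto
    moreover have "Sub S A" using S by (simp add: Sub_def)
    ultimately obtain z where z: "z \<epsilon> S" "\<And>u. u \<epsilon> S \<Longrightarrow> \<not> opr u z \<epsilon> W" using wf unfolding wfr_def by blast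
    then obtain v v' where v: "opr z v \<epsilon> f" "opr z v' \<epsilon> f'" "v \<noteq> v'" using S by blast
    then obtain p p' where p: "p \<epsilon> T" "Res W f z p" "R z p v" "p' \<epsilon> T" "Res W f' z p'" "R z p' v'"
      using f f' unfolding App_def by metis
    have "z \<epsilon> a" "z \<epsilon> a'" using v Fun_dom F by blast+
    have "Res W f' z p"
    proof (rule Res_cong[OF p(2)])
      fix u t assume u: "opr u z \<epsilon> W"
      then have ua: "u \<epsilon> a" "u \<epsilon> a'" using \<open>z \<epsilon> a\<close> \<open>z \<epsilon> a'\<close> f f' unfolding App_def by blast+
      then obtain t1 t2 where t: "opr u t1 \<epsilon> f" "opr u t2 \<epsilon> f'" using Fun_ex F by blast
      have "t1 = t2" using S z(2) u t ua(1) F(3) unfolding Sub_def by blast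
      then show "opr u t \<epsilon> f \<longleftrightarrow> opr u t \<epsilon> f'" using t FunD F by blast
    qed
    then have "p = p'" using p(5) by (rule Res_unique)
    moreover have "z \<epsilon> A" using z S by blast
    moreover have "Sv p" using Res_Sv[OF Fun_Sv[OF F(1)] p(2)] .
    moreover have "v \<epsilon> T" "v' \<epsilon> T" using v ZF_app[OF T f(2)] ZF_app[OF T f'(2)] by blast+
    ultimately show False using R[of z p] p v(3) by blast
  qed
  \<comment> \<open>The union of all partial solutions, as a relation definable in \<open>T\<close>.
    Uniqueness of its values lets replacement turn it into a set.\<close>
  define \<psi> where "\<psi> x y \<longleftrightarrow> (\<exists>a f. a \<epsilon> T \<and> f \<epsilon> T \<and> App a f \<and> opr x y \<epsilon> f)" for x y
  have \<psi>_unique: "y = y'" if "\<psi> x y" "\<psi> x y'" for x y y' using that agree unfolding \<psi>_def by blast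
  have \<psi>_T: "y \<epsilon> T" if "\<psi> x y" for x y using that ZF_app[OF T] unfolding \<psi>_def by blast
  define f\<psi> where "f\<psi> x y = (\<^bold>\<exists>a f. fApp a f \<^bold>\<and> is_app f x y)" for x y
  have h_\<psi>: "holds E (els T) (xs @ A # W # zs) (f\<psi> x y)
      \<longleftrightarrow> \<psi> ((xs @ A # W # zs) ! x) ((xs @ A # W # zs) ! y)"
    if zs: "set zs \<subseteq> els T" and xy: "x < length (xs @ A # W # zs)" "y < length (xs @ A # W # zs)" for zs x y
  proof -
    define L where "L = xs @ A # W # zs"
    have L: "set L \<subseteq> els T" "x < length L" "y < length L" using zs xy xs A W by (auto simp: L_def)
    have "holds E (els T) (L @ [a, f]) (fApp (length L) (Suc (length L))) \<longleftrightarrow> App a f" if "a \<epsilon> T" "f \<epsilon> T" for a f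
    proof -
      have "xs @ A # W # (zs @ [a, f]) = L @ [a, f]" by (simp add: L_def)
      from h_App[of "zs @ [a, f]" "length L" "Suc (length L)", unfolded this] show ?thesis using zs that by simp
    qed
    then have "holds E (els T) L (f\<psi> x y) \<longleftrightarrow> (\<exists>a\<in>els T. \<exists>f\<in>els T. App a f \<and> opr (L ! x) (L ! y) \<epsilon> f)"
      unfolding f\<psi>_def using L T by (simp del: ex_simps bex_simps)
    then show ?thesis unfolding \<psi>_def by (auto simp: L_def)
  qed
  have fb_\<psi>: "0 < n \<Longrightarrow> fb n (f\<psi> x y)" for n x y by (simp add: f\<psi>_def fb_App)
  obtain a0 where a0: "a0 \<epsilon> T" "\<And>x. x \<epsilon> a0 \<longleftrightarrow> x \<epsilon> A \<and> (\<exists>y. y \<epsilon> T \<and> \<psi> x y)"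
  proof (rule ZF_sep[of T "xs @ [A, W]" A "\<^bold>\<exists>y. f\<psi> (?n + 2) y"])
    fix x assume x: "x \<epsilon> T"
    have "holds E (els T) (xs @ A # W # [x, y]) (f\<psi> (?n + 2) (?n + 3)) \<longleftrightarrow> \<psi> x y" if "y \<epsilon> T" for y
      using h_\<psi>[of "[x, y]" "?n + 2" "?n + 3"] x that by (simp add: numeral_2_eq_2 numeral_3_eq_3)
    then show "holds E (els T) ((xs @ [A, W]) @ [x]) (\<^bold>\<exists>y. f\<psi> (?n + 2) y) \<longleftrightarrow> (\<exists>y. y \<epsilon> T \<and> \<psi> x y)"
      using x by (simp add: numeral_2_eq_2 numeral_3_eq_3) blast
  qed (use T xs A W fb_\<psi> in auto)
  define G where "G x = opr x (THE y. \<psi> x y)" for x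
  have G: "G x = opr x y" if "\<psi> x y" for x y
    unfolding G_def using that \<psi>_unique by (metis the_equality)
  obtain f0 where f0: "f0 \<epsilon> T" "\<And>q. q \<epsilon> f0 \<longleftrightarrow> (\<exists>x. x \<epsilon> a0 \<and> q = G x)"
  proof (rule ZF_repl[of T "xs @ [A, W]" a0 "\<^bold>\<exists>y. f\<psi> (?n + 3) y \<^bold>\<and> is_pair (?n + 3) y (?n + 2)" G])
    fix x q assume x: "x \<epsilon> a0" "x \<epsilon> T" "q \<epsilon> T"
    then obtain y where y: "y \<epsilon> T" "\<psi> x y" using a0(2) by blast
    have "holds E (els T) (xs @ A # W # [q, x, z]) (f\<psi> (?n + 3) (?n + 4)) \<longleftrightarrow> \<psi> x z" if "z \<epsilon> T" for z
      using h_\<psi>[of "[q, x, z]" "?n + 3" "?n + 4"] x that by (simp add: numeral_2_eq_2 numeral_3_eq_3 eval_nat_numeral)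
    then have "holds E (els T) ((xs @ [A, W]) @ [q, x]) (\<^bold>\<exists>y. f\<psi> (?n + 3) y \<^bold>\<and> is_pair (?n + 3) y (?n + 2))
      \<longleftrightarrow> (\<exists>z\<in>els T. \<psi> x z \<and> q = opr x z)"
      using x T A W xs by (simp add: eval_nat_numeral del: bex_simps ex_simps)
    also have "\<dots> \<longleftrightarrow> q = G x" using y \<psi>_unique G by (metis els_iff)
    finally show "holds E (els T) ((xs @ [A, W]) @ [q, x]) (\<^bold>\<exists>y. f\<psi> (?n + 3) y \<^bold>\<and> is_pair (?n + 3) y (?n + 2)) \<longleftrightarrow> q = G x" .
  next
    fix x assume "x \<epsilon> a0"
    then obtain y where y: "y \<epsilon> T" "\<psi> x y" and "x \<epsilon> A" using a0(2) by blast
    then show "G x \<epsilon> T" using ZF_Trn[OF T A] G by (simp add: ZF_opr[OF T])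
  qed (use T xs A W a0 fb_\<psi> in auto)
  have f0_iff: "opr x y \<epsilon> f0 \<longleftrightarrow> \<psi> x y" for x y
  proof
    assume "opr x y \<epsilon> f0"
    then obtain x' where x': "x' \<epsilon> a0" "opr x y = G x'" using f0(2) by blast
    then obtain y' where "\<psi> x' y'" using a0(2) by blast
    then show "\<psi> x y" using x' G by simp
  next
    assume xy: "\<psi> x y"
    then have "x \<epsilon> A" using Fun_dom unfolding \<psi>_def App_def Sub_def by blast
    then have "x \<epsilon> a0" using a0(2) xy \<psi>_T by blast
    then show "opr x y \<epsilon> f0" unfolding f0(2) using G[OF xy] by (intro exI[of _ x]) simp
  qed
  have App_\<psi>: "u \<epsilon> a0 \<and> (\<forall>v. opr u v \<epsilon> f \<longleftrightarrow> opr u v \<epsilon> f0)" if f: "a \<epsilon> T" "f \<epsilon> T" "App a f" and u: "u \<epsilon> a" for a f u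
  proof -
    obtain v where v: "opr u v \<epsilon> f" using f(3) u Fun_ex unfolding App_def by blast
    then have "\<psi> u v" using f unfolding \<psi>_def by blast
    moreover have "u \<epsilon> A" using u f(3) unfolding App_def Sub_def by blast
    ultimately have "u \<epsilon> a0" using a0(2) \<psi>_T by blast
    moreover have "opr u w \<epsilon> f \<longleftrightarrow> opr u w \<epsilon> f0" for w
    proof
      assume "opr u w \<epsilon> f"
      then have "\<psi> u w" using f unfolding \<psi>_def by blast
      then show "opr u w \<epsilon> f0" using f0_iff by simp
    next
      assume "opr u w \<epsilon> f0"
      then have "w = v" using f0_iff \<psi>_unique \<open>\<psi> u v\<close> by blast
      then show "opr u w \<epsilon> f" using v by simp
    qed
    ultimately show ?thesis by blast
  qed
  have F0: "Fun f0 a0"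
  proof (rule FunI)
    show "q \<epsilon> f0 \<Longrightarrow> \<exists>x y. x \<epsilon> a0 \<and> q = opr x y" for q using f0(2) G a0(2) by metis
    show "x \<epsilon> a0 \<Longrightarrow> \<exists>y. opr x y \<epsilon> f0" for x using f0_iff a0(2) by blast
    show "opr x y \<epsilon> f0 \<Longrightarrow> opr x z \<epsilon> f0 \<Longrightarrow> y = z" for x y z using f0_iff \<psi>_unique by blast
  qed
  have App0: "App a0 f0"
    unfolding App_def
  proof (intro conjI allI impI)
    show "Sub a0 A" using a0(2) by (simp add: Sub_def)
    show "Fun f0 a0" by (rule F0)
    show "u \<epsilon> a0" if ux: "x \<epsilon> a0 \<and> opr u x \<epsilon> W" for x u
    proof -
      obtain a f y where f: "a \<epsilon> T" "f \<epsilon> T" "App a f" "opr x y \<epsilon> f" using ux a0(2) unfolding \<psi>_def by blast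
      then have "x \<epsilon> a" using Fun_dom unfolding App_def by blast
      then have "u \<epsilon> a" using ux f(3) unfolding App_def by blast
      then show ?thesis using App_\<psi>[OF f(1-3)] by blast
    qed
    show "\<exists>p. p \<epsilon> T \<and> Res W f0 x p \<and> R x p y" if xy: "opr x y \<epsilon> f0" for x y
    proof -
      obtain a f where f: "a \<epsilon> T" "f \<epsilon> T" "App a f" "opr x y \<epsilon> f" using xy f0_iff unfolding \<psi>_def by blast
      then obtain p where p: "p \<epsilon> T" "Res W f x p" "R x p y" unfolding App_def by blast
      have "x \<epsilon> a" using f Fun_dom unfolding App_def by blast
      then have "u \<epsilon> a" if "opr u x \<epsilon> W" for u using that f(3) unfolding App_def by blast
      then have "Res W f0 x p" using App_\<psi>[OF f(1-3)] by (intro Res_cong[OF p(2)]) blast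
      then show ?thesis using p by blast
    qed
  qed
  \<comment> \<open>A \<open>W\<close>-minimal point outside the domain has all its predecessors
    inside, so adjoining one pair gives a larger partial solution, which contradicts the choice of
    \<open>a0\<close>.\<close>
  have "a0 = A"
  proof (rule ccontr)
    assume "a0 \<noteq> A"
    obtain S where S: "\<And>x. x \<epsilon> S \<longleftrightarrow> x \<epsilon> A \<and> \<not> x \<epsilon> a0"
      by (rule vsep[of "[a0]" "\<^bold>\<not> 1 \<^bold>\<in> 0" A "\<lambda>x. \<not> x \<epsilon> a0"]) auto
    have "S \<noteq> emp"
    proof
      assume "S = emp"
      then have "a0 = A" using S a0(2) by (intro extensionality) (metis not_emp)
      with \<open>a0 \<noteq> A\<close> show False by simp
    qed
    then obtain x where x: "x \<epsilon> S" "\<And>u. u \<epsilon> S \<Longrightarrow> \<not> opr u x \<epsilon> W"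
      using wf S unfolding wfr_def Sub_def by blast
    then have xA: "x \<epsilon> A" "\<not> x \<epsilon> a0" "x \<epsilon> T" using S ZF_Trn[OF T A] by blast+
    have below: "u \<epsilon> a0" if "opr u x \<epsilon> W" for u using x(2) S WA that by blast
    obtain p where p: "p \<epsilon> T" "Res W f0 x p" using Res_exists[OF T W f0(1) xA(3)] by blast
    then obtain y where y: "y \<epsilon> T" "R x p y" using R[OF xA(1)] Res_Sv[OF Fun_Sv[OF F0]] by blast
    let ?a = "adj a0 x" and ?f = "adj f0 (opr x y)"
    have aT: "?a \<epsilon> T" "?f \<epsilon> T" using a0(1) f0(1) xA(3) y(1) by (simp_all add: ZF_adj T ZF_opr)
    have old: "opr u v \<epsilon> ?f \<longleftrightarrow> opr u v \<epsilon> f0" if "u \<epsilon> a0" for u v using that xA(2) by auto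
    have res: "Res W ?f z q" if "Res W f0 z q" "\<And>u. opr u z \<epsilon> W \<Longrightarrow> u \<epsilon> a0" for z q
      using old that(2) by (intro Res_cong[OF that(1)]) blast
    have "App ?a ?f"
      unfolding App_def
    proof (intro conjI allI impI)
      show "Sub ?a A" using a0(2) xA(1) by (simp add: Sub_def)
      show "Fun ?f ?a" using F0 xA(2) by (rule Fun_adj)
      show "u \<epsilon> ?a" if "z \<epsilon> ?a \<and> opr u z \<epsilon> W" for z u
        using that below App0 unfolding App_def adj_iff by blast
      show "\<exists>p. p \<epsilon> T \<and> Res W ?f z p \<and> R z p v" if "opr z v \<epsilon> ?f" for z v
      proof (cases "z = x")
        case True
        then have "v = y" using that Fun_dom[OF F0] xA(2) unfolding adj_iff opr_inject by blast
        then show ?thesis using True p y res[OF p(2) below] by blast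
      next
        case False
        then have zv: "opr z v \<epsilon> f0" using that by simp
        then obtain q where q: "q \<epsilon> T" "Res W f0 z q" "R z q v" using App0 unfolding App_def by blast
        have "u \<epsilon> a0" if "opr u z \<epsilon> W" for u using that App0 Fun_dom[OF F0 zv] unfolding App_def by blast
        then show ?thesis using q res by blast
      qed
    qed
    then have "x \<epsilon> a0" using App_\<psi>[OF aT, of x] by simp
    with xA(2) show False by simp
  qed
  then show ?thesis using that[OF f0(1)] F0 App0 unfolding App_def by blast
qed

definition Rng :: "'a \<Rightarrow> 'a \<Rightarrow> bool" where "Rng f r \<longleftrightarrow> (\<forall>y. y \<epsilon> r \<longleftrightarrow> (\<exists>x. opr x y \<epsilon> f))"

definition is_rng :: "var \<Rightarrow> var \<Rightarrow> form" where
  "is_rng f r = (\<^bold>\<forall>y. y \<^bold>\<in> r \<^bold>\<longleftrightarrow> (\<^bold>\<exists>x. is_app f x y))"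

lemma fb_is_rng [simp]: "0 < n \<Longrightarrow> fb n (is_rng f r)"
  by (simp add: is_rng_def)

lemma h_rng [simp]:
  assumes T: "ZF T" and xs: "set xs \<subseteq> els T" "f < length xs" "r < length xs"
  shows "holds E (els T) xs (is_rng f r) \<longleftrightarrow> Rng (xs ! f) (xs ! r)"
proof -
  have A: "xs ! f \<epsilon> T" "xs ! r \<epsilon> T" using nth_in[OF xs(1)] xs by auto
  have "holds E (els T) xs (is_rng f r) \<longleftrightarrow> (\<forall>y\<in>els T. y \<epsilon> xs ! r \<longleftrightarrow> (\<exists>x\<in>els T. opr x y \<epsilon> xs ! f))"
    unfolding is_rng_def using assms by simp
  also have "\<dots> \<longleftrightarrow> Rng (xs ! f) (xs ! r)"
    unfolding Rng_def using ZF_Trn[OF T A(2)] ZF_app[OF T A(1)] by blast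
  finally show ?thesis .
qed

lemma ZF_rng:
  assumes T: "ZF T" "f \<epsilon> T"
  obtains r where "r \<epsilon> T" "Rng f r"
proof -
  have b: "big (big f) \<epsilon> T" using ZF_big T by blast
  obtain r where r: "r \<epsilon> T" "\<And>y. y \<epsilon> r \<longleftrightarrow> y \<epsilon> big (big f) \<and> (\<exists>x. opr x y \<epsilon> f)"
    by (rule ZF_sep[of T "[f]" "big (big f)" "\<^bold>\<exists>x. is_app 0 x 1" "\<lambda>y. \<exists>x. opr x y \<epsilon> f"])
      (use T b in \<open>simp_all add: bnd del: big_iff\<close>)
  have "y \<epsilon> big (big f)" if "opr x y \<epsilon> f" for x y
  proof -
    have "upr x y \<epsilon> opr x y" "y \<epsilon> upr x y" by (simp_all add: opr_def)
    then show ?thesis unfolding big_iff using that by blast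
  qed
  then show ?thesis using that[OF r(1)] r(2) unfolding Rng_def by blast
qed

lemma Rng_unique: "Rng f r \<Longrightarrow> Rng f r' \<Longrightarrow> r = r'"
  by (rule extensionality) (simp add: Rng_def)

text \<open>The recursion step takes the range of the restriction, so the value at \<open>x\<close>
  is the set of values at its \<open>W\<close>-predecessors.\<close>

lemma ZF_collapse:
  assumes T: "ZF T" and A: "A \<epsilon> T" and W: "W \<epsilon> T" and wf: "wfr A W" and WA: "\<And>u x. opr u x \<epsilon> W \<Longrightarrow> u \<epsilon> A"
  obtains s where "s \<epsilon> T" "Fun s A" "\<And>x y v. opr x y \<epsilon> s \<Longrightarrow> v \<epsilon> y \<longleftrightarrow> (\<exists>u. opr u x \<epsilon> W \<and> opr u v \<epsilon> s)"
proof -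
  obtain s where s: "s \<epsilon> T" "Fun s A" "\<And>x y. opr x y \<epsilon> s \<Longrightarrow> \<exists>p. p \<epsilon> T \<and> Res W s x p \<and> Rng p y"
  proof (rule ZF_wfrec[OF T A W wf WA, where xs = "[]" and F = "\<lambda>x p y. is_rng p y" and R = "\<lambda>x p y. Rng p y"])
    show "\<exists>!y. y \<epsilon> T \<and> Rng p y" if "p \<epsilon> T" for p
      using ZF_rng[OF T that] Rng_unique by metis
  qed (use T in auto)
  have "v \<epsilon> y \<longleftrightarrow> (\<exists>u. opr u x \<epsilon> W \<and> opr u v \<epsilon> s)" if "opr x y \<epsilon> s" for x y v
    using s(3)[OF that] unfolding Rng_def Res_def by (metis opr_inject)
  then show ?thesis using that s by blast
qed

lemma wfr_mem: "(\<And>u x. opr u x \<epsilon> W \<Longrightarrow> u \<epsilon> x) \<Longrightarrow> wfr A W"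
  unfolding wfr_def using foundation unfolding Fnd_def by blast

text \<open>Membership restricted to \<open>H\<close> is collapsed inside a model containing
  \<open>H\<close>. Extensionality is only needed relative to \<open>H\<close>, so \<open>H\<close>
  does not have to be transitive.\<close>

theorem mostowski:
  assumes ext: "\<And>x y. x \<epsilon> H \<Longrightarrow> y \<epsilon> H \<Longrightarrow> (\<And>z. z \<epsilon> H \<Longrightarrow> z \<epsilon> x \<longleftrightarrow> z \<epsilon> y) \<Longrightarrow> x = y"
  obtains \<pi> T where "Fun \<pi> H" "Rng \<pi> T" "Trn T" "\<And>x x' y. opr x y \<epsilon> \<pi> \<Longrightarrow> opr x' y \<epsilon> \<pi> \<Longrightarrow> x = x'"
    "\<And>x y v. opr x y \<epsilon> \<pi> \<Longrightarrow> v \<epsilon> y \<longleftrightarrow> (\<exists>u. u \<epsilon> H \<and> u \<epsilon> x \<and> opr u v \<epsilon> \<pi>)"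
    "\<And>x y u v. opr x y \<epsilon> \<pi> \<Longrightarrow> opr u v \<epsilon> \<pi> \<Longrightarrow> v \<epsilon> y \<longleftrightarrow> u \<epsilon> x"
proof -
  obtain Q where Q: "ZF Q" "H \<epsilon> Q" using Loc Mdl_ZF by blast
  obtain W where W: "W \<epsilon> Q" and W_iff: "\<And>u x. opr u x \<epsilon> W \<longleftrightarrow> u \<epsilon> H \<and> x \<epsilon> H \<and> u \<epsilon> x"
    by (rule ZF_rel[OF Q(1) Q(2,2), of "[]" "\<lambda>u x. u \<^bold>\<in> x" "\<lambda>u x. u \<epsilon> x"]) (simp_all add: that)
  obtain \<pi> where \<pi>: "\<pi> \<epsilon> Q" "Fun \<pi> H" "\<And>x y v. opr x y \<epsilon> \<pi> \<Longrightarrow> v \<epsilon> y \<longleftrightarrow> (\<exists>u. opr u x \<epsilon> W \<and> opr u v \<epsilon> \<pi>)"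
    using ZF_collapse[OF Q W wfr_mem] W_iff by metis
  have mem: "v \<epsilon> y \<longleftrightarrow> (\<exists>u. u \<epsilon> H \<and> u \<epsilon> x \<and> opr u v \<epsilon> \<pi>)" if "opr x y \<epsilon> \<pi>" for x y v
    using \<pi>(3)[OF that] Fun_dom[OF \<pi>(2) that] W_iff by blast
  obtain T where T: "Rng \<pi> T" using ZF_rng[OF Q(1) \<pi>(1)] by metis
  have "Trn T" unfolding Trn_def using T mem unfolding Rng_def by blast
  let ?P = "\<lambda>x. \<forall>x' y. opr x y \<epsilon> \<pi> \<longrightarrow> opr x' y \<epsilon> \<pi> \<longrightarrow> x = x'"
  \<comment> \<open>Membership induction on one argument only: elements in \<open>H\<close> of the
    two preimages collapse into the same set, and the induction hypothesis applies to those of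
    \<open>x\<close>.\<close>
  have inj: "?P x" if "x \<epsilon> H" for x
  proof (rule vind[of "[\<pi>]" "\<^bold>\<forall>x' y. is_app 0 1 y \<^bold>\<longrightarrow> is_app 0 x' y \<^bold>\<longrightarrow> 1 \<^bold>= x'" H ?P x, OF _ _ _ that])
    fix N x assume N: "ZF N" "set [\<pi>] \<subseteq> els N" "x \<epsilon> N"
    then have "(\<forall>x'\<in>els N. \<forall>y\<in>els N. opr x y \<epsilon> \<pi> \<longrightarrow> opr x' y \<epsilon> \<pi> \<longrightarrow> x = x') \<longleftrightarrow> ?P x"
      using ZF_app[OF N(1), of \<pi>] unfolding list.set by blast
    then show "holds E (els N) ([\<pi>] @ [x]) (\<^bold>\<forall>x' y. is_app 0 1 y \<^bold>\<longrightarrow> is_app 0 x' y \<^bold>\<longrightarrow> 1 \<^bold>= x') \<longleftrightarrow> ?P x"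
      using N by (simp del: all_simps ball_simps)
  next
    fix x assume x: "x \<epsilon> H" and IH: "\<And>y. y \<epsilon> H \<Longrightarrow> y \<epsilon> x \<Longrightarrow> ?P y"
    show "?P x"
    proof (intro allI impI)
      fix x' y assume xy: "opr x y \<epsilon> \<pi>" "opr x' y \<epsilon> \<pi>"
      then have x': "x' \<epsilon> H" using Fun_dom[OF \<pi>(2)] by blast
      show "x = x'"
      proof (rule ext[OF x x'])
        fix z assume z: "z \<epsilon> H"
        then obtain v where v: "opr z v \<epsilon> \<pi>" using Fun_ex[OF \<pi>(2)] by blast
        show "z \<epsilon> x \<longleftrightarrow> z \<epsilon> x'"
        proof
          assume "z \<epsilon> x"
          then have "v \<epsilon> y" using mem[OF xy(1)] z v by blast
          then obtain u where "u \<epsilon> x'" "opr u v \<epsilon> \<pi>" using mem[OF xy(2)] by blast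
          then show "z \<epsilon> x'" using IH[OF z \<open>z \<epsilon> x\<close>] v by blast
        next
          assume "z \<epsilon> x'"
          then have "v \<epsilon> y" using mem[OF xy(2)] z v by blast
          then obtain u where "u \<epsilon> H" "u \<epsilon> x" "opr u v \<epsilon> \<pi>" using mem[OF xy(1)] by blast
          then show "z \<epsilon> x" using IH[of u] v by blast
        qed
      qed
    qed
  qed simp
  have inj': "x = x'" if "opr x y \<epsilon> \<pi>" "opr x' y \<epsilon> \<pi>" for x x' y
    using inj Fun_dom[OF \<pi>(2)] that by blast
  have iso: "v \<epsilon> y \<longleftrightarrow> u \<epsilon> x" if "opr x y \<epsilon> \<pi>" "opr u v \<epsilon> \<pi>" for x y u v
    using mem[OF that(1)] that(2) inj' Fun_dom[OF \<pi>(2) that(2)] by blast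
  show ?thesis by (rule that[OF \<pi>(2) T \<open>Trn T\<close>]) (fact inj' mem iso)+
qed

text \<open>The axiom speaks of pairwise disjoint families, so each nonempty member is first tagged
  with itself; a transversal of the tagged family is the graph of a choice function.\<close>

lemma ZF_choice:
  assumes T: "ZF T" "a \<epsilon> T"
  obtains c where "c \<epsilon> T" "Sv c" "\<And>x y. opr x y \<epsilon> c \<Longrightarrow> x \<epsilon> a \<and> y \<epsilon> x" "\<And>x. x \<epsilon> a \<Longrightarrow> x \<noteq> emp \<Longrightarrow> \<exists>y. opr x y \<epsilon> c"
proof -
  obtain b where b: "b \<epsilon> T" "\<And>x. x \<epsilon> b \<longleftrightarrow> x \<epsilon> a \<and> x \<noteq> emp"
    by (rule ZF_sep[of T "[]" a "\<^bold>\<not> is_empty 0" "\<lambda>x. x \<noteq> emp"]) (use T in auto)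
  \<comment> \<open>The product of the singleton of \<open>x\<close> with \<open>x\<close>, as the
    disjoint copy of \<open>x\<close>.\<close>
  define G where "G x = mk {q. \<exists>y. y \<epsilon> x \<and> q = opr x y}" for x
  have G: "G x \<epsilon> T \<and> (\<forall>q. q \<epsilon> G x \<longleftrightarrow> (\<exists>y. y \<epsilon> x \<and> q = opr x y))" if x: "x \<epsilon> T" for x
  proof -
    obtain c where c: "c \<epsilon> T" "\<And>q. q \<epsilon> c \<longleftrightarrow> (\<exists>u y. u \<epsilon> upr x x \<and> y \<epsilon> x \<and> q = opr u y)"
      using ZF_prod[OF T(1) ZF_upr[OF T(1) x x] x] by metis
    then have "els c = {q. \<exists>y. y \<epsilon> x \<and> q = opr x y}" by (auto simp: els_def)
    then have "small {q. \<exists>y. y \<epsilon> x \<and> q = opr x y}" unfolding small_def by blast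
    then have "q \<epsilon> G x \<longleftrightarrow> (\<exists>y. y \<epsilon> x \<and> q = opr x y)" for q unfolding G_def by (simp add: mem_mk)
    moreover from this have "G x = c" by (intro extensionality) (use c(2) in auto)
    ultimately show ?thesis using c(1) by blast
  qed
  have bT: "x \<epsilon> T" if "x \<epsilon> b" for x using ZF_Trn[OF T(1) b(1) that] .
  obtain fam where fam: "fam \<epsilon> T" "\<And>z. z \<epsilon> fam \<longleftrightarrow> (\<exists>x. x \<epsilon> b \<and> z = G x)"
  proof (rule ZF_repl[of T "[]" b "\<^bold>\<forall>q. q \<^bold>\<in> 0 \<^bold>\<longleftrightarrow> (\<^bold>\<exists>y. y \<^bold>\<in> 1 \<^bold>\<and> is_pair 1 y q)" G])
    fix x z assume x: "x \<epsilon> b" "x \<epsilon> T" "z \<epsilon> T"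
    have 1: "(\<exists>y\<in>els T. y \<epsilon> x \<and> q = opr x y) \<longleftrightarrow> (\<exists>y. y \<epsilon> x \<and> q = opr x y)" for q
      using ZF_Trn[OF T(1) x(2)] by blast
    have "(\<forall>q\<in>els T. q \<epsilon> z \<longleftrightarrow> (\<exists>y. y \<epsilon> x \<and> q = opr x y)) \<longleftrightarrow> z = G x"
    proof
      assume *: "\<forall>q\<in>els T. q \<epsilon> z \<longleftrightarrow> (\<exists>y. y \<epsilon> x \<and> q = opr x y)"
      show "z = G x"
      proof (rule extensionality)
        fix q
        have "q \<epsilon> T" if "q \<epsilon> z \<or> q \<epsilon> G x" using that ZF_Trn[OF T(1)] x(3) G[OF x(2)] by blast
        then show "q \<epsilon> z \<longleftrightarrow> q \<epsilon> G x" using * G[OF x(2)] by (metis els_iff)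
      qed
    qed (use G[OF x(2)] in simp)
    then show "holds E (els T) ([] @ [z, x]) (\<^bold>\<forall>q. q \<^bold>\<in> 0 \<^bold>\<longleftrightarrow> (\<^bold>\<exists>y. y \<^bold>\<in> 1 \<^bold>\<and> is_pair 1 y q)) \<longleftrightarrow> z = G x"
      using x T by (simp add: 1 del: bex_simps ex_simps)
  qed (use T b G bT in auto)
  have "holds E (els T) [] ax_choice"
    using T(1) by (rule ZF_sentence) (simp_all add: zfc_def fb_sentences)
  then have "(\<forall>y\<in>els T. y \<epsilon> fam \<longrightarrow> y \<noteq> emp) \<and> (\<forall>y\<in>els T. \<forall>z\<in>els T. \<forall>u\<in>els T. y \<epsilon> fam \<and> z \<epsilon> fam \<and> u \<epsilon> y \<and> u \<epsilon> z \<longrightarrow> y = z)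
    \<longrightarrow> (\<exists>c\<in>els T. \<forall>y\<in>els T. y \<epsilon> fam \<longrightarrow> (\<exists>u\<in>els T. u \<epsilon> y \<and> u \<epsilon> c \<and> (\<forall>v\<in>els T. v \<epsilon> y \<and> v \<epsilon> c \<longrightarrow> v = u)))"
    using T(1) fam(1) by (simp add: ax_choice_def del: all_simps ball_simps ex_simps bex_simps)
  moreover have "\<forall>y\<in>els T. y \<epsilon> fam \<longrightarrow> y \<noteq> emp"
    using fam(2) G[OF bT] b(2) by (metis emp_iff)
  moreover have "\<forall>y\<in>els T. \<forall>z\<in>els T. \<forall>u\<in>els T. y \<epsilon> fam \<and> z \<epsilon> fam \<and> u \<epsilon> y \<and> u \<epsilon> z \<longrightarrow> y = z"
    using fam(2) G[OF bT] by (metis opr_inject)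
  ultimately obtain C where C: "C \<epsilon> T" "\<And>y. y \<epsilon> T \<Longrightarrow> y \<epsilon> fam \<Longrightarrow> \<exists>u\<in>els T. u \<epsilon> y \<and> u \<epsilon> C \<and> (\<forall>v\<in>els T. v \<epsilon> y \<and> v \<epsilon> C \<longrightarrow> v = u)"
    by auto
  obtain c where c: "c \<epsilon> T" "\<And>q. q \<epsilon> c \<longleftrightarrow> q \<epsilon> big fam \<and> q \<epsilon> C"
    by (rule ZF_sep[of T "[C]" "big fam" "1 \<^bold>\<in> 0" "\<lambda>q. q \<epsilon> C"]) (use T C(1) ZF_big[OF T(1) fam(1)] in auto)
  have c_iff: "opr x y \<epsilon> c \<longleftrightarrow> x \<epsilon> b \<and> y \<epsilon> x \<and> opr x y \<epsilon> C" for x y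
    unfolding c(2) big_iff fam(2) using G[OF bT] by (metis opr_inject)
  have ex1: "\<exists>!y. opr x y \<epsilon> c" if x: "x \<epsilon> b" for x
  proof -
    have GT: "G x \<epsilon> T" "G x \<epsilon> fam" using G[OF bT[OF x]] fam(2) x by blast+
    obtain u where u: "u \<epsilon> G x" "u \<epsilon> C" "\<forall>v\<in>els T. v \<epsilon> G x \<and> v \<epsilon> C \<longrightarrow> v = u" using C(2)[OF GT] by blast
    then obtain y where y: "y \<epsilon> x" "u = opr x y" using G[OF bT[OF x]] by blast
    show ?thesis
    proof
      show "opr x y \<epsilon> c" using c_iff x y u by simp
      fix z assume "opr x z \<epsilon> c"
      then have "z \<epsilon> x" "opr x z \<epsilon> C" using c_iff by auto
      moreover from this have "opr x z \<epsilon> G x" using G[OF bT[OF x]] by blast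
      moreover have "opr x z \<epsilon> T" using ZF_Trn[OF T(1) GT(1) \<open>opr x z \<epsilon> G x\<close>] .
      ultimately have "opr x z = u" using u(3) by simp
      then show "z = y" using y(2) by simp
    qed
  qed
  show ?thesis
  proof (rule that[OF c(1)])
    show "Sv c" unfolding Sv_def using ex1 c_iff by blast
    show "opr x y \<epsilon> c \<Longrightarrow> x \<epsilon> a \<and> y \<epsilon> x" for x y using c_iff b(2) by blast
    show "x \<epsilon> a \<Longrightarrow> x \<noteq> emp \<Longrightarrow> \<exists>y. opr x y \<epsilon> c" for x using ex1 b(2) by blast
  qed
qed

lemma ZF_dom:
  assumes T: "ZF T" "f \<epsilon> T"
  obtains d where "d \<epsilon> T" "\<And>x. x \<epsilon> d \<longleftrightarrow> (\<exists>y. opr x y \<epsilon> f)"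
proof -
  have b: "big (big f) \<epsilon> T" using ZF_big T by blast
  obtain d where d: "d \<epsilon> T" "\<And>x. x \<epsilon> d \<longleftrightarrow> x \<epsilon> big (big f) \<and> (\<exists>y. opr x y \<epsilon> f)"
    by (rule ZF_sep[of T "[f]" "big (big f)" "\<^bold>\<exists>y. is_app 0 1 y" "\<lambda>x. \<exists>y. opr x y \<epsilon> f"])
      (use T b in \<open>simp_all add: bnd del: big_iff\<close>)
  have "x \<epsilon> big (big f)" if "opr x y \<epsilon> f" for x y
  proof -
    have "upr x y \<epsilon> opr x y" "x \<epsilon> upr x y" by (simp_all add: opr_def)
    then show ?thesis unfolding big_iff using that by blast
  qed
  then show ?thesis using that[OF d(1)] d(2) by blast
qed

text \<open>Elements of \<open>A\<close> are chosen one after another from what remains. No Hartogs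
  number is needed to stop: a partial enumeration is determined by its range, a subset of
  \<open>A\<close>, so all of them form a set in \<open>T\<close>, and their union exhausts
  \<open>A\<close>.\<close>

theorem wellorder:
  assumes T: "ZF T" and A: "A \<epsilon> T"
  obtains \<eta> h where "h \<epsilon> T" "\<eta> \<epsilon> T" "Ord \<eta>" "Fun h \<eta>" "\<And>y. y \<epsilon> A \<longleftrightarrow> (\<exists>x. opr x y \<epsilon> h)"
proof -
  obtain p where p: "p \<epsilon> T" "\<And>z. z \<epsilon> p \<longleftrightarrow> z \<epsilon> T \<and> Sub z A" using ZF_pow[OF T A] by metis
  obtain c where c: "c \<epsilon> T" "Sv c" "\<And>x y. opr x y \<epsilon> c \<Longrightarrow> x \<epsilon> p \<and> y \<epsilon> x" "\<And>x. x \<epsilon> p \<Longrightarrow> x \<noteq> emp \<Longrightarrow> \<exists>y. opr x y \<epsilon> c"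
    using ZF_choice[OF T p(1)] by metis
  define Nx where "Nx x h Y \<longleftrightarrow> (\<forall>z. z \<epsilon> Y \<longleftrightarrow> z \<epsilon> A \<and> \<not> (\<exists>u. u \<epsilon> x \<and> opr u z \<epsilon> h))" for x h Y
  define Apx where "Apx \<xi> h \<longleftrightarrow> Ord \<xi> \<and> Fun h \<xi> \<and> (\<forall>x y. opr x y \<epsilon> h \<longrightarrow> (\<exists>Y. Nx x h Y \<and> opr Y y \<epsilon> c))" for \<xi> h
  define fApx where "fApx \<xi> h = (is_ord \<xi> \<^bold>\<and> is_fun h \<xi> \<^bold>\<and> (\<^bold>\<forall>x y. is_app h x y \<^bold>\<longrightarrow>
      (\<^bold>\<exists>Y. (\<^bold>\<forall>z. z \<^bold>\<in> Y \<^bold>\<longleftrightarrow> z \<^bold>\<in> 0 \<^bold>\<and> \<^bold>\<not> (\<^bold>\<exists>u. u \<^bold>\<in> x \<^bold>\<and> is_app h u z)) \<^bold>\<and> is_app 1 Y y)))" for \<xi> h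
  have fb_Apx: "0 < n \<Longrightarrow> fb n (fApx \<xi> h)" for n \<xi> h by (simp add: fApx_def)
  have h_Apx: "holds E (els T) (A # c # zs) (fApx \<xi> h) \<longleftrightarrow> Apx ((A # c # zs) ! \<xi>) ((A # c # zs) ! h)"
    if zs: "set zs \<subseteq> els T" "\<xi> < length (A # c # zs)" "h < length (A # c # zs)" for zs \<xi> h
  proof -
    define L where "L = A # c # zs"
    have L: "set L \<subseteq> els T" "\<xi> < length L" "h < length L" "0 < length L" "Suc 0 < length L" "L ! 0 = A" "L ! Suc 0 = c"
      using zs A c(1) by (auto simp: L_def)
    have in_T: "L ! \<xi> \<epsilon> T" "L ! h \<epsilon> T" using nth_in[OF L(1)] L by auto
    have 1: "(\<exists>u\<in>els T. u \<epsilon> x \<and> opr u z \<epsilon> L ! h) \<longleftrightarrow> (\<exists>u. u \<epsilon> x \<and> opr u z \<epsilon> L ! h)" for x z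
      using ZF_app[OF T in_T(2)] by blast
    have 2: "(\<forall>z\<in>els T. z \<epsilon> Y \<longleftrightarrow> z \<epsilon> A \<and> (\<forall>u. u \<epsilon> x \<longrightarrow> \<not> opr u z \<epsilon> L ! h)) \<longleftrightarrow> Nx x (L ! h) Y" if "Y \<epsilon> T" for x Y
      unfolding Nx_def using ZF_Trn[OF T that] ZF_Trn[OF T A] by blast
    have 3: "(\<forall>x\<in>els T. \<forall>y\<in>els T. opr x y \<epsilon> L ! h \<longrightarrow> P x y) \<longleftrightarrow> (\<forall>x y. opr x y \<epsilon> L ! h \<longrightarrow> P x y)" for P
      using ZF_app[OF T in_T(2)] by blast
    have 4: "(\<exists>Y\<in>els T. Nx x (L ! h) Y \<and> opr Y y \<epsilon> c) \<longleftrightarrow> (\<exists>Y. Nx x (L ! h) Y \<and> opr Y y \<epsilon> c)" for x y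
      using ZF_app[OF T c(1)] by blast
    have "holds E (els T) L (fApx \<xi> h) \<longleftrightarrow> Apx (L ! \<xi>) (L ! h)"
      unfolding fApx_def Apx_def using L T in_T by (simp add: 1 2 3 4 del: all_simps ball_simps ex_simps bex_simps)
    then show ?thesis by (simp only: L_def)
  qed
  have val: "y \<epsilon> A \<and> (\<forall>u. u \<epsilon> x \<longrightarrow> \<not> opr u y \<epsilon> h)" if h: "Apx \<xi> h" "opr x y \<epsilon> h" for \<xi> h x y
  proof -
    obtain Y where "Nx x h Y" "opr Y y \<epsilon> c" using h unfolding Apx_def by blast
    then show ?thesis using c(3) unfolding Nx_def by blast
  qed
  have agree: "y = y'" if h: "Apx \<xi> h" and h': "Apx \<xi>' h'" and y: "opr x y \<epsilon> h" "opr x y' \<epsilon> h'" for \<xi> h \<xi>' h' x y y'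
  proof -
    let ?P = "\<lambda>x. \<forall>y y'. opr x y \<epsilon> h \<longrightarrow> opr x y' \<epsilon> h' \<longrightarrow> y = y'"
    have F: "Fun h \<xi>" "Fun h' \<xi>'" "Ord \<xi>" "Ord \<xi>'" using h h' by (auto simp: Apx_def)
    have "?P x"
    proof (rule vind[of "[h, h']" "\<^bold>\<forall>y y'. is_app 0 2 y \<^bold>\<longrightarrow> is_app 1 2 y' \<^bold>\<longrightarrow> y \<^bold>= y'" \<xi> ?P x, OF _ _ _ Fun_dom[OF F(1) y(1)]])
      fix N x assume N: "ZF N" "set [h, h'] \<subseteq> els N" "x \<epsilon> N"
      have hN: "h \<epsilon> N" "h' \<epsilon> N" using N by simp_all
      have "(\<forall>y\<in>els N. \<forall>y'\<in>els N. opr x y \<epsilon> h \<longrightarrow> opr x y' \<epsilon> h' \<longrightarrow> y = y') \<longleftrightarrow> ?P x"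
        using ZF_app[OF N(1) hN(1)] ZF_app[OF N(1) hN(2)] by blast
      then show "holds E (els N) ([h, h'] @ [x]) (\<^bold>\<forall>y y'. is_app 0 2 y \<^bold>\<longrightarrow> is_app 1 2 y' \<^bold>\<longrightarrow> y \<^bold>= y') \<longleftrightarrow> ?P x"
        using N by (simp del: all_simps ball_simps)
    next
      fix x assume x: "x \<epsilon> \<xi>" and IH: "\<And>u. u \<epsilon> \<xi> \<Longrightarrow> u \<epsilon> x \<Longrightarrow> ?P u"
      show "?P x"
      proof (intro allI impI)
        fix y y' assume y: "opr x y \<epsilon> h" "opr x y' \<epsilon> h'"
        obtain Y Y' where Y: "Nx x h Y" "opr Y y \<epsilon> c" "Nx x h' Y'" "opr Y' y' \<epsilon> c"
          using h h' y unfolding Apx_def by blast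
        have "opr u z \<epsilon> h \<longleftrightarrow> opr u z \<epsilon> h'" if u: "u \<epsilon> x" for u z
        proof -
          have "u \<epsilon> \<xi>" "u \<epsilon> \<xi>'" using Ord_Trn[OF F(3) x u] Ord_Trn[OF F(4) Fun_dom[OF F(2) y(2)] u] .
          then obtain w w' where w: "opr u w \<epsilon> h" "opr u w' \<epsilon> h'" using Fun_ex F by blast
          then have "w = w'" using IH[OF \<open>u \<epsilon> \<xi>\<close> u] by blast
          then show ?thesis using w FunD F by blast
        qed
        then have "Y = Y'" using Y(1,3) unfolding Nx_def by (intro extensionality) metis
        then show "y = y'" using Y(2,4) c(2) unfolding Sv_def by blast
      qed
    qed simp
    then show ?thesis using y by blast
  qed
  have inj: "x = x'" if h: "Apx \<xi> h" "opr x y \<epsilon> h" "opr x' y \<epsilon> h" for \<xi> h x x' y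
  proof -
    have "Ord \<xi>" "x \<epsilon> \<xi>" "x' \<epsilon> \<xi>" using h Fun_dom unfolding Apx_def by blast+
    then have "x \<epsilon> x' \<or> x = x' \<or> x' \<epsilon> x" using Ord_trich Ord_mem by blast
    then show ?thesis using val h by blast
  qed
  \<comment> \<open>Were one enumeration longer, its value at the end of the shorter one would
    already occur earlier, by agreement and equality of ranges, against injectivity.\<close>
  have rng_less: "\<not> \<xi> \<epsilon> \<xi>'" if h: "Apx \<xi> h" "Rng h I" and h': "Apx \<xi>' h'" "Rng h' I" for \<xi> h I \<xi>' h'
  proof
    assume \<xi>: "\<xi> \<epsilon> \<xi>'"
    have F: "Fun h \<xi>" "Fun h' \<xi>'" "Ord \<xi>'" using h h' by (auto simp: Apx_def)
    obtain y where y: "opr \<xi> y \<epsilon> h'" using Fun_ex[OF F(2) \<xi>] by blast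
    then obtain u where u: "opr u y \<epsilon> h" using h(2) h'(2) unfolding Rng_def by blast
    then have "u \<epsilon> \<xi>" using Fun_dom[OF F(1)] by blast
    then have "u \<epsilon> \<xi>'" using Ord_Trn[OF F(3) \<xi>] by blast
    then obtain y' where y': "opr u y' \<epsilon> h'" using Fun_ex[OF F(2)] by blast
    then have "y = y'" using agree h(1) h'(1) u by blast
    then have "u = \<xi>" using inj[OF h'(1)] y y' by blast
    then show False using \<open>u \<epsilon> \<xi>\<close> no_loop by blast
  qed
  have rng_unique: "h = h'" if h: "Apx \<xi> h" "Rng h I" and h': "Apx \<xi>' h'" "Rng h' I" for \<xi> h I \<xi>' h'
  proof -
    have F: "Fun h \<xi>" "Fun h' \<xi>'" "Ord \<xi>" "Ord \<xi>'" using h h' by (auto simp: Apx_def)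
    have "\<xi> = \<xi>'" using rng_less h h' Ord_trich[OF F(3,4)] by blast
    have "q \<epsilon> h \<Longrightarrow> q \<epsilon> h'" for q
      using Fun_pair[OF F(1)] Fun_ex[OF F(2)] agree[OF h(1) h'(1)] \<open>\<xi> = \<xi>'\<close> by metis
    moreover have "q \<epsilon> h' \<Longrightarrow> q \<epsilon> h" for q
      using Fun_pair[OF F(2)] Fun_ex[OF F(1)] agree[OF h(1) h'(1)] \<open>\<xi> = \<xi>'\<close> by metis
    ultimately show ?thesis by (intro extensionality) blast
  qed
  have dom_T: "\<xi> \<epsilon> T" if "h \<epsilon> T" "Fun h \<xi>" for h \<xi>
  proof -
    obtain d where d: "d \<epsilon> T" "\<And>x. x \<epsilon> d \<longleftrightarrow> (\<exists>y. opr x y \<epsilon> h)" using ZF_dom[OF T \<open>h \<epsilon> T\<close>] by metis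
    have "x \<epsilon> d \<longleftrightarrow> x \<epsilon> \<xi>" for x using d(2) Fun_dom[OF that(2)] Fun_ex[OF that(2)] by blast
    then have "d = \<xi>" by (rule extensionality)
    with d(1) show ?thesis by simp
  qed
  \<comment> \<open>The ranges are separated from the power set, and replacement then maps each
    range to its unique enumeration.\<close>
  obtain \<I> where \<I>: "\<I> \<epsilon> T" "\<And>I. I \<epsilon> \<I> \<longleftrightarrow> I \<epsilon> p \<and> (\<exists>\<xi>\<in>els T. \<exists>h\<in>els T. Apx \<xi> h \<and> Rng h I)"
  proof (rule ZF_sep[of T "[A, c]" p "\<^bold>\<exists>\<xi> h. fApx \<xi> h \<^bold>\<and> is_rng h 2"])
    fix I assume I: "I \<epsilon> T"
    have "holds E (els T) (A # c # [I, \<xi>, h]) (fApx 3 4) \<longleftrightarrow> Apx \<xi> h" if "\<xi> \<epsilon> T" "h \<epsilon> T" for \<xi> h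
      using h_Apx[of "[I, \<xi>, h]" 3 4] I that by simp
    then show "holds E (els T) ([A, c] @ [I]) (\<^bold>\<exists>\<xi> h. fApx \<xi> h \<^bold>\<and> is_rng h 2) \<longleftrightarrow> (\<exists>\<xi>\<in>els T. \<exists>h\<in>els T. Apx \<xi> h \<and> Rng h I)"
      using I T A c(1) by (simp add: eval_nat_numeral del: ex_simps bex_simps)
  qed (use T A c(1) p fb_Apx in auto)
  define G where "G I = (THE h. \<exists>\<xi>. Apx \<xi> h \<and> Rng h I)" for I
  have G: "G I = h" if "Apx \<xi> h" "Rng h I" for I \<xi> h
    unfolding G_def using that rng_unique by (intro the_equality) blast+
  obtain \<H> where \<H>: "\<H> \<epsilon> T" "\<And>h. h \<epsilon> \<H> \<longleftrightarrow> (\<exists>I. I \<epsilon> \<I> \<and> h = G I)"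
  proof (rule ZF_repl[of T "[A, c]" \<I> "\<^bold>\<exists>\<xi>. fApx \<xi> 2 \<^bold>\<and> is_rng 2 3" G])
    fix I h assume I: "I \<epsilon> \<I>" "I \<epsilon> T" "h \<epsilon> T"
    then obtain \<xi> h' where h': "\<xi> \<epsilon> T" "h' \<epsilon> T" "Apx \<xi> h'" "Rng h' I" using \<I>(2) by auto
    have "holds E (els T) (A # c # [h, I, \<xi>]) (fApx 4 2) \<longleftrightarrow> Apx \<xi> h" if "\<xi> \<epsilon> T" for \<xi>
      using h_Apx[of "[h, I, \<xi>]" 4 2] I that by simp
    then have "holds E (els T) ([A, c] @ [h, I]) (\<^bold>\<exists>\<xi>. fApx \<xi> 2 \<^bold>\<and> is_rng 2 3) \<longleftrightarrow> (\<exists>\<xi>\<in>els T. Apx \<xi> h \<and> Rng h I)"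
      using I T A c(1) by (simp add: eval_nat_numeral del: ex_simps bex_simps)
    also have "\<dots> \<longleftrightarrow> h = G I" unfolding G[OF h'(3,4)] using h' rng_unique by blast
    finally show "holds E (els T) ([A, c] @ [h, I]) (\<^bold>\<exists>\<xi>. fApx \<xi> 2 \<^bold>\<and> is_rng 2 3) \<longleftrightarrow> h = G I" .
  next
    fix I assume "I \<epsilon> \<I>"
    then show "G I \<epsilon> T" using \<I>(2) G by auto
  qed (use T A c(1) \<I> fb_Apx in auto)
  define h where "h = big \<H>"
  have hT: "h \<epsilon> T" using ZF_big[OF T \<H>(1)] by (simp add: h_def)
  have \<H>_iff: "k \<epsilon> \<H> \<longleftrightarrow> k \<epsilon> T \<and> (\<exists>\<xi>. Apx \<xi> k)" for k
  proof
    assume "k \<epsilon> \<H>"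
    then obtain I \<xi> k' where "k' \<epsilon> T" "Apx \<xi> k'" "Rng k' I" "k = G I" using \<H>(2) \<I>(2) by auto
    then show "k \<epsilon> T \<and> (\<exists>\<xi>. Apx \<xi> k)" using G by auto
  next
    assume "k \<epsilon> T \<and> (\<exists>\<xi>. Apx \<xi> k)"
    then obtain \<xi> where k: "k \<epsilon> T" "Apx \<xi> k" by blast
    obtain I where I: "I \<epsilon> T" "Rng k I" using ZF_rng[OF T k(1)] by metis
    have "Sub I A" using I(2) val[OF k(2)] unfolding Sub_def Rng_def by blast
    moreover have "\<xi> \<epsilon> T" using dom_T k unfolding Apx_def by blast
    ultimately have "I \<epsilon> \<I>" using \<I>(2) p(2) I k by auto
    then show "k \<epsilon> \<H>" using \<H>(2) G[OF k(2) I(2)] by blast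
  qed
  have mem_h: "q \<epsilon> h \<longleftrightarrow> (\<exists>\<xi> k. k \<epsilon> T \<and> Apx \<xi> k \<and> q \<epsilon> k)" for q
    unfolding h_def big_iff \<H>_iff by blast
  have Sv: "opr x y \<epsilon> h \<Longrightarrow> opr x y' \<epsilon> h \<Longrightarrow> y = y'" for x y y' using mem_h agree by blast
  obtain \<eta> where \<eta>: "\<eta> \<epsilon> T" and \<eta>_iff: "\<And>x. x \<epsilon> \<eta> \<longleftrightarrow> (\<exists>y. opr x y \<epsilon> h)"
    using ZF_dom[OF T hT] by metis
  have below: "opr u z \<epsilon> h \<longleftrightarrow> opr u z \<epsilon> k" if k: "k \<epsilon> T" "Apx \<xi> k" "u \<epsilon> \<xi>" for u z k \<xi>
  proof -
    have "Fun k \<xi>" using k(2) by (simp add: Apx_def)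
    then obtain w where w: "opr u w \<epsilon> k" using Fun_ex k(3) by blast
    then have "opr u w \<epsilon> h" using mem_h k by blast
    then show ?thesis using w Sv mem_h k by blast
  qed
  have Fh: "Fun h \<eta>"
  proof (rule FunI)
    show "x \<epsilon> \<eta> \<Longrightarrow> \<exists>y. opr x y \<epsilon> h" for x using \<eta>_iff by blast
    show "\<exists>x y. x \<epsilon> \<eta> \<and> q = opr x y" if q: "q \<epsilon> h" for q
    proof -
      obtain \<xi> k where k: "k \<epsilon> T" "Apx \<xi> k" "q \<epsilon> k" using q mem_h by blast
      then have "Fun k \<xi>" by (simp add: Apx_def)
      then obtain x y where "q = opr x y" using Fun_pair k(3) by blast
      then show ?thesis using q \<eta>_iff by blast
    qed
  qed (rule Sv)
  have "Ord \<eta>"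
  proof (rule Ord_of_Trn)
    have *: "Ord x \<and> (\<forall>u. u \<epsilon> x \<longrightarrow> u \<epsilon> \<eta>)" if x: "x \<epsilon> \<eta>" for x
    proof -
      obtain \<xi> k y where k: "k \<epsilon> T" "Apx \<xi> k" "opr x y \<epsilon> k" using x \<eta>_iff mem_h by blast
      then have F: "Fun k \<xi>" "Ord \<xi>" by (auto simp: Apx_def)
      then have "x \<epsilon> \<xi>" using Fun_dom k(3) by blast
      then show ?thesis using Ord_mem[OF F(2)] Ord_Trn[OF F(2)] Fun_ex[OF F(1)] k mem_h \<eta>_iff by metis
    qed
    then show "Trn \<eta>" "\<And>y. y \<epsilon> \<eta> \<Longrightarrow> Ord y" unfolding Trn_def by blast+
  qed
  have Apx_h: "Apx \<eta> h"
    unfolding Apx_def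
  proof (intro conjI allI impI)
    fix x y assume "opr x y \<epsilon> h"
    then obtain \<xi> k where k: "k \<epsilon> T" "Apx \<xi> k" "opr x y \<epsilon> k" using mem_h by blast
    then obtain Y where Y: "Nx x k Y" "opr Y y \<epsilon> c" unfolding Apx_def by blast
    have "Ord \<xi>" "x \<epsilon> \<xi>" using k Fun_dom unfolding Apx_def by blast+
    then have "u \<epsilon> \<xi>" if "u \<epsilon> x" for u using Ord_Trn that by blast
    then have "Nx x h Y" using Y(1) below[OF k(1,2)] unfolding Nx_def by blast
    then show "\<exists>Y. Nx x h Y \<and> opr Y y \<epsilon> c" using Y(2) by blast
  qed fact+
  have "z \<epsilon> A \<longleftrightarrow> (\<exists>x. opr x z \<epsilon> h)" for z
  proof
    show "\<exists>x. opr x z \<epsilon> h \<Longrightarrow> z \<epsilon> A" using val[OF Apx_h] by blast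
    assume z: "z \<epsilon> A"
    show "\<exists>x. opr x z \<epsilon> h"
    proof (rule ccontr)
      assume nz: "\<nexists>x. opr x z \<epsilon> h"
      \<comment> \<open>If \<open>z\<close> is missed, the remainder \<open>Y\<close> is nonempty
        and a choice from it extends \<open>h\<close> at \<open>\<eta>\<close>. The longer
        enumeration would be part of \<open>h\<close>, putting \<open>\<eta>\<close> into
        itself.\<close>
      obtain Y where Y: "Y \<epsilon> T" "\<And>z. z \<epsilon> Y \<longleftrightarrow> z \<epsilon> A \<and> \<not> (\<exists>x. opr x z \<epsilon> h)"
        by (rule ZF_sep[of T "[h]" A "\<^bold>\<not> (\<^bold>\<exists>x. is_app 0 x 1)" "\<lambda>z. \<not> (\<exists>x. opr x z \<epsilon> h)"])
          (use T A hT in \<open>simp_all add: bnd\<close>)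
      have "Y \<epsilon> p" using Y p(2) by (simp add: Sub_def)
      moreover have "Y \<noteq> emp" using Y(2)[of z] z nz by auto
      ultimately obtain y where y: "opr Y y \<epsilon> c" using c(4) by blast
      let ?h = "adj h (opr \<eta> y)"
      have yT: "y \<epsilon> T" using y ZF_app[OF T c(1)] by blast
      have "?h \<epsilon> T" using ZF_adj[OF T hT] yT \<eta> by (simp add: ZF_opr[OF T])
      moreover have "Apx (suc \<eta>) ?h"
        unfolding Apx_def
      proof (intro conjI allI impI)
        show "Ord (suc \<eta>)" using \<open>Ord \<eta>\<close> by (rule Ord_suc)
        show "Fun ?h (suc \<eta>)" unfolding suc_def using Fh no_loop by (rule Fun_adj)
        have old: "opr u w \<epsilon> ?h \<longleftrightarrow> opr u w \<epsilon> h" if "u \<epsilon> \<eta>" for u w using that no_loop by auto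
        fix x v assume xv: "opr x v \<epsilon> ?h"
        show "\<exists>Y. Nx x ?h Y \<and> opr Y v \<epsilon> c"
        proof (cases "x = \<eta>")
          case True
          then have "v = y" using xv Fun_dom[OF Fh] no_loop unfolding adj_iff opr_inject by blast
          moreover have "Nx x ?h Y" using Y(2) old Fun_dom[OF Fh] True unfolding Nx_def by metis
          ultimately show ?thesis using y by blast
        next
          case False
          then have "opr x v \<epsilon> h" using xv by simp
          then obtain Z where Z: "Nx x h Z" "opr Z v \<epsilon> c" "x \<epsilon> \<eta>" using Apx_h Fun_dom[OF Fh] unfolding Apx_def by blast
          then have "u \<epsilon> \<eta>" if "u \<epsilon> x" for u using Ord_Trn[OF \<open>Ord \<eta>\<close>] that by blast
          then have "Nx x ?h Z" using Z(1) old unfolding Nx_def by blast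
          then show ?thesis using Z(2) by blast
        qed
      qed
      ultimately have "opr \<eta> y \<epsilon> h" unfolding mem_h by (intro exI[of _ "suc \<eta>"] exI[of _ ?h]) simp
      then show False using \<eta>_iff no_loop by blast
    qed
  qed
  then show ?thesis using that[OF hT \<eta> \<open>Ord \<eta>\<close> Fh] by blast
qed

section \<open>Transfer of axioms and internal truth of standard formulas\<close>

lemma valid_Forall:
  "(\<forall>v. (\<forall>i. v i \<in> A) \<longrightarrow> ev E A p v) \<longleftrightarrow> (\<forall>v. (\<forall>i. v i \<in> A) \<longrightarrow> ev E A (Forall p) v)"
proof
  assume *: "\<forall>v. (\<forall>i. v i \<in> A) \<longrightarrow> ev E A p v"
  show "\<forall>v. (\<forall>i. v i \<in> A) \<longrightarrow> ev E A (Forall p) v"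
  proof (intro allI impI)
    fix v :: "nat \<Rightarrow> 'a" assume v: "\<forall>i. v i \<in> A"
    have "ev E A p (case_nat d v)" if "d \<in> A" for d
    proof -
      have "\<forall>i. case_nat d v i \<in> A" using v that by (simp split: nat.split)
      then show ?thesis by (rule spec[OF *, of "case_nat d v", THEN mp])
    qed
    then show "ev E A (Forall p) v" by simp
  qed
next
  assume *: "\<forall>v. (\<forall>i. v i \<in> A) \<longrightarrow> ev E A (Forall p) v"
  show "\<forall>v. (\<forall>i. v i \<in> A) \<longrightarrow> ev E A p v"
  proof (intro allI impI)
    fix v :: "nat \<Rightarrow> 'a" assume v: "\<forall>i. v i \<in> A"
    then have "\<forall>i. v (Suc i) \<in> A" by blast
    then have "ev E A (Forall p) (\<lambda>i. v (Suc i))" by (rule spec[OF *, of "\<lambda>i. v (Suc i)", THEN mp])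
    then have "ev E A p (case_nat (v 0) (\<lambda>i. v (Suc i)))" using v by simp
    moreover have "case_nat (v 0) (\<lambda>i. v (Suc i)) = v" by (auto split: nat.split)
    ultimately show "ev E A p v" by simp
  qed
qed

lemma valid_closure:
  "(\<forall>v. (\<forall>i. v i \<in> A) \<longrightarrow> ev E A p v) \<longleftrightarrow> (\<forall>v. (\<forall>i. v i \<in> A) \<longrightarrow> ev E A ((Forall ^^ k) p) v)"
proof (induction k)
  case (Suc k)
  have "(\<forall>v. (\<forall>i. v i \<in> A) \<longrightarrow> ev E A ((Forall ^^ k) p) v) \<longleftrightarrow>
      (\<forall>v. (\<forall>i. v i \<in> A) \<longrightarrow> ev E A (Forall ((Forall ^^ k) p)) v)"
    by (rule valid_Forall)
  then show ?case unfolding Suc.IH funpow.simps o_apply .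
qed simp

text \<open>Axiom instances with parameters are turned into sentences by universal closure, so
  agreement on sentences is enough.\<close>

lemma ZF_transfer:
  assumes "ZF T" "Trn T'" "T' \<noteq> emp" and eq: "\<And>p v. free_below 0 p \<Longrightarrow> ev E (els T) p v \<longleftrightarrow> ev E (els T') p v"
  shows "ZF T'"
  unfolding ZF_def
proof (intro conjI ballI)
  fix p assume "p \<in> zfc"
  obtain k where k: "free_below k p" using free_below_exists by blast
  let ?q = "(Forall ^^ k) p"
  have q: "free_below 0 ?q" using k by (simp add: free_below_funpow_Forall)
  have "\<forall>v. (\<forall>i. v i \<in> els T) \<longrightarrow> ev E (els T) p v" using assms(1) \<open>p \<in> zfc\<close> by (auto simp: ZF_def)
  then have 1: "\<forall>v. (\<forall>i. v i \<in> els T) \<longrightarrow> ev E (els T) ?q v" using valid_closure by blast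
  have "ev E (els T) ?q (\<lambda>i. emp)" using 1 ZF_emp[OF assms(1)] by simp
  then have "ev E (els T') ?q v" for v using eq[OF q] ev_cong[OF q] by blast
  then have "\<forall>v. (\<forall>i. v i \<in> els T') \<longrightarrow> ev E (els T') p v" using valid_closure by blast
  then show "\<forall>v. (\<forall>i. v i \<epsilon> T') \<longrightarrow> ev E (els T') p v" by simp
qed (use assms in auto)

lemma tarski_vaught:
  assumes "H \<subseteq> P" and wit: "\<And>q v. (\<And>i. v i \<in> H) \<Longrightarrow> \<exists>d\<in>P. ev E P q (case_nat d v) \<Longrightarrow> \<exists>d\<in>H. ev E P q (case_nat d v)"
  shows "(\<And>i. v i \<in> H) \<Longrightarrow> ev E H p v \<longleftrightarrow> ev E P p v"
proof (induction p arbitrary: v)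
  case (Forall p)
  have IH: "ev E H p (case_nat d v) \<longleftrightarrow> ev E P p (case_nat d v)" if "d \<in> H" for d
    using Forall.prems that by (intro Forall.IH) (auto split: nat.split)
  have "\<exists>d\<in>H. ev E P (Neg p) (case_nat d v)" if "\<exists>d\<in>P. ev E P (Neg p) (case_nat d v)"
    using wit[of v "Neg p"] Forall.prems that by blast
  then show ?case using IH assms(1) by auto
qed auto

text \<open>\<open>Sat\<close> could fail for want of a truth sequence; one is built in any model
  that contains \<open>M\<close>.\<close>

lemma Sat_std:
  assumes "nb m p" "length xs = m" "set xs \<subseteq> els M"
  shows "Sat M (nu m) (code p) (lseq xs) \<longleftrightarrow> nsat E (els M) p (\<lambda>i. xs ! i)"
proof
  show "Sat M (nu m) (code p) (lseq xs) \<Longrightarrow> nsat E (els M) p (\<lambda>i. xs ! i)" using Sat_truth assms(2) by blast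
  assume *: "nsat E (els M) p (\<lambda>i. xs ! i)"
  obtain T where T: "ZF T" "M \<epsilon> T" using Loc Mdl_ZF by blast
  obtain n f k where f: "Cons (nu m) n f" "k \<epsilon> n" "opr k (code p) \<epsilon> f" using Fml_code[OF assms(1)] unfolding Fml_def by blast
  obtain s where s: "TSq M (nu m) n f s" using TSq_exists[OF T _ f(1)] by auto
  then obtain S where S: "opr k S \<epsilon> s" using Fun_ex f(2) unfolding TSq_def by blast
  have "lseq xs \<epsilon> S" using TSq_truth[OF s f(2,3) S] assms * by blast
  then show "Sat M (nu m) (code p) (lseq xs)" unfolding Sat_def using s f S Nt_nu by blast
qed

lemma named_fm:
  obtains m p where "l \<le> m" "nb m p" "\<And>A v. nsat E A p v \<longleftrightarrow> ev E A q v"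
proof -
  obtain k where k: "free_below k q" using free_below_exists by blast
  let ?p = "named (\<lambda>i. i) k q"
  obtain m where "l \<le> m" "nb m ?p" using nb_exists by blast
  then show ?thesis using that nsat_named[OF k, of "\<lambda>i. i" k] by blast
qed

lemma nth_map_case:
  "i < m \<Longrightarrow> (d # map v [0..<m - 1]) ! i = case_nat d v i"
  by (cases i) auto

text \<open>The code and its bound depend on \<open>q\<close> alone. This uniformity in
  \<open>M\<close> is what lets one coded formula be compared in a model and in its image under an
  embedding.\<close>

lemma Sat_fm:
  obtains m p where "0 < m" "nb m p" "\<And>M d v. d \<epsilon> M \<Longrightarrow> (\<And>i. v i \<epsilon> M) \<Longrightarrow>
    Sat M (nu m) (code p) (lseq (d # map v [0..<m - 1])) \<longleftrightarrow> ev E (els M) q (case_nat d v)"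
proof -
  obtain m p where m: "1 \<le> m" "nb m p" and p: "\<And>A v. nsat E A p v \<longleftrightarrow> ev E A q v" using named_fm by blast
  have "Sat M (nu m) (code p) (lseq (d # map v [0..<m - 1])) \<longleftrightarrow> ev E (els M) q (case_nat d v)"
    if "d \<epsilon> M" "\<And>i. v i \<epsilon> M" for M d v
  proof -
    let ?xs = "d # map v [0..<m - 1]"
    have "Sat M (nu m) (code p) (lseq ?xs) \<longleftrightarrow> nsat E (els M) p (\<lambda>i. ?xs ! i)"
      using m that by (intro Sat_std) auto
    also have "\<dots> \<longleftrightarrow> nsat E (els M) p (case_nat d v)"
      by (rule nsat_cong[OF m(2)]) (rule nth_map_case)
    finally show ?thesis using p by simp
  qed
  then show ?thesis using that[of m p] m by simp
qed

end

section \<open>Hulls and the constructible power set\<close>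

context bst
begin

section \<open>Assignments of possibly nonstandard length\<close>

lemma Map_update:
  assumes "Map a m M" "i \<epsilon> m" "d \<epsilon> M"
  obtains b where "Map b m M" "opr i d \<epsilon> b" "Agr m i a b"
proof -
  obtain a' where a': "\<And>q. q \<epsilon> a' \<longleftrightarrow> q \<epsilon> a \<and> \<not> (\<exists>y. q = opr i y)"
    by (rule vsep[of "[i]" "\<^bold>\<not> (\<^bold>\<exists>y. is_pair 0 y 1)" a "\<lambda>q. \<not> (\<exists>y. q = opr i y)"]) (simp, simp add: bnd, blast)
  let ?b = "adj a' (opr i d)"
  have F: "Fun a m" and M: "\<And>x y. opr x y \<epsilon> a \<Longrightarrow> y \<epsilon> M" using assms(1) by (auto simp: Map_def)
  have b: "opr x y \<epsilon> ?b \<longleftrightarrow> (if x = i then y = d else opr x y \<epsilon> a)" for x y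
    using a' by auto
  have "Fun ?b m"
  proof (rule FunI)
    show "p \<epsilon> ?b \<Longrightarrow> \<exists>x y. x \<epsilon> m \<and> p = opr x y" for p
      using a' Fun_pair[OF F] assms(2) unfolding adj_iff by blast
    show "x \<epsilon> m \<Longrightarrow> \<exists>y. opr x y \<epsilon> ?b" for x unfolding b using Fun_ex[OF F] by auto
    show "opr x y \<epsilon> ?b \<Longrightarrow> opr x z \<epsilon> ?b \<Longrightarrow> y = z" for x y z unfolding b using FunD[OF F] by (auto split: if_splits)
  qed
  moreover have "y \<epsilon> M" if "opr x y \<epsilon> ?b" for x y using that M assms(3) unfolding b by (auto split: if_splits)
  ultimately have "Map ?b m M" by (simp add: Map_def)
  moreover have "opr i d \<epsilon> ?b" by simp
  moreover have "Agr m i a ?b" unfolding Agr_def b by simp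
  ultimately show ?thesis using that by blast
qed

text \<open>The external assignment induced by an internal one, which is read only at standard
  variables even if its domain is a nonstandard number.\<close>

definition aval :: "'a \<Rightarrow> nat \<Rightarrow> 'a" where "aval a i = (THE y. opr (nu i) y \<epsilon> a)"

lemma aval:
  assumes "Map a m M" "nu i \<epsilon> m"
  shows "opr (nu i) y \<epsilon> a \<longleftrightarrow> y = aval a i" "aval a i \<epsilon> M"
proof -
  have F: "Fun a m" using assms(1) by (simp add: Map_def)
  obtain z where z: "opr (nu i) z \<epsilon> a" using Fun_ex[OF F assms(2)] by blast
  then have "aval a i = z" unfolding aval_def using FunD[OF F] by (intro the_equality) blast+
  then show "opr (nu i) y \<epsilon> a \<longleftrightarrow> y = aval a i" "aval a i \<epsilon> M"
    using z FunD[OF F] assms(1) unfolding Map_def by blast+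
qed

lemma aval_lseq: "i < length xs \<Longrightarrow> aval (lseq xs) i = xs ! i"
  unfolding aval_def by (intro the_equality) auto

text \<open>Internal assignments can no longer be listed, but an external formula inspects only
  standard variables. Changing one of them is possible within the internal assignments by
  \<open>Map_update\<close>.\<close>

lemma TSq_truth_nonstandard:
  assumes s: "TSq M m n f s" and m: "\<And>i. nu i \<epsilon> m"
  shows "k \<epsilon> n \<Longrightarrow> opr k (code p) \<epsilon> f \<Longrightarrow> opr k S \<epsilon> s \<Longrightarrow>
    a \<epsilon> S \<longleftrightarrow> Map a m M \<and> nsat E (els M) p (aval a)"
proof (induction p arbitrary: k S a)
  case (NMem i j)
  then have "TC M m f s k (code (NMem i j)) S" using s unfolding TSq_def by blast
  then have "TS M m S (\<lambda>a. \<exists>x y. opr (nu i) x \<epsilon> a \<and> opr (nu j) y \<epsilon> a \<and> x \<epsilon> y)" by (auto simp: TC_def)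
  then show ?case unfolding TS_def using aval(1)[OF _ m] by auto
next
  case (NEq i j)
  then have "TC M m f s k (code (NEq i j)) S" using s unfolding TSq_def by blast
  then have "TS M m S (\<lambda>a. \<exists>x. opr (nu i) x \<epsilon> a \<and> opr (nu j) x \<epsilon> a)" by (auto simp: TC_def)
  then show ?case unfolding TS_def using aval(1)[OF _ m] by auto
next
  case NFls
  then have "TC M m f s k (code NFls) S" using s unfolding TSq_def by blast
  then have "TS M m S (\<lambda>a. False)" by (auto simp: TC_def)
  then show ?case by (simp add: TS_def)
next
  case (NImp p q)
  have "TC M m f s k (code (NImp p q)) S" using s NImp.prems unfolding TSq_def by blast
  then obtain k1 S1 k2 S2 where k: "k1 \<epsilon> k" "opr k1 (code p) \<epsilon> f" "opr k1 S1 \<epsilon> s"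
    "k2 \<epsilon> k" "opr k2 (code q) \<epsilon> f" "opr k2 S2 \<epsilon> s" and S: "TS M m S (\<lambda>a. a \<epsilon> S1 \<longrightarrow> a \<epsilon> S2)"
    by (auto simp: TC_def)
  have F: "Fun f n" using s by (simp add: TSq_def)
  have "a \<epsilon> S1 \<longleftrightarrow> Map a m M \<and> nsat E (els M) p (aval a)" by (rule NImp.IH(1)[OF Fun_dom[OF F k(2)] k(2,3)])
  moreover have "a \<epsilon> S2 \<longleftrightarrow> Map a m M \<and> nsat E (els M) q (aval a)" by (rule NImp.IH(2)[OF Fun_dom[OF F k(5)] k(5,6)])
  ultimately show ?case using S unfolding TS_def by auto
next
  case (NAll i p)
  have "TC M m f s k (code (NAll i p)) S" using s NAll.prems unfolding TSq_def by blast
  then obtain k1 S1 where k: "k1 \<epsilon> k" "opr k1 (code p) \<epsilon> f" "opr k1 S1 \<epsilon> s" and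
    S: "TS M m S (\<lambda>a. \<forall>b. Map b m M \<and> Agr m (nu i) a b \<longrightarrow> b \<epsilon> S1)"
    by (auto simp: TC_def)
  have F: "Fun f n" using s by (simp add: TSq_def)
  have IH: "b \<epsilon> S1 \<longleftrightarrow> Map b m M \<and> nsat E (els M) p (aval b)" for b
    by (rule NAll.IH[OF Fun_dom[OF F k(2)] k(2,3)])
  have agr: "aval b = (aval a)(i := aval b i)" if "Map a m M" "Map b m M" "Agr m (nu i) a b" for b
  proof
    fix j
    show "aval b j = ((aval a)(i := aval b i)) j"
    proof (cases "j = i")
      case False
      have "opr (nu j) (aval b j) \<epsilon> b" using aval(1)[OF that(2) m] by simp
      then have "opr (nu j) (aval b j) \<epsilon> a" using that(3) m False unfolding Agr_def by (metis nu_inject)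
      then show ?thesis using aval(1)[OF that(1) m] False by simp
    qed simp
  qed
  have "(\<forall>b. Map b m M \<and> Agr m (nu i) a b \<longrightarrow> b \<epsilon> S1) \<longleftrightarrow> nsat E (els M) (NAll i p) (aval a)" if a: "Map a m M"
  proof
    assume *: "\<forall>b. Map b m M \<and> Agr m (nu i) a b \<longrightarrow> b \<epsilon> S1"
    have "nsat E (els M) p ((aval a)(i := d))" if "d \<epsilon> M" for d
    proof -
      obtain b where b: "Map b m M" "opr (nu i) d \<epsilon> b" "Agr m (nu i) a b" using Map_update[OF a m \<open>d \<epsilon> M\<close>] by metis
      then have "nsat E (els M) p (aval b)" using * IH by blast
      moreover have "aval b i = d" using b aval(1)[OF b(1) m] by simp
      ultimately show ?thesis using agr[OF a b(1,3)] by simp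
    qed
    then show "nsat E (els M) (NAll i p) (aval a)" by simp
  next
    assume *: "nsat E (els M) (NAll i p) (aval a)"
    show "\<forall>b. Map b m M \<and> Agr m (nu i) a b \<longrightarrow> b \<epsilon> S1"
    proof (intro allI impI)
      fix b assume b: "Map b m M \<and> Agr m (nu i) a b"
      then have "aval b i \<epsilon> M" using aval(2) m by blast
      then have "nsat E (els M) p ((aval a)(i := aval b i))" using * by simp
      moreover have "(aval a)(i := aval b i) = aval b" using agr[OF a, of b] b by metis
      ultimately show "b \<epsilon> S1" using IH b by simp
    qed
  qed
  then show ?case using S unfolding TS_def by blast
qed

text \<open>The natural number \<open>m\<close> of the structure need not be standard.\<close>

lemma Sat_code:
  assumes sat: "Sat M m (code p) a" and p: "nb l p" "\<And>i. i < l \<Longrightarrow> nu i \<epsilon> m"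
  shows "Map a m M" "nsat E (els M) p (aval a)"
proof -
  obtain n f s k S where m: "Nt m" and s: "TSq M m n f s" "k \<epsilon> n" "opr k (code p) \<epsilon> f" "opr k S \<epsilon> s" "a \<epsilon> S"
    using sat unfolding Sat_def by blast
  have "Map a m M \<and> nsat E (els M) p (aval a)"
  proof (cases "\<forall>i. nu i \<epsilon> m")
    case True
    then show ?thesis using TSq_truth_nonstandard[OF s(1) _ s(2,3,4)] s(5) by blast
  next
    case False
    \<comment> \<open>A number that misses some standard number is at most that number, hence
      standard itself, and assignments are lists again.\<close>
    then obtain i where "\<not> nu i \<epsilon> m" by blast
    then have "m \<epsilon> suc (nu i)" using Ord_trich[OF Nt_Ord[OF m] Nt_Ord[OF Nt_nu, of i]] by auto
    then obtain m' where m': "m = nu m'" using mem_nu[of m "Suc i"] by (auto simp: nu.simps)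
    obtain xs where xs: "length xs = m'" "set xs \<subseteq> els M" "a = lseq xs" "nsat E (els M) p (\<lambda>i. xs ! i)"
      using TSq_truth[OF s(1)[unfolded m'] s(2,3,4)] s(5) by blast
    have "i < m'" if "i < l" for i using p(2)[OF that] by (simp add: m')
    then have "nsat E (els M) p (aval a)"
      using xs nsat_cong[OF p(1), of "\<lambda>i. xs ! i" "aval a"] aval_lseq by simp
    then show ?thesis using xs by (simp add: m' Map_nu_iff) blast
  qed
  then show "Map a m M" "nsat E (els M) p (aval a)" by blast+
qed

text \<open>If every \<open>x \<in> S\<close> had an element of \<open>S\<close> five levels below it, then a minimal set with
  an element of \<open>S\<close> at most four levels below would give a contradiction.\<close>

lemma foundation_depth:
  assumes "s0 \<epsilon> S"
  shows "\<exists>x. x \<epsilon> S \<and> (\<forall>y. y \<epsilon> S \<longrightarrow> \<not> (\<exists>a b c d. a \<epsilon> x \<and> b \<epsilon> a \<and> c \<epsilon> b \<and> d \<epsilon> c \<and> y \<epsilon> d))"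
proof (rule ccontr)
  assume neg: "\<not> ?thesis"
  define P where "P x \<longleftrightarrow> (\<exists>s. s \<epsilon> S \<and> (s = x \<or> s \<epsilon> x \<or> (\<exists>a. a \<epsilon> x \<and> s \<epsilon> a) \<or> (\<exists>a b. a \<epsilon> x \<and> b \<epsilon> a \<and> s \<epsilon> b)
      \<or> (\<exists>a b c. a \<epsilon> x \<and> b \<epsilon> a \<and> c \<epsilon> b \<and> s \<epsilon> c)))" for x
  have step: "\<exists>y. y \<epsilon> x \<and> P y" if Px: "P x" for x
  proof -
    obtain s where s: "s \<epsilon> S" and c: "s = x \<or> s \<epsilon> x \<or> (\<exists>a. a \<epsilon> x \<and> s \<epsilon> a) \<or> (\<exists>a b. a \<epsilon> x \<and> b \<epsilon> a \<and> s \<epsilon> b)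
      \<or> (\<exists>a b c. a \<epsilon> x \<and> b \<epsilon> a \<and> c \<epsilon> b \<and> s \<epsilon> c)" using Px unfolding P_def by blast
    show ?thesis
    proof (cases "s = x")
      case True
      then obtain y where "y \<epsilon> S" "\<exists>a b c d. a \<epsilon> x \<and> b \<epsilon> a \<and> c \<epsilon> b \<and> d \<epsilon> c \<and> y \<epsilon> d" using neg s by blast
      then show ?thesis unfolding P_def by metis
    next
      case False
      then show ?thesis using c s unfolding P_def by metis
    qed
  qed
  obtain Q where Q: "ZF Q" "S \<epsilon> Q" using Loc Mdl_ZF by blast
  obtain B where B: "\<And>x. x \<epsilon> B \<longleftrightarrow> x \<epsilon> Q \<and> P x"
  proof (rule vsep[of "[S]" "\<^bold>\<exists>s. s \<^bold>\<in> 0 \<^bold>\<and> (s \<^bold>= 1 \<^bold>\<or> s \<^bold>\<in> 1 \<^bold>\<or> (\<^bold>\<exists>a. a \<^bold>\<in> 1 \<^bold>\<and> s \<^bold>\<in> a) \<^bold>\<or> (\<^bold>\<exists>a b. a \<^bold>\<in> 1 \<^bold>\<and> b \<^bold>\<in> a \<^bold>\<and> s \<^bold>\<in> b)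
      \<^bold>\<or> (\<^bold>\<exists>a b c. a \<^bold>\<in> 1 \<^bold>\<and> b \<^bold>\<in> a \<^bold>\<and> c \<^bold>\<in> b \<^bold>\<and> s \<^bold>\<in> c))" Q P])
    fix N x assume "ZF N" "set [S] \<subseteq> els N" "x \<epsilon> N"
    then show "holds E (els N) ([S] @ [x]) (\<^bold>\<exists>s. s \<^bold>\<in> 0 \<^bold>\<and> (s \<^bold>= 1 \<^bold>\<or> s \<^bold>\<in> 1 \<^bold>\<or> (\<^bold>\<exists>a. a \<^bold>\<in> 1 \<^bold>\<and> s \<^bold>\<in> a) \<^bold>\<or> (\<^bold>\<exists>a b. a \<^bold>\<in> 1 \<^bold>\<and> b \<^bold>\<in> a \<^bold>\<and> s \<^bold>\<in> b)
      \<^bold>\<or> (\<^bold>\<exists>a b c. a \<^bold>\<in> 1 \<^bold>\<and> b \<^bold>\<in> a \<^bold>\<and> c \<^bold>\<in> b \<^bold>\<and> s \<^bold>\<in> c))) \<longleftrightarrow> P x"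
      unfolding P_def by (simp add: bnd)
  qed (simp, blast)
  have "s0 \<epsilon> B" using B assms ZF_Trn[OF Q] unfolding P_def by blast
  then have "Fnd B" by (intro foundation) auto
  then obtain x where x: "x \<epsilon> B" "\<And>z. z \<epsilon> B \<Longrightarrow> \<not> z \<epsilon> x" unfolding Fnd_def by blast
  then obtain y where "y \<epsilon> x" "P y" using step B by blast
  then show False using x B ZF_Trn[OF Q(1)] by blast
qed

text \<open>Both the map and the formulas are external. Where the map has to occur in a separation
  formula, a set representing its graph is carried along separately.\<close>

definition elem :: "('a \<Rightarrow> 'a) \<Rightarrow> 'a \<Rightarrow> 'a \<Rightarrow> bool" where
  "elem g A B \<longleftrightarrow> (\<forall>x. x \<epsilon> A \<longrightarrow> g x \<epsilon> B)
     \<and> (\<forall>p v. (\<forall>i. v i \<epsilon> A) \<longrightarrow> (ev E (els A) p v \<longleftrightarrow> ev E (els B) p (\<lambda>i. g (v i))))"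

lemma elem_in: "elem g A B \<Longrightarrow> x \<epsilon> A \<Longrightarrow> g x \<epsilon> B"
  by (simp add: elem_def)

lemma elem_ev: "elem g A B \<Longrightarrow> (\<And>i. v i \<epsilon> A) \<Longrightarrow> ev E (els A) p v \<longleftrightarrow> ev E (els B) p (\<lambda>i. g (v i))"
  by (simp add: elem_def)

lemma elem_comp: "elem g A B \<Longrightarrow> elem h B C \<Longrightarrow> elem (\<lambda>x. h (g x)) A C"
  by (simp add: elem_def)

text \<open>The element \<open>a\<close> pads the assignment beyond the listed values, as
  elementarity speaks of assignments with all values in \<open>A\<close>.\<close>

lemma elem_holds:
  assumes g: "elem g A B" and a: "a \<epsilon> A" and xs: "set xs \<subseteq> els A" "fb (length xs) F"
  shows "holds E (els A) xs F \<longleftrightarrow> holds E (els B) (map g xs) F"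
proof -
  define v where "v i = (if i < length xs then xs ! (length xs - Suc i) else a)" for i
  have v: "v i \<epsilon> A" for i using xs(1) a nth_in[OF xs(1), of "length xs - Suc i"] by (auto simp: v_def)
  have "holds E (els A) xs F \<longleftrightarrow> ev E (els A) (F (length xs)) v"
    using ev_holds[OF xs(2), of v] by (simp add: v_def)
  also have "\<dots> \<longleftrightarrow> ev E (els B) (F (length (map g xs))) (\<lambda>i. g (v i))" using elem_ev[OF g v] by simp
  also have "\<dots> \<longleftrightarrow> holds E (els B) (map g xs) F"
    using xs(2) by (intro ev_holds) (auto simp: v_def)
  finally show ?thesis .
qed

lemma elem_mem: "elem g A B \<Longrightarrow> x \<epsilon> A \<Longrightarrow> y \<epsilon> A \<Longrightarrow> g x \<epsilon> g y \<longleftrightarrow> x \<epsilon> y"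
  using elem_holds[of g A B x "[x, y]" "0 \<^bold>\<in> 1"] by simp

lemma elem_inj: "elem g A B \<Longrightarrow> x \<epsilon> A \<Longrightarrow> y \<epsilon> A \<Longrightarrow> g x = g y \<longleftrightarrow> x = y"
  using elem_holds[of g A B x "[x, y]" "0 \<^bold>= 1"] by simp

lemma elem_ZF:
  assumes "elem g A B" "ZF A" "Trn B"
  shows "ZF B"
proof (rule ZF_transfer[OF assms(2,3)])
  have e: "emp \<epsilon> A" using ZF_emp assms(2) by blast
  then show "B \<noteq> emp" using elem_in[OF assms(1)] not_emp by metis
  fix p and v :: "nat \<Rightarrow> 'a" assume p: "free_below 0 p"
  have "ev E (els A) p v \<longleftrightarrow> ev E (els A) p (\<lambda>i. emp)" by (rule ev_cong[OF p]) simp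
  also have "\<dots> \<longleftrightarrow> ev E (els B) p (\<lambda>i. g emp)" using elem_ev[OF assms(1)] e by simp
  also have "\<dots> \<longleftrightarrow> ev E (els B) p v" by (rule ev_cong[OF p]) simp
  finally show "ev E (els A) p v \<longleftrightarrow> ev E (els B) p v" .
qed

text \<open>\<open>D\<close> is the graph of an assignment to the variables other than \<open>v\<^sub>0\<close>.\<close>

definition Wit :: "('a \<Rightarrow> 'a \<Rightarrow> bool) \<Rightarrow> 'a \<Rightarrow> 'a \<Rightarrow> 'a \<Rightarrow> 'a \<Rightarrow> bool" where
  "Wit D P m k y \<longleftrightarrow> (\<exists>b. Map b m P \<and> opr emp y \<epsilon> b
    \<and> (\<forall>i z. i \<epsilon> m \<and> i \<noteq> emp \<longrightarrow> (opr i z \<epsilon> b \<longleftrightarrow> D i z)) \<and> Sat P m k b)"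

definition is_wit :: "(var \<Rightarrow> var \<Rightarrow> form) \<Rightarrow> var \<Rightarrow> var \<Rightarrow> var \<Rightarrow> var \<Rightarrow> form" where
  "is_wit D P m k y = (\<^bold>\<exists>b. is_map b m P \<^bold>\<and> (\<^bold>\<exists>e. is_empty e \<^bold>\<and> is_app b e y
    \<^bold>\<and> (\<^bold>\<forall>i z. i \<^bold>\<in> m \<^bold>\<and> \<^bold>\<not> i \<^bold>= e \<^bold>\<longrightarrow> (is_app b i z \<^bold>\<longleftrightarrow> D i z))) \<^bold>\<and> sat P m k b)"

lemma h_wit:
  assumes Q: "ZF Q" and xs: "set xs \<subseteq> els Q" "P < length xs" "m < length xs" "k < length xs" "y < length xs"
    and D: "\<And>zs i z. set zs \<subseteq> els Q \<Longrightarrow> i < length (xs @ zs) \<Longrightarrow> z < length (xs @ zs) \<Longrightarrow>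
      holds E (els Q) (xs @ zs) (fD i z) \<longleftrightarrow> D ((xs @ zs) ! i) ((xs @ zs) ! z)"
    and DQ: "\<And>i z. D i z \<Longrightarrow> z \<epsilon> Q"
  shows "holds E (els Q) xs (is_wit fD P m k y) \<longleftrightarrow> Wit D (xs ! P) (xs ! m) (xs ! k) (xs ! y)"
proof -
  have A: "xs ! P \<epsilon> Q" "xs ! m \<epsilon> Q" "xs ! y \<epsilon> Q" using nth_in[OF xs(1)] xs by auto
  have 2: "(\<forall>i\<in>els Q. \<forall>z\<in>els Q. i \<epsilon> xs ! m \<and> i \<noteq> emp \<longrightarrow> (opr i z \<epsilon> b \<longleftrightarrow> D i z))
    \<longleftrightarrow> (\<forall>i z. i \<epsilon> xs ! m \<and> i \<noteq> emp \<longrightarrow> (opr i z \<epsilon> b \<longleftrightarrow> D i z))" if "b \<epsilon> Q" for b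
    using ZF_app[OF Q that] DQ ZF_Trn[OF Q A(2)] by blast
  have 3: "b \<epsilon> Q" if "Map b (xs ! m) (xs ! P)" "Sat (xs ! P) (xs ! m) (xs ! k) b" for b
    using ZF_map[OF Q _ that(1) ZF_Trn[OF Q A(1)]] that(2) unfolding Sat_def by blast
  have 4: "emp \<epsilon> Q" using ZF_emp[OF Q] .
  have 5: "(\<exists>e\<in>els Q. e = emp \<and> F e) \<longleftrightarrow> F emp" for F using 4 by blast
  have "holds E (els Q) xs (is_wit fD P m k y) \<longleftrightarrow> (\<exists>b\<in>els Q. Map b (xs ! m) (xs ! P) \<and> opr emp (xs ! y) \<epsilon> b
    \<and> (\<forall>i z. i \<epsilon> xs ! m \<and> i \<noteq> emp \<longrightarrow> (opr i z \<epsilon> b \<longleftrightarrow> D i z)) \<and> Sat (xs ! P) (xs ! m) (xs ! k) b)"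
    unfolding is_wit_def using Q xs 4 2 D[of "[_, _, _, _]"]
    by (simp add: 5 del: all_simps ball_simps ex_simps bex_simps)
  also have "\<dots> \<longleftrightarrow> Wit D (xs ! P) (xs ! m) (xs ! k) (xs ! y)"
    unfolding Wit_def using 3 by blast
  finally show ?thesis .
qed

text \<open>The relation \<open>D\<close> need only be right at the variables from 1 to
  \<open>m - 1\<close>, since the bound \<open>nb m p\<close> hides all others and variable 0 holds
  \<open>y\<close>.\<close>

lemma Wit_iff:
  assumes m: "0 < m" "nb m p" and p: "\<And>M d v. d \<epsilon> M \<Longrightarrow> (\<And>i. v i \<epsilon> M) \<Longrightarrow>
      Sat M (nu m) (code p) (lseq (d # map v [0..<m - 1])) \<longleftrightarrow> ev E (els M) q (case_nat d v)"
    and v: "\<And>i. v i \<epsilon> P" and y: "y \<epsilon> P" and D: "\<And>i z. i < m - 1 \<Longrightarrow> D (nu (Suc i)) z \<longleftrightarrow> z = v i"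
  shows "Wit D P (nu m) (code p) y \<longleftrightarrow> ev E (els P) q (case_nat y v)"
proof -
  let ?ys = "y # map v [0..<m - 1]"
  have lys: "length ?ys = m" using m(1) by simp
  have rhs: "D (nu i) z \<longleftrightarrow> z = ?ys ! i" if "i < m" "i \<noteq> 0" for i z
    using D[of "i - 1" z] that by simp
  have "Wit D P (nu m) (code p) y \<longleftrightarrow> Sat P (nu m) (code p) (lseq ?ys)"
  proof
    assume "Wit D P (nu m) (code p) y"
    then obtain b where b: "Map b (nu m) P" "opr emp y \<epsilon> b" "Sat P (nu m) (code p) b"
      "\<And>i z. i \<epsilon> nu m \<Longrightarrow> i \<noteq> emp \<Longrightarrow> opr i z \<epsilon> b \<longleftrightarrow> D i z"
      unfolding Wit_def by blast
    obtain ys where ys: "length ys = m" "b = lseq ys" using Map_nu[OF b(1)] by metis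
    have "ys ! i = ?ys ! i" if i: "i < m" for i
    proof (cases "i = 0")
      case True
      have "opr (nu 0) y \<epsilon> b" using b(2) by (simp add: nu.simps)
      then show ?thesis using ys i True by auto
    next
      case False
      then have "nu i \<noteq> emp" using nu_inject[of i 0] by (simp add: nu.simps)
      moreover have "opr (nu i) (ys ! i) \<epsilon> b" using ys i by auto
      ultimately show ?thesis using b(4)[of "nu i" "ys ! i"] rhs[OF i False] i by simp
    qed
    then have "ys = ?ys" using ys(1) lys by (intro nth_equalityI) auto
    then show "Sat P (nu m) (code p) (lseq ?ys)" using b(3) ys(2) by simp
  next
    assume s: "Sat P (nu m) (code p) (lseq ?ys)"
    have "Map (lseq ?ys) (nu (length ?ys)) P" unfolding Map_lseq using y v by auto
    then have "Map (lseq ?ys) (nu m) P" using lys by simp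
    moreover have "opr emp y \<epsilon> lseq ?ys" unfolding opr_mem_lseq using m(1) by (intro exI[of _ 0]) (simp add: nu.simps)
    moreover have "opr i z \<epsilon> lseq ?ys \<longleftrightarrow> D i z" if "i \<epsilon> nu m" "i \<noteq> emp" for i z
    proof -
      obtain l where l: "l < m" "i = nu l" using mem_nu \<open>i \<epsilon> nu m\<close> by blast
      then have "l \<noteq> 0" using \<open>i \<noteq> emp\<close> by (metis nu.simps(1))
      then show ?thesis using rhs[OF l(1)] l lys unfolding opr_mem_lseq by auto
    qed
    ultimately show "Wit D P (nu m) (code p) y" unfolding Wit_def using s by blast
  qed
  then show ?thesis using p[OF y, of v] v by blast
qed

text \<open>The elements of \<open>N0\<close> serve as names for the elements of the hull: \<open>(\<emptyset>, x)\<close> is a name for \<open>x\<close>, the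
  empty set is a name for \<open>X\<close>, and \<open>((m, k), w)\<close> is a name for a chosen \<open>y\<close> with \<open>P \<Turnstile> k[y, \<dots>]\<close>, where the
  parameters are named by \<open>w\<close>.\<close>

lemma hull:
  assumes N0: "ZF N0" and P: "ZF P" "N0 \<epsilon> P" "X \<epsilon> P"
  obtains H f where "Fun f N0" "Rng f H" "Sub N0 H" "X \<epsilon> H" "elem (\<lambda>x. x) H P"
proof -
  obtain Q where Q: "ZF Q" "P \<epsilon> Q" using Loc Mdl_ZF by blast
  have NQ: "N0 \<epsilon> Q" and XQ: "X \<epsilon> Q" using ZF_Trn[OF Q] P by blast+
  obtain pw where pw: "pw \<epsilon> Q" "\<And>z. z \<epsilon> pw \<longleftrightarrow> z \<epsilon> Q \<and> Sub z P" using ZF_pow[OF Q] by metis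
  obtain c where c: "c \<epsilon> Q" "Sv c" "\<And>x y. opr x y \<epsilon> c \<Longrightarrow> x \<epsilon> pw \<and> y \<epsilon> x" "\<And>x. x \<epsilon> pw \<Longrightarrow> x \<noteq> emp \<Longrightarrow> \<exists>y. opr x y \<epsilon> c"
    using ZF_choice[OF Q(1) pw(1)] by metis
  \<comment> \<open>The recursion for a name \<open>u\<close> needs the values of the names listed
    in its second component; these are its predecessors.\<close>
  obtain W where W: "W \<epsilon> Q" and W_iff: "\<And>x u. opr x u \<epsilon> W \<longleftrightarrow> x \<epsilon> N0 \<and> u \<epsilon> N0 \<and> (\<exists>mk w i. u = opr mk w \<and> opr i x \<epsilon> w)"
  proof (rule ZF_rel[OF Q(1) NQ NQ, of "[]" "\<lambda>x u. \<^bold>\<exists>mk w i. is_pair mk w u \<^bold>\<and> is_app w i x"])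
    fix p x u assume xu: "p \<epsilon> Q" "x \<epsilon> Q" "u \<epsilon> Q"
    have "(\<exists>mk\<in>els Q. \<exists>w\<in>els Q. \<exists>i\<in>els Q. u = opr mk w \<and> opr i x \<epsilon> w) \<longleftrightarrow> (\<exists>mk w i. u = opr mk w \<and> opr i x \<epsilon> w)"
      using xu ZF_opr[OF Q(1)] ZF_app[OF Q(1)] by blast
    then show "holds E (els Q) ([] @ [p, x, u]) (\<^bold>\<exists>mk w i. is_pair mk w (Suc (Suc (length []))) \<^bold>\<and> is_app w i (Suc (length [])))
      \<longleftrightarrow> (\<exists>mk w i. u = opr mk w \<and> opr i x \<epsilon> w)"
      using xu Q(1) by (simp add: eval_nat_numeral del: ex_simps bex_simps)
  qed (simp_all add: that)
  have wf: "wfr N0 W"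
    unfolding wfr_def
  proof (intro allI impI)
    fix S assume "S \<noteq> emp \<and> Sub S N0"
    then obtain s0 where "s0 \<epsilon> S" using emp_iff by blast
    then obtain x where x: "x \<epsilon> S" "\<And>y. y \<epsilon> S \<Longrightarrow> \<not> (\<exists>a b c d. a \<epsilon> x \<and> b \<epsilon> a \<and> c \<epsilon> b \<and> d \<epsilon> c \<and> y \<epsilon> d)"
      using foundation_depth by blast
    have "\<not> opr y x \<epsilon> W" if y: "y \<epsilon> S" for y
    proof
      assume "opr y x \<epsilon> W"
      then obtain mk w i where w: "x = opr mk w" "opr i y \<epsilon> w" using W_iff by blast
      \<comment> \<open>A listed name sits exactly five membership steps below: through the
        unordered and ordered pairs around \<open>w\<close>, and through those around the
        entry.\<close>
      have "upr mk w \<epsilon> x" "w \<epsilon> upr mk w" "upr i y \<epsilon> opr i y" "y \<epsilon> upr i y" unfolding w(1) by (simp_all add: opr_def)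
      then show False using x(2)[OF y] w(2) by blast
    qed
    then show "\<exists>x. x \<epsilon> S \<and> (\<forall>y. y \<epsilon> S \<longrightarrow> \<not> opr y x \<epsilon> W)" using x(1) by blast
  qed
  \<comment> \<open>The parameter at variable \<open>i\<close> is found in two steps:
    \<open>w\<close> gives its name, and the recursion so far gives the value of that name.\<close>
  define via where "via w p i z \<longleftrightarrow> (\<exists>u. opr i u \<epsilon> w \<and> opr u z \<epsilon> p)" for w p i z
  define is_via where "is_via w p i z = (\<^bold>\<exists>u. is_app w i u \<^bold>\<and> is_app p u z)" for w p i z
  have fb_via: "fb n (is_wit (is_via w p) a m k y)" if "0 < n" for n w p a m k y
    using that by (simp add: is_wit_def is_via_def)
  have h_is_via: "holds E (els Q) K (is_via w p i z) \<longleftrightarrow> via (K ! w) (K ! p) (K ! i) (K ! z)"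
    if K: "set K \<subseteq> els Q" "w < length K" "p < length K" "i < length K" "z < length K" for K w p i z
  proof -
    have "K ! w \<epsilon> Q" using nth_in[OF K(1,2)] by simp
    then have "(\<exists>u\<in>els Q. opr (K ! i) u \<epsilon> K ! w \<and> opr u (K ! z) \<epsilon> K ! p) \<longleftrightarrow> via (K ! w) (K ! p) (K ! i) (K ! z)"
      unfolding via_def using ZF_app[OF Q(1)] by blast
    then show ?thesis unfolding is_via_def using K Q(1) by simp
  qed
  have h_via: "holds E (els Q) L (is_wit (is_via w p) a m k y) \<longleftrightarrow> Wit (via (L ! w) (L ! p)) (L ! a) (L ! m) (L ! k) (L ! y)"
    if L: "set L \<subseteq> els Q" "w < length L" "p < length L" "a < length L" "m < length L" "k < length L" "y < length L" for L w p a m k y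
  proof (rule h_wit)
    have A: "L ! w \<epsilon> Q" "L ! p \<epsilon> Q" using nth_in[OF L(1)] L by auto
    show "via (L ! w) (L ! p) i z \<Longrightarrow> z \<epsilon> Q" for i z unfolding via_def using ZF_app[OF Q(1) A(2)] by blast
    show "holds E (els Q) (L @ zs) (is_via w p i z) \<longleftrightarrow> via (L ! w) (L ! p) ((L @ zs) ! i) ((L @ zs) ! z)"
      if "set zs \<subseteq> els Q" "i < length (L @ zs)" "z < length (L @ zs)" for zs i z
      using h_is_via[of "L @ zs" w p i z] that L by simp
  qed (use L Q in auto)
  define St where "St u p Y \<longleftrightarrow> (\<exists>m k w. u = opr (opr m k) w \<and> (\<forall>y. y \<epsilon> Y \<longleftrightarrow> y \<epsilon> P \<and> Wit (via w p) P m k y))" for u p Y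
  define fSt where "fSt u p Y = (\<^bold>\<exists>mk m k w. is_pair mk w u \<^bold>\<and> is_pair m k mk \<^bold>\<and> (\<^bold>\<forall>y. y \<^bold>\<in> Y \<^bold>\<longleftrightarrow> y \<^bold>\<in> 0 \<^bold>\<and> is_wit (is_via w p) 0 m k y))" for u p Y
  \<comment> \<open>A tagged pair denotes its second component; any other name denotes the chosen
    witness if its witness set is nonempty; everything else falls back to \<open>X\<close>. The
    empty set is not a pair, so it names \<open>X\<close>.\<close>
  define R where "R u p y \<longleftrightarrow> u = opr emp y \<or> \<not> (\<exists>x. u = opr emp x) \<and>
     ((\<exists>Y. St u p Y \<and> opr Y y \<epsilon> c) \<or> \<not> (\<exists>Y z. St u p Y \<and> opr Y z \<epsilon> c) \<and> y = X)" for u p y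
  define fR where "fR u p y = ((\<^bold>\<exists>e. is_empty e \<^bold>\<and> is_pair e y u) \<^bold>\<or> \<^bold>\<not> (\<^bold>\<exists>e x. is_empty e \<^bold>\<and> is_pair e x u) \<^bold>\<and>
     ((\<^bold>\<exists>Y. fSt u p Y \<^bold>\<and> is_app 1 Y y) \<^bold>\<or> \<^bold>\<not> (\<^bold>\<exists>Y z. fSt u p Y \<^bold>\<and> is_app 1 Y z) \<^bold>\<and> y \<^bold>= 2))" for u p y
  have St_unique: "Y = Y'" if "St u p Y" "St u p Y'" for u p Y Y'
    using that unfolding St_def by (intro extensionality) (metis opr_inject)
  have h_St: "holds E (els Q) L (fSt u p Y) \<longleftrightarrow> St (L ! u) (L ! p) (L ! Y)"
    if L: "set L \<subseteq> els Q" "u < length L" "p < length L" "Y < length L" "0 < length L" "L ! 0 = P" for L u p Y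
  proof -
    have A: "L ! u \<epsilon> Q" "L ! Y \<epsilon> Q" using nth_in[OF L(1)] L by auto
    have 1: "(\<forall>y\<in>els Q. y \<epsilon> L ! Y \<longleftrightarrow> y \<epsilon> P \<and> F y) \<longleftrightarrow> (\<forall>y. y \<epsilon> L ! Y \<longleftrightarrow> y \<epsilon> P \<and> F y)" for F
      using ZF_Trn[OF Q(1) A(2)] ZF_Trn[OF Q] by blast
    have 2: "(\<exists>mk\<in>els Q. \<exists>m\<in>els Q. \<exists>k\<in>els Q. \<exists>w\<in>els Q. L ! u = opr mk w \<and> mk = opr m k \<and> F m k w)
      \<longleftrightarrow> (\<exists>m k w. L ! u = opr (opr m k) w \<and> F m k w)" for F
      using A(1) ZF_opr[OF Q(1)] by (metis els_iff)
    show ?thesis unfolding fSt_def St_def using L Q(1)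
      by (simp add: 1 2 h_via del: all_simps ball_simps ex_simps bex_simps)
  qed
  have h_R: "holds E (els Q) ([P, c, X] @ zs) (fR u p y)
      \<longleftrightarrow> R (([P, c, X] @ zs) ! u) (([P, c, X] @ zs) ! p) (([P, c, X] @ zs) ! y)"
    if zs: "set zs \<subseteq> els Q" "u < length ([P, c, X] @ zs)" "p < length ([P, c, X] @ zs)" "y < length ([P, c, X] @ zs)" for zs u p y
  proof -
    define L where "L = [P, c, X] @ zs"
    have L: "set L \<subseteq> els Q" "u < length L" "p < length L" "y < length L" "0 < length L" "1 < length L" "2 < length L"
      "L ! 0 = P" "L ! 1 = c" "L ! 2 = X"
      using zs Q(2) c(1) XQ by (auto simp: L_def)
    have A: "L ! u \<epsilon> Q" using nth_in[OF L(1)] L by auto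
    have 1: "(\<exists>e\<in>els Q. e = emp \<and> F e) \<longleftrightarrow> F emp" for F using ZF_emp[OF Q(1)] by blast
    have 2: "(\<exists>e\<in>els Q. \<exists>x\<in>els Q. e = emp \<and> L ! u = opr e x) \<longleftrightarrow> (\<exists>x. L ! u = opr emp x)"
      using A ZF_emp[OF Q(1)] ZF_opr[OF Q(1)] by (metis els_iff)
    have 3: "(\<exists>Y\<in>els Q. S Y \<and> opr Y z \<epsilon> c) \<longleftrightarrow> (\<exists>Y. S Y \<and> opr Y z \<epsilon> c)" for S z
      using ZF_app[OF Q(1) c(1)] by blast
    have 4: "(\<exists>Y\<in>els Q. \<exists>z\<in>els Q. S Y \<and> opr Y z \<epsilon> c) \<longleftrightarrow> (\<exists>Y z. S Y \<and> opr Y z \<epsilon> c)" for S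
      using ZF_app[OF Q(1) c(1)] by blast
    have 5: "holds E (els Q) (L @ vs) (fSt u p (length L)) \<longleftrightarrow> St (L ! u) (L ! p) (hd vs)" if "set vs \<subseteq> els Q" "vs \<noteq> []" for vs
      using h_St[of "L @ vs" u p "length L"] that L by (simp add: hd_conv_nth)
    have "holds E (els Q) L (fR u p y) \<longleftrightarrow> R (L ! u) (L ! p) (L ! y)"
      unfolding fR_def R_def using L Q(1) ZF_emp[OF Q(1)]
      by (simp add: 1 2 3 4 5 del: all_simps ball_simps ex_simps bex_simps)
    then show ?thesis by (simp only: L_def)
  qed
  have fb_R: "0 < n \<Longrightarrow> fb n (fR u p y)" for n u p y by (simp add: fR_def fSt_def fb_via)
  have ex1: "\<exists>!y. y \<epsilon> Q \<and> R u p y" if u: "u \<epsilon> N0" for u p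
  proof (cases "\<exists>x. u = opr emp x")
    case True
    then obtain x where x: "u = opr emp x" by blast
    then have "x \<epsilon> Q" using u ZF_Trn[OF Q(1) NQ] ZF_opr[OF Q(1)] by metis
    then show ?thesis unfolding R_def x by auto
  next
    case no: False
    show ?thesis
    proof (cases "\<exists>Y z. St u p Y \<and> opr Y z \<epsilon> c")
      case True
      then obtain Y z where Y: "St u p Y" "opr Y z \<epsilon> c" by blast
      then have "z \<epsilon> Q" using ZF_app[OF Q(1) c(1)] by blast
      have "R u p y \<longleftrightarrow> opr Y y \<epsilon> c" for y
        unfolding R_def using no Y St_unique by blast
      then show ?thesis using \<open>z \<epsilon> Q\<close> Y(2) c(2) unfolding Sv_def by metis
    next
      case False
      then show ?thesis unfolding R_def using no XQ by blast
    qed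
  qed
  obtain f where f: "f \<epsilon> Q" "Fun f N0" "\<And>x y. opr x y \<epsilon> f \<Longrightarrow> \<exists>p. p \<epsilon> Q \<and> Res W f x p \<and> R x p y"
  proof (rule ZF_wfrec[OF Q(1) NQ W wf, where xs = "[P, c, X]" and F = fR and R = R])
    show "opr u x \<epsilon> W \<Longrightarrow> u \<epsilon> N0" for u x using W_iff by blast
  qed (use Q c(1) XQ fb_R ex1 h_R in auto)
  obtain H where H: "H \<epsilon> Q" "Rng f H" using ZF_rng[OF Q(1) f(1)] by metis
  have HI: "y \<epsilon> H \<longleftrightarrow> (\<exists>u. opr u y \<epsilon> f)" for y using H(2) unfolding Rng_def by blast
  have NH: "x \<epsilon> H" if x: "x \<epsilon> N0" for x
  proof -
    have "opr emp x \<epsilon> N0" using x ZF_emp[OF N0] ZF_opr[OF N0] by blast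
    then obtain y where y: "opr (opr emp x) y \<epsilon> f" using Fun_ex[OF f(2)] by blast
    then have "x = y" using f(3)[OF y] unfolding R_def by auto
    then show ?thesis using y HI by blast
  qed
  have XH: "X \<epsilon> H"
  proof -
    obtain y where y: "opr emp y \<epsilon> f" using Fun_ex[OF f(2) ZF_emp[OF N0]] by blast
    have ne: "emp \<noteq> opr a b" for a b unfolding opr_def by (metis not_emp upr_iff)
    then have "\<not> St emp p Y" for p Y unfolding St_def by blast
    then have "X = y" using f(3)[OF y] ne unfolding R_def by blast
    then show ?thesis using y HI by blast
  qed
  have HP: "y \<epsilon> P" if y: "y \<epsilon> H" for y
  proof -
    obtain u where u: "opr u y \<epsilon> f" using y HI by blast
    obtain p where p: "R u p y" using f(3)[OF u] by blast
    have "u \<epsilon> P" using Fun_dom[OF f(2) u] ZF_Trn[OF P(1,2)] by blast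
    show ?thesis
    proof (cases "u = opr emp y")
      case True
      then show ?thesis using \<open>u \<epsilon> P\<close> ZF_opr[OF P(1)] by blast
    next
      case False
      then have "(\<exists>Y. St u p Y \<and> opr Y y \<epsilon> c) \<or> y = X" using p unfolding R_def by blast
      then show ?thesis using P(3) c(3) unfolding St_def by blast
    qed
  qed
  have sub: "els H \<subseteq> els P" using HP by blast
  have wit: "\<exists>d\<in>els H. ev E (els P) q (case_nat d v)"
    if v: "\<And>i. v i \<in> els H" and d: "\<exists>d\<in>els P. ev E (els P) q (case_nat d v)" for q v
  proof -
    obtain m p where m: "0 < m" "nb m p" and p: "\<And>M d v. d \<epsilon> M \<Longrightarrow> (\<And>i. v i \<epsilon> M) \<Longrightarrow>
        Sat M (nu m) (code p) (lseq (d # map v [0..<m - 1])) \<longleftrightarrow> ev E (els M) q (case_nat d v)"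
      using Sat_fm[of q] by metis
    have vP: "v i \<epsilon> P" for i using v[of i] HP by blast
    have "\<forall>i. \<exists>u. opr u (v i) \<epsilon> f" using v HI by blast
    then obtain uu where uu: "\<And>i. opr (uu i) (v i) \<epsilon> f" by metis
    have uuN: "uu i \<epsilon> N0" for i using Fun_dom[OF f(2) uu] .
    \<comment> \<open>The entry at 0 is a placeholder, as variable 0 is reserved for the witness.
      The list of names is a finite function into \<open>N0\<close> and so belongs to
      \<open>N0\<close>; hence the witness asked for has a name in \<open>N0\<close>.\<close>
    let ?ws = "emp # map uu [0..<m - 1]"
    define w where "w = lseq ?ws"
    have "Map w (nu (length ?ws)) N0" unfolding w_def Map_lseq using uuN ZF_emp[OF N0] by auto
    moreover have len: "length ?ws = m" using m(1) by simp
    ultimately have "w \<epsilon> N0" using ZF_map[OF N0 Nt_nu] by metis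
    moreover have "nu m \<epsilon> N0" "code p \<epsilon> N0" using ZF_nu[OF N0] Fml_in[OF N0 Fml_code[OF m(2)]] by blast+
    ultimately have uN: "opr (opr (nu m) (code p)) w \<epsilon> N0" (is "?u \<epsilon> N0") using ZF_opr[OF N0] by blast
    then obtain y0 where y0: "opr ?u y0 \<epsilon> f" using Fun_ex[OF f(2)] by blast
    obtain r where r: "r \<epsilon> Q" "Res W f ?u r" "R ?u r y0" using f(3)[OF y0] by blast
    have w_iff: "opr i u \<epsilon> w \<longleftrightarrow> (\<exists>k<m. i = nu k \<and> u = ?ws ! k)" for i u
      unfolding w_def using len by simp
    have r_iff: "opr (uu i) z \<epsilon> r \<longleftrightarrow> z = v i" if "i < m - 1" for i z
    proof -
      have "opr (nu (Suc i)) (uu i) \<epsilon> w" unfolding w_iff using that by (intro exI[of _ "Suc i"]) simp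
      then have "opr (uu i) ?u \<epsilon> W" using W_iff uN uuN by blast
      then have "opr (uu i) z \<epsilon> r \<longleftrightarrow> opr (uu i) z \<epsilon> f" using r(2) unfolding Res_def by (metis opr_inject)
      then show ?thesis using uu FunD[OF f(2)] by blast
    qed
    have wit_iff: "Wit (via w r) P (nu m) (code p) y \<longleftrightarrow> ev E (els P) q (case_nat y v)" if y: "y \<epsilon> P" for y
    proof (rule Wit_iff[OF m p vP y])
      fix i z assume i: "i < m - 1"
      have "opr (nu (Suc i)) u \<epsilon> w \<longleftrightarrow> u = uu i" for u unfolding w_iff using i by auto
      then show "via w r (nu (Suc i)) z \<longleftrightarrow> z = v i" unfolding via_def using r_iff[OF i] by simp
    qed
    obtain Y where Y: "Y \<epsilon> Q" "\<And>y. y \<epsilon> Y \<longleftrightarrow> y \<epsilon> P \<and> Wit (via w r) P (nu m) (code p) y"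
    proof (rule ZF_sep[of Q "[P, nu m, code p, w, r]" P "is_wit (is_via 3 4) 0 1 2 5"])
      show "set [P, nu m, code p, w, r] \<subseteq> els Q"
        using Q(2) r(1) ZF_nu[OF Q(1)] Fml_in[OF Q(1) Fml_code[OF m(2)]] ZF_Trn[OF Q(1) NQ \<open>w \<epsilon> N0\<close>] by simp
      then show "y \<epsilon> Q \<Longrightarrow> holds E (els Q) ([P, nu m, code p, w, r] @ [y]) (is_wit (is_via 3 4) 0 1 2 5)
          \<longleftrightarrow> Wit (via w r) P (nu m) (code p) y" for y
        using h_via[of "[P, nu m, code p, w, r, y]" 3 4 0 1 2 5] by (simp add: eval_nat_numeral)
    qed (use Q fb_via in auto)
    have SY: "St ?u r Y" unfolding St_def using Y(2) by blast
    have "Y \<noteq> emp" using d Y(2) wit_iff by (metis els_iff not_emp)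
    moreover have "Y \<epsilon> pw" using Y pw(2) unfolding Sub_def by blast
    ultimately obtain z where z: "opr Y z \<epsilon> c" using c(4) by blast
    have ne: "opr a b \<noteq> emp" for a b unfolding opr_def by (metis not_emp upr_iff)
    have "?u \<noteq> opr emp x" for x using ne by simp
    then obtain Y' where "St ?u r Y'" "opr Y' y0 \<epsilon> c" using r(3) SY z unfolding R_def by blast
    then have "opr Y y0 \<epsilon> c" using St_unique SY by blast
    then have "y0 \<epsilon> Y" using c(3) by blast
    then have "ev E (els P) q (case_nat y0 v)" using Y(2) wit_iff by blast
    moreover have "y0 \<epsilon> H" using HI y0 by blast
    ultimately show ?thesis by blast
  qed
  show ?thesis
  proof (rule that[OF f(2) H(2)])
    show "Sub N0 H" using NH unfolding Sub_def by blast
    show "X \<epsilon> H" by (rule XH)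
    show "elem (\<lambda>x. x) H P" unfolding elem_def using tarski_vaught[OF sub wit] HP by simp
  qed
qed

text \<open>Elementarity in a transitive model makes \<open>H\<close> extensional, so it collapses
  injectively. The transitive part of \<open>H\<close> is not moved, and neither are subsets of that
  part that belong to \<open>H\<close>.\<close>

lemma elementary_collapse:
  assumes P: "ZF P" and H: "H \<noteq> emp" and elemH: "elem (\<lambda>x. x) H P"
  obtains g \<pi> T where "ZF T" "elem g H T" "Fun \<pi> H" "\<And>x y. opr x y \<epsilon> \<pi> \<longleftrightarrow> x \<epsilon> H \<and> y = g x"
    "\<And>y. y \<epsilon> T \<Longrightarrow> \<exists>x. x \<epsilon> H \<and> y = g x" "\<And>A x. Trn A \<Longrightarrow> Sub A H \<Longrightarrow> x \<epsilon> H \<Longrightarrow> Sub x A \<Longrightarrow> g x = x"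
proof -
  have ext: "x = y" if xy: "x \<epsilon> H" "y \<epsilon> H" and eq: "\<And>z. z \<epsilon> H \<Longrightarrow> z \<epsilon> x \<longleftrightarrow> z \<epsilon> y" for x y
  proof -
    have xyP: "x \<epsilon> P" "y \<epsilon> P" using xy elem_in[OF elemH] by blast+
    have "holds E (els H) [x, y] (\<^bold>\<forall>z. z \<^bold>\<in> 0 \<^bold>\<longleftrightarrow> z \<^bold>\<in> 1)" using eq by simp
    then have "holds E (els P) [x, y] (\<^bold>\<forall>z. z \<^bold>\<in> 0 \<^bold>\<longleftrightarrow> z \<^bold>\<in> 1)"
      using elem_holds[OF elemH xy(1), of "[x, y]" "\<^bold>\<forall>z. z \<^bold>\<in> 0 \<^bold>\<longleftrightarrow> z \<^bold>\<in> 1"] xy by simp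
    then have "\<forall>z. z \<epsilon> P \<longrightarrow> (z \<epsilon> x \<longleftrightarrow> z \<epsilon> y)" by simp
    then show "x = y" using ZF_Trn[OF P] xyP by (intro extensionality) blast
  qed
  obtain \<pi> T where \<pi>: "Fun \<pi> H" "Rng \<pi> T" "Trn T" "\<And>x x' y. opr x y \<epsilon> \<pi> \<Longrightarrow> opr x' y \<epsilon> \<pi> \<Longrightarrow> x = x'"
    "\<And>x y v. opr x y \<epsilon> \<pi> \<Longrightarrow> v \<epsilon> y \<longleftrightarrow> (\<exists>u. u \<epsilon> H \<and> u \<epsilon> x \<and> opr u v \<epsilon> \<pi>)"
    "\<And>x y u v. opr x y \<epsilon> \<pi> \<Longrightarrow> opr u v \<epsilon> \<pi> \<Longrightarrow> v \<epsilon> y \<longleftrightarrow> u \<epsilon> x"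
  proof (rule mostowski[of H])
    show "x \<epsilon> H \<Longrightarrow> y \<epsilon> H \<Longrightarrow> (\<And>z. z \<epsilon> H \<Longrightarrow> z \<epsilon> x \<longleftrightarrow> z \<epsilon> y) \<Longrightarrow> x = y" for x y by (rule ext)
  qed (rule that)
  define g where "g x = (THE y. opr x y \<epsilon> \<pi>)" for x
  have g: "opr x y \<epsilon> \<pi> \<longleftrightarrow> x \<epsilon> H \<and> y = g x" for x y
  proof
    assume xy: "opr x y \<epsilon> \<pi>"
    then have "g x = y" unfolding g_def using FunD[OF \<pi>(1)] by (intro the_equality) blast+
    then show "x \<epsilon> H \<and> y = g x" using Fun_dom[OF \<pi>(1) xy] by blast
  next
    assume x: "x \<epsilon> H \<and> y = g x"
    then obtain z where z: "opr x z \<epsilon> \<pi>" using Fun_ex[OF \<pi>(1)] by blast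
    then have "g x = z" unfolding g_def using FunD[OF \<pi>(1)] by (intro the_equality) blast+
    then show "opr x y \<epsilon> \<pi>" using x z by simp
  qed
  have T: "y \<epsilon> T \<longleftrightarrow> (\<exists>x. x \<epsilon> H \<and> y = g x)" for y using \<pi>(2) g unfolding Rng_def by blast
  have bij: "bij_betw g (els H) (els T)"
    unfolding bij_betw_def inj_on_def using T \<pi>(4) g by (auto simp: image_def)
  have gmem: "g u \<epsilon> g x \<longleftrightarrow> u \<epsilon> x" if "x \<epsilon> H" "u \<epsilon> H" for x u using \<pi>(6) g that by blast
  have gev: "ev E (els H) p v \<longleftrightarrow> ev E (els T) p (\<lambda>i. g (v i))" if "\<And>i. v i \<epsilon> H" for p v
    using ev_iso[OF bij, where E = E and E' = E] gmem that by simp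
  have elemT: "elem g H T" unfolding elem_def using gev T by blast

  have "ZF T"
  proof (rule ZF_transfer[OF P \<pi>(3)])
    obtain a where a: "a \<epsilon> H" using H emp_iff by blast
    then show "T \<noteq> emp" using T not_emp by metis
    fix p and v :: "nat \<Rightarrow> 'a" assume p: "free_below 0 p"
    have "ev E (els P) p v \<longleftrightarrow> ev E (els P) p (\<lambda>i. a)" by (rule ev_cong[OF p]) simp
    also have "\<dots> \<longleftrightarrow> ev E (els T) p (\<lambda>i. g a)" using elem_ev[OF elemH, of "\<lambda>i. a"] gev a by simp
    also have "\<dots> \<longleftrightarrow> ev E (els T) p v" by (rule ev_cong[OF p]) simp
    finally show "ev E (els P) p v \<longleftrightarrow> ev E (els T) p v" .
  qed
  have g_eq: "g x = x" if x: "x \<epsilon> H" and u: "\<And>u. u \<epsilon> x \<Longrightarrow> u \<epsilon> H \<and> g u = u" for x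
  proof (rule extensionality)
    fix v
    have "v \<epsilon> g x \<longleftrightarrow> (\<exists>u. u \<epsilon> H \<and> u \<epsilon> x \<and> opr u v \<epsilon> \<pi>)" using \<pi>(5) g x by blast
    then show "v \<epsilon> g x \<longleftrightarrow> v \<epsilon> x" using g u by metis
  qed
  \<comment> \<open>First the elements of \<open>A\<close> are fixed, by induction; then any element
    of \<open>H\<close> included in \<open>A\<close>, since it has only fixed elements.\<close>
  have g_id: "g x = x" if A: "Trn A" "Sub A H" "x \<epsilon> H" "Sub x A" for A x
  proof -
    have AH: "\<And>x. x \<epsilon> A \<Longrightarrow> x \<epsilon> H" using A(2) unfolding Sub_def by blast
    have "opr y y \<epsilon> \<pi>" if y: "y \<epsilon> A" for y
    proof (rule vind[of "[\<pi>]" "is_app 0 1 1" A "\<lambda>y. opr y y \<epsilon> \<pi>" y, OF _ _ _ y])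
      fix y assume y: "y \<epsilon> A" and IH: "\<And>u. u \<epsilon> A \<Longrightarrow> u \<epsilon> y \<Longrightarrow> opr u u \<epsilon> \<pi>"
      have "g y = y" using A(1) y IH g AH unfolding Trn_def by (intro g_eq) metis+
      then show "opr y y \<epsilon> \<pi>" using g AH[OF y] by simp
    qed simp_all
    then show ?thesis using A(3,4) g AH unfolding Sub_def by (intro g_eq) metis+
  qed
  show ?thesis
    by (rule that[OF \<open>ZF T\<close> elemT \<pi>(1) g]) (use T g_id in blast)+
qed

text \<open>The tall model axiom excludes bijections while the hull yields a surjection. Least
  preimages invert the surjection to an injection of \<beta> into \<alpha>, and the Cantor-Bernstein
  argument combines it with the inclusion.\<close>

lemma surjection_bij:
  assumes O: "Ord \<alpha>" "Ord \<beta>" "Sub \<alpha> \<beta>" and sv: "Sv s" and onto: "\<And>y. y \<epsilon> \<beta> \<Longrightarrow> \<exists>x. x \<epsilon> \<alpha> \<and> opr x y \<epsilon> s"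
  obtains b where "Bij b \<alpha> \<beta>"
proof -
  obtain Q where Q: "ZF Q" "set [\<alpha>, \<beta>, s] \<subseteq> els Q" using Loc_list Mdl_ZF by blast
  then have AQ: "\<alpha> \<epsilon> Q" "\<beta> \<epsilon> Q" "s \<epsilon> Q" by simp_all
  \<comment> \<open>\<open>x\<close> is the least preimage of \<open>y\<close> under
    \<open>s\<close>; the well-order of \<alpha> replaces choice here.\<close>
  define lst where "lst x y \<longleftrightarrow> opr x y \<epsilon> s \<and> (\<forall>u. u \<epsilon> x \<longrightarrow> \<not> opr u y \<epsilon> s)" for x y
  have lst_ex: "\<exists>x. x \<epsilon> \<alpha> \<and> lst x y" if y: "y \<epsilon> \<beta>" for y
  proof -
    obtain D where D: "\<And>x. x \<epsilon> D \<longleftrightarrow> x \<epsilon> \<alpha> \<and> opr x y \<epsilon> s"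
      by (rule vsep[of "[s, y]" "is_app 0 2 1" \<alpha> "\<lambda>x. opr x y \<epsilon> s"]) (simp, simp, blast)
    then have "D \<noteq> emp" using onto[OF y] by auto
    then obtain x where x: "x \<epsilon> D" "\<And>z. z \<epsilon> D \<Longrightarrow> \<not> z \<epsilon> x" using foundation unfolding Fnd_def by blast
    then have "lst x y" unfolding lst_def using D Ord_Trn[OF O(1)] by blast
    then show ?thesis using x(1) D by blast
  qed
  have lst_eq: "x = x'" if "lst x y" "lst x' y" "x \<epsilon> \<alpha>" "x' \<epsilon> \<alpha>" for x x' y
    using that Ord_trich Ord_mem[OF O(1)] unfolding lst_def by blast
  have lst_inj: "y = y'" if "lst x y" "lst x y'" for x y y'
    using that sv unfolding lst_def Sv_def by blast
  obtain i where i: "i \<epsilon> Q" and i_iff: "\<And>x y. opr x y \<epsilon> i \<longleftrightarrow> x \<epsilon> \<alpha> \<and> y \<epsilon> \<beta> \<and> lst x y"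
    by (rule ZF_rel[OF Q(1) AQ(1,2), of "[s]" "\<lambda>x y. is_app 0 x y \<^bold>\<and> (\<^bold>\<forall>u. u \<^bold>\<in> x \<^bold>\<longrightarrow> \<^bold>\<not> is_app 0 u y)" lst])
      (use Q(1) AQ(3) in \<open>simp_all add: lst_def bnd that\<close>)
  obtain pw where pw: "pw \<epsilon> Q" "\<And>z. z \<epsilon> pw \<longleftrightarrow> z \<epsilon> Q \<and> Sub z \<beta>" using ZF_pow[OF Q(1) AQ(2)] by metis
  \<comment> \<open>The set \<open>S\<close> below is the smallest one containing the part of
    \<beta> outside \<alpha> and closed under least preimages. It is formed as an intersection
    inside \<open>Q\<close>, where the power set of \<beta> is available, so no iteration along
    omega is needed.\<close>
  define cl where "cl Z \<longleftrightarrow> (\<forall>x. x \<epsilon> \<beta> \<and> \<not> x \<epsilon> \<alpha> \<longrightarrow> x \<epsilon> Z) \<and> (\<forall>x y. y \<epsilon> Z \<and> opr x y \<epsilon> i \<longrightarrow> x \<epsilon> Z)" for Z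
  obtain S where S: "S \<epsilon> Q" "\<And>z. z \<epsilon> S \<longleftrightarrow> z \<epsilon> \<beta> \<and> (\<forall>Z. Z \<epsilon> pw \<longrightarrow> cl Z \<longrightarrow> z \<epsilon> Z)"
  proof (rule ZF_sep[of Q "[\<alpha>, \<beta>, i, pw]" \<beta> "\<^bold>\<forall>Z. Z \<^bold>\<in> 3 \<^bold>\<longrightarrow> (\<^bold>\<forall>x. x \<^bold>\<in> 1 \<^bold>\<and> \<^bold>\<not> x \<^bold>\<in> 0 \<^bold>\<longrightarrow> x \<^bold>\<in> Z) \<^bold>\<and>
      (\<^bold>\<forall>x y. y \<^bold>\<in> Z \<^bold>\<and> is_app 2 x y \<^bold>\<longrightarrow> x \<^bold>\<in> Z) \<^bold>\<longrightarrow> 4 \<^bold>\<in> Z"])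
    fix z assume z: "z \<epsilon> Q"
    have 1: "(\<forall>x\<in>els Q. x \<epsilon> \<beta> \<and> \<not> x \<epsilon> \<alpha> \<longrightarrow> x \<epsilon> Z) \<longleftrightarrow> (\<forall>x. x \<epsilon> \<beta> \<and> \<not> x \<epsilon> \<alpha> \<longrightarrow> x \<epsilon> Z)" for Z
      using ZF_Trn[OF Q(1) AQ(2)] by blast
    have 2: "(\<forall>x\<in>els Q. \<forall>y\<in>els Q. y \<epsilon> Z \<and> opr x y \<epsilon> i \<longrightarrow> x \<epsilon> Z) \<longleftrightarrow> (\<forall>x y. y \<epsilon> Z \<and> opr x y \<epsilon> i \<longrightarrow> x \<epsilon> Z)" for Z
      using ZF_app[OF Q(1) i] by blast
    have 3: "(\<forall>Z\<in>els Q. Z \<epsilon> pw \<longrightarrow> F Z) \<longleftrightarrow> (\<forall>Z. Z \<epsilon> pw \<longrightarrow> F Z)" for F using pw(2) by blast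
    show "holds E (els Q) ([\<alpha>, \<beta>, i, pw] @ [z]) (\<^bold>\<forall>Z. Z \<^bold>\<in> 3 \<^bold>\<longrightarrow> (\<^bold>\<forall>x. x \<^bold>\<in> 1 \<^bold>\<and> \<^bold>\<not> x \<^bold>\<in> 0 \<^bold>\<longrightarrow> x \<^bold>\<in> Z) \<^bold>\<and>
      (\<^bold>\<forall>x y. y \<^bold>\<in> Z \<^bold>\<and> is_app 2 x y \<^bold>\<longrightarrow> x \<^bold>\<in> Z) \<^bold>\<longrightarrow> 4 \<^bold>\<in> Z) \<longleftrightarrow> (\<forall>Z. Z \<epsilon> pw \<longrightarrow> cl Z \<longrightarrow> z \<epsilon> Z)"
      unfolding cl_def using z Q(1) AQ i pw(1)
      by (simp add: 1 2 3 del: all_simps ball_simps ex_simps bex_simps)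
  qed (use Q pw AQ i in auto)
  have S_cl: "x \<epsilon> S" if "y \<epsilon> S" "opr x y \<epsilon> i" for x y
    using that O(3) i_iff unfolding S(2) cl_def Sub_def by blast
  have S_base: "x \<epsilon> S" if "x \<epsilon> \<beta>" "\<not> x \<epsilon> \<alpha>" for x using that unfolding S(2) cl_def by blast
  \<comment> \<open>Otherwise \<open>x\<close> could be dropped from \<open>S\<close> without
    violating the closure conditions, against minimality.\<close>
  have S_inv: "\<exists>y. y \<epsilon> S \<and> opr x y \<epsilon> i" if x: "x \<epsilon> S" "x \<epsilon> \<alpha>" for x
  proof (rule ccontr)
    assume no: "\<not> ?thesis"
    obtain Z where Z: "Z \<epsilon> Q" "\<And>z. z \<epsilon> Z \<longleftrightarrow> z \<epsilon> S \<and> z \<noteq> x"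
    proof (rule ZF_sep[of Q "[x]" S "\<^bold>\<not> 1 \<^bold>= 0" "\<lambda>z. z \<noteq> x"])
      show "set [x] \<subseteq> els Q" using ZF_Trn[OF Q(1) S(1) x(1)] by simp
    qed (use Q S(1) in auto)
    have "Z \<epsilon> pw" using pw(2) Z S(2) unfolding Sub_def by blast
    moreover have "cl Z" unfolding cl_def using Z(2) S_base S_cl no x(2) by blast
    ultimately have "x \<epsilon> Z" using x(1) S(2) by blast
    then show False using Z(2) by blast
  qed
  \<comment> \<open>On \<open>S\<close> the map goes back from a least preimage to the point it came
    from; elsewhere it is the identity.\<close>
  define bb where "bb x y \<longleftrightarrow> x \<epsilon> S \<and> y \<epsilon> S \<and> opr x y \<epsilon> i \<or> \<not> x \<epsilon> S \<and> y = x" for x y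
  obtain b where "b \<epsilon> Q" and b: "\<And>p. p \<epsilon> b \<Longrightarrow> \<exists>x y. p = opr x y" "\<And>x y. opr x y \<epsilon> b \<longleftrightarrow> x \<epsilon> \<alpha> \<and> y \<epsilon> \<beta> \<and> bb x y"
    by (rule ZF_rel[OF Q(1) AQ(1,2), of "[S, i]" "\<lambda>x y. x \<^bold>\<in> 0 \<^bold>\<and> y \<^bold>\<in> 0 \<^bold>\<and> is_app 1 x y \<^bold>\<or> \<^bold>\<not> x \<^bold>\<in> 0 \<^bold>\<and> y \<^bold>= x" bb])
      (use Q(1) S(1) i in \<open>simp_all add: bb_def that\<close>)
  have "Fun b \<alpha>"
  proof (rule FunI)
    show "p \<epsilon> b \<Longrightarrow> \<exists>x y. x \<epsilon> \<alpha> \<and> p = opr x y" for p using b by metis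
    show "\<exists>y. opr x y \<epsilon> b" if x: "x \<epsilon> \<alpha>" for x
    proof (cases "x \<epsilon> S")
      case True
      then obtain y where "y \<epsilon> S" "opr x y \<epsilon> i" using S_inv x by blast
      then show ?thesis using b(2) True x i_iff unfolding bb_def by blast
    next
      case False
      then show ?thesis using b(2) x O(3) unfolding bb_def Sub_def by blast
    qed
    show "y = z" if "opr x y \<epsilon> b" "opr x z \<epsilon> b" for x y z
      using that lst_inj unfolding b(2) bb_def i_iff by blast
  qed
  moreover have "x = y" if "opr x z \<epsilon> b" "opr y z \<epsilon> b" for x y z
    using that lst_eq unfolding b(2) bb_def i_iff by blast
  moreover have "\<exists>x. opr x y \<epsilon> b" if y: "y \<epsilon> \<beta>" for y
  proof (cases "y \<epsilon> S")
    case True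
    obtain x where "x \<epsilon> \<alpha>" "lst x y" using lst_ex y by blast
    then have "opr x y \<epsilon> i" using i_iff y by blast
    then show ?thesis using b(2) S_cl[OF True] i_iff True unfolding bb_def by blast
  next
    case False
    then show ?thesis using b(2) S_base y unfolding bb_def by blast
  qed
  moreover have "y \<epsilon> \<beta>" if "opr x y \<epsilon> b" for x y using that b(2) by blast
  ultimately have "Bij b \<alpha> \<beta>" unfolding Bij_def Inj_def Map_def by blast
  then show ?thesis using that by blast
qed

lemma composition:
  obtains k where "\<And>x z. opr x z \<epsilon> k \<longleftrightarrow> (\<exists>y. opr x y \<epsilon> f \<and> opr y z \<epsilon> g)"
proof -
  obtain Q where Q: "ZF Q" "set [f, g] \<subseteq> els Q" using Loc_list Mdl_ZF by blast
  then have fg: "f \<epsilon> Q" "g \<epsilon> Q" by simp_all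
  obtain d where d: "d \<epsilon> Q" "\<And>x. x \<epsilon> d \<longleftrightarrow> (\<exists>y. opr x y \<epsilon> f)" using ZF_dom[OF Q(1) fg(1)] by metis
  obtain r where r: "r \<epsilon> Q" "Rng g r" using ZF_rng[OF Q(1) fg(2)] by metis
  obtain k where k: "\<And>x z. opr x z \<epsilon> k \<longleftrightarrow> x \<epsilon> d \<and> z \<epsilon> r \<and> (\<exists>y. opr x y \<epsilon> f \<and> opr y z \<epsilon> g)"
  proof (rule ZF_rel[OF Q(1) d(1) r(1), of "[f, g]" "\<lambda>x z. \<^bold>\<exists>y. is_app 0 x y \<^bold>\<and> is_app 1 y z"])
    fix k assume "\<And>x z. opr x z \<epsilon> k \<longleftrightarrow> x \<epsilon> d \<and> z \<epsilon> r \<and> (\<exists>y. opr x y \<epsilon> f \<and> opr y z \<epsilon> g)"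
    then show thesis by (rule that)
  qed (use Q(1) fg in \<open>simp_all add: bnd\<close>)
  have "opr x z \<epsilon> k \<longleftrightarrow> (\<exists>y. opr x y \<epsilon> f \<and> opr y z \<epsilon> g)" for x z
    unfolding k using d(2) r(2) unfolding Rng_def by blast
  then show ?thesis using that by blast
qed

section \<open>Elementary embeddings and strongly critical models\<close>

lemma elem_opr:
  assumes "elem g A B" "ZF A" "ZF B" "x \<epsilon> A" "y \<epsilon> A"
  shows "g (opr x y) = opr (g x) (g y)"
proof -
  have p: "opr x y \<epsilon> A" using assms ZF_opr by blast
  then show ?thesis
    using elem_holds[OF assms(1,4), of "[x, y, opr x y]" "is_pair 0 1 2"] assms elem_in[OF assms(1)]
    by simp
qed

lemma elem_adj:
  assumes g: "elem g A B" and A: "ZF A" "ZF B" and xy: "x \<epsilon> A" "y \<epsilon> A"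
  shows "g (adj x y) = adj (g x) (g y)"
proof -
  let ?F = "\<^bold>\<forall>z. z \<^bold>\<in> 2 \<^bold>\<longleftrightarrow> z \<^bold>\<in> 0 \<^bold>\<or> z \<^bold>= 1"
  have a: "adj x y \<epsilon> A" using A(1) xy ZF_adj by blast
  have B: "g x \<epsilon> B" "g y \<epsilon> B" "g (adj x y) \<epsilon> B" using elem_in[OF g] xy a by blast+
  have "holds E (els A) [x, y, adj x y] ?F" by simp
  then have "holds E (els B) [g x, g y, g (adj x y)] ?F"
    using elem_holds[OF g xy(1), of "[x, y, adj x y]" ?F] xy a by simp
  then have "\<forall>z. z \<epsilon> B \<longrightarrow> (z \<epsilon> g (adj x y) \<longleftrightarrow> z \<epsilon> g x \<or> z = g y)" by simp
  then show ?thesis using ZF_Trn[OF A(2) B(3)] ZF_Trn[OF A(2) B(1)] B(2) by (intro extensionality) auto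
qed

lemma elem_emp:
  assumes "elem g A B" "ZF A" "ZF B"
  shows "g emp = emp"
  using elem_holds[OF assms(1) ZF_emp[OF assms(2)], of "[emp]" "is_empty 0"] assms
    ZF_emp[OF assms(2)] elem_in[OF assms(1) ZF_emp[OF assms(2)]] by simp

lemma elem_nu:
  assumes "elem g A B" "ZF A" "ZF B"
  shows "g (nu n) = nu n"
  by (induction n) (simp_all add: nu.simps suc_def elem_emp[OF assms] elem_adj[OF assms] ZF_nu[OF assms(2)])

lemma code_in: "ZF A \<Longrightarrow> code p \<epsilon> A"
  by (induction p) (simp_all add: ZF_codes ZF_nu)

lemma elem_code:
  assumes "elem g A B" "ZF A" "ZF B"
  shows "g (code p) = code p"
  by (induction p) (simp_all add: kMem_def kEq_def kFls_def kImp_def kAll_def elem_opr[OF assms] elem_nu[OF assms]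
      ZF_nu[OF assms(2)] ZF_opr[OF assms(2)] code_in[OF assms(2)])

lemma lseq_in: "ZF A \<Longrightarrow> set xs \<subseteq> els A \<Longrightarrow> lseq xs \<epsilon> A"
  by (induction xs rule: rev_induct) (simp_all add: ZF_emp ZF_adj ZF_opr ZF_nu)

lemma elem_lseq:
  assumes "elem g A B" "ZF A" "ZF B"
  shows "set xs \<subseteq> els A \<Longrightarrow> g (lseq xs) = lseq (map g xs)"
  by (induction xs rule: rev_induct) (simp_all add: elem_emp[OF assms] elem_adj[OF assms] elem_opr[OF assms]
      elem_nu[OF assms] ZF_nu[OF assms(2)] ZF_opr[OF assms(2)] lseq_in[OF assms(2)])

lemma elem_Trn:
  assumes "elem g A B" "ZF A" "ZF B" "x \<epsilon> A"
  shows "Trn (g x) \<longleftrightarrow> Trn x"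
  using elem_holds[OF assms(1,4), of "[x]" "is_trans 0"] assms elem_in[OF assms(1,4)] by simp

lemma elem_Ord:
  assumes "elem g A B" "ZF A" "ZF B" "x \<epsilon> A"
  shows "Ord (g x) \<longleftrightarrow> Ord x"
  using elem_holds[OF assms(1,4), of "[x]" "is_ord 0"] assms elem_in[OF assms(1,4)] by simp

lemma elem_Map:
  assumes "elem g A B" "ZF A" "ZF B" "f \<epsilon> A" "a \<epsilon> A" "b \<epsilon> A"
  shows "Map (g f) (g a) (g b) \<longleftrightarrow> Map f a b"
  using elem_holds[OF assms(1,4), of "[f, a, b]" "is_map 0 1 2"] assms elem_in[OF assms(1)] by simp

lemma elem_Fun:
  assumes "elem g A B" "ZF A" "ZF B" "f \<epsilon> A" "a \<epsilon> A"
  shows "Fun (g f) (g a) \<longleftrightarrow> Fun f a"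
  using elem_holds[OF assms(1,4), of "[f, a]" "is_fun 0 1"] assms elem_in[OF assms(1)] by simp

text \<open>Satisfaction in \<open>N\<close> is a statement about elements of \<open>A\<close>, so
  the map preserves it. Standard codes and standard numbers are fixed, which makes the transferred
  statement about \<open>g N\<close> concern the same external formula.\<close>

lemma elem_restrict:
  assumes g: "elem g A B" "ZF A" "ZF B" and N: "N \<epsilon> A"
  shows "elem g N (g N)"
  unfolding elem_def
proof (intro conjI allI impI)
  have NA: "x \<epsilon> A" if "x \<epsilon> N" for x using ZF_Trn[OF g(2) N that] .
  show "x \<epsilon> N \<Longrightarrow> g x \<epsilon> g N" for x using elem_mem[OF g(1) NA N] by blast
  then have gN: "x \<epsilon> N \<Longrightarrow> g x \<epsilon> g N" for x .
  fix q and v :: "nat \<Rightarrow> 'a" assume v: "\<forall>i. v i \<epsilon> N"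
  obtain m p where m: "0 < m" "nb m p" and p: "\<And>M d v. d \<epsilon> M \<Longrightarrow> (\<And>i. v i \<epsilon> M) \<Longrightarrow>
      Sat M (nu m) (code p) (lseq (d # map v [0..<m - 1])) \<longleftrightarrow> ev E (els M) q (case_nat d v)"
    using Sat_fm[of q] by metis
  let ?w = "\<lambda>i. v (Suc i)" and ?xs = "v 0 # map (\<lambda>i. v (Suc i)) [0..<m - 1]"
  have xs: "set ?xs \<subseteq> els A" using v NA by auto
  have c: "case_nat (h (v 0)) (\<lambda>i. h (v (Suc i))) = (\<lambda>i. h (v i))" for h :: "'a \<Rightarrow> 'a" by (auto split: nat.split)
  have S: "set [N, nu m, code p, lseq ?xs] \<subseteq> els A" using N ZF_nu[OF g(2)] code_in[OF g(2)] lseq_in[OF g(2) xs] by simp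
  then have S': "set (map g [N, nu m, code p, lseq ?xs]) \<subseteq> els B" using elem_in[OF g(1)] by auto
  have "ev E (els N) q v \<longleftrightarrow> Sat N (nu m) (code p) (lseq ?xs)"
    using p[of "v 0" N ?w] v c[of "\<lambda>x. x"] by simp
  also have "\<dots> \<longleftrightarrow> holds E (els A) [N, nu m, code p, lseq ?xs] (sat 0 1 2 3)" using S g(2) by simp
  also have "\<dots> \<longleftrightarrow> holds E (els B) (map g [N, nu m, code p, lseq ?xs]) (sat 0 1 2 3)"
    by (rule elem_holds[OF g(1) N S]) simp
  also have "\<dots> \<longleftrightarrow> Sat (g N) (nu m) (code p) (lseq (map g ?xs))"
    using S' g(3) elem_nu[OF g] elem_code[OF g] elem_lseq[OF g xs] by simp
  also have "\<dots> \<longleftrightarrow> ev E (els (g N)) q (\<lambda>i. g (v i))"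
    using p[of "g (v 0)" "g N" "\<lambda>i. g (v (Suc i))"] v gN c[of g] by (simp add: o_def)
  finally show "ev E (els N) q v \<longleftrightarrow> ev E (els (g N)) q (\<lambda>i. g (v i))" .
qed

text \<open>For the least ordinal \<open>x\<close> that is lowered, applying the map once more
  lowers \<open>g x\<close> too, although \<open>g x\<close> is smaller than
  \<open>x\<close>.\<close>

lemma elem_Ord_le:
  assumes g: "elem g A B" and x: "\<theta> \<epsilon> A" "Trn A" "Ord \<theta>" and s: "\<And>x y. x \<epsilon> A \<Longrightarrow> opr x y \<epsilon> s \<longleftrightarrow> y = g x"
  shows "\<not> g \<theta> \<epsilon> \<theta>"
proof
  assume "g \<theta> \<epsilon> \<theta>"
  have tA: "\<And>x. x \<epsilon> suc \<theta> \<Longrightarrow> x \<epsilon> A" using x unfolding suc_iff Trn_def by blast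
  \<comment> \<open>The external map enters through its graph \<open>s\<close>; the successor makes
    \<open>\<theta>\<close> itself a candidate.\<close>
  obtain D where D: "\<And>x. x \<epsilon> D \<longleftrightarrow> x \<epsilon> suc \<theta> \<and> (\<exists>y. opr x y \<epsilon> s \<and> y \<epsilon> x)"
    by (rule vsep[of "[s]" "\<^bold>\<exists>y. is_app 0 1 y \<^bold>\<and> y \<^bold>\<in> 1" "suc \<theta>" "\<lambda>x. \<exists>y. opr x y \<epsilon> s \<and> y \<epsilon> x"])
      (simp, simp add: bnd del: suc_iff, blast)
  have D': "x \<epsilon> D \<longleftrightarrow> x \<epsilon> suc \<theta> \<and> g x \<epsilon> x" for x  proof (cases "x \<epsilon> suc \<theta>")
    case True
    then show ?thesis unfolding D s[OF tA[OF True]] by blast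
  qed (use D in blast)
  have "\<theta> \<epsilon> D" using D' \<open>g \<theta> \<epsilon> \<theta>\<close> by simp
  then have "D \<noteq> emp" by auto
  then obtain x where x': "x \<epsilon> D" "\<And>z. z \<epsilon> D \<Longrightarrow> \<not> z \<epsilon> x" using foundation unfolding Fnd_def by blast
  then have gx: "g x \<epsilon> x" "x \<epsilon> suc \<theta>" using D' by blast+
  have "Ord (suc \<theta>)" using Ord_suc x(3) .
  then have "g x \<epsilon> suc \<theta>" using Ord_Trn gx by blast
  moreover from this have "g (g x) \<epsilon> g x" using elem_mem[OF g] tA gx by blast
  ultimately show False using x' D' gx by blast
qed

text \<open>\<open>w\<close> lists functions, and the parameter at variable \<open>i\<close> is the
  value of the \<open>i\<close>-th one at \<open>\<xi>\<close>. With \<open>is_wit\<close> this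
  expresses truth at coordinate \<open>\<xi>\<close> in the manner of an ultrapower.\<close>

definition evl :: "'a \<Rightarrow> 'a \<Rightarrow> 'a \<Rightarrow> 'a \<Rightarrow> bool" where
  "evl w \<xi> i z \<longleftrightarrow> (\<exists>f. opr i f \<epsilon> w \<and> opr \<xi> z \<epsilon> f)"

definition is_evl :: "var \<Rightarrow> var \<Rightarrow> var \<Rightarrow> var \<Rightarrow> form" where
  "is_evl w \<xi> i z = (\<^bold>\<exists>f. is_app w i f \<^bold>\<and> is_app f \<xi> z)"

lemma fb_is_evl [simp]: "0 < n \<Longrightarrow> fb n (is_wit (is_evl w \<xi>) P m k y)"
  by (simp add: is_wit_def is_evl_def)

lemma h_is_evl [simp]:
  assumes Q: "ZF Q" and L: "set L \<subseteq> els Q" "w < length L" "\<xi> < length L" "i < length L" "z < length L"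
  shows "holds E (els Q) L (is_evl w \<xi> i z) \<longleftrightarrow> evl (L ! w) (L ! \<xi>) (L ! i) (L ! z)"
proof -
  have "L ! w \<epsilon> Q" using nth_in[OF L(1,2)] by simp
  then have "(\<exists>f\<in>els Q. opr (L ! i) f \<epsilon> L ! w \<and> opr (L ! \<xi>) (L ! z) \<epsilon> f) \<longleftrightarrow> evl (L ! w) (L ! \<xi>) (L ! i) (L ! z)"
    unfolding evl_def using ZF_app[OF Q] by blast
  then show ?thesis unfolding is_evl_def using L Q by simp
qed

lemma h_wit_evl [simp]:
  assumes Q: "ZF Q" and L: "set L \<subseteq> els Q" "w < length L" "\<xi> < length L" "P < length L" "m < length L" "k < length L" "y < length L"
  shows "holds E (els Q) L (is_wit (is_evl w \<xi>) P m k y) \<longleftrightarrow> Wit (evl (L ! w) (L ! \<xi>)) (L ! P) (L ! m) (L ! k) (L ! y)"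
proof (rule h_wit)
  have "L ! w \<epsilon> Q" using nth_in[OF L(1,2)] by simp
  then show "evl (L ! w) (L ! \<xi>) i z \<Longrightarrow> z \<epsilon> Q" for i z unfolding evl_def using ZF_app[OF Q] by blast
  show "holds E (els Q) (L @ zs) (is_evl w \<xi> i z) \<longleftrightarrow> evl (L ! w) (L ! \<xi>) ((L @ zs) ! i) ((L @ zs) ! z)"
    if "set zs \<subseteq> els Q" "i < length (L @ zs)" "z < length (L @ zs)" for zs i z
    using h_is_evl[OF Q, of "L @ zs" w \<xi> i z] that L by simp
qed (use L Q in auto)

text \<open>The transitive collapse of \<open>{j(f)(\<kappa>) | f : \<kappa> \<rightarrow> N3}\<close>, which is elementary in \<open>j(N3)\<close> by
  Los's argument.\<close>

lemma normal_ultrapower: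
  assumes j: "elem j N K" and N: "ZF N" and K: "ZF K" and jj: "\<And>x y. opr x y \<epsilon> jj \<longleftrightarrow> x \<epsilon> N \<and> y = j x"
    and N3: "ZF N3" "N3 \<epsilon> N" and \<kappa>: "\<kappa> \<epsilon> N3" "Ord \<kappa>" "\<kappa> \<epsilon> j \<kappa>" and below: "\<And>\<zeta>. \<zeta> \<epsilon> \<kappa> \<Longrightarrow> j \<zeta> = \<zeta>"
    and maps: "\<And>f. f \<epsilon> N \<Longrightarrow> Map f \<kappa> \<kappa> \<Longrightarrow> f \<epsilon> N3"
  obtains e ee T where "ZF T" "elem e N3 T" "\<And>x y. x \<epsilon> N3 \<Longrightarrow> opr x y \<epsilon> ee \<longleftrightarrow> y = e x"
    "\<And>\<zeta>. \<zeta> \<epsilon> \<kappa> \<Longrightarrow> e \<zeta> = \<zeta>" "\<kappa> \<epsilon> e \<kappa>" "\<And>y. y \<epsilon> e \<kappa> \<Longrightarrow> \<exists>f. Map f \<kappa> \<kappa> \<and> f \<epsilon> N3 \<and> opr \<kappa> y \<epsilon> e f"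
proof -
  let ?K3 = "j N3"
  have N3N: "x \<epsilon> N" if "x \<epsilon> N3" for x using ZF_Trn[OF N N3(2) that] .
  have \<kappa>N: "\<kappa> \<epsilon> N" using N3N \<kappa>(1) .
  have j3: "elem j N3 ?K3" using elem_restrict[OF j N K N3(2)] .
  have K3K: "?K3 \<epsilon> K" using elem_in[OF j N3(2)] .
  have K3: "ZF ?K3"
  proof (rule elem_ZF[OF j3 N3(1)])
    show "Trn ?K3" using elem_Trn[OF j N K N3(2)] N3(1) unfolding ZF_def by blast
  qed
  have jin: "x \<epsilon> N \<Longrightarrow> j x \<epsilon> K" for x using elem_in[OF j] .
  have jMap: "Map (j f) (j \<kappa>) ?K3" if "f \<epsilon> N" "Map f \<kappa> N3" for f
    using elem_Map[OF j N K that(1) \<kappa>N N3(2)] that(2) by blast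
  have jholds: "holds E (els N) xs F \<longleftrightarrow> holds E (els K) (map j xs) F" if "set xs \<subseteq> els N" "fb (length xs) F" for xs F
    using elem_holds[OF j \<kappa>N that] .
  obtain H where H0: "\<And>y. y \<epsilon> H \<longleftrightarrow> y \<epsilon> ?K3 \<and> (\<exists>f z. f \<epsilon> N \<and> Map f \<kappa> N3 \<and> opr f z \<epsilon> jj \<and> opr \<kappa> y \<epsilon> z)"
  proof (rule vsep[of "[N, N3, \<kappa>, jj]" "\<^bold>\<exists>f z. f \<^bold>\<in> 0 \<^bold>\<and> is_map f 2 1 \<^bold>\<and> is_app 3 f z \<^bold>\<and> is_app z 2 4" ?K3])
    fix Q y assume Q: "ZF Q" "set [N, N3, \<kappa>, jj] \<subseteq> els Q" "y \<epsilon> Q"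
    then have jQ: "jj \<epsilon> Q" by simp
    have "(\<exists>f\<in>els Q. \<exists>z\<in>els Q. f \<epsilon> N \<and> Map f \<kappa> N3 \<and> opr f z \<epsilon> jj \<and> opr \<kappa> y \<epsilon> z)
        \<longleftrightarrow> (\<exists>f z. f \<epsilon> N \<and> Map f \<kappa> N3 \<and> opr f z \<epsilon> jj \<and> opr \<kappa> y \<epsilon> z)"
      using ZF_app[OF Q(1) jQ] by blast
    then show "holds E (els Q) ([N, N3, \<kappa>, jj] @ [y]) (\<^bold>\<exists>f z. f \<^bold>\<in> 0 \<^bold>\<and> is_map f 2 1 \<^bold>\<and> is_app 3 f z \<^bold>\<and> is_app z 2 4)
        \<longleftrightarrow> (\<exists>f z. f \<epsilon> N \<and> Map f \<kappa> N3 \<and> opr f z \<epsilon> jj \<and> opr \<kappa> y \<epsilon> z)"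
      using Q by (simp add: eval_nat_numeral del: ex_simps bex_simps)
  qed (simp, blast)
  have H: "y \<epsilon> H \<longleftrightarrow> (\<exists>f. f \<epsilon> N \<and> Map f \<kappa> N3 \<and> opr \<kappa> y \<epsilon> j f)" for y
    unfolding H0 jj using jMap unfolding Map_def by blast
  have HK: "y \<epsilon> ?K3" if "y \<epsilon> H" for y using H0 that by blast
  \<comment> \<open>\<open>j x\<close> is represented by the constant function with value
    \<open>x\<close>.\<close>
  have jH: "j x \<epsilon> H" if x: "x \<epsilon> N3" for x
  proof -
    obtain f where f: "f \<epsilon> N" "\<And>p. p \<epsilon> f \<Longrightarrow> \<exists>\<xi> y. p = opr \<xi> y" and "\<And>\<xi> y. opr \<xi> y \<epsilon> f \<longleftrightarrow> \<xi> \<epsilon> \<kappa> \<and> y \<epsilon> upr x x \<and> True"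
      by (rule ZF_rel[OF N \<kappa>N ZF_upr[OF N N3N[OF x] N3N[OF x]], of "[]" "\<lambda>\<xi> y. y \<^bold>= y" "\<lambda>\<xi> y. True"]) (simp_all add: that)
    then have fI: "opr \<xi> y \<epsilon> f \<longleftrightarrow> \<xi> \<epsilon> \<kappa> \<and> y = x" for \<xi> y by auto
    have "Fun f \<kappa>" by (rule FunI) (use f(2) fI in metis)+
    then have M: "Map f \<kappa> N3" unfolding Map_def fI using x by blast
    let ?F = "\<^bold>\<forall>\<xi>. \<xi> \<^bold>\<in> 0 \<^bold>\<longrightarrow> is_app 1 \<xi> 2"
    have "holds E (els N) [\<kappa>, f, x] ?F" using N \<kappa>N f(1) N3N[OF x] fI by simp
    then have "holds E (els K) [j \<kappa>, j f, j x] ?F" using jholds[of "[\<kappa>, f, x]" ?F] \<kappa>N f(1) N3N[OF x] by simp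
    then have "\<forall>\<xi>\<in>els K. \<xi> \<epsilon> j \<kappa> \<longrightarrow> opr \<xi> (j x) \<epsilon> j f" using K jin \<kappa>N f(1) N3N[OF x] by simp
    then have "opr \<kappa> (j x) \<epsilon> j f" using ZF_Trn[OF K jin[OF \<kappa>N] \<kappa>(3)] \<kappa>(3) by simp
    then show ?thesis using H f(1) M by blast
  qed
  \<comment> \<open>\<kappa> is represented by the identity function.\<close>
  have \<kappa>H: "\<kappa> \<epsilon> H"
  proof -
    obtain f where f: "f \<epsilon> N" "\<And>p. p \<epsilon> f \<Longrightarrow> \<exists>\<xi> y. p = opr \<xi> y" and "\<And>\<xi> y. opr \<xi> y \<epsilon> f \<longleftrightarrow> \<xi> \<epsilon> \<kappa> \<and> y \<epsilon> \<kappa> \<and> \<xi> = y"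
      by (rule ZF_rel[OF N \<kappa>N \<kappa>N, of "[]" "\<lambda>\<xi> y. \<xi> \<^bold>= y" "(=)"]) (simp_all add: that)
    then have fI: "opr \<xi> y \<epsilon> f \<longleftrightarrow> \<xi> \<epsilon> \<kappa> \<and> y = \<xi>" for \<xi> y by auto
    have "Fun f \<kappa>" by (rule FunI) (use f(2) fI in metis)+
    then have M: "Map f \<kappa> N3" unfolding Map_def fI using ZF_Trn[OF N3(1) \<kappa>(1)] by blast
    let ?F = "\<^bold>\<forall>\<xi>. \<xi> \<^bold>\<in> 0 \<^bold>\<longrightarrow> is_app 1 \<xi> \<xi>"
    have "holds E (els N) [\<kappa>, f] ?F" using N \<kappa>N f(1) fI by simp
    then have "holds E (els K) [j \<kappa>, j f] ?F" using jholds[of "[\<kappa>, f]" ?F] \<kappa>N f(1) by simp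
    then have "\<forall>\<xi>\<in>els K. \<xi> \<epsilon> j \<kappa> \<longrightarrow> opr \<xi> \<xi> \<epsilon> j f" using K jin \<kappa>N f(1) by simp
    then have "opr \<kappa> \<kappa> \<epsilon> j f" using ZF_Trn[OF K jin[OF \<kappa>N] \<kappa>(3)] \<kappa>(3) by simp
    then show ?thesis using H f(1) M by blast
  qed
  \<comment> \<open>A single choice function in \<open>N\<close> for subsets of \<open>N3\<close>
    selects the witnesses at all coordinates at once, so that they form a function in
    \<open>N\<close>.\<close>
  obtain pw where pw: "pw \<epsilon> N" "\<And>z. z \<epsilon> pw \<longleftrightarrow> z \<epsilon> N \<and> Sub z N3" using ZF_pow[OF N N3(2)] by metis
  obtain c where c: "c \<epsilon> N" "Sv c" "\<And>x y. opr x y \<epsilon> c \<Longrightarrow> x \<epsilon> pw \<and> y \<epsilon> x" "\<And>x. x \<epsilon> pw \<Longrightarrow> x \<noteq> emp \<Longrightarrow> \<exists>y. opr x y \<epsilon> c"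
    using ZF_choice[OF N pw(1)] by metis
  have wit: "\<exists>d\<in>els H. ev E (els ?K3) q (case_nat d v)"
    if v: "\<And>i. v i \<in> els H" and d: "\<exists>d\<in>els ?K3. ev E (els ?K3) q (case_nat d v)" for q v
  proof -
    obtain m p where m: "0 < m" "nb m p" and p: "\<And>M d v. d \<epsilon> M \<Longrightarrow> (\<And>i. v i \<epsilon> M) \<Longrightarrow>
        Sat M (nu m) (code p) (lseq (d # map v [0..<m - 1])) \<longleftrightarrow> ev E (els M) q (case_nat d v)"
      using Sat_fm[of q] by metis
    have "\<forall>i. \<exists>f. f \<epsilon> N \<and> Map f \<kappa> N3 \<and> opr \<kappa> (v i) \<epsilon> j f" using v H by blast
    then obtain ff where ff: "\<And>i. ff i \<epsilon> N" "\<And>i. Map (ff i) \<kappa> N3" "\<And>i. opr \<kappa> (v i) \<epsilon> j (ff i)" by metis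
    \<comment> \<open>The entry at 0 is again a placeholder for the variable of the witness.\<close>
    let ?ws = "emp # map ff [0..<m - 1]"
    have ws: "set ?ws \<subseteq> els N" using ff(1) ZF_emp[OF N] by auto
    define w where "w = lseq ?ws"
    have wN: "w \<epsilon> N" unfolding w_def using lseq_in[OF N ws] .
    have jw: "j w = lseq (emp # map (\<lambda>i. j (ff i)) [0..<m - 1])"
      unfolding w_def elem_lseq[OF j N K ws] by (simp add: elem_emp[OF j N K] o_def)
    have inN: "nu m \<epsilon> N" "code p \<epsilon> N" using ZF_nu[OF N] code_in[OF N] by blast+
    define W where "W \<xi> y \<longleftrightarrow> Wit (evl w \<xi>) N3 (nu m) (code p) y" for \<xi> y
    define Y where "Y \<xi> A \<longleftrightarrow> (\<forall>y. y \<epsilon> A \<longleftrightarrow> y \<epsilon> N3 \<and> W \<xi> y)" for \<xi> A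
    have Y_unique: "A = A'" if "Y \<xi> A" "Y \<xi> A'" for \<xi> A A' using that unfolding Y_def by (intro extensionality) blast
    have Y_ex: "\<exists>A. A \<epsilon> pw \<and> Y \<xi> A" if \<xi>: "\<xi> \<epsilon> N" for \<xi>
    proof -
      obtain A where "A \<epsilon> N" "\<And>y. y \<epsilon> A \<longleftrightarrow> y \<epsilon> N3 \<and> W \<xi> y"
      proof (rule ZF_sep[of N "[N3, nu m, code p, w, \<xi>]" N3 "is_wit (is_evl 3 4) 0 1 2 5"])
        show "y \<epsilon> N \<Longrightarrow> holds E (els N) ([N3, nu m, code p, w, \<xi>] @ [y]) (is_wit (is_evl 3 4) 0 1 2 5) \<longleftrightarrow> W \<xi> y" for y
          unfolding W_def using N N3(2) inN wN \<xi> by (simp add: eval_nat_numeral)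
      qed (use N N3 inN wN \<xi> in auto)
      then show ?thesis using pw(2) unfolding Y_def Sub_def by blast
    qed
    \<comment> \<open>At coordinate \<open>\<xi>\<close> take the chosen element of the set of
      witnesses for the parameters evaluated at \<open>\<xi>\<close>, or the empty set if there is
      no witness.\<close>
    let ?f = "\<lambda>\<xi> y. \<^bold>\<exists>A. (\<^bold>\<forall>y. y \<^bold>\<in> A \<^bold>\<longleftrightarrow> y \<^bold>\<in> 0 \<^bold>\<and> is_wit (is_evl 3 \<xi>) 0 1 2 y) \<^bold>\<and> (is_app 4 A y \<^bold>\<or> is_empty A \<^bold>\<and> is_empty y)"
    obtain f where f: "f \<epsilon> N" "\<And>p. p \<epsilon> f \<Longrightarrow> \<exists>\<xi> y. p = opr \<xi> y"
      and fI: "\<And>\<xi> y. opr \<xi> y \<epsilon> f \<longleftrightarrow> \<xi> \<epsilon> \<kappa> \<and> y \<epsilon> N3 \<and> (\<exists>A. Y \<xi> A \<and> (opr A y \<epsilon> c \<or> A = emp \<and> y = emp))"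
    proof (rule ZF_rel[OF N \<kappa>N N3(2), of "[N3, nu m, code p, w, c]" ?f])
      fix q \<xi> y assume q: "q \<epsilon> N" "\<xi> \<epsilon> N" "y \<epsilon> N"
      have 1: "(\<forall>y\<in>els N. y \<epsilon> A \<longleftrightarrow> y \<epsilon> N3 \<and> Wit (evl w \<xi>) N3 (nu m) (code p) y) \<longleftrightarrow> Y \<xi> A" if "A \<epsilon> N" for A
        unfolding Y_def W_def using ZF_Trn[OF N that] N3N by blast
      have 2: "(\<exists>A\<in>els N. Y \<xi> A \<and> F A) \<longleftrightarrow> (\<exists>A. Y \<xi> A \<and> F A)" for F
        using Y_ex[OF q(2)] Y_unique pw(2) by (metis els_iff)
      let ?xs = "[N3, nu m, code p, w, c]"
      show "holds E (els N) (?xs @ [q, \<xi>, y]) (?f (Suc (length ?xs)) (Suc (Suc (length ?xs))))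
          \<longleftrightarrow> (\<exists>A. Y \<xi> A \<and> (opr A y \<epsilon> c \<or> A = emp \<and> y = emp))"
        using q N N3(2) inN wN c(1) by (simp add: 1 2 eval_nat_numeral del: all_simps ball_simps ex_simps bex_simps)
    qed (use N3(2) inN wN c(1) that in simp_all)
    have "Fun f \<kappa>"
    proof (rule FunI)
      show "p \<epsilon> f \<Longrightarrow> \<exists>x y. x \<epsilon> \<kappa> \<and> p = opr x y" for p using f(2) fI by metis
      show "\<exists>y. opr \<xi> y \<epsilon> f" if \<xi>: "\<xi> \<epsilon> \<kappa>" for \<xi>
      proof -
        obtain A where A: "A \<epsilon> pw" "Y \<xi> A" using Y_ex[OF ZF_Trn[OF N \<kappa>N \<xi>]] by blast
        show ?thesis
        proof (cases "A = emp")
          case True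
          then show ?thesis using A(2) fI \<xi> ZF_emp[OF N3(1)] by blast
        next
          case False
          then obtain y where y: "opr A y \<epsilon> c" using c(4) A(1) by blast
          then have "y \<epsilon> N3" using c(3) A(2) unfolding Y_def by blast
          then show ?thesis using A(2) fI \<xi> y by blast
        qed
      qed
      show "y = z" if y: "opr \<xi> y \<epsilon> f" and z: "opr \<xi> z \<epsilon> f" for \<xi> y z
      proof -
        obtain A where A: "Y \<xi> A" "opr A y \<epsilon> c \<or> A = emp \<and> y = emp" using y fI by blast
        obtain A' where A': "Y \<xi> A'" "opr A' z \<epsilon> c \<or> A' = emp \<and> z = emp" using z fI by blast
        have "A = A'" using Y_unique A(1) A'(1) .
        then show ?thesis using A(2) A'(2) c(2,3) not_emp unfolding Sv_def by metis
      qed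
    qed
    then have M: "Map f \<kappa> N3" unfolding Map_def using fI by blast
    \<comment> \<open>In \<open>N\<close> the function returns a witness wherever one exists. This
      is transferred to \<open>K\<close> as a statement about all coordinates below
      \<open>j(\<kappa>)\<close> and then read at the coordinate \<kappa>.\<close>
    let ?F = "\<^bold>\<forall>\<xi> y. \<xi> \<^bold>\<in> 4 \<^bold>\<and> is_app 5 \<xi> y \<^bold>\<longrightarrow> (\<^bold>\<exists>z. z \<^bold>\<in> 0 \<^bold>\<and> is_wit (is_evl 3 \<xi>) 0 1 2 z) \<^bold>\<longrightarrow> is_wit (is_evl 3 \<xi>) 0 1 2 y"
    let ?L = "[N3, nu m, code p, w, \<kappa>, f]"
    have L: "set ?L \<subseteq> els N" using N3(2) inN wN \<kappa>N f(1) by simp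
    have key: "W \<xi> y" if y: "opr \<xi> y \<epsilon> f" and z: "z \<epsilon> N3" "W \<xi> z" for \<xi> y z
    proof -
      obtain A where A: "Y \<xi> A" "opr A y \<epsilon> c \<or> A = emp \<and> y = emp" using y fI by blast
      have "z \<epsilon> A" using A(1) z unfolding Y_def by blast
      then have "y \<epsilon> A" using A(2) c(3) by auto
      then show ?thesis using A(1) unfolding Y_def by blast
    qed
    have "holds E (els N) ?L ?F"
      using L N key unfolding W_def by (simp add: eval_nat_numeral) blast
    moreover have "holds E (els N) ?L ?F \<longleftrightarrow> holds E (els K) (map j ?L) ?F"
      by (rule jholds[OF L]) simp
    ultimately have "holds E (els K) [?K3, nu m, code p, j w, j \<kappa>, j f] ?F"
      using elem_nu[OF j N K] elem_code[OF j N K] by simp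
    moreover have L': "set [?K3, nu m, code p, j w, j \<kappa>, j f] \<subseteq> els K"
      using K3K ZF_nu[OF K] code_in[OF K] jin[OF wN] jin[OF \<kappa>N] jin[OF f(1)] by simp
    ultimately have *: "\<forall>\<xi>\<in>els K. \<forall>y\<in>els K. \<xi> \<epsilon> j \<kappa> \<and> opr \<xi> y \<epsilon> j f \<longrightarrow>
        (\<exists>z\<in>els K. z \<epsilon> ?K3 \<and> Wit (evl (j w) \<xi>) ?K3 (nu m) (code p) z) \<longrightarrow> Wit (evl (j w) \<xi>) ?K3 (nu m) (code p) y"
      using K by (simp add: eval_nat_numeral del: all_simps ball_simps ex_simps bex_simps)
    have wit_iff: "Wit (evl (j w) \<kappa>) ?K3 (nu m) (code p) y \<longleftrightarrow> ev E (els ?K3) q (case_nat y v)" if y: "y \<epsilon> ?K3" for y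
    proof (rule Wit_iff[OF m p _ y])
      show "v i \<epsilon> ?K3" for i using v[of i] HK by blast
      fix i z assume i: "i < m - 1"
      have "opr (nu (Suc i)) g \<epsilon> j w \<longleftrightarrow> g = j (ff i)" for g unfolding jw using i by auto
      then have "evl (j w) \<kappa> (nu (Suc i)) z \<longleftrightarrow> opr \<kappa> z \<epsilon> j (ff i)" unfolding evl_def by simp
      moreover have "Fun (j (ff i)) (j \<kappa>)" using jMap[OF ff(1,2)] unfolding Map_def by blast
      ultimately show "evl (j w) \<kappa> (nu (Suc i)) z \<longleftrightarrow> z = v i" using ff(3)[of i] FunD by blast
    qed
    have MK: "Map (j f) (j \<kappa>) ?K3" using jMap f(1) M .
    then obtain y where y: "opr \<kappa> y \<epsilon> j f" using Fun_ex \<kappa>(3) unfolding Map_def by blast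
    have yK: "y \<epsilon> ?K3" using MK y unfolding Map_def by blast
    obtain d where "d \<epsilon> ?K3" "ev E (els ?K3) q (case_nat d v)" using d by blast
    then have "d \<epsilon> ?K3" "Wit (evl (j w) \<kappa>) ?K3 (nu m) (code p) d" using wit_iff by blast+
    then have "Wit (evl (j w) \<kappa>) ?K3 (nu m) (code p) y"
      using * ZF_Trn[OF K K3K] yK ZF_Trn[OF K jin[OF \<kappa>N] \<kappa>(3)] \<kappa>(3) y by blast
    then have "ev E (els ?K3) q (case_nat y v)" using wit_iff yK by blast
    moreover have "y \<epsilon> H" using H f(1) M y by blast
    ultimately show ?thesis by blast
  qed
  have elH: "elem (\<lambda>x. x) H ?K3"
    unfolding elem_def using tarski_vaught[of "els H" "els ?K3", OF _ wit] HK by blast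
  have "H \<noteq> emp" using \<kappa>H by auto
  obtain g \<pi> T where T: "ZF T" "elem g H T" "\<And>x y. opr x y \<epsilon> \<pi> \<longleftrightarrow> x \<epsilon> H \<and> y = g x"
    "\<And>y. y \<epsilon> T \<Longrightarrow> \<exists>x. x \<epsilon> H \<and> y = g x" and fixed: "\<And>A x. Trn A \<Longrightarrow> Sub A H \<Longrightarrow> x \<epsilon> H \<Longrightarrow> Sub x A \<Longrightarrow> g x = x"
    by (rule elementary_collapse[OF K3 \<open>H \<noteq> emp\<close> elH]) (rule that)
  have gholds: "holds E (els ?K3) xs F \<longleftrightarrow> holds E (els T) (map g xs) F" if "set xs \<subseteq> els H" "fb (length xs) F" for xs F
    using elem_holds[OF elH \<kappa>H that] elem_holds[OF T(2) \<kappa>H that] by simp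
  define e where "e x = g (j x)" for x
  have "elem j N3 H"
    unfolding elem_def
  proof (intro conjI allI impI)
    show "x \<epsilon> N3 \<Longrightarrow> j x \<epsilon> H" for x by (rule jH)
    fix q and v :: "nat \<Rightarrow> 'a" assume v: "\<forall>i. v i \<epsilon> N3"
    have "ev E (els N3) q v \<longleftrightarrow> ev E (els ?K3) q (\<lambda>i. j (v i))" using elem_ev[OF j3] v by blast
    also have "\<dots> \<longleftrightarrow> ev E (els H) q (\<lambda>i. j (v i))" using elem_ev[OF elH, of "\<lambda>i. j (v i)"] v jH by blast
    finally show "ev E (els N3) q v \<longleftrightarrow> ev E (els H) q (\<lambda>i. j (v i))" .
  qed
  then have e: "elem e N3 T" unfolding e_def using elem_comp T(2) by blast
  obtain ee where ee0: "\<And>x z. opr x z \<epsilon> ee \<longleftrightarrow> (\<exists>y. opr x y \<epsilon> jj \<and> opr y z \<epsilon> \<pi>)" using composition by metis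
  have ee: "opr x y \<epsilon> ee \<longleftrightarrow> y = e x" if "x \<epsilon> N3" for x y
    unfolding ee0 jj T(3) e_def using jH that N3N by blast
  have trn: "Trn \<kappa>" using \<kappa>(2) by (simp add: Ord_iff)
  have \<kappa>T: "\<zeta> \<epsilon> H" if "\<zeta> \<epsilon> \<kappa>" for \<zeta> using jH[OF ZF_Trn[OF N3(1) \<kappa>(1) that]] below[OF that] by simp
  then have subH: "Sub \<kappa> H" by (simp add: Sub_def)
  \<comment> \<open>The ordinals below \<kappa> are fixed by \<open>j\<close> and hence lie in
    \<open>H\<close>; together with \<kappa> itself in \<open>H\<close>, the collapse leaves
    \<kappa> in place.\<close>
  have g\<kappa>: "g \<kappa> = \<kappa>" using fixed[OF trn subH \<kappa>H] by (simp add: Sub_def)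
  have g\<zeta>: "g \<zeta> = \<zeta>" if "\<zeta> \<epsilon> \<kappa>" for \<zeta>
    using fixed[OF trn subH \<kappa>T[OF that]] trn that unfolding Sub_def Trn_def by blast
  have e\<zeta>: "e \<zeta> = \<zeta>" if "\<zeta> \<epsilon> \<kappa>" for \<zeta> using below g\<zeta> that by (simp add: e_def)
  have \<kappa>e: "\<kappa> \<epsilon> e \<kappa>" using elem_mem[OF T(2) \<kappa>H jH[OF \<kappa>(1)]] \<kappa>(3) g\<kappa> by (simp add: e_def)
  have "\<exists>f. Map f \<kappa> \<kappa> \<and> f \<epsilon> N3 \<and> opr \<kappa> y \<epsilon> e f" if y: "y \<epsilon> e \<kappa>" for y
  proof -
    have "y \<epsilon> T" using ZF_Trn[OF T(1) elem_in[OF e \<kappa>(1)] y] .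
    then obtain d where d: "d \<epsilon> H" "y = g d" using T(4) by blast
    have dj: "d \<epsilon> j \<kappa>" using elem_mem[OF T(2) d(1) jH[OF \<kappa>(1)]] y d(2) by (simp add: e_def)
    obtain f where f: "f \<epsilon> N" "Map f \<kappa> N3" "opr \<kappa> d \<epsilon> j f" using H d(1) by blast
    \<comment> \<open>The representing function takes values in \<open>N3\<close>; values outside
      \<kappa> are replaced by the empty set. As the represented \<open>d\<close> lies in
      \<open>j(\<kappa>)\<close>, its value at coordinate \<kappa> is unaffected.\<close>
    let ?P = "\<lambda>\<xi> z. opr \<xi> z \<epsilon> f \<or> z = emp \<and> \<not> (\<exists>u. u \<epsilon> \<kappa> \<and> opr \<xi> u \<epsilon> f)"
    obtain f' where f': "f' \<epsilon> N" "\<And>p. p \<epsilon> f' \<Longrightarrow> \<exists>\<xi> y. p = opr \<xi> y" and f'I: "\<And>\<xi> z. opr \<xi> z \<epsilon> f' \<longleftrightarrow> \<xi> \<epsilon> \<kappa> \<and> z \<epsilon> \<kappa> \<and> ?P \<xi> z"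
      by (rule ZF_rel[OF N \<kappa>N \<kappa>N, of "[\<kappa>, f]" "\<lambda>\<xi> z. is_app 1 \<xi> z \<^bold>\<or> is_empty z \<^bold>\<and> \<^bold>\<not> (\<^bold>\<exists>u. u \<^bold>\<in> 0 \<^bold>\<and> is_app 1 \<xi> u)" ?P])
        (use N \<kappa>N f(1) in \<open>simp_all add: bnd that\<close>)
    have "\<kappa> \<noteq> emp" using \<kappa>(3) elem_emp[OF j N K] no_loop by metis
    then have "emp \<epsilon> \<kappa>" using Ord_trich[OF Ord_emp \<kappa>(2)] by auto
    have Ff: "Fun f \<kappa>" using f(2) by (simp add: Map_def)
    have "Fun f' \<kappa>"
    proof (rule FunI)
      show "p \<epsilon> f' \<Longrightarrow> \<exists>x y. x \<epsilon> \<kappa> \<and> p = opr x y" for p using f'(2) f'I by metis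
      show "\<xi> \<epsilon> \<kappa> \<Longrightarrow> \<exists>y. opr \<xi> y \<epsilon> f'" for \<xi> unfolding f'I using \<open>emp \<epsilon> \<kappa>\<close> by blast
      show "opr \<xi> y \<epsilon> f' \<Longrightarrow> opr \<xi> z \<epsilon> f' \<Longrightarrow> y = z" for \<xi> y z unfolding f'I using FunD[OF Ff] by blast
    qed
    then have M: "Map f' \<kappa> \<kappa>" unfolding Map_def using f'I by blast
    have f'3: "f' \<epsilon> N3" using maps f'(1) M .
    let ?F = "\<^bold>\<forall>\<xi> z. \<xi> \<^bold>\<in> 0 \<^bold>\<and> z \<^bold>\<in> 0 \<^bold>\<and> is_app 1 \<xi> z \<^bold>\<longrightarrow> is_app 2 \<xi> z"
    have "holds E (els N) [\<kappa>, f, f'] ?F" using N \<kappa>N f(1) f'(1) f'I by simp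
    then have "holds E (els K) [j \<kappa>, j f, j f'] ?F" using jholds[of "[\<kappa>, f, f']" ?F] \<kappa>N f(1) f'(1) by simp
    then have "\<forall>\<xi>\<in>els K. \<forall>z\<in>els K. \<xi> \<epsilon> j \<kappa> \<and> z \<epsilon> j \<kappa> \<and> opr \<xi> z \<epsilon> j f \<longrightarrow> opr \<xi> z \<epsilon> j f'"
      using K jin \<kappa>N f(1) f'(1) by simp
    then have "opr \<kappa> d \<epsilon> j f'"
      using ZF_Trn[OF K jin[OF \<kappa>N] \<kappa>(3)] ZF_Trn[OF K jin[OF \<kappa>N] dj] \<kappa>(3) dj f(3) by blast
    then have "holds E (els ?K3) [j f', \<kappa>, d] (is_app 0 1 2)"
      using K3 HK[OF \<kappa>H] HK[OF d(1)] elem_in[OF j3 f'3] by simp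
    then have "holds E (els T) [e f', \<kappa>, y] (is_app 0 1 2)"
      using gholds[of "[j f', \<kappa>, d]" "is_app 0 1 2"] jH[OF f'3] \<kappa>H d g\<kappa> by (simp add: e_def)
    then have "opr \<kappa> y \<epsilon> e f'"
      using T(1) elem_in[OF e f'3] \<open>y \<epsilon> T\<close> elem_in[OF T(2) \<kappa>H] g\<kappa> by simp
    then show ?thesis using M f'3 by blast
  qed
  then show ?thesis using that[OF T(1) e ee e\<zeta> \<kappa>e] by blast
qed

definition Emb :: "'a \<Rightarrow> 'a \<Rightarrow> 'a \<Rightarrow> bool" where
  "Emb j N K \<longleftrightarrow> Map j N K \<and> (\<forall>m c a b. Fml m c \<and> Map a m N \<and> Map b m K
     \<and> (\<forall>i x y. opr i x \<epsilon> a \<and> opr x y \<epsilon> j \<longrightarrow> opr i y \<epsilon> b) \<longrightarrow> (Sat N m c a \<longleftrightarrow> Sat K m c b))"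

text \<open>An internal embedding preserves all coded formulas; restricted to standard codes and to
  assignments of standard length this is external elementarity.\<close>

lemma Emb_elem:
  assumes "Emb j N K"
  obtains g where "elem g N K" "\<And>x y. opr x y \<epsilon> j \<longleftrightarrow> x \<epsilon> N \<and> y = g x"
proof -
  have F: "Fun j N" and jK: "\<And>x y. opr x y \<epsilon> j \<Longrightarrow> y \<epsilon> K" using assms unfolding Emb_def Map_def by blast+
  define g where "g x = (THE y. opr x y \<epsilon> j)" for x
  have g: "opr x y \<epsilon> j \<longleftrightarrow> x \<epsilon> N \<and> y = g x" for x y
  proof (cases "x \<epsilon> N")
    case True
    then obtain z where z: "opr x z \<epsilon> j" using Fun_ex[OF F] by blast
    then have "g x = z" unfolding g_def using FunD[OF F] by (intro the_equality) blast+
    then show ?thesis using True z FunD[OF F] by blast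
  qed (use Fun_dom[OF F] in blast)
  have gK: "g x \<epsilon> K" if "x \<epsilon> N" for x using g jK that by blast
  have "ev E (els N) q v \<longleftrightarrow> ev E (els K) q (\<lambda>i. g (v i))" if v: "\<And>i. v i \<epsilon> N" for q v
  proof -
    obtain m p where m: "nb m p" and p: "\<And>A v. nsat E A p v \<longleftrightarrow> ev E A q v" using named_fm[of 0 q] by metis
    have *: "Sat M (nu m) (code p) (lseq (map w [0..<m])) \<longleftrightarrow> ev E (els M) q w" if w: "\<And>i. w i \<epsilon> M" for M w
    proof -
      have "Sat M (nu m) (code p) (lseq (map w [0..<m])) \<longleftrightarrow> nsat E (els M) p (\<lambda>i. map w [0..<m] ! i)"
        using w by (intro Sat_std[OF m]) auto
      also have "\<dots> \<longleftrightarrow> nsat E (els M) p w" by (rule nsat_cong[OF m]) simp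
      finally show ?thesis using p by simp
    qed
    let ?a = "lseq (map v [0..<m])" and ?b = "lseq (map (\<lambda>i. g (v i)) [0..<m])"
    have a: "Map ?a (nu m) N" "Map ?b (nu m) K"
      using Map_lseq[of "map v [0..<m]" N] Map_lseq[of "map (\<lambda>i. g (v i)) [0..<m]" K] v gK by auto
    have "\<forall>i x y. opr i x \<epsilon> ?a \<and> opr x y \<epsilon> j \<longrightarrow> opr i y \<epsilon> ?b" using g by auto
    then have "Sat N (nu m) (code p) ?a \<longleftrightarrow> Sat K (nu m) (code p) ?b"
      using assms Fml_code[OF m] a unfolding Emb_def by blast
    then show ?thesis using *[of v N] *[of "\<lambda>i. g (v i)" K] v gK by blast
  qed
  then have "elem g N K" unfolding elem_def using gK by blast
  then show ?thesis using that g by blast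
qed

text \<open>If all ordinals up to \<open>\<eta>\<close> were fixed, the enumeration \<open>h\<close>
  of \<open>M\<close> would be fixed as well, and with it its range \<open>M\<close>.\<close>

lemma critical_ordinal:
  assumes j: "elem j N K" "ZF N" "ZF K" and jj: "\<And>x y. opr x y \<epsilon> jj \<longleftrightarrow> x \<epsilon> N \<and> y = j x"
    and h: "h \<epsilon> N" "\<eta> \<epsilon> N" "Ord \<eta>" "Fun h \<eta>" "Rng h M" and M: "M \<epsilon> N" "\<And>y. y \<epsilon> M \<Longrightarrow> j y = y" "j M \<noteq> M"
  obtains \<kappa> where "\<kappa> \<epsilon> suc \<eta>" "Ord \<kappa>" "\<And>\<zeta>. \<zeta> \<epsilon> \<kappa> \<Longrightarrow> j \<zeta> = \<zeta>" "\<kappa> \<epsilon> j \<kappa>"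
proof -
  have s: "Ord (suc \<eta>)" "suc \<eta> \<epsilon> N" using Ord_suc[OF h(3)] ZF_suc[OF j(2) h(2)] .
  have sN: "\<zeta> \<epsilon> N" if "\<zeta> \<epsilon> suc \<eta>" for \<zeta> using ZF_Trn[OF j(2) s(2) that] .
  have ex: "\<exists>\<zeta>. \<zeta> \<epsilon> suc \<eta> \<and> j \<zeta> \<noteq> \<zeta>"
  proof (rule ccontr)
    assume "\<not> ?thesis"
    then have fixed: "\<And>\<zeta>. \<zeta> \<epsilon> suc \<eta> \<Longrightarrow> j \<zeta> = \<zeta>" by blast
    have Fj: "Fun (j h) \<eta>" using elem_Fun[OF j h(1,2)] h(4) fixed[of \<eta>] by simp
    \<comment> \<open>Both components of each pair are fixed, so \<open>h\<close> is included in
      \<open>j h\<close>; as both are functions on \<open>\<eta>\<close>, they have the same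
      pairs.\<close>
    have sub: "opr \<zeta> y \<epsilon> j h" if y: "opr \<zeta> y \<epsilon> h" for \<zeta> y
    proof -
      have "\<zeta> \<epsilon> \<eta>" "y \<epsilon> M" using Fun_dom[OF h(4) y] h(5) y unfolding Rng_def by blast+
      then have "j \<zeta> = \<zeta>" "j y = y" using fixed M(2) by auto
      moreover have "\<zeta> \<epsilon> N" "y \<epsilon> N" using ZF_app[OF j(2) h(1) y] by blast+
      ultimately have "j (opr \<zeta> y) = opr \<zeta> y" using elem_opr[OF j] by simp
      then show ?thesis using elem_mem[OF j(1) _ h(1)] y ZF_Trn[OF j(2) h(1) y] by metis
    qed
    have "opr \<zeta> y \<epsilon> h" if y: "opr \<zeta> y \<epsilon> j h" for \<zeta> y
    proof -
      obtain y' where y': "opr \<zeta> y' \<epsilon> h" using Fun_ex[OF h(4) Fun_dom[OF Fj y]] by blast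
      then have "y = y'" using sub FunD[OF Fj y] by blast
      then show ?thesis using y' by simp
    qed
    then have "Rng (j h) M" using h(5) sub unfolding Rng_def by blast
    moreover have "Rng (j h) (j M)"
      using elem_holds[OF j(1) h(1), of "[h, M]" "is_rng 0 1"] h(1,5) M(1) j(2,3) elem_in[OF j(1)] by simp
    ultimately show False using Rng_unique M(3) by blast
  qed
  obtain D where D: "\<And>x. x \<epsilon> D \<longleftrightarrow> x \<epsilon> suc \<eta> \<and> \<not> opr x x \<epsilon> jj"
    by (rule vsep[of "[jj]" "\<^bold>\<not> is_app 0 1 1" "suc \<eta>" "\<lambda>x. \<not> opr x x \<epsilon> jj"]) (simp, simp, blast)
  have DI: "x \<epsilon> D \<longleftrightarrow> x \<epsilon> suc \<eta> \<and> j x \<noteq> x" for x unfolding D jj using sN by metis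
  then have "D \<noteq> emp" using ex not_emp by metis
  then obtain \<kappa> where k: "\<kappa> \<epsilon> D" "\<And>z. z \<epsilon> D \<Longrightarrow> \<not> z \<epsilon> \<kappa>" using foundation unfolding Fnd_def by blast
  then have \<kappa>: "\<kappa> \<epsilon> suc \<eta>" "j \<kappa> \<noteq> \<kappa>" using DI by blast+
  have O: "Ord \<kappa>" "Ord (j \<kappa>)" using Ord_mem[OF s(1) \<kappa>(1)] elem_Ord[OF j sN[OF \<kappa>(1)]] by blast+
  have below: "j \<zeta> = \<zeta>" if "\<zeta> \<epsilon> \<kappa>" for \<zeta> using k(2) DI Ord_Trn[OF s(1) \<kappa>(1) that] that by blast
  \<comment> \<open>If the least moved ordinal were lowered, its image would be a fixed point,
    against injectivity.\<close>
  have "\<not> j \<kappa> \<epsilon> \<kappa>"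
  proof
    assume a: "j \<kappa> \<epsilon> \<kappa>"
    then have "j (j \<kappa>) = j \<kappa>" "j \<kappa> \<epsilon> N" using below sN Ord_Trn[OF s(1) \<kappa>(1)] by blast+
    then show False using elem_inj[OF j(1) _ sN[OF \<kappa>(1)]] \<kappa>(2) by blast
  qed
  then have "\<kappa> \<epsilon> j \<kappa>" using Ord_trich[OF O] \<kappa>(2) by auto
  then show ?thesis using that[OF \<kappa>(1) O(1) below] by blast
qed

lemma Map_Sub:
  assumes "ZF N" "a \<epsilon> N" "Map f a a"
  shows "Sub f N"
proof -
  have "p \<epsilon> N" if pf: "p \<epsilon> f" for p
  proof -
    obtain x y where "x \<epsilon> a" "p = opr x y" using Fun_pair assms(3) pf unfolding Map_def by blast
    moreover from this have "y \<epsilon> a" using assms(3) pf unfolding Map_def by blast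
    ultimately show ?thesis using ZF_opr[OF assms(1)] ZF_Trn[OF assms(1,2)] by blast
  qed
  then show ?thesis by (simp add: Sub_def)
qed

text \<open>States that \<open>k\<close> is no larger than the set of self-maps of
  \<open>\<mu>\<close>. The domain of \<open>s\<close> is left open, so the notion is absolute: no
  set of all self-maps has to be computed.\<close>

definition Cov :: "'a \<Rightarrow> 'a \<Rightarrow> 'a \<Rightarrow> bool" where
  "Cov s \<mu> k \<longleftrightarrow> (\<forall>p. p \<epsilon> s \<longrightarrow> (\<exists>f y. p = opr f y \<and> Map f \<mu> \<mu>)) \<and> Sv s \<and> Rng s k"

definition is_cov :: "var \<Rightarrow> var \<Rightarrow> var \<Rightarrow> form" where
  "is_cov s \<mu> k = ((\<^bold>\<forall>p. p \<^bold>\<in> s \<^bold>\<longrightarrow> (\<^bold>\<exists>f y. is_pair f y p \<^bold>\<and> is_map f \<mu> \<mu>))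
     \<^bold>\<and> (\<^bold>\<forall>x y z. is_app s x y \<^bold>\<and> is_app s x z \<^bold>\<longrightarrow> y \<^bold>= z) \<^bold>\<and> is_rng s k)"

lemma fb_is_cov [simp]: "0 < n \<Longrightarrow> fb n (is_cov s \<mu> k)"
  by (simp add: is_cov_def)

lemma h_cov [simp]:
  assumes T: "ZF T" and xs: "set xs \<subseteq> els T" "s < length xs" "\<mu> < length xs" "k < length xs"
  shows "holds E (els T) xs (is_cov s \<mu> k) \<longleftrightarrow> Cov (xs ! s) (xs ! \<mu>) (xs ! k)"
proof -
  have A: "xs ! s \<epsilon> T" using nth_in[OF xs(1)] xs by auto
  have 1: "(\<exists>f\<in>els T. \<exists>y\<in>els T. p = opr f y \<and> F f) \<longleftrightarrow> (\<exists>f y. p = opr f y \<and> F f)" if "p \<epsilon> T" for p F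
    using that ZF_opr[OF T] by blast
  have 2: "(\<forall>x\<in>els T. \<forall>y\<in>els T. \<forall>z\<in>els T. opr x y \<epsilon> xs ! s \<and> opr x z \<epsilon> xs ! s \<longrightarrow> y = z) \<longleftrightarrow> Sv (xs ! s)"
    unfolding Sv_def using ZF_app[OF T A] by blast
  have 3: "(\<forall>p\<in>els T. p \<epsilon> xs ! s \<longrightarrow> F p) \<longleftrightarrow> (\<forall>p. p \<epsilon> xs ! s \<longrightarrow> F p)" for F using ZF_Trn[OF T A] by blast
  show ?thesis unfolding is_cov_def Cov_def 3[symmetric] using T xs
    by (simp add: 1 2 del: all_simps ball_simps ex_simps bex_simps)
qed

lemma h_model [simp]: "x < length xs \<Longrightarrow> holds E UNIV xs (is_model x) \<longleftrightarrow> Mdl (xs ! x)"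
  unfolding Mdl_iff is_model_def sat_ZFC_def is_valid_def by (simp add: h_Ax)

lemma h_emb [simp]: "j < length xs \<Longrightarrow> N < length xs \<Longrightarrow> K < length xs \<Longrightarrow>
    holds E UNIV xs (is_elem_emb j N K) \<longleftrightarrow> Emb (xs ! j) (xs ! N) (xs ! K)"
  unfolding is_elem_emb_def Emb_def by simp

text \<open>The number \<open>m\<close> in \<open>sat_card_less\<close> is existentially quantified
  and may be nonstandard. The entries of a construction sequence force the variables of a standard
  formula occurring in it to be elements of \<open>m\<close>, as \<open>Sat_code\<close>
  requires.\<close>

lemma Cons_nb:
  assumes m: "Nt m" and f: "Cons m n f"
  shows "opr k (code p) \<epsilon> f \<Longrightarrow> \<exists>l. nb l p \<and> (\<forall>i<l. nu i \<epsilon> m)"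
proof (induction p arbitrary: k)
  have le: "nu i \<epsilon> m" if "nu l \<epsilon> m" "i \<le> l" for i l
    using Ord_Trn[OF Nt_Ord[OF m] that(1), of "nu i"] that by (cases "i = l") auto
  have FC: "FC m f k (code p)" if "opr k (code p) \<epsilon> f" for k p
    using f Fun_dom that unfolding Cons_def by blast
  {
    case (NMem i j)
    then have ij: "nu i \<epsilon> m" "nu j \<epsilon> m" using FC[OF NMem] by (auto simp: FC_def)
    then have "nu (max i j) \<epsilon> m" by (simp add: max_def)
    then show ?case using le by (intro exI[of _ "Suc (max i j)"]) auto
  next
    case (NEq i j)
    then have ij: "nu i \<epsilon> m" "nu j \<epsilon> m" using FC[OF NEq] by (auto simp: FC_def)
    then have "nu (max i j) \<epsilon> m" by (simp add: max_def)
    then show ?case using le by (intro exI[of _ "Suc (max i j)"]) auto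
  next
    case NFls
    show ?case by (intro exI[of _ 0]) simp
  next
    case (NImp p q)
    then obtain k1 k2 where "opr k1 (code p) \<epsilon> f" "opr k2 (code q) \<epsilon> f" using FC[OF NImp.prems] by (auto simp: FC_def)
    then obtain l l' where l: "nb l p" "\<forall>i<l. nu i \<epsilon> m" "nb l' q" "\<forall>i<l'. nu i \<epsilon> m" using NImp.IH by blast
    then show ?case using nb_mono[of l p "max l l'"] nb_mono[of l' q "max l l'"]
      by (intro exI[of _ "max l l'"]) (auto simp: max_def)
  next
    case (NAll i p)
    then obtain k1 where k: "opr k1 (code p) \<epsilon> f" "nu i \<epsilon> m" using FC[OF NAll.prems] by (auto simp: FC_def)
    then obtain l where l: "nb l p" "\<forall>i<l. nu i \<epsilon> m" using NAll.IH by blast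
    then show ?case using nb_mono[of l p "max l (Suc i)"] le[OF k(2)]
      by (intro exI[of _ "max l (Suc i)"]) (auto simp: less_max_iff_disj)
  }
qed

lemma sat_card_less_Bij:
  assumes M: "Mdl M" and s: "holds E UNIV [x, y, \<delta>, M] (sat_card_less 3 0 1)"
  shows "\<not> (\<exists>f. f \<epsilon> M \<and> Bij f x y)"
proof -
  have q: "holds E UNIV xs (c \<^bold>\<simeq> quote 2 p) \<longleftrightarrow> xs ! c = code (named (\<lambda>i. 2 - Suc i) 2 p)" if "c < length xs" for xs c p
    using that by (intro h_val tv_quote) auto
  have n: "holds E UNIV xs (c \<^bold>\<simeq> num k) \<longleftrightarrow> xs ! c = nu k" if "c < length xs" for xs c k
    using that by (intro h_val tv_num) auto
  let ?p = "named (\<lambda>i. 2 - Suc i) 2 (card_less 0 1 2)"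
  obtain m a where a: "Map a m M" "opr (nu 0) x \<epsilon> a" "opr (nu 1) y \<epsilon> a" "Sat M m (code ?p) a"
    using s by (auto simp: sat_card_less_def q n)
  obtain k f n s where "Nt m" "TSq M m n f s" "opr k (code ?p) \<epsilon> f"
    using a(4) unfolding Sat_def by blast
  then obtain l where l: "nb l ?p" "\<And>i. i < l \<Longrightarrow> nu i \<epsilon> m" using Cons_nb TSq_Cons by blast
  have sat: "nsat E (els M) ?p (aval a)" using Sat_code[OF a(4) l] by blast
  have "Fun a m" using a(1) by (simp add: Map_def)
  then have "aval a 0 = x" "aval a 1 = y"
    using aval(1)[OF a(1) Fun_dom[OF _ a(2)] , of x] aval(1)[OF a(1) Fun_dom[OF _ a(3)], of y] a(2,3) by auto
  have "fb 2 (card_less 0 1)" by simp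
  then have "free_below 2 (card_less 0 1 2)" by (simp only: fb_def)
  then have "ev E (els M) (card_less 0 1 2) (\<lambda>i. aval a (2 - Suc i))"
    using sat by (subst nsat_named[of 2 _ "\<lambda>i. 2 - Suc i" 2, symmetric]) simp_all
  moreover have "ev E (els M) (card_less 0 1 (length [x, y])) (\<lambda>i. aval a (2 - Suc i)) \<longleftrightarrow> holds E (els M) [x, y] (card_less 0 1)"
    using \<open>aval a 0 = x\<close> \<open>aval a 1 = y\<close> by (intro ev_holds) (auto simp: less_Suc_eq)
  ultimately have "holds E (els M) [x, y] (card_less 0 1)" by (simp add: numeral_2_eq_2)
  moreover have "x \<epsilon> M" "y \<epsilon> M" using a unfolding Map_def by blast+
  ultimately show ?thesis using Mdl_ZF[OF M] by auto
qed

lemma tall: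
  assumes "holds E UNIV [] TMA" "Ord \<kappa>"
  shows "\<exists>\<alpha>. Ord \<alpha> \<and> \<kappa> \<epsilon> \<alpha> \<and> (\<forall>\<delta>. Ord \<delta> \<and> (\<alpha> \<epsilon> \<delta> \<or> \<alpha> = \<delta>) \<longrightarrow>
      (\<exists>M. Mdl M \<and> \<delta> \<epsilon> M \<and> \<not> (\<exists>f. f \<epsilon> M \<and> Bij f \<kappa> \<alpha>)))"
proof -
  have "\<exists>\<alpha>. Ord \<alpha> \<and> \<kappa> \<epsilon> \<alpha> \<and> (\<forall>\<delta>. Ord \<delta> \<and> (\<alpha> \<epsilon> \<delta> \<or> \<alpha> = \<delta>) \<longrightarrow>
      (\<exists>M. Mdl M \<and> \<delta> \<epsilon> M \<and> holds E UNIV [\<kappa>, \<alpha>, \<delta>, M] (sat_card_less 3 0 1)))"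
    using assms by (simp add: TMA_def numeral_3_eq_3)
  then show ?thesis using sat_card_less_Bij by blast
qed

lemma critical:
  assumes "holds E UNIV [] exists_strongly_critical"
  obtains M where "Mdl M" "\<And>x. \<exists>N K j. Mdl N \<and> Mdl K \<and> Emb j N K \<and> M \<epsilon> N \<and> x \<epsilon> N \<and> (\<forall>y. y \<epsilon> M \<longrightarrow> opr y y \<epsilon> j) \<and> \<not> opr M M \<epsilon> j"
proof -
  have "\<exists>M. Mdl M \<and> (\<forall>x. \<exists>N. Mdl N \<and> (\<exists>K. Mdl K \<and> (\<exists>j. Emb j N K \<and> M \<epsilon> N \<and> x \<epsilon> N \<and> M \<epsilon> N
      \<and> (\<forall>y. y \<epsilon> M \<longrightarrow> opr y y \<epsilon> j) \<and> \<not> opr M M \<epsilon> j)))"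
    using assms by (simp add: exists_strongly_critical_def strongly_critical_def strongly_critical_at_def in_Crit_def)
  then obtain M where M: "Mdl M" and *: "\<And>x. \<exists>N. Mdl N \<and> (\<exists>K. Mdl K \<and> (\<exists>j. Emb j N K \<and> M \<epsilon> N \<and> x \<epsilon> N \<and> M \<epsilon> N
      \<and> (\<forall>y. y \<epsilon> M \<longrightarrow> opr y y \<epsilon> j) \<and> \<not> opr M M \<epsilon> j))" by blast
  have "\<exists>N K j. Mdl N \<and> Mdl K \<and> Emb j N K \<and> M \<epsilon> N \<and> x \<epsilon> N \<and> (\<forall>y. y \<epsilon> M \<longrightarrow> opr y y \<epsilon> j) \<and> \<not> opr M M \<epsilon> j" for x
    using *[of x] by fast
  then show ?thesis using that M by blast
qed

end

section \<open>The contradiction from constructibility and tall models\<close>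

locale tall_bst = bst +
  assumes VL: "\<exists>\<alpha> A. Ord \<alpha> \<and> Lev \<alpha> A \<and> x \<epsilon> A"
    and TM: "Ord \<kappa> \<Longrightarrow> \<exists>\<alpha>. Ord \<alpha> \<and> \<kappa> \<epsilon> \<alpha> \<and> (\<forall>\<delta>. Ord \<delta> \<and> (\<alpha> \<epsilon> \<delta> \<or> \<alpha> = \<delta>) \<longrightarrow>
      (\<exists>M. Mdl M \<and> \<delta> \<epsilon> M \<and> \<not> (\<exists>f. f \<epsilon> M \<and> Bij f \<kappa> \<alpha>)))"
begin

theorem power_absolute:
  assumes N0: "ZF N0"
  obtains \<theta> where "Ord \<theta>" "\<And>N X. ZF N \<Longrightarrow> \<theta> \<epsilon> N \<Longrightarrow> Sub X N0 \<Longrightarrow> X \<epsilon> N"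
proof -
  obtain Q where Q: "ZF Q" "N0 \<epsilon> Q" using Loc Mdl_ZF by blast
  obtain h \<kappa> where h: "Ord \<kappa>" "Fun h \<kappa>" "\<And>y. y \<epsilon> N0 \<longleftrightarrow> (\<exists>x. opr x y \<epsilon> h)" using wellorder[OF Q] by metis
  obtain \<theta> where \<theta>: "Ord \<theta>" "\<kappa> \<epsilon> \<theta>" and tall: "\<And>\<delta>. Ord \<delta> \<Longrightarrow> \<theta> \<epsilon> \<delta> \<or> \<theta> = \<delta> \<Longrightarrow>
      \<exists>M. Mdl M \<and> \<delta> \<epsilon> M \<and> \<not> (\<exists>f. f \<epsilon> M \<and> Bij f \<kappa> \<theta>)" using TM[OF h(1)] by blast
  have no_bij: "\<not> Bij b \<kappa> \<theta>" for b
  proof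
    assume b: "Bij b \<kappa> \<theta>"
    obtain \<epsilon>' A where A: "Ord \<epsilon>'" "Lev \<epsilon>' A" "b \<epsilon> A" using VL by blast
    \<comment> \<open>The larger of the two ordinals: above \<open>\<theta>\<close> for the tall
      model axiom, and high enough for the model to contain the level where \<open>b\<close>
      appears.\<close>
    obtain \<delta> where \<delta>: "Ord \<delta>" "\<theta> \<epsilon> \<delta> \<or> \<theta> = \<delta>" "\<epsilon>' \<epsilon> \<delta> \<or> \<epsilon>' = \<delta>"
      using Ord_trich[OF \<theta>(1) A(1)] \<theta>(1) A(1) by blast
    obtain M where M: "Mdl M" "\<delta> \<epsilon> M" "\<not> (\<exists>f. f \<epsilon> M \<and> Bij f \<kappa> \<theta>)" using tall[OF \<delta>(1,2)] by blast
    have "ZF M" using Mdl_ZF M(1) .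
    then have "\<epsilon>' \<epsilon> M" using ZF_Trn M(2) \<delta>(3) by blast
    then have "A \<epsilon> M" using Lev_in \<open>ZF M\<close> A(2) by blast
    then have "b \<epsilon> M" using ZF_Trn \<open>ZF M\<close> A(3) by blast
    then show False using M(3) b by blast
  qed
  have main: "X \<epsilon> N" if N: "ZF N" "\<theta> \<epsilon> N" and X: "Sub X N0" for N X
  proof -
    obtain \<delta> A where A: "Lev \<delta> A" "X \<epsilon> A" using VL by blast
    then obtain \<beta> g where g: "\<delta> \<epsilon> \<beta>" "LH \<beta> g" "opr \<delta> A \<epsilon> g" unfolding Lev_def by blast
    \<comment> \<open>The hierarchy \<open>g\<close> is put into \<open>P\<close> along with its
      length, because the formula for levels finds its witnesses only inside the model.\<close>
    obtain P where P: "ZF P" "set [N0, X, \<beta>, g] \<subseteq> els P" using Loc_list Mdl_ZF by blast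
    then have inP: "N0 \<epsilon> P" "X \<epsilon> P" "\<beta> \<epsilon> P" "g \<epsilon> P" by simp_all
    obtain H f where f: "Fun f N0" "Rng f H" and H: "Sub N0 H" "X \<epsilon> H" "elem (\<lambda>x. x) H P"
      using hull[OF N0 P(1) inP(1,2)] by metis
    have "H \<noteq> emp" using H(2) by auto
    obtain G \<pi> T where T: "ZF T" "elem G H T" "\<And>x y. opr x y \<epsilon> \<pi> \<longleftrightarrow> x \<epsilon> H \<and> y = G x"
      "\<And>y. y \<epsilon> T \<Longrightarrow> \<exists>x. x \<epsilon> H \<and> y = G x" "\<And>A x. Trn A \<Longrightarrow> Sub A H \<Longrightarrow> x \<epsilon> H \<Longrightarrow> Sub x A \<Longrightarrow> G x = x"
      by (rule elementary_collapse[OF P(1) \<open>H \<noteq> emp\<close> H(3)]) (rule that)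
    have "Trn N0" using N0 by (simp add: ZF_def)
    then have GX: "G X = X" using T(5) H(1,2) X by blast
    let ?F = "\<^bold>\<exists>\<delta> A. is_L_level \<delta> A \<^bold>\<and> 0 \<^bold>\<in> A"
    have "\<delta> \<epsilon> P" "A \<epsilon> P" using ZF_app[OF P(1) inP(4) g(3)] by blast+
    then have "holds E (els P) [X] ?F" using P(1) inP g A(2) by auto
    then have "holds E (els T) [X] ?F"
      using elem_holds[OF H(3,2), of "[X]" ?F] elem_holds[OF T(2) H(2), of "[X]" ?F] H(2) GX by simp
    moreover have "X \<epsilon> T" using elem_in[OF T(2) H(2)] GX by simp
    ultimately obtain \<delta>' A' where A': "\<delta>' \<epsilon> T" "Lev \<delta>' A'" "X \<epsilon> A'"
      using T(1) unfolding Lev_def by auto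
    then have "Ord \<delta>'" using Ord_mem unfolding Lev_def LH_def by blast
    show ?thesis
    proof (cases "\<delta>' \<epsilon> \<theta>")
      case True
      then have "A' \<epsilon> N" using Lev_in[OF N(1) _ A'(2)] ZF_Trn[OF N] by blast
      then show ?thesis using ZF_Trn[OF N(1)] A'(3) by blast
    next
      case False
      \<comment> \<open>If \<open>\<delta>'\<close> is not below \<open>\<theta>\<close>, all of
        \<open>\<theta>\<close> lies in \<open>T\<close>. Enumerating \<open>N0\<close>, passing to
        the hull and collapsing then maps \<kappa> onto \<open>\<theta>\<close>.\<close>
      have \<theta>T: "y \<epsilon> T" if "y \<epsilon> \<theta>" for y
        using Ord_trich[OF \<theta>(1) \<open>Ord \<delta>'\<close>] False that ZF_Trn[OF T(1)] A'(1) by blast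
      obtain k1 where k1: "\<And>x z. opr x z \<epsilon> k1 \<longleftrightarrow> (\<exists>y. opr x y \<epsilon> h \<and> opr y z \<epsilon> f)" using composition by metis
      obtain k where k: "\<And>x z. opr x z \<epsilon> k \<longleftrightarrow> (\<exists>y. opr x y \<epsilon> k1 \<and> opr y z \<epsilon> \<pi>)" using composition by metis
      have "\<exists>x. x \<epsilon> \<kappa> \<and> opr x y \<epsilon> k" if y\<theta>: "y \<epsilon> \<theta>" for y
      proof -
        obtain d where d: "d \<epsilon> H" "y = G d" using T(4)[OF \<theta>T[OF y\<theta>]] by blast
        obtain n where n: "opr n d \<epsilon> f" using f(2) d(1) unfolding Rng_def by blast
        obtain x where x: "opr x n \<epsilon> h" using h(3) Fun_dom[OF f(1) n] by blast
        have "opr x y \<epsilon> k" using k k1 T(3) d n x by blast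
        then show ?thesis using Fun_dom[OF h(2) x] by blast
      qed
      moreover have "Sv k" unfolding Sv_def k k1 T(3) using FunD[OF h(2)] FunD[OF f(1)] by blast
      moreover have "Sub \<kappa> \<theta>" using Ord_Sub_iff h(1) \<theta> by blast
      ultimately obtain b where "Bij b \<kappa> \<theta>" using surjection_bij[OF h(1) \<theta>(1)] by metis
      then show ?thesis using no_bij by blast
    qed
  qed
  show ?thesis using that[OF \<theta>(1)] main by blast
qed

theorem no_strongly_critical:
  assumes M: "Mdl M"
    and SC: "\<And>x. \<exists>N K j. Mdl N \<and> Mdl K \<and> Emb j N K \<and> M \<epsilon> N \<and> x \<epsilon> N \<and> (\<forall>y. y \<epsilon> M \<longrightarrow> opr y y \<epsilon> j) \<and> \<not> opr M M \<epsilon> j"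
  shows False
proof -
  obtain N0 where N0: "ZF N0" "M \<epsilon> N0" using Loc Mdl_ZF by blast
  obtain h \<eta> where h: "h \<epsilon> N0" "\<eta> \<epsilon> N0" "Ord \<eta>" "Fun h \<eta>" "\<And>y. y \<epsilon> M \<longleftrightarrow> (\<exists>x. opr x y \<epsilon> h)" using wellorder[OF N0] by metis
  obtain \<theta>1 where \<theta>1: "\<And>N X. ZF N \<Longrightarrow> \<theta>1 \<epsilon> N \<Longrightarrow> Sub X N0 \<Longrightarrow> X \<epsilon> N" using power_absolute[OF N0(1)] by metis
  obtain N2 where "Mdl N2" "set [N0, \<theta>1] \<subseteq> els N2" using Loc_list by blast
  then have N2: "ZF N2" "N0 \<epsilon> N2" "\<theta>1 \<epsilon> N2" using Mdl_ZF by simp_all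
  obtain \<theta>2 where O2: "Ord \<theta>2" and \<theta>2: "\<And>N X. ZF N \<Longrightarrow> \<theta>2 \<epsilon> N \<Longrightarrow> Sub X N2 \<Longrightarrow> X \<epsilon> N"
    using power_absolute[OF N2(1)] by metis
  obtain N3 where "Mdl N3" "set [N2, \<theta>2] \<subseteq> els N3" using Loc_list by blast
  then have N3: "ZF N3" "N2 \<epsilon> N3" "\<theta>2 \<epsilon> N3" using Mdl_ZF by simp_all
  obtain N K jj where "Mdl N" "Mdl K" and jj0: "Emb jj N K" "M \<epsilon> N" "N3 \<epsilon> N" "\<And>y. y \<epsilon> M \<Longrightarrow> opr y y \<epsilon> jj" "\<not> opr M M \<epsilon> jj"
    using SC[of N3] by blast
  then have NK: "ZF N" "ZF K" using Mdl_ZF by blast+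
  obtain j where j: "elem j N K" and jj: "\<And>x y. opr x y \<epsilon> jj \<longleftrightarrow> x \<epsilon> N \<and> y = j x"    by (rule Emb_elem[OF jj0(1)]) (rule that)
  have N23: "x \<epsilon> N3" if "x \<epsilon> N2" for x using ZF_Trn[OF N3(1,2) that] .
  have N02: "x \<epsilon> N2" if "x \<epsilon> N0" for x using ZF_Trn[OF N2(1,2) that] .
  have N3N: "x \<epsilon> N" if "x \<epsilon> N3" for x using ZF_Trn[OF NK(1) jj0(3) that] .
  have hN: "h \<epsilon> N" "\<eta> \<epsilon> N" using h(1,2) N02 N23 N3N by blast+
  have RM: "Rng h M" unfolding Rng_def using h(5) by blast
  have jM: "y \<epsilon> M \<Longrightarrow> j y = y" for y using jj0(4) jj by metis
  have ne: "j M \<noteq> M" using jj0(2,5) jj by metis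
  obtain \<kappa> where \<kappa>: "\<kappa> \<epsilon> suc \<eta>" "Ord \<kappa>" "\<kappa> \<epsilon> j \<kappa>" and below: "\<And>\<zeta>. \<zeta> \<epsilon> \<kappa> \<Longrightarrow> j \<zeta> = \<zeta>"
    by (rule critical_ordinal[OF j NK jj hN h(3,4) RM jj0(2) jM ne]) (assumption | rule that)+
  have \<kappa>0: "\<kappa> \<epsilon> N0" using ZF_Trn[OF N0(1) ZF_suc[OF N0(1) h(2)] \<kappa>(1)] .
  \<comment> \<open>A function on an element of \<open>N0\<close> is a subset of \<open>N0\<close>,
    and \<open>N2\<close> contains the ordinal beyond which these are all present.\<close>
  have maps2: "f \<epsilon> N2" if "Map f \<mu> \<mu>" "\<mu> \<epsilon> N0" for f \<mu>
    using \<theta>1[OF N2(1,3)] Map_Sub[OF N0(1) that(2,1)] by blast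
  have \<kappa>3: "\<kappa> \<epsilon> N3" using \<kappa>0 N02 N23 by blast
  obtain e ee T where T: "ZF T" and e: "elem e N3 T" and ee: "\<And>x y. x \<epsilon> N3 \<Longrightarrow> opr x y \<epsilon> ee \<longleftrightarrow> y = e x"
    and e\<zeta>: "\<And>\<zeta>. \<zeta> \<epsilon> \<kappa> \<Longrightarrow> e \<zeta> = \<zeta>" and \<kappa>e: "\<kappa> \<epsilon> e \<kappa>"
    and onto: "\<And>y. y \<epsilon> e \<kappa> \<Longrightarrow> \<exists>f. Map f \<kappa> \<kappa> \<and> f \<epsilon> N3 \<and> opr \<kappa> y \<epsilon> e f"
  proof (rule normal_ultrapower[OF j NK jj N3(1) jj0(3) \<kappa>3 \<kappa>(2,3)])
    show "\<zeta> \<epsilon> \<kappa> \<Longrightarrow> j \<zeta> = \<zeta>" for \<zeta> by (rule below)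
    show "Map f \<kappa> \<kappa> \<Longrightarrow> f \<epsilon> N3" for f using maps2[OF _ \<kappa>0] N23 by blast
  qed (rule that)
  have eT: "x \<epsilon> N3 \<Longrightarrow> e x \<epsilon> T" for x using elem_in[OF e] .
  \<comment> \<open>\<open>e\<close> cannot lower an ordinal, so \<open>\<theta>2\<close> is at most
    its image in \<open>T\<close> and belongs to \<open>T\<close> by transitivity. Hence every
    subset of \<open>N2\<close> is in \<open>T\<close>, although \<open>T\<close> may well fail to
    include \<open>N3\<close>.\<close>
  have \<theta>2T: "\<theta>2 \<epsilon> T"
  proof -
    have "Trn N3" using N3(1) by (simp add: ZF_def)
    then have "\<not> e \<theta>2 \<epsilon> \<theta>2" by (rule elem_Ord_le[OF e N3(3) _ O2 ee])
    moreover have "Ord (e \<theta>2)" using elem_Ord[OF e N3(1) T N3(3)] O2 by blast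
    ultimately consider "\<theta>2 \<epsilon> e \<theta>2" | "\<theta>2 = e \<theta>2" using Ord_trich[OF O2] by blast
    then show ?thesis
    proof cases
      case 1
      then show ?thesis by (rule ZF_Trn[OF T eT[OF N3(3)]])
    next
      case 2
      then show ?thesis using eT[OF N3(3)] by simp
    qed
  qed
  have \<kappa>T: "\<kappa> \<epsilon> T" using ZF_Trn[OF T eT[OF \<kappa>3] \<kappa>e] .
  have Oe: "Ord (e \<kappa>)" using elem_Ord[OF e N3(1) T \<kappa>3] \<kappa>(2) by blast
  \<comment> \<open>The set of all functions from \<kappa> to itself: by \<open>maps2\<close> none
    of them is missing from \<open>N2\<close>.\<close>
  obtain Z where Z0: "\<And>f. f \<epsilon> Z \<longleftrightarrow> f \<epsilon> N2 \<and> Map f \<kappa> \<kappa>"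
    by (rule vsep[of "[\<kappa>]" "is_map 1 0 0" N2 "\<lambda>f. Map f \<kappa> \<kappa>"]) (simp, simp, blast)
  have Z: "f \<epsilon> Z \<longleftrightarrow> Map f \<kappa> \<kappa>" for f using Z0 maps2[OF _ \<kappa>0] by blast
  have ZN3: "f \<epsilon> N3" if "f \<epsilon> Z" for f using Z0 N23 that by blast
  have ZT: "Z \<epsilon> T" using \<theta>2[OF T \<theta>2T] Z0 unfolding Sub_def by blast
  have eZ: "Map (e f) (e \<kappa>) (e \<kappa>)" if "f \<epsilon> Z" for f
    using elem_Map[OF e N3(1) T ZN3[OF that] \<kappa>3 \<kappa>3] Z that by blast
  have val_ex: "\<exists>y. y \<epsilon> e \<kappa> \<and> opr \<kappa> y \<epsilon> e f" if "f \<epsilon> Z" for f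
    using eZ[OF that] Fun_ex[OF _ \<kappa>e] unfolding Map_def by blast
  have val_eq: "y = z" if "f \<epsilon> Z" "opr \<kappa> y \<epsilon> e f" "opr \<kappa> z \<epsilon> e f" for f y z
    using eZ[OF that(1)] FunD that(2,3) unfolding Map_def by blast
  \<comment> \<open>\<open>e\<close> is external, so the relation is expressed through the set
    \<open>ee\<close>. It is formed in an ambient model \<open>Q\<close> and reaches
    \<open>T\<close> only as a subset of \<open>N2\<close>.\<close>
  let ?RP = "\<lambda>f g. \<exists>u v a b. opr f a \<epsilon> ee \<and> opr \<kappa> u \<epsilon> a \<and> opr g b \<epsilon> ee \<and> opr \<kappa> v \<epsilon> b \<and> u \<epsilon> v"
  obtain Q where Q: "ZF Q" "set [Z, ee, \<kappa>] \<subseteq> els Q" using Loc_list Mdl_ZF by blast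
  then have inQ: "Z \<epsilon> Q" "ee \<epsilon> Q" "\<kappa> \<epsilon> Q" by simp_all
  let ?r = "\<lambda>f g. \<^bold>\<exists>u v a b. is_app 0 f a \<^bold>\<and> is_app a 1 u \<^bold>\<and> is_app 0 g b \<^bold>\<and> is_app b 1 v \<^bold>\<and> u \<^bold>\<in> v"
  obtain R where "R \<epsilon> Q" and R0: "\<And>p. p \<epsilon> R \<Longrightarrow> \<exists>f g. p = opr f g" "\<And>f g. opr f g \<epsilon> R \<longleftrightarrow> f \<epsilon> Z \<and> g \<epsilon> Z \<and> ?RP f g"
  proof (rule ZF_rel[OF Q(1) inQ(1,1), of "[ee, \<kappa>]" ?r])
    fix p f g assume fg: "p \<epsilon> Q" "f \<epsilon> Q" "g \<epsilon> Q"
    have aQ: "u \<epsilon> Q" if "opr f a \<epsilon> ee" "opr \<kappa> u \<epsilon> a" for f a u using ZF_app[OF Q(1)] ZF_app[OF Q(1) inQ(2)] that by blast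
    have "(\<exists>u\<in>els Q. \<exists>v\<in>els Q. \<exists>a\<in>els Q. \<exists>b\<in>els Q. opr f a \<epsilon> ee \<and> opr \<kappa> u \<epsilon> a \<and> opr g b \<epsilon> ee \<and> opr \<kappa> v \<epsilon> b \<and> u \<epsilon> v) \<longleftrightarrow> ?RP f g"
      using aQ ZF_app[OF Q(1) inQ(2)] by blast
    then show "holds E (els Q) ([ee, \<kappa>] @ [p, f, g]) (?r (Suc (length [ee, \<kappa>])) (Suc (Suc (length [ee, \<kappa>])))) \<longleftrightarrow> ?RP f g"
      using fg Q(1) inQ by (simp add: eval_nat_numeral del: ex_simps bex_simps)
  qed (use inQ that in simp_all)
  have R: "opr f g \<epsilon> R \<longleftrightarrow> f \<epsilon> Z \<and> g \<epsilon> Z \<and> (\<exists>u v. opr \<kappa> u \<epsilon> e f \<and> opr \<kappa> v \<epsilon> e g \<and> u \<epsilon> v)" for f g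
    unfolding R0(2) using ee[OF ZN3] by (cases "f \<epsilon> Z \<and> g \<epsilon> Z") auto
  have "Sub R N2"
    unfolding Sub_def
  proof (intro allI impI)
    fix q assume "q \<epsilon> R"
    then obtain f g where "f \<epsilon> Z" "g \<epsilon> Z" "q = opr f g" using R0 by metis
    then show "q \<epsilon> N2" using Z0 ZF_opr[OF N2(1)] by blast
  qed
  then have RT: "R \<epsilon> T" using \<theta>2[OF T \<theta>2T] by blast
  \<comment> \<open>The values at \<kappa> are ordinals below \<open>e(\<kappa>)\<close>; a function
    with the least value is minimal.\<close>
  have wf: "wfr Z R"
    unfolding wfr_def
  proof (intro allI impI)
    fix S assume S: "S \<noteq> emp \<and> Sub S Z"
    then have SZ: "f \<epsilon> Z" if "f \<epsilon> S" for f using that unfolding Sub_def by blast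
    obtain D where D0: "\<And>y. y \<epsilon> D \<longleftrightarrow> y \<epsilon> e \<kappa> \<and> (\<exists>f a. f \<epsilon> S \<and> opr f a \<epsilon> ee \<and> opr \<kappa> y \<epsilon> a)"
    proof (rule vsep[of "[S, ee, \<kappa>]" "\<^bold>\<exists>f a. f \<^bold>\<in> 0 \<^bold>\<and> is_app 1 f a \<^bold>\<and> is_app a 2 3" "e \<kappa>"])
      fix Q y assume Q: "ZF Q" "set [S, ee, \<kappa>] \<subseteq> els Q" "y \<epsilon> Q"
      then have eQ: "ee \<epsilon> Q" by simp
      have "(\<exists>f\<in>els Q. \<exists>a\<in>els Q. f \<epsilon> S \<and> opr f a \<epsilon> ee \<and> opr \<kappa> y \<epsilon> a) \<longleftrightarrow> (\<exists>f a. f \<epsilon> S \<and> opr f a \<epsilon> ee \<and> opr \<kappa> y \<epsilon> a)"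
        using ZF_app[OF Q(1) eQ] by blast
      then show "holds E (els Q) ([S, ee, \<kappa>] @ [y]) (\<^bold>\<exists>f a. f \<^bold>\<in> 0 \<^bold>\<and> is_app 1 f a \<^bold>\<and> is_app a 2 3)
          \<longleftrightarrow> (\<exists>f a. f \<epsilon> S \<and> opr f a \<epsilon> ee \<and> opr \<kappa> y \<epsilon> a)"
        using Q by (simp add: eval_nat_numeral del: ex_simps bex_simps)
    qed (simp, blast)
    have D: "y \<epsilon> D \<longleftrightarrow> y \<epsilon> e \<kappa> \<and> (\<exists>f. f \<epsilon> S \<and> opr \<kappa> y \<epsilon> e f)" for y
      unfolding D0 using ee[OF ZN3[OF SZ]] by (auto cong: conj_cong)
    obtain f0 where "f0 \<epsilon> S" using S emp_iff by blast
    then obtain y0 where "y0 \<epsilon> D" using val_ex[OF SZ] D by blast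
    then have "D \<noteq> emp" by auto
    then obtain y where y: "y \<epsilon> D" "\<And>z. z \<epsilon> D \<Longrightarrow> \<not> z \<epsilon> y" using foundation unfolding Fnd_def by blast
    then obtain f where f: "f \<epsilon> S" "opr \<kappa> y \<epsilon> e f" using D by blast
    have "\<not> opr g f \<epsilon> R" if g: "g \<epsilon> S" for g
    proof
      assume "opr g f \<epsilon> R"
      then obtain u v where u: "opr \<kappa> u \<epsilon> e g" "opr \<kappa> v \<epsilon> e f" "u \<epsilon> v" using R by blast
      have "v = y" using val_eq[OF SZ[OF f(1)] u(2) f(2)] .
      moreover have "u \<epsilon> e \<kappa>" using eZ[OF SZ[OF g]] u(1) unfolding Map_def by blast
      ultimately show False using y(2)[of u] D g u by blast
    qed
    then show "\<exists>x. x \<epsilon> S \<and> (\<forall>y. y \<epsilon> S \<longrightarrow> \<not> opr y x \<epsilon> R)" using f(1) by blast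
  qed
  obtain s where s: "s \<epsilon> T" "Fun s Z" "\<And>x y v. opr x y \<epsilon> s \<Longrightarrow> v \<epsilon> y \<longleftrightarrow> (\<exists>u. opr u x \<epsilon> R \<and> opr u v \<epsilon> s)"
    by (rule ZF_collapse[OF T ZT RT wf]) (use R in blast, rule that)
  \<comment> \<open>The collapse recovers the value at \<kappa>: by induction every ordinal below
    \<open>y\<close> is the collapse of some function, because each one is represented. Thus
    \<open>T\<close> has the evaluation map although \<open>ee\<close> need not be in
    \<open>T\<close>.\<close>
  have s_val: "\<forall>g b a. opr g b \<epsilon> s \<and> opr g a \<epsilon> ee \<and> opr \<kappa> y \<epsilon> a \<longrightarrow> b = y" (is "?P y") if y: "y \<epsilon> e \<kappa>" for y
  proof (rule vind[of "[s, ee, \<kappa>]" "\<^bold>\<forall>g b a. is_app 0 g b \<^bold>\<and> is_app 1 g a \<^bold>\<and> is_app a 2 3 \<^bold>\<longrightarrow> b \<^bold>= 3" "e \<kappa>" ?P y, OF _ _ _ y])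
    fix Q y assume Q: "ZF Q" "set [s, ee, \<kappa>] \<subseteq> els Q" "y \<epsilon> Q"
    then have eQ: "s \<epsilon> Q" "ee \<epsilon> Q" by simp_all
    have "(\<forall>g\<in>els Q. \<forall>b\<in>els Q. \<forall>a\<in>els Q. opr g b \<epsilon> s \<and> opr g a \<epsilon> ee \<and> opr \<kappa> y \<epsilon> a \<longrightarrow> b = y) \<longleftrightarrow> ?P y"
      using ZF_app[OF Q(1) eQ(1)] ZF_app[OF Q(1) eQ(2)] by blast
    then show "holds E (els Q) ([s, ee, \<kappa>] @ [y]) (\<^bold>\<forall>g b a. is_app 0 g b \<^bold>\<and> is_app 1 g a \<^bold>\<and> is_app a 2 3 \<^bold>\<longrightarrow> b \<^bold>= 3) \<longleftrightarrow> ?P y"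
      using Q by (simp add: eval_nat_numeral del: all_simps ball_simps)
  next
    fix y assume y: "y \<epsilon> e \<kappa>" and IH: "\<And>u. u \<epsilon> e \<kappa> \<Longrightarrow> u \<epsilon> y \<Longrightarrow> ?P u"
    have IH': "b = u" if "u \<epsilon> y" "opr g b \<epsilon> s" "opr \<kappa> u \<epsilon> e g" for u g b
    proof -
      have "u \<epsilon> e \<kappa>" using Ord_Trn[OF Oe y that(1)] .
      moreover have "opr g (e g) \<epsilon> ee" using ee[OF ZN3[OF Fun_dom[OF s(2) that(2)]]] by simp
      ultimately show ?thesis using IH that by blast
    qed
    show "?P y"
    proof (intro allI impI)
      fix g b a assume gb: "opr g b \<epsilon> s \<and> opr g a \<epsilon> ee \<and> opr \<kappa> y \<epsilon> a"
      then have g: "g \<epsilon> Z" using Fun_dom[OF s(2)] by blast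
      have gy: "opr \<kappa> y \<epsilon> e g" using gb ee[OF ZN3[OF g]] by auto
      show "b = y"
      proof (rule extensionality)
        fix v
        have "v \<epsilon> b \<longleftrightarrow> (\<exists>u. opr u g \<epsilon> R \<and> opr u v \<epsilon> s)" using s(3) gb by blast
        also have "\<dots> \<longleftrightarrow> v \<epsilon> y"
        proof
          assume "\<exists>u. opr u g \<epsilon> R \<and> opr u v \<epsilon> s"
          then obtain u where u: "opr u g \<epsilon> R" "opr u v \<epsilon> s" by blast
          then obtain u' y' where u': "opr \<kappa> u' \<epsilon> e u" "opr \<kappa> y' \<epsilon> e g" "u' \<epsilon> y'" using R by blast
          have "y' = y" using val_eq[OF g u'(2) gy] .
          then show "v \<epsilon> y" using IH'[OF _ u(2) u'(1)] u'(3) by blast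
        next
          assume v: "v \<epsilon> y"
          then have "v \<epsilon> e \<kappa>" using Ord_Trn[OF Oe y] by blast
          then obtain f where f: "Map f \<kappa> \<kappa>" "opr \<kappa> v \<epsilon> e f" using onto by blast
          then have fZ: "f \<epsilon> Z" using Z by blast
          obtain b' where b': "opr f b' \<epsilon> s" using Fun_ex[OF s(2) fZ] by blast
          then have "b' = v" using IH'[OF v b' f(2)] by blast
          then show "\<exists>u. opr u g \<epsilon> R \<and> opr u v \<epsilon> s" using b' R fZ g f(2) gy v by blast
        qed
        finally show "v \<epsilon> b \<longleftrightarrow> v \<epsilon> y" .
      qed
    qed
  qed simp
  have s_eq: "b = y" if "opr g b \<epsilon> s" "opr \<kappa> y \<epsilon> e g" for g b y
  proof -
    have g: "g \<epsilon> Z" using Fun_dom[OF s(2) that(1)] .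
    then have "y \<epsilon> e \<kappa>" using eZ that(2) unfolding Map_def by blast
    moreover have "opr g (e g) \<epsilon> ee" using ee[OF ZN3[OF g]] by simp
    ultimately show ?thesis using s_val that by blast
  qed
  have "Rng s (e \<kappa>)"
    unfolding Rng_def
  proof (intro allI iffI)
    fix y
    assume "y \<epsilon> e \<kappa>"
    then obtain f where f: "Map f \<kappa> \<kappa>" "opr \<kappa> y \<epsilon> e f" using onto by blast
    then obtain b where "opr f b \<epsilon> s" using Fun_ex[OF s(2)] Z by blast
    then show "\<exists>x. opr x y \<epsilon> s" using s_eq f(2) by blast
  next
    fix y assume "\<exists>x. opr x y \<epsilon> s"
    then obtain g where g: "opr g y \<epsilon> s" by blast
    then obtain y' where "y' \<epsilon> e \<kappa>" "opr \<kappa> y' \<epsilon> e g" using val_ex[OF Fun_dom[OF s(2)]] by blast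
    then show "y \<epsilon> e \<kappa>" using s_eq[OF g] by blast
  qed
  moreover have "\<exists>f y. p = opr f y \<and> Map f \<kappa> \<kappa>" if "p \<epsilon> s" for p
    using Fun_pair[OF s(2) that] Z by blast
  ultimately have "Cov s \<kappa> (e \<kappa>)" unfolding Cov_def using Fun_Sv[OF s(2)] by blast
  \<comment> \<open>In \<open>T\<close> the bound variable for the smaller ordinal is witnessed by
    \<kappa> itself, which lies below \<open>e(\<kappa>)\<close>; pulling back yields an ordinal
    below \<kappa>.\<close>
  let ?F = "\<^bold>\<exists>\<mu> s. \<mu> \<^bold>\<in> 0 \<^bold>\<and> is_cov s \<mu> 0"
  have "holds E (els T) [e \<kappa>] ?F" using T eT[OF \<kappa>3] \<kappa>T \<kappa>e s(1) \<open>Cov s \<kappa> (e \<kappa>)\<close> by auto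
  then have "holds E (els N3) [\<kappa>] ?F" using elem_holds[OF e \<kappa>3, of "[\<kappa>]" ?F] \<kappa>3 by simp
  then obtain \<mu> s' where s': "\<mu> \<epsilon> \<kappa>" "s' \<epsilon> N3" "Cov s' \<mu> \<kappa>" using N3(1) \<kappa>3 by auto
  have \<mu>: "\<mu> \<epsilon> N0" "\<mu> \<epsilon> N3" "e \<mu> = \<mu>" using ZF_Trn[OF N0(1) \<kappa>0 s'(1)] ZF_Trn[OF N3(1) \<kappa>3 s'(1)] e\<zeta>[OF s'(1)] .
  have "holds E (els T) (map e [s', \<mu>, \<kappa>]) (is_cov 0 1 2)"
    using elem_holds[OF e \<kappa>3, of "[s', \<mu>, \<kappa>]" "is_cov 0 1 2"] N3(1) s'(2,3) \<mu>(2) \<kappa>3 by simp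
  then have C: "Cov (e s') \<mu> (e \<kappa>)" using T eT s'(2) \<mu> \<kappa>3 eT[OF \<mu>(2)] by simp
  then obtain z where z: "opr z \<kappa> \<epsilon> e s'" using \<kappa>e unfolding Cov_def Rng_def by blast
  then obtain f y where "opr z \<kappa> = opr f y" "Map f \<mu> \<mu>" using C unfolding Cov_def by blast
  then have Mz: "Map z \<mu> \<mu>" by simp
  then have z3: "z \<epsilon> N3" using maps2 \<mu>(1) N23 by blast
  have Mez: "Map (e z) \<mu> \<mu>" using elem_Map[OF e N3(1) T z3 \<mu>(2,2)] Mz \<mu>(3) by simp
  \<comment> \<open>The pairs in \<open>z\<close> consist of ordinals below \<kappa> and are fixed.
    As \<open>z\<close> and \<open>e z\<close> are both functions on the fixed ordinal
    \<open>\<mu>\<close>, inclusion gives equality.\<close>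
  have z_sub: "opr a b \<epsilon> e z" if ab: "opr a b \<epsilon> z" for a b
  proof -
    have "a \<epsilon> \<mu>" "b \<epsilon> \<mu>" using Mz Fun_dom ab unfolding Map_def by blast+
    then have "a \<epsilon> \<kappa>" "b \<epsilon> \<kappa>" using Ord_Trn[OF \<kappa>(2) s'(1)] by blast+
    then have "e (opr a b) = opr a b" using elem_opr[OF e N3(1) T] e\<zeta> ZF_Trn[OF N3(1) \<kappa>3] by simp
    then show ?thesis using elem_mem[OF e ZF_Trn[OF N3(1) z3 ab] z3] ab by simp
  qed
  have "e z = z"
  proof (rule extensionality)
    fix q
    show "q \<epsilon> e z \<longleftrightarrow> q \<epsilon> z"
    proof
      assume "q \<epsilon> z"
      then obtain a b where "q = opr a b" using Fun_pair Mz unfolding Map_def by blast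
      then show "q \<epsilon> e z" using z_sub \<open>q \<epsilon> z\<close> by blast
    next
      have Fe: "Fun (e z) \<mu>" and Fz: "Fun z \<mu>" using Mez Mz unfolding Map_def by blast+
      assume "q \<epsilon> e z"
      then obtain a b where q: "a \<epsilon> \<mu>" "q = opr a b" using Fun_pair[OF Fe] by blast
      obtain b' where b': "opr a b' \<epsilon> z" using Fun_ex[OF Fz q(1)] by blast
      then have "b' = b" using FunD[OF Fe z_sub[OF b']] \<open>q \<epsilon> e z\<close> q(2) by blast
      then show "q \<epsilon> z" using b' q(2) by simp
    qed
  qed
  \<comment> \<open>Since \<open>z\<close> is fixed and in the domain of \<open>e s'\<close>, it is
    already in the domain of \<open>s'\<close>; its value there is below \<kappa>, hence fixed, and
    must be the value \<kappa> of \<open>e s'\<close> at \<open>z\<close>.\<close>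
  have "holds E (els T) (map e [s', z]) (\<^bold>\<exists>y. is_app 0 1 y)"
    using T eT[OF s'(2)] eT[OF z3] z \<kappa>T \<open>e z = z\<close> by auto
  then have "holds E (els N3) [s', z] (\<^bold>\<exists>y. is_app 0 1 y)"
    using elem_holds[OF e \<kappa>3, of "[s', z]" "\<^bold>\<exists>y. is_app 0 1 y"] s'(2) z3 by simp
  then obtain y where y: "y \<epsilon> N3" "opr z y \<epsilon> s'" using N3(1) s'(2) z3 by auto
  then have "y \<epsilon> \<kappa>" using s'(3) unfolding Cov_def Rng_def by blast
  then have "e (opr z y) = opr z y" using elem_opr[OF e N3(1) T z3 y(1)] e\<zeta> \<open>e z = z\<close> by simp
  then have "opr z y \<epsilon> e s'" using elem_mem[OF e ZF_Trn[OF N3(1) s'(2) y(2)] s'(2)] y(2) by simp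
  then have "y = \<kappa>" using z C unfolding Cov_def Sv_def by blast
  then show False using \<open>y \<epsilon> \<kappa>\<close> no_loop by blast
qed

end

context bst
begin

lemma inconsistent:
  assumes "holds E UNIV [] V_eq_L" "holds E UNIV [] TMA" "holds E UNIV [] exists_strongly_critical"
  shows False
proof -
  interpret tall_bst E
  proof
    show "\<exists>\<alpha> A. Ord \<alpha> \<and> Lev \<alpha> A \<and> x \<epsilon> A" for x
      using assms(1) unfolding Lev_def by (simp add: V_eq_L_def)
  qed (rule tall[OF assms(2)])
  show False using critical[OF assms(3)] no_strongly_critical by metis
qed

end

text \<open>Completeness provides a carrier that is some set of naturals, while \<open>bst\<close>
  requires a full type; an infinite carrier is in bijection with the naturals. In a finite structure
  a set with the most elements could be properly enlarged.\<close>

lemma LZFC_infinite: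
  assumes ax: "\<And>p v. p \<in> LZFC \<Longrightarrow> ev E A p v" and "A \<noteq> {}"
  shows "infinite A"
proof
  assume fin: "finite A"
  have h: "holds E A [] F" if "F 0 \<in> LZFC" "fb 0 F" for F using ax that ev_sentence by blast
  have loc: "\<exists>y\<in>A. E x y \<and> (\<forall>z\<in>A. E z y \<longrightarrow> (\<forall>u\<in>A. E u z \<longrightarrow> E u y))" if x: "x \<in> A" for x
  proof -
    have "holds E A [] Loc_ZFC" by (rule h) (simp_all add: LZFC_def fb_sentences)
    then obtain y where "y \<in> A" "E x y" "holds E A [x, y] (is_trans 1)" using x by (auto simp: Loc_ZFC_def)
    then show ?thesis by (auto simp: is_trans_def sub_def)
  qed
  have pair: "\<exists>p\<in>A. \<forall>z\<in>A. E z p \<longleftrightarrow> z = x \<or> z = y" if "x \<in> A" "y \<in> A" for x y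
    using h[of ax_pair] fb_sentences that by (simp add: LZFC_def BST_def ax_pair_def is_upair_def)
  \<comment> \<open>Foundation is not assumed, so Russell's subset of \<open>z\<close>, available by
    bounded separation, supplies something that is not an element of \<open>z\<close>.\<close>
  have russell: "\<exists>y\<in>A. \<forall>x\<in>A. E x y \<longleftrightarrow> E x z \<and> \<not> E x x" if "z \<in> A" for z
  proof -
    have "delta0 (Implies (Member 0 0) Falsum)" by (intro delta0.intros)
    then have "separation 0 (Implies (Member 0 0) Falsum) \<in> LZFC" unfolding LZFC_def BST_def by force
    then have "ev E A (separation 0 (Implies (Member 0 0) Falsum)) (\<lambda>i. z)" by (rule ax)
    then show ?thesis using that by (simp add: separation_def ev_forms)
  qed
  let ?c = "\<lambda>z. card {u \<in> A. E u z}"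
  obtain z where z: "z \<in> A" "\<And>y. y \<in> A \<Longrightarrow> ?c y \<le> ?c z"
  proof -
    have "Max (?c ` A) \<in> ?c ` A" using fin \<open>A \<noteq> {}\<close> by (intro Max_in) auto
    then obtain z where z: "z \<in> A" "?c z = Max (?c ` A)" by force
    have "?c y \<le> ?c z" if "y \<in> A" for y unfolding z(2) using fin that by (intro Max_ge) auto
    then show ?thesis using that z(1) by blast
  qed
  obtain r where r: "r \<in> A" "\<forall>x\<in>A. E x r \<longleftrightarrow> E x z \<and> \<not> E x x" using russell z(1) by blast
  then have "\<not> E r z" by blast
  obtain p where p: "p \<in> A" "\<forall>u\<in>A. E u p \<longleftrightarrow> u = z \<or> u = r" using pair z(1) r(1) by blast
  obtain y where y: "y \<in> A" "E p y" "\<forall>z\<in>A. E z y \<longrightarrow> (\<forall>u\<in>A. E u z \<longrightarrow> E u y)" using loc p(1) by blast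
  have "E z y" "E r y" using y p z(1) r(1) by blast+
  \<comment> \<open>The transitive set \<open>y\<close> contains \<open>z\<close> and hence includes
    it; it also contains \<open>r\<close>, which \<open>z\<close> does not.\<close>
  then have "{u \<in> A. E u z} \<subset> {u \<in> A. E u y}" using y(3) z(1) r(1) \<open>\<not> E r z\<close> by blast
  then have "?c z < ?c y" using fin by (intro psubset_card_mono) auto
  then show False using z(2)[OF y(1)] by simp
qed

theorem theorem5p4:
  shows "LZFC \<union> {TMA 0, exists_strongly_critical 0} \<turnstile> (\<^bold>\<not> V_eq_L) 0"
proof (rule ccontr)
  let ?S = "LZFC \<union> {TMA 0, exists_strongly_critical 0}"
  assume not: "\<not> (?S \<turnstile> (\<^bold>\<not> V_eq_L) 0)"
  have fbS: "\<forall>p\<in>?S. free_below 0 p" using free_below_LZFC fb_sentences by (auto simp: fb_def)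
  have "fb 0 (\<^bold>\<not> V_eq_L)" using fb_sentences by simp
  then have "free_below 0 ((\<^bold>\<not> V_eq_L) 0)" by (simp add: fb_def)
  then obtain E A v where v: "\<And>i. v i \<in> (A :: nat set)" and S: "\<And>p. p \<in> ?S \<Longrightarrow> ev E A p v" and V: "\<not> ev E A ((\<^bold>\<not> V_eq_L) 0) v"
    by (rule completeness[OF fbS _ not]) (rule that)
  have S': "ev E A p w" if "p \<in> ?S" for p w
    using S[OF that] ev_cong[of 0 p w v] fbS that by blast
  \<comment> \<open>The structure is moved along a bijection to the full type of naturals, so that
    the locale \<open>bst\<close> applies.\<close>
  have "infinite A" using v S' by (intro LZFC_infinite[of E]) auto
  then obtain h where h: "bij_betw h (UNIV :: nat set) A" using Infinite_Set.bij_enumerate[of A] by blast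
  define E' where "E' x y = E (h x) (h y)" for x y
  have iso: "ev E A p (\<lambda>i. h (w i)) = ev E' UNIV p w" for p w
    using h by (rule ev_iso) (simp_all add: E'_def)
  interpret bst E'
    by unfold_locales (use iso S' in blast)
  have hS: "holds E' UNIV [] F" if "F 0 \<in> ?S" "fb 0 F" for F
    using iso S'[OF that(1)] ev_sentence[OF that(2)] by blast
  have "holds E A [] V_eq_L" using V by (simp add: ev_sentence[OF \<open>fb 0 (\<^bold>\<not> V_eq_L)\<close>])
  then have "ev E A (V_eq_L 0) w" for w using ev_sentence fb_sentences by blast
  then have "ev E' UNIV (V_eq_L 0) w" for w using iso by blast
  then have "holds E' UNIV [] V_eq_L" using ev_sentence fb_sentences by blast
  then show False by (rule inconsistent) (rule hS; simp add: fb_sentences)+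
qed

end
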